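(* Fix $p\in(1,\infty)$ and let $\mathfrak X=(X,\rho,\mu)$ be a metric measure space with $\mu(X\setminus\operatorname{supp}\mu)=0$. Then one of the following holds: (1) the topological boundary of $\Omega^p_{\rm HL}(\mathfrak X)$ in $[0,1]^2$ is empty, i.e. $\Omega^p_{\rm HL}(\mathfrak X)=\emptyset$ or $\Omega^p_{\rm HL}(\mathfrak X)=[0,1]^2$; or (2) this boundary equals $\{\delta\}\times[0,\lim_{u\to\delta}F(u)]\ \cup\ \{(u,F(u)):u\in(\delta,1]\}$ for some $\delta\in[0,1]$ and some concave nondecreasing $F:[\delta,1]\to[0,1]$ with $F(u)\le u$ (for $\delta=1$ read $\lim_{u\to\delta}F(u)=F(1)$). Conversely, for each $\delta\in[0,1]$ and each concave nondecreasing $F:[\delta,1]\to[0,1]$ with $F(u)\le u$ there exists a metric measure space $\mathfrak X$ such that $\mathcal M^{\rm c}_{\mathfrak X}$ is bounded from $L^{p,q}(\mathfrak X)$ to $L^{p,r}(\mathfrak X)$ if and only if $1/q\ge\delta$ and $1/r\le F(1/q)$.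
   Context: Metric measure space $(X,\rho,\mu)$: nonempty set, metric, nonnegative Borel measure; $\operatorname{supp}\mu=\{x:\mu(B(x,s))>0\ \forall s>0\}$. $\mathcal M^{\rm c}_{\mathfrak X}f(x)=\sup_{s>0}\mu(B(x,s))^{-1}\int_{B(x,s)}|f|d\mu$, balls with measure $0$ or $\infty$ omitted. Lorentz quasinorm: $d_f(t)=\mu(\{|f|>t\})$, $\|f\|_{p,q}=p^{1/q}(\int_0^\infty(t d_f(t)^{1/p})^q dt/t)^{1/q}$ for $q<\infty$, $\|f\|_{p,\infty}=\sup_{t>0}t d_f(t)^{1/p}$. $\Omega^p_{\rm HL}(\mathfrak X)=\{(1/q,1/r)\in[0,1]^2:\ \mathcal M^{\rm c}_{\mathfrak X}\text{ is bounded from }L^{p,q}(\mathfrak X)\text{ to }L^{p,r}(\mathfrak X)\}$, with $q,r\in[1,\infty]$ and the convention $1/\infty=0$. *)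

theory Defs
  imports "HOL-Analysis.Analysis"
begin

definition mm_space :: "'a set \<Rightarrow> ('a \<Rightarrow> 'a \<Rightarrow> real) \<Rightarrow> 'a measure \<Rightarrow> bool" where
  "mm_space X \<rho> \<mu> \<longleftrightarrow> X \<noteq> {} \<and> Metric_space X \<rho> \<and> space \<mu> = X \<and>
     sets \<mu> = sigma_sets X {U. openin (Metric_space.mtopology X \<rho>) U}"

definition oball :: "'a set \<Rightarrow> ('a \<Rightarrow> 'a \<Rightarrow> real) \<Rightarrow> 'a \<Rightarrow> real \<Rightarrow> 'a set" where
  "oball X \<rho> x s = {y \<in> X. \<rho> x y < s}"

definition supp_mu :: "'a set \<Rightarrow> ('a \<Rightarrow> 'a \<Rightarrow> real) \<Rightarrow> 'a measure \<Rightarrow> 'a set" where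
  "supp_mu X \<rho> \<mu> = {x \<in> X. \<forall>s>0. emeasure \<mu> (oball X \<rho> x s) > 0}"

text \<open>Centered Hardy-Littlewood maximal function (balls of measure 0 or infinity omitted;
  the supremum over the empty family is 0).\<close>
definition maxc :: "'a set \<Rightarrow> ('a \<Rightarrow> 'a \<Rightarrow> real) \<Rightarrow> 'a measure \<Rightarrow> ('a \<Rightarrow> real) \<Rightarrow> 'a \<Rightarrow> ennreal" where
  "maxc X \<rho> \<mu> f x =
     (SUP s \<in> {s. 0 < s \<and> 0 < emeasure \<mu> (oball X \<rho> x s) \<and> emeasure \<mu> (oball X \<rho> x s) < \<infinity>}.
        (\<integral>\<^sup>+ y \<in> oball X \<rho> x s. ennreal \<bar>f y\<bar> \<partial>\<mu>) / emeasure \<mu> (oball X \<rho> x s))"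

text \<open>Real powers of extended nonnegative reals (used only with positive exponents).\<close>
definition epowr :: "ennreal \<Rightarrow> real \<Rightarrow> ennreal" where
  "epowr x a = (if x = \<infinity> then \<infinity> else ennreal (enn2real x powr a))"

definition outer_mu :: "'a measure \<Rightarrow> 'a set \<Rightarrow> ennreal" where
  "outer_mu \<mu> S = (INF A \<in> {A \<in> sets \<mu>. S \<subseteq> A}. emeasure \<mu> A)"

definition distr_fun :: "'a measure \<Rightarrow> ('a \<Rightarrow> ennreal) \<Rightarrow> real \<Rightarrow> ennreal" where
  "distr_fun \<mu> g t = outer_mu \<mu> {x \<in> space \<mu>. g x > ennreal t}"

text \<open>Lorentz quasinorm ||g||_{p,q}, parametrised by a = 1/q in [0,1] (a = 0 means q = infinity).\<close>
definition lorentz :: "'a measure \<Rightarrow> real \<Rightarrow> real \<Rightarrow> ('a \<Rightarrow> ennreal) \<Rightarrow> ennreal" where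
  "lorentz \<mu> p a g =
     (if a = 0 then (SUP t \<in> {0<..}. ennreal t * epowr (distr_fun \<mu> g t) (1/p))
      else ennreal (p powr a) *
        epowr (\<integral>\<^sup>+ t \<in> {0<..}. epowr (ennreal t * epowr (distr_fun \<mu> g t) (1/p)) (1/a) / ennreal t \<partial>lborel) a)"

text \<open>Boundedness of the centered maximal operator from L^{p,q} to L^{p,r}, with a = 1/q, b = 1/r.\<close>
definition maxc_bounded :: "'a set \<Rightarrow> ('a \<Rightarrow> 'a \<Rightarrow> real) \<Rightarrow> 'a measure \<Rightarrow> real \<Rightarrow> real \<Rightarrow> real \<Rightarrow> bool" where
  "maxc_bounded X \<rho> \<mu> p a b \<longleftrightarrow>
     (\<exists>C::real. \<forall>f \<in> borel_measurable \<mu>.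
        lorentz \<mu> p a (\<lambda>x. ennreal \<bar>f x\<bar>) < \<infinity> \<longrightarrow>
        lorentz \<mu> p b (maxc X \<rho> \<mu> f) \<le> ennreal C * lorentz \<mu> p a (\<lambda>x. ennreal \<bar>f x\<bar>))"

definition Omega_HL :: "'a set \<Rightarrow> ('a \<Rightarrow> 'a \<Rightarrow> real) \<Rightarrow> 'a measure \<Rightarrow> real \<Rightarrow> (real \<times> real) set" where
  "Omega_HL X \<rho> \<mu> p = {(a, b). a \<in> {0..1} \<and> b \<in> {0..1} \<and> maxc_bounded X \<rho> \<mu> p a b}"

definition sq_boundary :: "(real \<times> real) set \<Rightarrow> (real \<times> real) set" where
  "sq_boundary S = (subtopology euclidean ({0..1} \<times> {0..1})) frontier_of S"

definition admissible :: "real \<Rightarrow> (real \<Rightarrow> real) \<Rightarrow> bool" where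
  "admissible \<delta> F \<longleftrightarrow> 0 \<le> \<delta> \<and> \<delta> \<le> 1 \<and> concave_on {\<delta>..1} F \<and> mono_on {\<delta>..1} F \<and>
     (\<forall>u \<in> {\<delta>..1}. 0 \<le> F u \<and> F u \<le> u)"

definition edge_lim :: "real \<Rightarrow> (real \<Rightarrow> real) \<Rightarrow> real" where
  "edge_lim \<delta> F = (if \<delta> = 1 then F 1 else Lim (at_right \<delta>) F)"

end

theory Submission
  imports Defs
begin

text \<open>Up to constants the \<open>L\<^sup>p\<^sup>,\<^sup>q\<close> quasinorm of \<open>g\<close> is the \<open>l\<^sup>q\<close> norm of the sequence
  \<open>2\<^sup>k \<mu>{g > 2\<^sup>k}\<^sup>1\<^sup>/\<^sup>p\<close> of its normalised level measures. Embeddings between these spaces and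
  Marcinkiewicz interpolation with equal first exponents make the region monotone and convex. If the points with a ball of finite
  measure are not essentially finite in number, there are disjoint balls of lacunary measure, and
  averages over them reproduce arbitrary \<open>l\<^sup>q\<close> sequences, which keeps the region below the diagonal;
  otherwise the region is the whole square. A convex monotone region below the diagonal has the stated boundary.

  For the converse, a countable set of atoms is equipped with a graph metric such that the maximal
  operator decouples into blocks. A block with \<open>M\<close> input pieces and \<open>K\<close> output pieces, of lacunary
  measures, has norm comparable to \<open>h M\<^sup>1\<^sup>-\<^sup>a K\<^sup>b\<close>, so sequences of blocks can be tuned to cut out
  any countable family of half planes \<open>b \<le> c + S a\<close> with \<open>S \<ge> 0\<close>.\<close>

subsection \<open>Powers of extended nonnegative reals and sequence spaces\<close>

text \<open>With equal first exponents everything is decided on the scale of the level sequences,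
  and lacunarity makes this scale visible: at each height the measures of lacunary pieces are
  dominated by the largest one, so the norm of a sum is comparable to the \<open>l^q\<close> norm of
  the norms of its pieces. Test functions and block spaces are assembled on this principle. The
  direct half works with outer measures of the level sets of the maximal function. The obstacle in
  the converse is that an output point averages over \<open>M\<close> input pieces, with
  \<open>M\<close> unbounded over the blocks. An iterated quasi-triangle inequality would lose a
  constant growing with \<open>M\<close>, so a triangle inequality with a constant independent of
  the number of summands is established; it rests on \<open>p > 1\<close> and has different proofs
  for second exponents above and below \<open>p\<close>. A half plane is encoded by \<open>M\<close>
  of size \<open>K^S\<close> and \<open>h = K^(-c-S)\<close>: then \<open>h M^(1-a) K^b\<close> is
  about \<open>K^(b-c-S a)\<close>, and boundedness in \<open>K\<close> means
  \<open>b \<le> c + S a\<close>.\<close>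

lemma epowr_ennreal [simp]: "0 \<le> x \<Longrightarrow> epowr (ennreal x) a = ennreal (x powr a)"
  by (simp add: epowr_def)

lemma epowr_top [simp]: "epowr \<infinity> a = \<infinity>" "epowr top a = top"
  by (simp_all add: epowr_def)

lemma epowr_0 [simp]: "epowr 0 a = 0"
  by (simp add: epowr_def)

lemma epowr_mono: "x \<le> y \<Longrightarrow> 0 \<le> a \<Longrightarrow> epowr x a \<le> epowr y a"
  by (cases x; cases y) (auto simp: powr_mono2 top_unique)

lemma epowr_mult: "0 < a \<Longrightarrow> epowr (x * y) a = epowr x a * epowr y a"
  by (cases x; cases y; cases "x = 0"; cases "y = 0")
     (auto simp: ennreal_mult[symmetric] powr_mult ennreal_mult_top ennreal_top_mult)

lemma epowr_epowr: "0 < a \<Longrightarrow> epowr (epowr x a) b = epowr x (a * b)"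
  by (cases x) (auto simp: powr_powr)

lemma epowr_one [simp]: "epowr x 1 = x"
  by (cases x) auto

lemma epowr_inverse: "0 < a \<Longrightarrow> epowr (epowr x a) (1 / a) = x" "0 < a \<Longrightarrow> epowr (epowr x (1 / a)) a = x"
  by (simp_all add: epowr_epowr)

lemma epowr_add: "epowr x (a + b) = epowr x a * epowr x b"
  by (cases x) (auto simp: powr_add ennreal_mult)

lemma epowr_eq_0 [simp]: "epowr x a = 0 \<longleftrightarrow> x = 0"
  by (cases x) auto

lemma epowr_eq_top [simp]: "epowr x a = top \<longleftrightarrow> x = top"
  by (cases x) auto

lemma epowr_le_iff: "0 < a \<Longrightarrow> epowr x a \<le> y \<longleftrightarrow> x \<le> epowr y (1 / a)"
  by (metis epowr_inverse epowr_mono less_imp_le zero_less_divide_1_iff)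

lemma le_epowr_iff: "0 < a \<Longrightarrow> y \<le> epowr x a \<longleftrightarrow> epowr y (1 / a) \<le> x"
  by (metis epowr_inverse epowr_mono less_imp_le zero_less_divide_1_iff)

lemma epowr_mono_exp: "1 \<le> x \<Longrightarrow> a \<le> b \<Longrightarrow> epowr x a \<le> epowr x b"
  by (cases x) (auto simp: powr_mono)

lemma borel_measurable_epowr [measurable]: "(\<lambda>x. epowr x a) \<in> borel_measurable borel"
  unfolding epowr_def by measurable

text \<open>\<open>a\<close> is the reciprocal of the exponent, as in \<open>lorentz\<close>, and
  \<open>a = 0\<close> gives the supremum norm. Values are in \<open>ennreal\<close> and the sum is
  an integral against counting measure, so that Tonelli exchanges sums over arbitrary index types
  without summability conditions.\<close>

definition lp :: "real \<Rightarrow> ('i \<Rightarrow> ennreal) \<Rightarrow> ennreal" where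
  "lp a x = (if a = 0 then (SUP i. x i)
     else epowr (\<integral>\<^sup>+ i. epowr (x i) (1 / a) \<partial>count_space UNIV) a)"

lemma lp_zero: "lp 0 x = (SUP i. x i)"
  by (simp add: lp_def)

lemma lp_pos: "0 < a \<Longrightarrow> lp a x = epowr (\<integral>\<^sup>+ i. epowr (x i) (1 / a) \<partial>count_space UNIV) a"
  by (simp add: lp_def)

lemma epowr_lp: "0 < a \<Longrightarrow> epowr (lp a x) (1 / a) = (\<integral>\<^sup>+ i. epowr (x i) (1 / a) \<partial>count_space UNIV)"
  by (simp add: lp_pos epowr_inverse)

lemma lp_leI: "0 < a \<Longrightarrow> (\<integral>\<^sup>+ i. epowr (x i) (1 / a) \<partial>count_space UNIV) \<le> epowr C (1 / a) \<Longrightarrow> lp a x \<le> C"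
  by (simp add: lp_pos epowr_le_iff)

lemma lp_mono: "(\<And>i. x i \<le> y i) \<Longrightarrow> 0 \<le> a \<Longrightarrow> lp a x \<le> lp a y"
  by (auto simp: lp_def intro!: SUP_mono epowr_mono nn_integral_mono)

lemma lp_zero_fun [simp]: "lp a (\<lambda>i. 0) = 0"
  by (simp add: lp_def)

lemma le_lp: "0 \<le> a \<Longrightarrow> x i \<le> lp a x"
proof (cases "a = 0")
  case False
  assume "0 \<le> a" with False have a: "0 < a" by simp
  have "epowr (x i) (1 / a) = (\<integral>\<^sup>+ j. epowr (x j) (1 / a) * indicator {i} j \<partial>count_space UNIV)"
    by (subst nn_integral_indicator_singleton) auto
  also have "\<dots> \<le> (\<integral>\<^sup>+ j. epowr (x j) (1 / a) \<partial>count_space UNIV)"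
    by (intro nn_integral_mono) (auto split: split_indicator)
  finally show ?thesis using a by (simp add: lp_pos le_epowr_iff)
qed (auto simp: lp_zero intro: SUP_upper)

lemma lp_cmult: "0 \<le> a \<Longrightarrow> lp a (\<lambda>i. c * x i) = c * lp a x"
proof (cases "a = 0")
  case False
  assume "0 \<le> a" with False have a: "0 < a" by simp
  then show ?thesis
    by (simp add: lp_pos epowr_mult nn_integral_cmult epowr_inverse)
qed (simp add: lp_zero SUP_mult_left_ennreal)

lemma lp_reindex: assumes "inj \<phi>" "0 \<le> a" shows "lp a (\<lambda>i. x (\<phi> i)) \<le> lp a x"
proof (cases "a = 0")
  case False
  with assms have a: "0 < a" by simp
  have "(\<integral>\<^sup>+ i. epowr (x (\<phi> i)) (1 / a) \<partial>count_space UNIV)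
      = (\<integral>\<^sup>+ i. epowr (x i) (1 / a) \<partial>count_space (range \<phi>))"
    using assms by (intro nn_integral_bij_count_space) (auto simp: bij_betw_def)
  also have "\<dots> \<le> (\<integral>\<^sup>+ i. epowr (x i) (1 / a) \<partial>count_space UNIV)"
    by (subst nn_integral_count_space_indicator, simp, intro nn_integral_mono)
       (auto split: split_indicator)
  finally show ?thesis using a by (auto simp: lp_pos intro: epowr_mono)
qed (auto simp: lp_zero intro!: SUP_mono)

text \<open>With \<open>s = 1/a\<close> and \<open>t = 1/b\<close>: every entry is at most the norm,
  so \<open>x^s = x^(s-t) x^t\<close> is at most \<open>norm^(s-t) x^t\<close>, and summing gives
  \<open>norm^s\<close>.\<close>

lemma lp_antimono_exponent: assumes "0 \<le> a" "a \<le> b" shows "lp a x \<le> lp b x"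
proof (cases "a = 0")
  case True
  then show ?thesis using assms by (auto simp: lp_zero intro!: SUP_least le_lp)
next
  case False
  with assms have a: "0 < a" and b: "0 < b" by auto
  show ?thesis
  proof (rule lp_leI[OF a])
    let ?s = "1 / a" and ?t = "1 / b"
    have st: "?t \<le> ?s" using a b assms by (simp add: field_simps)
    have "(\<integral>\<^sup>+ i. epowr (x i) ?s \<partial>count_space UNIV)
        \<le> (\<integral>\<^sup>+ i. epowr (lp b x) (?s - ?t) * epowr (x i) ?t \<partial>count_space UNIV)"
    proof (intro nn_integral_mono)
      fix i
      have "epowr (x i) ?s = epowr (x i) (?s - ?t) * epowr (x i) ?t"
        by (simp add: epowr_add[symmetric])
      also have "\<dots> \<le> epowr (lp b x) (?s - ?t) * epowr (x i) ?t"
        using st b by (intro mult_right_mono epowr_mono le_lp) auto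
      finally show "epowr (x i) ?s \<le> epowr (lp b x) (?s - ?t) * epowr (x i) ?t" .
    qed
    also have "\<dots> = epowr (lp b x) (?s - ?t) * epowr (lp b x) ?t"
      using b by (simp add: nn_integral_cmult epowr_lp)
    also have "\<dots> = epowr (lp b x) ?s" by (simp add: epowr_add[symmetric])
    finally show "(\<integral>\<^sup>+ i. epowr (x i) ?s \<partial>count_space UNIV) \<le> epowr (lp b x) ?s" .
  qed
qed

lemma SUP_le_epowr_sum:
  assumes "0 < s" shows "epowr (SUP i. z i) s \<le> (\<integral>\<^sup>+ i. epowr (z i) s \<partial>count_space UNIV)"
proof -
  have "(SUP i. z i) \<le> lp (1 / s) z" using assms by (intro SUP_least le_lp) auto
  then show ?thesis using assms by (simp add: lp_pos epowr_le_iff)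
qed

lemma sum_epowr_le:
  fixes c :: "'i \<Rightarrow> ennreal"
  assumes "1 \<le> s"
  shows "(\<integral>\<^sup>+ i. epowr (c i) s \<partial>count_space UNIV) \<le> epowr (\<integral>\<^sup>+ i. c i \<partial>count_space UNIV) s"
proof -
  have "lp (1 / s) c \<le> lp 1 c" using assms by (intro lp_antimono_exponent) auto
  then show ?thesis using assms by (simp add: lp_pos epowr_le_iff)
qed

text \<open>The supremum is replaced by an \<open>l^s\<close> sum, \<open>s = 1/a\<close>. By
  Tonelli the sum over \<open>k\<close> comes first and yields the norm of a reindexed sequence; the
  \<open>l^s\<close> norm of \<open>c\<close> is at most its sum because \<open>s\<close> is at
  least 1. Applied with shifts \<open>\<phi> i\<close> and geometric \<open>c\<close>.\<close>

lemma lp_SUP_le: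
  fixes x :: "'k \<Rightarrow> ennreal" and c :: "nat \<Rightarrow> ennreal"
  assumes "\<And>i. inj (\<phi> i)" "0 \<le> a" "a \<le> 1"
  shows "lp a (\<lambda>k. SUP i. c i * x (\<phi> i k)) \<le> (\<Sum>i. c i) * lp a x"
proof (cases "a = 0")
  case True
  have "c i * x (\<phi> i k) \<le> (\<Sum>i. c i) * lp a x" for i k
    using assms sum_le_suminf[of c "{i}"] by (intro mult_mono le_lp) auto
  then show ?thesis using True by (auto simp: lp_zero intro!: SUP_least)
next
  case False
  with assms have a: "0 < a" by simp
  let ?s = "1 / a"
  have s: "1 \<le> ?s" "0 < ?s" using a assms by auto
  show ?thesis
  proof (rule lp_leI[OF a])
    have "(\<integral>\<^sup>+ k. epowr (SUP i. c i * x (\<phi> i k)) ?s \<partial>count_space UNIV)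
      \<le> (\<integral>\<^sup>+ k. \<integral>\<^sup>+ i. epowr (c i * x (\<phi> i k)) ?s \<partial>count_space UNIV \<partial>count_space UNIV)"
      using s by (intro nn_integral_mono SUP_le_epowr_sum)
    also have "\<dots> = (\<integral>\<^sup>+ i. \<integral>\<^sup>+ k. epowr (c i * x (\<phi> i k)) ?s \<partial>count_space UNIV \<partial>count_space UNIV)"
      using nn_integral_fst_count_space[of "\<lambda>(k,i). epowr (c i * x (\<phi> i k)) ?s"]
        nn_integral_snd_count_space[of "\<lambda>(k,i). epowr (c i * x (\<phi> i k)) ?s"] by simp
    also have "\<dots> = (\<integral>\<^sup>+ i. epowr (c i) ?s * epowr (lp a (\<lambda>k. x (\<phi> i k))) ?s \<partial>count_space UNIV)"
      using a by (simp add: epowr_mult nn_integral_cmult epowr_lp)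
    also have "\<dots> \<le> (\<integral>\<^sup>+ i. epowr (c i) ?s * epowr (lp a x) ?s \<partial>count_space UNIV)"
      using assms s by (intro nn_integral_mono mult_left_mono epowr_mono lp_reindex) auto
    also have "\<dots> = (\<integral>\<^sup>+ i. epowr (c i) ?s \<partial>count_space UNIV) * epowr (lp a x) ?s"
      by (simp add: nn_integral_multc)
    also have "\<dots> \<le> epowr (\<integral>\<^sup>+ i. c i \<partial>count_space UNIV) ?s * epowr (lp a x) ?s"
      using s by (intro mult_right_mono sum_epowr_le) auto
    also have "\<dots> = epowr ((\<Sum>i. c i) * lp a x) ?s"
      using s by (simp add: epowr_mult nn_integral_count_space_nat)
    finally show "(\<integral>\<^sup>+ k. epowr (SUP i. c i * x (\<phi> i k)) ?s \<partial>count_space UNIV) \<le> epowr ((\<Sum>i. c i) * lp a x) ?s" .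
  qed
qed

lemma lp_swap: assumes "0 \<le> a"
  shows "lp a (\<lambda>i. lp a (\<lambda>j. x i j)) = lp a (\<lambda>j. lp a (\<lambda>i. x i j))"
proof (cases "a = 0")
  case True
  then show ?thesis by (simp add: lp_zero) (rule SUP_commute)
next
  case False
  with assms have a: "0 < a" by simp
  show ?thesis
    using a nn_integral_fst_count_space[of "\<lambda>(k,i). epowr (x k i) (1/a)"]
        nn_integral_snd_count_space[of "\<lambda>(k,i). epowr (x k i) (1/a)"]
    by (simp add: lp_pos epowr_inverse)
qed

lemma lp_const_le:
  assumes "finite I" "0 \<le> a"
  shows "lp a (\<lambda>i. c * indicator I i) \<le> ennreal (real (card I) powr a) * c"
proof (cases "a = 0")
  case True
  show ?thesis
  proof (cases "I = {}")
    case False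
    then have "real (card I) powr a = 1" using True assms by auto
    then show ?thesis using True by (auto simp: lp_zero intro!: SUP_least split: split_indicator)
  qed simp
next
  case False
  with assms have a: "0 < a" by simp
  have "(\<integral>\<^sup>+ i. epowr (c * indicator I i) (1 / a) \<partial>count_space UNIV)
      = (\<integral>\<^sup>+ i. epowr c (1 / a) * indicator I i \<partial>count_space UNIV)"
    by (intro nn_integral_cong) (auto split: split_indicator)
  also have "\<dots> = epowr c (1 / a) * ennreal (real (card I))"
    using assms by (simp add: nn_integral_cmult ennreal_of_nat_eq_real_of_nat)
  also have "\<dots> = epowr (ennreal (real (card I) powr a) * c) (1 / a)"
    using a by (simp add: epowr_mult powr_powr mult.commute del: epowr_ennreal)
       (simp add: powr_powr mult.commute)
  finally show ?thesis using a by (intro lp_leI) auto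
qed

lemma const_le_lp:
  assumes "finite I" "0 \<le> a" "\<And>i. i \<in> I \<Longrightarrow> c \<le> x i" "I \<noteq> {}"
  shows "ennreal (real (card I) powr a) * c \<le> lp a x"
proof (cases "a = 0")
  case True
  obtain i where "i \<in> I" using assms by auto
  then have "c \<le> lp a x" using assms le_lp[of a x i] order_trans by blast
  then show ?thesis using True assms by simp
next
  case False
  with assms have a: "0 < a" by simp
  have "epowr (ennreal (real (card I) powr a) * c) (1 / a) = epowr c (1 / a) * ennreal (real (card I))"
    using a by (simp add: epowr_mult powr_powr mult.commute del: epowr_ennreal)
       (simp add: powr_powr mult.commute)
  also have "\<dots> = (\<integral>\<^sup>+ i. epowr c (1 / a) * indicator I i \<partial>count_space UNIV)"
    using assms by (simp add: nn_integral_cmult ennreal_of_nat_eq_real_of_nat)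
  also have "\<dots> \<le> (\<integral>\<^sup>+ i. epowr (x i) (1 / a) \<partial>count_space UNIV)"
    using a assms by (intro nn_integral_mono) (auto split: split_indicator intro!: epowr_mono)
  finally show ?thesis using a by (simp add: lp_pos le_epowr_iff)
qed

section \<open>Minkowski's and Hoelder's inequalities\<close>

lemma ennreal_le_add_small:
  fixes X Y :: ennreal
  assumes "\<And>\<eta>. 0 < \<eta> \<Longrightarrow> X \<le> Y + c * ennreal \<eta>" "c < top"
  shows "X \<le> Y"
proof (rule ennreal_le_epsilon)
  fix e :: real assume "0 < e"
  obtain r where r: "c = ennreal r" "0 \<le> r" using assms by (cases c) auto
  have "X \<le> Y + c * ennreal (e / (r + 1))" using \<open>0 < e\<close> r by (intro assms) auto
  also have "c * ennreal (e / (r + 1)) = ennreal (r * (e / (r + 1)))" using r \<open>0 < e\<close> by (simp add: ennreal_mult[symmetric])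
  also have "\<dots> \<le> ennreal e" using r \<open>0 < e\<close> by (intro ennreal_leI) (simp add: field_simps)
  finally show "X \<le> Y + ennreal e" by (simp add: add_left_mono)
qed

text \<open>The endpoint 0 reduces to \<open>r powr s \<le> r\<close> for \<open>r\<close> in the
  open unit interval, applied to the weight of the other point.\<close>

lemma convex_on_powr:
  assumes "1 \<le> s" shows "convex_on {0..} (\<lambda>x::real. x powr s)"
proof (rule convex_onI)
  fix t x y :: real assume t: "0 < t" "t < 1" and xy: "x \<in> {0..}" "y \<in> {0..}"
  have small: "r powr s \<le> r" if "0 < r" "r < 1" for r :: real
    using powr_mono'[of 1 s r] assms that by simp
  consider "x = 0" | "y = 0" | "0 < x" "0 < y" using xy by fastforce
  then show "((1 - t) *\<^sub>R x + t *\<^sub>R y) powr s \<le> (1 - t) * x powr s + t * y powr s"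
  proof cases
    case 1
    then show ?thesis using small[of t] t xy by (simp add: powr_mult mult_right_mono)
  next
    case 2
    then show ?thesis using small[of "1 - t"] t xy by (simp add: powr_mult mult_right_mono)
  next
    case 3
    then show ?thesis using convex_onD[OF powr_convex[OF assms], of t x y] t by simp
  qed
qed auto

text \<open>The weighted form of convexity from which Minkowski's inequality follows by taking
  \<open>A\<close>, \<open>B\<close> slightly larger than the two norms.\<close>

lemma epowr_add_le_weighted:
  assumes "1 \<le> s" "0 < A" "0 < B"
  shows "epowr (u + v) s \<le> ennreal ((A + B) powr (s - 1)) *
    (ennreal (A powr (1 - s)) * epowr u s + ennreal (B powr (1 - s)) * epowr v s)"
proof (cases "u = top \<or> v = top")
  case True
  then show ?thesis using assms by (auto simp: ennreal_mult_top ennreal_top_mult)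
next
  case False
  then obtain x y where xy: "u = ennreal x" "v = ennreal y" "0 \<le> x" "0 \<le> y"
    by (cases u; cases v) auto
  \<comment> \<open>\<open>(x + y) / (A + B)\<close> is the convex combination of
    \<open>x / A\<close> and \<open>y / B\<close> with weights \<open>1 - \<theta>\<close> and
    \<open>\<theta>\<close>.\<close>
  define \<theta> where "\<theta> = B / (A + B)"
  have th: "1 - \<theta> = A / (A + B)" "0 \<le> \<theta>" "\<theta> \<le> 1" using assms by (auto simp: \<theta>_def field_simps)
  have cvx: "convex_on {0..} (\<lambda>x::real. x powr s)" using assms by (intro convex_on_powr) auto
  have "((1 - \<theta>) *\<^sub>R (x / A) + \<theta> *\<^sub>R (y / B)) powr s \<le> (1 - \<theta>) * (x / A) powr s + \<theta> * (y / B) powr s"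
    using th xy assms by (intro convex_onD[OF cvx]) auto
  moreover have "(1 - \<theta>) *\<^sub>R (x / A) + \<theta> *\<^sub>R (y / B) = (x + y) / (A + B)"
    unfolding th using assms by (simp add: \<theta>_def add_divide_distrib)
  ultimately have "((x + y) / (A + B)) powr s \<le> (A / (A + B)) * (x / A) powr s + B / (A + B) * (y / B) powr s"
    unfolding th by (simp add: \<theta>_def)
  then have "(A + B) powr s * ((x + y) / (A + B)) powr s \<le>
      (A + B) powr s * ((A / (A + B)) * (x / A) powr s + B / (A + B) * (y / B) powr s)"
    by (intro mult_left_mono) auto
  also have "(A + B) powr s * ((x + y) / (A + B)) powr s = (x + y) powr s"
    using assms xy by (simp add: powr_mult[symmetric])
  also have "(A + B) powr s * ((A / (A + B)) * (x / A) powr s + B / (A + B) * (y / B) powr s)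
     = (A + B) powr (s - 1) * (A powr (1 - s) * x powr s + B powr (1 - s) * y powr s)"
  proof -
    have "(A + B) powr s * (A / (A + B) * (x / A) powr s) = (A + B) powr (s - 1) * (A powr (1 - s) * x powr s)"
      using assms xy by (simp add: powr_divide powr_diff)
    moreover have "(A + B) powr s * (B / (A + B) * (y / B) powr s) = (A + B) powr (s - 1) * (B powr (1 - s) * y powr s)"
      using assms xy by (simp add: powr_divide powr_diff)
    ultimately show ?thesis by (simp only: distrib_left)
  qed
  finally show ?thesis using xy
    by (simp add: ennreal_mult[symmetric] ennreal_plus[symmetric] ennreal_leI del: ennreal_plus)
qed

lemma minkowski_add:
  fixes u v :: "'a \<Rightarrow> ennreal"
  assumes [measurable]: "u \<in> borel_measurable M" "v \<in> borel_measurable M" and s: "1 \<le> s"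
  shows "epowr (\<integral>\<^sup>+ x. epowr (u x + v x) s \<partial>M) (1 / s)
     \<le> epowr (\<integral>\<^sup>+ x. epowr (u x) s \<partial>M) (1 / s) + epowr (\<integral>\<^sup>+ x. epowr (v x) s \<partial>M) (1 / s)"
    (is "?L \<le> ?A + ?B")
proof (cases "?A = top \<or> ?B = top")
  case False
  then obtain A B where AB: "?A = ennreal A" "?B = ennreal B" "0 \<le> A" "0 \<le> B"
    by (cases ?A; cases ?B) auto
  have s0: "0 < s" using s by simp
  have IA: "(\<integral>\<^sup>+ x. epowr (u x) s \<partial>M) = ennreal (A powr s)"
    using epowr_inverse(2)[OF s0, of "\<integral>\<^sup>+ x. epowr (u x) s \<partial>M"] AB by simp
  have IB: "(\<integral>\<^sup>+ x. epowr (v x) s \<partial>M) = ennreal (B powr s)"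
    using epowr_inverse(2)[OF s0, of "\<integral>\<^sup>+ x. epowr (v x) s \<partial>M"] AB by simp
  show ?thesis
  proof (rule ennreal_le_add_small[where c = 2])
    fix \<eta> :: real assume eta: "0 < \<eta>"
    define A' B' where "A' = A + \<eta>" and "B' = B + \<eta>"
    have pos: "0 < A'" "0 < B'" using AB eta by (auto simp: A'_def B'_def)
    have "(\<integral>\<^sup>+ x. epowr (u x + v x) s \<partial>M) \<le> (\<integral>\<^sup>+ x. ennreal ((A' + B') powr (s - 1)) *
      (ennreal (A' powr (1 - s)) * epowr (u x) s + ennreal (B' powr (1 - s)) * epowr (v x) s) \<partial>M)"
      by (intro nn_integral_mono epowr_add_le_weighted s pos)
    also have "\<dots> = ennreal ((A' + B') powr (s - 1)) *
      (ennreal (A' powr (1 - s)) * ennreal (A powr s) + ennreal (B' powr (1 - s)) * ennreal (B powr s))"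
      by (simp add: nn_integral_cmult nn_integral_add IA IB)
    also have "\<dots> \<le> ennreal ((A' + B') powr (s - 1)) *
      (ennreal (A' powr (1 - s)) * ennreal (A' powr s) + ennreal (B' powr (1 - s)) * ennreal (B' powr s))"
      using AB eta s by (intro mult_left_mono add_mono ennreal_leI powr_mono2) (auto simp: A'_def B'_def)
    also have "\<dots> = ennreal ((A' + B') powr s)"
    proof -
      have "(A' + B') powr (s - 1) * (A' powr (1 - s) * A' powr s + B' powr (1 - s) * B' powr s) = (A' + B') powr s"
        using pos by (simp add: powr_add[symmetric] powr_diff)
      then show ?thesis by (simp add: ennreal_mult[symmetric] ennreal_plus[symmetric] del: ennreal_plus)
    qed
    finally have "?L \<le> epowr (ennreal ((A' + B') powr s)) (1 / s)" using s by (intro epowr_mono) auto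
    also have "\<dots> = ennreal (A' + B')" using pos s by (simp add: powr_powr)
    also have "\<dots> = ?A + ?B + 2 * ennreal \<eta>"
    proof -
      have "A' + B' = (A + B) + 2 * \<eta>" by (simp add: A'_def B'_def)
      then show ?thesis unfolding AB using AB eta by (simp add: ennreal_mult)
    qed
    finally show "?L \<le> ?A + ?B + 2 * ennreal \<eta>" .
  qed simp
qed auto

lemma minkowski_sum:
  fixes u :: "'i \<Rightarrow> 'a \<Rightarrow> ennreal"
  assumes "finite I" "\<And>i. i \<in> I \<Longrightarrow> u i \<in> borel_measurable M" "1 \<le> s"
  shows "epowr (\<integral>\<^sup>+ x. epowr (\<Sum>i\<in>I. u i x) s \<partial>M) (1 / s)
     \<le> (\<Sum>i\<in>I. epowr (\<integral>\<^sup>+ x. epowr (u i x) s \<partial>M) (1 / s))"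
  using assms(1,2)
proof (induction I rule: finite_induct)
  case (insert j I)
  have [measurable]: "u j \<in> borel_measurable M" "(\<lambda>x. \<Sum>i\<in>I. u i x) \<in> borel_measurable M"
    by (rule insert.prems, simp) (intro borel_measurable_sum insert.prems, simp)
  have "epowr (\<integral>\<^sup>+ x. epowr (u j x + (\<Sum>i\<in>I. u i x)) s \<partial>M) (1 / s)
     \<le> epowr (\<integral>\<^sup>+ x. epowr (u j x) s \<partial>M) (1 / s) + epowr (\<integral>\<^sup>+ x. epowr (\<Sum>i\<in>I. u i x) s \<partial>M) (1 / s)"
    by (intro minkowski_add assms(3)) measurable
  then show ?case using insert by (auto intro: order_trans add_left_mono)
qed simp

lemma lp_sum_le:
  assumes "finite I" "0 \<le> a" "a \<le> 1"
  shows "lp a (\<lambda>k. \<Sum>i\<in>I. x i k) \<le> (\<Sum>i\<in>I. lp a (x i))"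
proof (cases "a = 0")
  case True
  then show ?thesis using le_lp[of 0] by (auto simp: lp_zero intro!: SUP_least sum_mono SUP_upper)
next
  case False
  then show ?thesis using assms minkowski_sum[of I x "count_space UNIV" "1 / a"]
    by (simp add: lp_pos)
qed

lemma lp_add_le: "0 \<le> a \<Longrightarrow> a \<le> 1 \<Longrightarrow> lp a (\<lambda>k. x k + y k) \<le> lp a x + lp a y"
  using lp_sum_le[of "UNIV :: bool set" a "\<lambda>i. if i then x else y"] by (simp add: UNIV_bool add.commute)

text \<open>Hoelder's inequality against the constant 1, from Jensen's inequality for
  \<open>x powr (1 / a)\<close> with equal weights. The factor \<open>card I powr (1 - a)\<close> is
  the source of \<open>M powr (1 - a)\<close> in the norm of a block.\<close>

lemma sum_le_card_lp:
  fixes x :: "'i \<Rightarrow> ennreal"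
  assumes "finite I" "0 \<le> a" "a \<le> 1"
  shows "(\<Sum>i\<in>I. x i) \<le> ennreal (real (card I) powr (1 - a)) * lp a (\<lambda>i. x i * indicator I i)"
proof (cases "I = {}")
  case ne: False
  then have M: "0 < card I" using assms by (simp add: card_gt_0_iff)
  let ?y = "\<lambda>i. x i * indicator I i"
  show ?thesis
  proof (cases "a = 0")
    case True
    have "x i \<le> lp 0 ?y" if "i \<in> I" for i using le_lp[of 0 ?y i] that by simp
    then have "(\<Sum>i\<in>I. x i) \<le> (\<Sum>i\<in>I. lp 0 ?y)" by (rule sum_mono)
    then show ?thesis using True M by (simp add: ennreal_of_nat_eq_real_of_nat)
  next
    case False
    with assms have a: "0 < a" by simp
    let ?s = "1 / a"
    have s: "1 \<le> ?s" using a assms by simp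
    show ?thesis
    proof (cases "\<exists>i\<in>I. x i = top")
      case True
      then obtain i where "i \<in> I" "x i = top" by auto
      then have "lp a ?y = top" using le_lp[of a ?y i] a by (auto simp: top_unique)
      then show ?thesis using M by (simp add: ennreal_mult_top)
    next
      case False
      define r where "r i = enn2real (x i)" for i
      have r: "x i = ennreal (r i)" "0 \<le> r i" if "i \<in> I" for i
        using False that by (auto simp: r_def less_top)
      have cvx: "convex_on {0..} (\<lambda>x::real. x powr ?s)" using s by (intro convex_on_powr) auto
      have "(\<Sum>i\<in>I. (1 / real (card I)) *\<^sub>R r i) powr ?s \<le> (\<Sum>i\<in>I. (1 / real (card I)) * r i powr ?s)"
        by (rule convex_on_sum[OF assms(1) ne cvx]) (use M r in auto)
      then have "(\<Sum>i\<in>I. r i) powr ?s / real (card I) powr ?s \<le> (\<Sum>i\<in>I. r i powr ?s) / real (card I)"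
        using M r by (simp add: sum_divide_distrib[symmetric] powr_divide sum_nonneg)
      then have "(\<Sum>i\<in>I. r i) powr ?s \<le> (\<Sum>i\<in>I. r i powr ?s) * (real (card I) powr ?s / real (card I))"
        using M by (simp add: field_simps)
      also have "\<dots> = (\<Sum>i\<in>I. r i powr ?s) * real (card I) powr (?s - 1)"
        using M by (simp add: powr_diff)
      finally have *: "(\<Sum>i\<in>I. r i) powr ?s \<le> (\<Sum>i\<in>I. r i powr ?s) * real (card I) powr (?s - 1)" .
      have "(\<integral>\<^sup>+ i. epowr (?y i) ?s \<partial>count_space UNIV) = (\<Sum>i\<in>I. epowr (?y i) ?s)"
        by (rule nn_integral_count_space'[OF assms(1)]) auto
      also have "\<dots> = ennreal (\<Sum>i\<in>I. r i powr ?s)" using r by (simp add: sum_ennreal)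
      finally have l: "epowr (lp a ?y) ?s = ennreal (\<Sum>i\<in>I. r i powr ?s)" using a by (simp add: epowr_lp)
      have "epowr (\<Sum>i\<in>I. x i) ?s = ennreal ((\<Sum>i\<in>I. r i) powr ?s)"
        using r by (simp add: sum_ennreal sum_nonneg)
      also have "\<dots> \<le> ennreal ((\<Sum>i\<in>I. r i powr ?s) * real (card I) powr (?s - 1))"
        using * by (rule ennreal_leI)
      also have "\<dots> = epowr (ennreal (real (card I) powr (1 - a)) * lp a ?y) ?s"
      proof -
        have "(1 - a) * ?s = ?s - 1" using a by (simp add: field_simps)
        then show ?thesis using a by (simp add: epowr_mult l powr_powr ennreal_mult sum_nonneg mult.commute)
      qed
      finally show ?thesis using a by (simp add: epowr_le_iff epowr_epowr)
    qed
  qed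
qed simp

subsection \<open>Level sequences\<close>

lemma ennreal_pmult_le_iff: "0 < c \<Longrightarrow> ennreal c * x \<le> y \<longleftrightarrow> x \<le> ennreal (1 / c) * y"
proof -
  assume c: "0 < c"
  have 1: "ennreal (1 / c) * (ennreal c * z) = z" and 2: "ennreal c * (ennreal (1 / c) * z) = z" for z
    using c by (simp_all add: mult.assoc[symmetric] ennreal_mult[symmetric])
  show ?thesis
    using mult_left_mono[of "ennreal c * x" y "ennreal (1 / c)"]
      mult_left_mono[of x "ennreal (1 / c) * y" "ennreal c"] by (auto simp: 1 2)
qed

text \<open>\<open>D\<close> may be any function of the height, because besides distribution
  functions also the measures of level sets inside a single piece are treated.\<close>

definition lev :: "real \<Rightarrow> (real \<Rightarrow> ennreal) \<Rightarrow> int \<Rightarrow> ennreal" where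
  "lev p D k = ennreal (2 powr real_of_int k) * epowr (D (2 powr real_of_int k)) (1 / p)"

definition dl :: "real \<Rightarrow> real \<Rightarrow> 'a measure \<Rightarrow> ('a \<Rightarrow> ennreal) \<Rightarrow> ennreal" where
  "dl p a \<mu> g = lp a (lev p (distr_fun \<mu> g))"

text \<open>Converts between levels, on which norms are taken, and measures of level sets, on which
  additivity is available.\<close>

lemma lev_le_iff:
  assumes "0 < p"
  shows "lev p D k \<le> V \<longleftrightarrow> D (2 powr real_of_int k) \<le> epowr (ennreal (2 powr - real_of_int k) * V) p"
  using assms by (simp add: lev_def ennreal_pmult_le_iff epowr_le_iff powr_minus_divide)

lemma lev_mono: "0 < p \<Longrightarrow> D (2 powr real_of_int k) \<le> D' (2 powr real_of_int k) \<Longrightarrow> lev p D k \<le> lev p D' k"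
  unfolding lev_def by (intro mult_left_mono epowr_mono) auto

lemma lev_eq_0_iff: "lev p D k = 0 \<longleftrightarrow> D (2 powr real_of_int k) = 0"
  by (simp add: lev_def)

lemma geom_int_down:
  assumes "0 < s"
  shows "(\<integral>\<^sup>+ k. ennreal (2 powr (s * real_of_int k)) * indicator {..K} k \<partial>count_space UNIV)
    = ennreal (2 powr (s * real_of_int K) / (1 - 2 powr (- s)))"
proof -
  have r: "0 \<le> 2 powr (- s)" "2 powr (- s) < 1" using assms by (auto simp: powr_less_one)
  have bij: "bij_betw (\<lambda>i. K - int i) UNIV {..K}"
    by (rule bij_betwI[where g = "\<lambda>k. nat (K - k)"]) auto
  have "(\<integral>\<^sup>+ k. ennreal (2 powr (s * real_of_int k)) * indicator {..K} k \<partial>count_space UNIV)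
     = (\<integral>\<^sup>+ k. ennreal (2 powr (s * real_of_int k)) \<partial>count_space {..K})"
    by (simp add: nn_integral_count_space_indicator)
  also have "\<dots> = (\<integral>\<^sup>+ i. ennreal (2 powr (s * real_of_int (K - int i))) \<partial>count_space UNIV)"
    by (rule nn_integral_bij_count_space[OF bij, symmetric])
  also have "\<dots> = (\<Sum>i. ennreal (2 powr (s * real_of_int K) * (2 powr (- s)) ^ i))"
    by (simp add: nn_integral_count_space_nat powr_realpow[symmetric] powr_powr powr_add[symmetric] algebra_simps)
  also have "\<dots> = ennreal (\<Sum>i. 2 powr (s * real_of_int K) * (2 powr (- s)) ^ i)"
    using r by (intro suminf_ennreal2 summable_mult summable_geometric) auto
  also have "(\<Sum>i. 2 powr (s * real_of_int K) * (2 powr (- s)) ^ i) = 2 powr (s * real_of_int K) / (1 - 2 powr (- s))"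
    using r suminf_geometric[of "2 powr (- s)"] by (subst suminf_mult) (auto intro: summable_geometric)
  finally show ?thesis .
qed

lemma geom_int_up:
  assumes "0 < s"
  shows "(\<integral>\<^sup>+ k. ennreal (2 powr (- s * real_of_int k)) * indicator {K..} k \<partial>count_space UNIV)
    = ennreal (2 powr (- s * real_of_int K) / (1 - 2 powr (- s)))"
proof -
  have "(\<integral>\<^sup>+ k. ennreal (2 powr (- s * real_of_int k)) * indicator {K..} k \<partial>count_space UNIV)
     = (\<integral>\<^sup>+ k. ennreal (2 powr (s * real_of_int (- k))) * indicator {..- K} (- k) \<partial>count_space UNIV)"
    by (intro nn_integral_cong) (auto split: split_indicator)
  also have "\<dots> = (\<integral>\<^sup>+ k. ennreal (2 powr (s * real_of_int k)) * indicator {..- K} k \<partial>count_space UNIV)"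
    by (rule nn_integral_bij_count_space) (rule bij_uminus)
  also have "\<dots> = ennreal (2 powr (s * real_of_int (- K)) / (1 - 2 powr (- s)))"
    by (rule geom_int_down[OF assms])
  finally show ?thesis by simp
qed

lemma suminf_geom_powr:
  assumes "0 < s"
  shows "(\<Sum>i. ennreal (2 powr (- s * real i))) = ennreal (1 / (1 - 2 powr (- s)))"
proof -
  have r: "0 \<le> 2 powr (- s)" "2 powr (- s) < 1" using assms by (auto simp: powr_less_one)
  have "(\<Sum>i. ennreal (2 powr (- s * real i))) = (\<Sum>i. ennreal ((2 powr (- s)) ^ i))"
    by (simp add: powr_realpow[symmetric] powr_powr)
  also have "\<dots> = ennreal (\<Sum>i. (2 powr (- s)) ^ i)"
    using r by (intro suminf_ennreal2 summable_geometric) auto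
  also have "(\<Sum>i. (2 powr (- s)) ^ i) = 1 / (1 - 2 powr (- s))"
    using r by (intro suminf_geometric) auto
  finally show ?thesis .
qed

lemma floor_log2_bounds:
  assumes "0 < t"
  shows "2 powr real_of_int \<lfloor>log 2 t\<rfloor> \<le> t" "t < 2 powr (real_of_int \<lfloor>log 2 t\<rfloor> + 1)"
proof -
  have "2 powr real_of_int \<lfloor>log 2 t\<rfloor> \<le> 2 powr (log 2 t)" by simp
  then show "2 powr real_of_int \<lfloor>log 2 t\<rfloor> \<le> t" using assms by simp
  have "2 powr (log 2 t) < 2 powr (real_of_int \<lfloor>log 2 t\<rfloor> + 1)"
    by (intro powr_less_mono floor_less_iff[THEN iffD1]) (auto simp: floor_less_iff)
  then show "t < 2 powr (real_of_int \<lfloor>log 2 t\<rfloor> + 1)" using assms by simp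
qed

lemma ceiling_log2_bounds:
  assumes "0 < t"
  shows "t \<le> 2 powr real_of_int \<lceil>log 2 t\<rceil>" "2 powr (real_of_int \<lceil>log 2 t\<rceil> - 1) < t"
proof -
  have "2 powr (log 2 t) \<le> 2 powr real_of_int \<lceil>log 2 t\<rceil>" by simp
  then show "t \<le> 2 powr real_of_int \<lceil>log 2 t\<rceil>" using assms by simp
  have "2 powr (real_of_int \<lceil>log 2 t\<rceil> - 1) < 2 powr (log 2 t)" by (intro powr_less_mono) linarith+
  then show "2 powr (real_of_int \<lceil>log 2 t\<rceil> - 1) < t" using assms by simp
qed

section \<open>Outer measure and distribution functions\<close>

lemma outer_mu_mono: "S \<subseteq> T \<Longrightarrow> outer_mu \<mu> S \<le> outer_mu \<mu> T"
  unfolding outer_mu_def by (intro INF_superset_mono) auto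

lemma outer_mu_sets: assumes "S \<in> sets \<mu>" shows "outer_mu \<mu> S = emeasure \<mu> S"
proof (rule antisym)
  show "outer_mu \<mu> S \<le> emeasure \<mu> S" unfolding outer_mu_def using assms by (intro INF_lower) auto
  show "emeasure \<mu> S \<le> outer_mu \<mu> S" unfolding outer_mu_def by (intro INF_greatest emeasure_mono) auto
qed

text \<open>Near-optimal measurable covers. Outer measure is what \<open>distr_fun\<close> has to
  work with, as the maximal function is not known to be measurable.\<close>

lemma outer_mu_Un: "outer_mu \<mu> (S \<union> T) \<le> outer_mu \<mu> S + outer_mu \<mu> T"
proof (rule ennreal_le_add_small[where c = 2])
  fix e :: real assume e: "0 < e"
  show "outer_mu \<mu> (S \<union> T) \<le> outer_mu \<mu> S + outer_mu \<mu> T + 2 * ennreal e"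
  proof (cases "outer_mu \<mu> S = top \<or> outer_mu \<mu> T = top")
    case False
    have ex: "\<exists>A\<in>sets \<mu>. R \<subseteq> A \<and> emeasure \<mu> A \<le> outer_mu \<mu> R + ennreal e" if "outer_mu \<mu> R \<noteq> top" for R
    proof -
      have "outer_mu \<mu> R < outer_mu \<mu> R + ennreal e" using that e
        by (cases "outer_mu \<mu> R") (auto simp: ennreal_plus[symmetric] ennreal_less_iff simp del: ennreal_plus)
      then obtain A where "A \<in> sets \<mu>" "R \<subseteq> A" "emeasure \<mu> A < outer_mu \<mu> R + ennreal e"
        unfolding outer_mu_def[of \<mu> R] by (subst (asm) INF_less_iff) auto
      then show ?thesis by (auto intro: less_imp_le)
    qed
    obtain A B where AB: "A \<in> sets \<mu>" "S \<subseteq> A" "emeasure \<mu> A \<le> outer_mu \<mu> S + ennreal e"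
      "B \<in> sets \<mu>" "T \<subseteq> B" "emeasure \<mu> B \<le> outer_mu \<mu> T + ennreal e"
      using ex False by metis
    have "outer_mu \<mu> (S \<union> T) \<le> outer_mu \<mu> (A \<union> B)" using AB by (intro outer_mu_mono) auto
    also have "\<dots> = emeasure \<mu> (A \<union> B)" using AB by (simp add: outer_mu_sets)
    also have "\<dots> \<le> emeasure \<mu> A + emeasure \<mu> B" using AB by (intro emeasure_subadditive)
    also have "\<dots> \<le> (outer_mu \<mu> S + ennreal e) + (outer_mu \<mu> T + ennreal e)" using AB by (intro add_mono)
    also have "\<dots> = outer_mu \<mu> S + outer_mu \<mu> T + 2 * ennreal e"
      unfolding mult_2 by (simp add: ac_simps)
    finally show ?thesis .
  qed auto
qed simp

lemma distr_fun_mono: "(\<And>x. x \<in> space \<mu> \<Longrightarrow> g x \<le> h x) \<Longrightarrow> distr_fun \<mu> g t \<le> distr_fun \<mu> h t"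
  unfolding distr_fun_def by (intro outer_mu_mono) (auto intro: less_le_trans)

lemma distr_fun_antimono: "s \<le> t \<Longrightarrow> distr_fun \<mu> g t \<le> distr_fun \<mu> g s"
  unfolding distr_fun_def by (intro outer_mu_mono) (auto intro: le_less_trans ennreal_leI)

lemma distr_fun_add:
  assumes "\<And>x. x \<in> space \<mu> \<Longrightarrow> g x \<le> u x + v x" "0 \<le> t"
  shows "distr_fun \<mu> g (2 * t) \<le> distr_fun \<mu> u t + distr_fun \<mu> v t"
proof -
  have "u x > ennreal t \<or> v x > ennreal t" if "x \<in> space \<mu>" "g x > ennreal (2 * t)" for x
  proof (rule ccontr)
    assume "\<not> ?thesis"
    then have "u x + v x \<le> ennreal t + ennreal t" by (intro add_mono) auto
    also have "\<dots> = ennreal (2 * t)" using assms by (simp add: ennreal_plus[symmetric] del: ennreal_plus)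
    finally show False using assms(1)[OF that(1)] that by (meson leD order_trans)
  qed
  then show ?thesis unfolding distr_fun_def
    by (intro order_trans[OF outer_mu_mono outer_mu_Un]) auto
qed

lemma distr_fun_cmult:
  assumes "0 < c" shows "distr_fun \<mu> (\<lambda>x. ennreal c * g x) t = distr_fun \<mu> g (t / c)"
proof -
  have "ennreal t < ennreal c * y \<longleftrightarrow> ennreal (t / c) < y" for y
    using ennreal_pmult_le_iff[OF assms, of y "ennreal t"] assms
    by (auto simp: not_le[symmetric] ennreal_mult'[symmetric])
  then show ?thesis by (simp add: distr_fun_def)
qed

lemma dl_mono:
  "0 < p \<Longrightarrow> 0 \<le> a \<Longrightarrow> (\<And>x. x \<in> space \<mu> \<Longrightarrow> g x \<le> h x) \<Longrightarrow> dl p a \<mu> g \<le> dl p a \<mu> h"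
  unfolding dl_def by (intro lp_mono lev_mono distr_fun_mono)

lemma lp_shift: assumes "0 \<le> a" shows "lp a (\<lambda>k::int. x (k + j)) = lp a x"
proof (rule antisym)
  show "lp a (\<lambda>k. x (k + j)) \<le> lp a x" using assms by (intro lp_reindex) (auto intro: injI)
  show "lp a x \<le> lp a (\<lambda>k. x (k + j))"
    using lp_reindex[of "\<lambda>k. k - j" a "\<lambda>k. x (k + j)"] assms by (auto intro: injI)
qed

text \<open>For a power of 2 scaling is an exact shift of the levels; other factors are rounded
  where they occur.\<close>

lemma dl_cmult:
  assumes "0 \<le> a" shows "dl p a \<mu> (\<lambda>x. ennreal (2 powr real_of_int j) * g x) = ennreal (2 powr real_of_int j) * dl p a \<mu> g"
proof -
  have "lev p (distr_fun \<mu> (\<lambda>x. ennreal (2 powr real_of_int j) * g x)) k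
      = ennreal (2 powr real_of_int j) * lev p (distr_fun \<mu> g) (k + - j)" for k
    by (simp add: lev_def distr_fun_cmult powr_diff[symmetric] mult.assoc[symmetric] ennreal_mult[symmetric] powr_add[symmetric])
  then have "lev p (distr_fun \<mu> (\<lambda>x. ennreal (2 powr real_of_int j) * g x))
      = (\<lambda>k. ennreal (2 powr real_of_int j) * lev p (distr_fun \<mu> g) (k + - j))" by (rule ext)
  then have "dl p a \<mu> (\<lambda>x. ennreal (2 powr real_of_int j) * g x)
     = lp a (\<lambda>k. ennreal (2 powr real_of_int j) * lev p (distr_fun \<mu> g) (k + - j))"
    by (simp only: dl_def)
  also have "\<dots> = ennreal (2 powr real_of_int j) * dl p a \<mu> g"
    unfolding dl_def lp_cmult[OF assms] lp_shift[OF assms] ..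
  finally show ?thesis .
qed

text \<open>The \<open>l^p\<close> norm is at most the \<open>l^1\<close> norm, on an index set of
  two points.\<close>

lemma epowr_add_le:
  assumes "1 \<le> p" shows "epowr (x + y) (1 / p) \<le> epowr x (1 / p) + epowr y (1 / p)"
proof -
  have "(\<integral>\<^sup>+ i. epowr (if i then epowr x (1/p) else epowr y (1/p)) p \<partial>count_space UNIV)
    \<le> epowr (\<integral>\<^sup>+ i. (if i then epowr x (1/p) else epowr y (1/p)) \<partial>count_space UNIV) p"
    using assms by (intro sum_epowr_le)
  then show ?thesis using assms
    by (simp add: nn_integral_count_space_finite UNIV_bool epowr_inverse epowr_le_iff add.commute)
qed

lemma lev_add_le:
  assumes "1 \<le> p" "D (2 powr real_of_int k) \<le> D1 (2 powr real_of_int (k - 1)) + D2 (2 powr real_of_int (k - 1))"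
  shows "lev p D k \<le> 2 * (lev p D1 (k - 1) + lev p D2 (k - 1))"
proof -
  have "lev p D k \<le> ennreal (2 powr real_of_int k) *
     (epowr (D1 (2 powr real_of_int (k - 1))) (1/p) + epowr (D2 (2 powr real_of_int (k - 1))) (1/p))"
    unfolding lev_def using assms
    by (intro mult_left_mono order_trans[OF epowr_mono epowr_add_le]) auto
  also have "ennreal (2 powr real_of_int k) = 2 * ennreal (2 powr real_of_int (k - 1))"
  proof -
    have "2 powr real_of_int k = 2 * 2 powr real_of_int (k - 1)" by (simp add: powr_diff)
    then show ?thesis by (simp add: ennreal_mult)
  qed
  finally show ?thesis by (simp add: lev_def distrib_left mult.assoc)
qed

lemma distr_fun_add_level:
  assumes "\<And>x. x \<in> space \<mu> \<Longrightarrow> g x \<le> u x + v x"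
  shows "distr_fun \<mu> g (2 powr real_of_int k)
     \<le> distr_fun \<mu> u (2 powr real_of_int (k - 1)) + distr_fun \<mu> v (2 powr real_of_int (k - 1))"
proof -
  have "2 powr real_of_int k = 2 * 2 powr real_of_int (k - 1)" by (simp add: powr_diff)
  then show ?thesis using distr_fun_add[OF assms, where t = "2 powr real_of_int (k - 1)"] by simp
qed

text \<open>Quasi-triangle inequality for two functions: halving the height shifts the levels by one
  and costs the factor 2. Iterated, the constant would grow with the number of terms, so sums over
  input pieces go through \<open>dl_sum_le\<close> instead.\<close>

lemma lp_lev_add_le:
  assumes "1 \<le> p" "0 \<le> a" "a \<le> 1"
    "\<And>k. D (2 powr real_of_int k) \<le> D1 (2 powr real_of_int (k - 1)) + D2 (2 powr real_of_int (k - 1))"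
  shows "lp a (lev p D) \<le> 2 * (lp a (lev p D1) + lp a (lev p D2))"
proof -
  have "lp a (lev p D) \<le> lp a (\<lambda>k. 2 * (lev p D1 (k + - 1) + lev p D2 (k + - 1)))"
    using assms lev_add_le[of p D _ D1 D2] by (intro lp_mono) auto
  also have "\<dots> = 2 * lp a (\<lambda>k. lev p D1 (k + - 1) + lev p D2 (k + - 1))"
    by (rule lp_cmult[OF assms(2)])
  also have "\<dots> = 2 * lp a (\<lambda>k. lev p D1 k + lev p D2 k)"
    using lp_shift[OF assms(2), of "\<lambda>k. lev p D1 k + lev p D2 k" "-1"] by simp
  also have "\<dots> \<le> 2 * (lp a (lev p D1) + lp a (lev p D2))"
    using assms by (intro mult_left_mono lp_add_le) auto
  finally show ?thesis .
qed

text \<open>The norm of a function bounded by \<open>v\<close> on a set of measure \<open>V\<close>.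
  The largest of these norms, at \<open>a = 1\<close>, is a geometric series equal to twice its last
  term, so the constant 2 serves for all \<open>a\<close>.\<close>

lemma lp_lev_indicator_le:
  assumes p: "0 < p" and a: "0 \<le> a" "a \<le> 1" and v: "0 \<le> v"
    and D: "\<And>k. D (2 powr real_of_int k) \<le> (if 2 powr real_of_int k < v then V else 0)"
  shows "lp a (lev p D) \<le> ennreal (2 * v) * epowr V (1 / p)"
proof (cases "v = 0")
  case True
  have "lev p D k = 0" for k using True D[of k] powr_ge_zero[of 2 "real_of_int k"]
    by (simp add: lev_def not_less[symmetric] split: if_splits)
  then have "lev p D = (\<lambda>k. 0)" by (rule ext)
  then show ?thesis by simp
next
  case False
  with v have v: "0 < v" by simp
  define K where "K = \<lfloor>log 2 v\<rfloor>"
  have "lp a (lev p D) \<le> lp 1 (lev p D)" using a by (intro lp_antimono_exponent)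
  also have "\<dots> = (\<integral>\<^sup>+ k. lev p D k \<partial>count_space UNIV)" by (simp add: lp_pos)
  also have "\<dots> \<le> (\<integral>\<^sup>+ k. epowr V (1/p) * (ennreal (2 powr (1 * real_of_int k)) * indicator {..K} k) \<partial>count_space UNIV)"
  proof (intro nn_integral_mono)
    fix k :: int
    show "lev p D k \<le> epowr V (1/p) * (ennreal (2 powr (1 * real_of_int k)) * indicator {..K} k)"
    proof (cases "2 powr real_of_int k < v")
      case True
      then have "real_of_int k < log 2 v" using v by (simp add: less_log_iff)
      then have "k \<le> K" by (simp add: K_def le_floor_iff)
      moreover have "lev p D k \<le> epowr V (1/p) * ennreal (2 powr real_of_int k)"
        unfolding lev_def using D[of k] True p by (subst mult.commute, intro mult_right_mono epowr_mono) auto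
      ultimately show ?thesis by simp
    next
      case False
      then show ?thesis using D[of k] by (simp add: lev_def)
    qed
  qed
  also have "\<dots> = epowr V (1/p) * ennreal (2 powr (1 * real_of_int K) / (1 - 2 powr (- 1)))"
    by (simp only: nn_integral_cmult geom_int_down[of 1] zero_less_one measurable_count_space_eq1 space_borel Pi_UNIV UNIV_I)
  also have "\<dots> \<le> epowr V (1/p) * ennreal (2 * v)"
    using floor_log2_bounds[OF v] by (intro mult_left_mono ennreal_leI) (auto simp: K_def powr_minus)
  finally show ?thesis by (simp add: mult.commute)
qed

lemma le_lp_lev:
  assumes p: "0 < p" and a: "0 \<le> a" and v: "0 < v" and D: "\<And>t. 0 < t \<Longrightarrow> t < v \<Longrightarrow> V \<le> D t"
  shows "ennreal v * epowr V (1 / p) \<le> 2 * lp a (lev p D)"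
proof -
  \<comment> \<open>The largest integer with \<open>2 powr k < v\<close>; then \<open>v\<close> is
    at most twice \<open>2 powr k\<close>.\<close>
  define k where "k = \<lceil>log 2 v\<rceil> - 1"
  have k: "2 powr real_of_int k < v" "v \<le> 2 * 2 powr real_of_int k"
    using ceiling_log2_bounds[OF v] by (auto simp: k_def powr_diff)
  have "ennreal v * epowr V (1 / p) \<le> ennreal (2 * 2 powr real_of_int k) * epowr (D (2 powr real_of_int k)) (1 / p)"
    using k p by (intro mult_mono ennreal_leI epowr_mono D) auto
  also have "\<dots> = 2 * lev p D k" by (simp add: lev_def ennreal_mult mult.assoc)
  also have "\<dots> \<le> 2 * lp a (lev p D)" using a by (intro mult_left_mono le_lp) auto
  finally show ?thesis .
qed

subsection \<open>Discretisation of the Lorentz quasinorm\<close>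

text \<open>Between \<open>2^k\<close> and \<open>2^(k+1)\<close> one has
  \<open>t \<le> 2 * 2^k\<close>, the distribution function is at most its value at
  \<open>2^k\<close>, and \<open>dt / t\<close> contributes at most 1. The factor \<open>p\<close>
  bounds \<open>p powr a\<close>.\<close>

lemma lorentz_le_dl:
  assumes p: "1 < p" and a: "0 \<le> a" "a \<le> 1"
  shows "lorentz \<mu> p a g \<le> ennreal (2 * p) * dl p a \<mu> g"
proof (cases "a = 0")
  case True
  let ?D = "distr_fun \<mu> g"
  have "ennreal t * epowr (?D t) (1/p) \<le> ennreal (2 * p) * dl p a \<mu> g" if t: "0 < t" for t
  proof -
    define k where "k = \<lfloor>log 2 t\<rfloor>"
    have k: "2 powr real_of_int k \<le> t" "t \<le> 2 * 2 powr real_of_int k"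
      using floor_log2_bounds[OF t] by (auto simp: k_def powr_add)
    have "ennreal t * epowr (?D t) (1/p) \<le> ennreal (2 * 2 powr real_of_int k) * epowr (?D (2 powr real_of_int k)) (1/p)"
      using k p by (intro mult_mono ennreal_leI epowr_mono distr_fun_antimono) auto
    also have "\<dots> = ennreal 2 * lev p ?D k" by (simp add: lev_def ennreal_mult mult.assoc)
    also have "\<dots> \<le> ennreal (2 * p) * dl p a \<mu> g" unfolding dl_def
      using p a by (intro mult_mono le_lp ennreal_leI) auto
    finally show ?thesis .
  qed
  then show ?thesis using True by (auto simp: lorentz_def intro!: SUP_least)
next
  case False
  with a have a0: "0 < a" by simp
  let ?D = "distr_fun \<mu> g"
  let ?x = "lev p ?D"
  have "(\<integral>\<^sup>+ t \<in> {0<..}. epowr (ennreal t * epowr (?D t) (1/p)) (1/a) / ennreal t \<partial>lborel)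
     \<le> (\<integral>\<^sup>+ t. \<integral>\<^sup>+ k. ennreal (2 powr - real_of_int k) * epowr (2 * ?x k) (1/a) *
          indicator {2 powr real_of_int k ..< 2 * 2 powr real_of_int k} t \<partial>count_space UNIV \<partial>lborel)"
  proof (intro nn_integral_mono)
    fix t :: real
    show "epowr (ennreal t * epowr (?D t) (1/p)) (1/a) / ennreal t * indicator {0<..} t
      \<le> (\<integral>\<^sup>+ k. ennreal (2 powr - real_of_int k) * epowr (2 * ?x k) (1/a) *
          indicator {2 powr real_of_int k ..< 2 * 2 powr real_of_int k} t \<partial>count_space UNIV)"
    proof (cases "0 < t")
      case t: True
      define k where "k = \<lfloor>log 2 t\<rfloor>"
      have k: "2 powr real_of_int k \<le> t" "t < 2 * 2 powr real_of_int k"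
        using floor_log2_bounds[OF t] by (auto simp: k_def powr_add)
      have "epowr (ennreal t * epowr (?D t) (1/p)) (1/a) / ennreal t
         = ennreal (1 / t) * epowr (ennreal t * epowr (?D t) (1/p)) (1/a)"
        using t by (simp add: divide_ennreal_def inverse_ennreal mult.commute divide_inverse)
      also have "\<dots> \<le> ennreal (2 powr - real_of_int k) * epowr (ennreal (2 * 2 powr real_of_int k) * epowr (?D (2 powr real_of_int k)) (1/p)) (1/a)"
        using k p a0 t by (intro mult_mono ennreal_leI epowr_mono distr_fun_antimono)
          (auto simp: powr_minus divide_inverse)
      also have "\<dots> = ennreal (2 powr - real_of_int k) * epowr (2 * ?x k) (1/a) *
          indicator {2 powr real_of_int k ..< 2 * 2 powr real_of_int k} t"
        using k by (simp add: lev_def ennreal_mult mult.assoc)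
      also have "\<dots> \<le> lp 1 (\<lambda>k. ennreal (2 powr - real_of_int k) * epowr (2 * ?x k) (1/a) *
          indicator {2 powr real_of_int k ..< 2 * 2 powr real_of_int k} t)"
        by (rule le_lp) simp
      finally show ?thesis using t by (simp add: lp_pos)
    qed auto
  qed
  also have "\<dots> = (\<integral>\<^sup>+ k. \<integral>\<^sup>+ t. ennreal (2 powr - real_of_int k) * epowr (2 * ?x k) (1/a) *
          indicator {2 powr real_of_int k ..< 2 * 2 powr real_of_int k} t \<partial>lborel \<partial>count_space UNIV)"
    by (rule nn_integral_count_space_nn_integral) auto
  also have "\<dots> = (\<integral>\<^sup>+ k. epowr (2 * ?x k) (1/a) \<partial>count_space UNIV)"
  proof (intro nn_integral_cong)
    fix k :: int
    have "emeasure lborel {2 powr real_of_int k ..< 2 * 2 powr real_of_int k} = ennreal (2 powr real_of_int k)"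
      by (subst emeasure_lborel_Ico) auto
    then show "(\<integral>\<^sup>+ t. ennreal (2 powr - real_of_int k) * epowr (2 * ?x k) (1/a) *
          indicator {2 powr real_of_int k ..< 2 * 2 powr real_of_int k} t \<partial>lborel) = epowr (2 * ?x k) (1/a)"
      by (simp add: nn_integral_cmult mult.commute[of _ "epowr _ _"] mult.assoc ennreal_mult[symmetric] powr_add[symmetric])
  qed
  finally have "epowr (\<integral>\<^sup>+ t \<in> {0<..}. epowr (ennreal t * epowr (?D t) (1/p)) (1/a) / ennreal t \<partial>lborel) a
      \<le> lp a (\<lambda>k. 2 * ?x k)"
    using a0 by (auto simp: lp_pos intro: epowr_mono)
  also have "\<dots> = 2 * dl p a \<mu> g" using a by (simp add: lp_cmult dl_def)
  finally have "lorentz \<mu> p a g \<le> ennreal (p powr a) * (2 * dl p a \<mu> g)"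
    using False by (simp add: lorentz_def mult_left_mono)
  also have "\<dots> \<le> ennreal p * (2 * dl p a \<mu> g)"
    using p a powr_mono[of a 1 p] by (intro mult_right_mono ennreal_leI) auto
  also have "\<dots> = ennreal (2 * p) * dl p a \<mu> g" using p by (simp add: ennreal_mult ac_simps)
  finally show ?thesis .
qed

lemma half_mult: "ennreal (1/2) * (ennreal c * z) = ennreal (c / 2) * z"
proof -
  have "ennreal (1/2) * ennreal c = ennreal (1/2 * c)" by (rule ennreal_mult'[symmetric]) simp
  then show ?thesis by (simp only: mult.assoc[symmetric]) simp
qed

text \<open>Here the dyadic intervals end at \<open>2^k\<close>, where the distribution function is
  smallest on them. One factor 2 comes from \<open>t \<ge> 2^k / 2\<close>, the other from the
  length \<open>2^k / 2\<close> of the interval, since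
  \<open>(1/2) powr a \<ge> 1/2\<close>.\<close>

lemma dl_le_lorentz:
  assumes p: "1 < p" and a: "0 \<le> a" "a \<le> 1"
  shows "dl p a \<mu> g \<le> 4 * lorentz \<mu> p a g"
proof (cases "a = 0")
  case True
  have "lev p (distr_fun \<mu> g) k \<le> lorentz \<mu> p a g" for k
    using True by (auto simp: lorentz_def lev_def intro!: SUP_upper2[of "2 powr real_of_int k"])
  then have "dl p a \<mu> g \<le> 1 * lorentz \<mu> p a g" using True by (auto simp: dl_def lp_zero intro: SUP_least)
  also have "\<dots> \<le> 4 * lorentz \<mu> p a g" by (intro mult_right_mono) auto
  finally show ?thesis .
next
  case False
  with a have a0: "0 < a" by simp
  let ?D = "distr_fun \<mu> g"
  let ?x = "lev p ?D"
  let ?I = "\<integral>\<^sup>+ t \<in> {0<..}. epowr (ennreal t * epowr (?D t) (1/p)) (1/a) / ennreal t \<partial>lborel"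
  have "(\<integral>\<^sup>+ t. \<integral>\<^sup>+ k. ennreal (2 powr - real_of_int k) * epowr (ennreal (1/2) * ?x k) (1/a) *
          indicator {2 powr real_of_int k / 2 <.. 2 powr real_of_int k} t \<partial>count_space UNIV \<partial>lborel) \<le> ?I"
  proof (intro nn_integral_mono)
    fix t :: real
    show "(\<integral>\<^sup>+ k. ennreal (2 powr - real_of_int k) * epowr (ennreal (1/2) * ?x k) (1/a) *
          indicator {2 powr real_of_int k / 2 <.. 2 powr real_of_int k} t \<partial>count_space UNIV)
      \<le> epowr (ennreal t * epowr (?D t) (1/p)) (1/a) / ennreal t * indicator {0<..} t"
    proof (cases "0 < t")
      case t: True
      define k where "k = \<lceil>log 2 t\<rceil>"
      have k: "2 powr real_of_int k / 2 < t" "t \<le> 2 powr real_of_int k"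
        using ceiling_log2_bounds[OF t] by (auto simp: k_def powr_diff)
      have uniq: "j = k" if "2 powr real_of_int j / 2 < t" "t \<le> 2 powr real_of_int j" for j
      proof -
        have "2 powr (real_of_int j - 1) < 2 powr real_of_int k" "2 powr (real_of_int k - 1) < 2 powr real_of_int j"
          using that k by (auto simp: powr_diff)
        then have "real_of_int j - 1 < real_of_int k" "real_of_int k - 1 < real_of_int j"
          by (metis powr_less_cancel_iff one_less_numeral_iff semiring_norm(76))+
        then show ?thesis by linarith
      qed
      have "(\<integral>\<^sup>+ j. ennreal (2 powr - real_of_int j) * epowr (ennreal (1/2) * ?x j) (1/a) *
          indicator {2 powr real_of_int j / 2 <.. 2 powr real_of_int j} t \<partial>count_space UNIV)
        = (\<integral>\<^sup>+ j. ennreal (2 powr - real_of_int j) * epowr (ennreal (1/2) * ?x j) (1/a) * indicator {k} j \<partial>count_space UNIV)"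
      proof (intro nn_integral_cong)
        fix j
        have "t \<in> {2 powr real_of_int j / 2 <.. 2 powr real_of_int j} \<longleftrightarrow> j \<in> {k}"
          unfolding greaterThanAtMost_iff singleton_iff using k uniq[of j] by blast
        then have "indicator {2 powr real_of_int j / 2 <.. 2 powr real_of_int j} t = (indicator {k} j :: ennreal)"
          unfolding indicator_def by (simp only:)
        then show "ennreal (2 powr - real_of_int j) * epowr (ennreal (1/2) * ?x j) (1/a) *
          indicator {2 powr real_of_int j / 2 <.. 2 powr real_of_int j} t
          = ennreal (2 powr - real_of_int j) * epowr (ennreal (1/2) * ?x j) (1/a) * indicator {k} j"
          by (simp only:)
      qed
      also have "\<dots> = ennreal (2 powr - real_of_int k) * epowr (ennreal (1/2) * ?x k) (1/a)"
        by (subst nn_integral_indicator_singleton) auto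
      also have "\<dots> = ennreal (2 powr - real_of_int k) * epowr (ennreal (2 powr real_of_int k / 2) * epowr (?D (2 powr real_of_int k)) (1/p)) (1/a)"
        by (simp only: lev_def half_mult)
      also have "\<dots> \<le> ennreal (1 / t) * epowr (ennreal t * epowr (?D t) (1/p)) (1/a)"
      proof (intro mult_mono ennreal_leI epowr_mono distr_fun_antimono)
        show "2 powr - real_of_int k \<le> 1 / t"
          unfolding powr_minus_divide by (rule divide_left_mono[OF k(2)]) (use t in auto)
        show "2 powr real_of_int k / 2 \<le> t" by (rule less_imp_le[OF k(1)])
        show "t \<le> 2 powr real_of_int k" by (rule k(2))
      qed (use p a0 in simp_all)
      also have "\<dots> = epowr (ennreal t * epowr (?D t) (1/p)) (1/a) / ennreal t"
        using t by (simp add: divide_ennreal_def inverse_ennreal mult.commute divide_inverse)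
      finally show ?thesis using t by simp
    next
      case False
      then have "indicator {2 powr real_of_int j / 2 <.. 2 powr real_of_int j} t = (0::ennreal)" for j
        using powr_gt_zero[of 2 "real_of_int j"] by (auto split: split_indicator)
      then show ?thesis by simp
    qed
  qed
  also have "(\<integral>\<^sup>+ t. \<integral>\<^sup>+ k. ennreal (2 powr - real_of_int k) * epowr (ennreal (1/2) * ?x k) (1/a) *
          indicator {2 powr real_of_int k / 2 <.. 2 powr real_of_int k} t \<partial>count_space UNIV \<partial>lborel)
      = (\<integral>\<^sup>+ k. \<integral>\<^sup>+ t. ennreal (2 powr - real_of_int k) * epowr (ennreal (1/2) * ?x k) (1/a) *
          indicator {2 powr real_of_int k / 2 <.. 2 powr real_of_int k} t \<partial>lborel \<partial>count_space UNIV)"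
    by (rule nn_integral_count_space_nn_integral) auto
  also have "\<dots> = (\<integral>\<^sup>+ k. ennreal (1/2) * epowr (ennreal (1/2) * ?x k) (1/a) \<partial>count_space UNIV)"
  proof (intro nn_integral_cong)
    fix k :: int
    have "emeasure lborel {2 powr real_of_int k / 2 <.. 2 powr real_of_int k} = ennreal (2 powr real_of_int k / 2)"
      by (subst emeasure_lborel_Ioc) auto
    then show "(\<integral>\<^sup>+ t. ennreal (2 powr - real_of_int k) * epowr (ennreal (1/2) * ?x k) (1/a) *
          indicator {2 powr real_of_int k / 2 <.. 2 powr real_of_int k} t \<partial>lborel) = ennreal (1/2) * epowr (ennreal (1/2) * ?x k) (1/a)"
      by (simp add: nn_integral_cmult mult.commute[of _ "epowr _ _"] mult.assoc ennreal_mult[symmetric] powr_add[symmetric])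
  qed
  also have "\<dots> = ennreal (1/2) * epowr (lp a (\<lambda>k. ennreal (1/2) * ?x k)) (1/a)"
    using a0 by (simp add: nn_integral_cmult epowr_lp)
  finally have "epowr (ennreal (1/2) * epowr (lp a (\<lambda>k. ennreal (1/2) * ?x k)) (1/a)) a \<le> epowr ?I a"
    using a0 by (intro epowr_mono) auto
  moreover have "epowr (ennreal (1/2) * epowr L (1/a)) a = ennreal ((1/2) powr a) * L" for L
    unfolding epowr_mult[OF a0] epowr_inverse(2)[OF a0] by (subst epowr_ennreal) auto
  ultimately have 1: "ennreal ((1/2) powr a) * (ennreal (1/2) * dl p a \<mu> g) \<le> epowr ?I a"
    unfolding dl_def by (simp only: lp_cmult[OF a(1)])
  have half: "1 / 2 \<le> (1/2::real) powr a" using a powr_mono'[of a 1 "1/2"] by simp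
  have "dl p a \<mu> g = 4 * (ennreal (1/2) * (ennreal (1/2) * dl p a \<mu> g))"
  proof -
    have "4 * (ennreal (1/2) * (ennreal (1/2) * z)) = z" for z
    proof -
      have "(4::ennreal) = ennreal 4" by simp
      then show ?thesis by (simp only: mult.assoc[symmetric] ennreal_mult[symmetric]) simp
    qed
    then show ?thesis by (simp only:)
  qed
  also have "\<dots> \<le> 4 * (ennreal ((1/2) powr a) * (ennreal (1/2) * dl p a \<mu> g))"
    by (intro mult_left_mono mult_right_mono ennreal_leI half) auto
  also have "\<dots> \<le> 4 * (1 * epowr ?I a)" unfolding mult_1 by (intro mult_left_mono 1) auto
  also have "\<dots> \<le> 4 * (ennreal (p powr a) * epowr ?I a)"
    using p a ge_one_powr_ge_zero[of p a] by (intro mult_left_mono mult_right_mono) auto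
  also have "\<dots> = 4 * lorentz \<mu> p a g" using False by (simp add: lorentz_def)
  finally show ?thesis .
qed

text \<open>From here on \<open>dl\<close> replaces \<open>lorentz\<close>, so that boundedness
  becomes a statement about level sequences.\<close>

lemma maxc_bounded_iff:
  assumes p: "1 < p" and a: "0 \<le> a" "a \<le> 1" and b: "0 \<le> b" "b \<le> 1"
  shows "maxc_bounded X \<rho> \<mu> p a b \<longleftrightarrow> (\<exists>C\<ge>0. \<forall>f \<in> borel_measurable \<mu>.
     dl p a \<mu> (\<lambda>x. ennreal \<bar>f x\<bar>) < \<infinity> \<longrightarrow>
     dl p b \<mu> (maxc X \<rho> \<mu> f) \<le> ennreal C * dl p a \<mu> (\<lambda>x. ennreal \<bar>f x\<bar>))"
proof
  assume "maxc_bounded X \<rho> \<mu> p a b"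
  then obtain C where C: "\<And>f. f \<in> borel_measurable \<mu> \<Longrightarrow> lorentz \<mu> p a (\<lambda>x. ennreal \<bar>f x\<bar>) < \<infinity> \<Longrightarrow>
        lorentz \<mu> p b (maxc X \<rho> \<mu> f) \<le> ennreal C * lorentz \<mu> p a (\<lambda>x. ennreal \<bar>f x\<bar>)"
    unfolding maxc_bounded_def by blast
  show "\<exists>C\<ge>0. \<forall>f \<in> borel_measurable \<mu>.
     dl p a \<mu> (\<lambda>x. ennreal \<bar>f x\<bar>) < \<infinity> \<longrightarrow>
     dl p b \<mu> (maxc X \<rho> \<mu> f) \<le> ennreal C * dl p a \<mu> (\<lambda>x. ennreal \<bar>f x\<bar>)"
  \<comment> \<open>\<open>4\<close> and \<open>2 * p\<close> are the constants of the
    discretisation; \<open>max C 0\<close> is there because \<open>C\<close> may be negative, and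
    \<open>ennreal\<close> then sends it to 0.\<close>
  proof (intro exI[of _ "4 * max C 0 * (2 * p)"] conjI ballI impI)
    fix f assume f: "f \<in> borel_measurable \<mu>" "dl p a \<mu> (\<lambda>x. ennreal \<bar>f x\<bar>) < \<infinity>"
    let ?f = "\<lambda>x. ennreal \<bar>f x\<bar>"
    have "lorentz \<mu> p a ?f < \<infinity>" using lorentz_le_dl[OF p a, of \<mu> ?f] f(2)
      by (auto simp: ennreal_mult_less_top intro: le_less_trans)
    then have "lorentz \<mu> p b (maxc X \<rho> \<mu> f) \<le> ennreal C * lorentz \<mu> p a ?f" using C f by blast
    then have "4 * lorentz \<mu> p b (maxc X \<rho> \<mu> f) \<le> 4 * (ennreal C * (ennreal (2 * p) * dl p a \<mu> ?f))"
      using lorentz_le_dl[OF p a, of \<mu> ?f] by (meson mult_left_mono order_trans zero_le)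
    also have "\<dots> = ennreal (4 * max C 0 * (2 * p)) * dl p a \<mu> ?f"
      using p by (cases "0 \<le> C") (auto simp: ennreal_mult ac_simps max_def ennreal_neg)
    finally show "dl p b \<mu> (maxc X \<rho> \<mu> f) \<le> ennreal (4 * max C 0 * (2 * p)) * dl p a \<mu> ?f"
      using dl_le_lorentz[OF p b] order_trans by blast
  qed (use p in simp)
next
  assume "\<exists>C\<ge>0. \<forall>f \<in> borel_measurable \<mu>.
     dl p a \<mu> (\<lambda>x. ennreal \<bar>f x\<bar>) < \<infinity> \<longrightarrow>
     dl p b \<mu> (maxc X \<rho> \<mu> f) \<le> ennreal C * dl p a \<mu> (\<lambda>x. ennreal \<bar>f x\<bar>)"
  then obtain C where C0: "0 \<le> C" and C: "\<And>f. f \<in> borel_measurable \<mu> \<Longrightarrow> dl p a \<mu> (\<lambda>x. ennreal \<bar>f x\<bar>) < \<infinity> \<Longrightarrow>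
        dl p b \<mu> (maxc X \<rho> \<mu> f) \<le> ennreal C * dl p a \<mu> (\<lambda>x. ennreal \<bar>f x\<bar>)"
    by blast
  show "maxc_bounded X \<rho> \<mu> p a b" unfolding maxc_bounded_def
  proof (intro exI[of _ "2 * p * C * 4"] ballI impI)
    fix f assume f: "f \<in> borel_measurable \<mu>" "lorentz \<mu> p a (\<lambda>x. ennreal \<bar>f x\<bar>) < \<infinity>"
    let ?f = "\<lambda>x. ennreal \<bar>f x\<bar>"
    have "dl p a \<mu> ?f < \<infinity>" using dl_le_lorentz[OF p a, of \<mu> ?f] f(2)
      by (auto simp: ennreal_mult_less_top intro: le_less_trans)
    then have "dl p b \<mu> (maxc X \<rho> \<mu> f) \<le> ennreal C * dl p a \<mu> ?f" using C f by blast
    then have "ennreal (2 * p) * dl p b \<mu> (maxc X \<rho> \<mu> f) \<le> ennreal (2 * p) * (ennreal C * (4 * lorentz \<mu> p a ?f))"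
      using dl_le_lorentz[OF p a, of \<mu> ?f] by (meson mult_left_mono order_trans zero_le)
    also have "\<dots> = ennreal (2 * p * C * 4) * lorentz \<mu> p a ?f"
      using p C0 by (simp add: ennreal_mult ac_simps)
    finally show "lorentz \<mu> p b (maxc X \<rho> \<mu> f) \<le> ennreal (2 * p * C * 4) * lorentz \<mu> p a ?f"
      using lorentz_le_dl[OF p b] order_trans by blast
  qed
qed

subsection \<open>Decoupling of lacunary pieces\<close>

text \<open>The last nonzero term of a partial sum dominates the earlier ones geometrically, and
  zero terms are skipped by the induction; \<open>\<rho> / (\<rho> - 1)\<close> is the sum of the
  geometric series.\<close>

lemma lacunary_suminf_le:
  fixes z :: "nat \<Rightarrow> ennreal"
  assumes \<rho>: "1 < \<rho>" and z: "\<And>m m'. m' < m \<Longrightarrow> 0 < z m \<Longrightarrow> ennreal (\<rho> ^ (m - m')) * z m' \<le> z m"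
  shows "(\<Sum>m. z m) \<le> ennreal (\<rho> / (\<rho> - 1)) * (SUP m. z m)"
proof -
  have "(\<Sum>i<n. z i) \<le> ennreal (\<rho> / (\<rho> - 1)) * (SUP m. z m)" for n
  proof (induction n)
    case (Suc n)
    show ?case
    proof (cases "z n = 0")
      case False
      then have pos: "0 < z n" by (simp add: zero_less_iff_neq_zero)
      have zi: "z i \<le> ennreal ((1 / \<rho>) ^ (n - i)) * z n" if "i \<le> n" for i
      proof (cases "i = n")
        case False
        then show ?thesis using z[of i n] that pos \<rho>
          by (simp add: ennreal_pmult_le_iff power_one_over)
      qed simp
      have "(\<Sum>i<Suc n. z i) \<le> (\<Sum>i<Suc n. ennreal ((1 / \<rho>) ^ (n - i)) * z n)"
        by (intro sum_mono zi) auto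
      also have "\<dots> = ennreal (\<Sum>i<Suc n. (1 / \<rho>) ^ (n - i)) * z n"
        using \<rho> by (simp add: sum_distrib_right[symmetric] sum_ennreal del: sum.lessThan_Suc)
      also have "(\<Sum>i<Suc n. (1 / \<rho>) ^ (n - i)) = (\<Sum>i<Suc n. (1 / \<rho>) ^ i)"
        using sum.nat_diff_reindex[of "\<lambda>i. (1 / \<rho>) ^ i" "Suc n"] by simp
      also have "\<dots> \<le> \<rho> / (\<rho> - 1)"
      proof -
        have "(\<Sum>i<Suc n. (1 / \<rho>) ^ i) = (1 - (1 / \<rho>) ^ Suc n) / (1 - 1 / \<rho>)"
          using \<rho> by (subst sum_gp_strict) auto
        also have "\<dots> \<le> 1 / (1 - 1 / \<rho>)" using \<rho> by (intro divide_right_mono) auto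
        also have "\<dots> = \<rho> / (\<rho> - 1)" using \<rho> by (simp add: field_simps)
        finally show ?thesis .
      qed
      finally have "(\<Sum>i<Suc n. z i) \<le> ennreal (\<rho> / (\<rho> - 1)) * z n"
        by (simp add: ennreal_leI mult_right_mono)
      also have "\<dots> \<le> ennreal (\<rho> / (\<rho> - 1)) * (SUP m. z m)"
        by (intro mult_left_mono SUP_upper) auto
      finally show ?thesis .
    qed (use Suc in simp)
  qed simp
  then show ?thesis by (simp add: suminf_eq_SUP SUP_le_iff)
qed

text \<open>The guard \<open>0 < D m t\<close> restricts the requirement to the heights that piece
  \<open>m\<close> still reaches; above them an earlier piece may be the only one left.\<close>

definition lacunary :: "(nat \<Rightarrow> real \<Rightarrow> ennreal) \<Rightarrow> bool" where
  "lacunary D \<longleftrightarrow> (\<forall>t>0. \<forall>m m'. m' < m \<longrightarrow> 0 < D m t \<longrightarrow> 2 ^ (m - m') * D m' t \<le> D m t)"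

text \<open>At each height the sum of the measures is at most twice the largest, and
  \<open>2 \<le> 2 powr p\<close> turns this into a factor 2 on levels. The largest level is at most
  the \<open>l^q\<close> norm over the pieces, and the norms over pieces and over heights
  commute.\<close>

lemma lacunary_upper:
  assumes p: "1 \<le> p" and a: "0 \<le> a" "a \<le> 1" and lac: "lacunary D'"
    and D: "\<And>t. 0 < t \<Longrightarrow> D t \<le> (\<Sum>m. D' m t)"
  shows "lp a (lev p D) \<le> 2 * lp a (\<lambda>m. lp a (lev p (D' m)))"
proof -
  have "lev p D k \<le> 2 * lp a (\<lambda>m. lev p (D' m) k)" for k
  proof -
    let ?t = "2 powr real_of_int k" and ?V = "lp a (\<lambda>m. lev p (D' m) k)"
    have "lev p (D' m) k \<le> ?V" for m using a le_lp[of a "\<lambda>m. lev p (D' m) k" m] by simp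
    then have V: "D' m ?t \<le> epowr (ennreal (2 powr - real_of_int k) * ?V) p" for m
      using p by (subst (asm) lev_le_iff) auto
    have "D ?t \<le> (\<Sum>m. D' m ?t)" by (rule D) simp
    also have "\<dots> \<le> ennreal (2 / (2 - 1)) * (SUP m. D' m ?t)"
      using lac by (intro lacunary_suminf_le) (auto simp: lacunary_def ennreal_power[symmetric])
    also have "\<dots> \<le> 2 * epowr (ennreal (2 powr - real_of_int k) * ?V) p"
      using V by (simp add: mult_left_mono SUP_le_iff)
    also have "\<dots> \<le> epowr 2 p * epowr (ennreal (2 powr - real_of_int k) * ?V) p"
      using p epowr_mono_exp[of 2 1 p] by (intro mult_right_mono) auto
    also have "\<dots> = epowr (ennreal (2 powr - real_of_int k) * (2 * ?V)) p"
      using p by (simp add: epowr_mult ac_simps)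
    finally show ?thesis using p by (subst lev_le_iff) auto
  qed
  then have "lp a (lev p D) \<le> lp a (\<lambda>k. 2 * lp a (\<lambda>m. lev p (D' m) k))" using a by (intro lp_mono)
  also have "\<dots> = 2 * lp a (\<lambda>m. lp a (lev p (D' m)))"
    using a by (subst lp_cmult) (auto simp: lp_swap[of a "\<lambda>k m. lev p (D' m) k"])
  finally show ?thesis .
qed

text \<open>The power \<open>1 / a\<close> of a level contains the power \<open>1 / (p * a)\<close>
  of a measure, so lacunarity with ratio 2 becomes lacunarity with ratio
  \<open>2 powr (1 / (p * a))\<close>; the outer power \<open>a\<close> returns to norms. For
  \<open>a = 0\<close> the supremum loses nothing.\<close>

definition lac_const :: "real \<Rightarrow> real \<Rightarrow> real" where
  "lac_const p a = (if a = 0 then 1 else (2 powr (1 / (p * a)) / (2 powr (1 / (p * a)) - 1)) powr a)"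

lemma lac_const_nonneg: "0 \<le> lac_const p a"
  by (simp add: lac_const_def)

text \<open>At a fixed height the pieces grow at least geometrically, so their \<open>l^q\<close>
  norm is comparable to the largest level, which \<open>D\<close> dominates. Domination is asked of
  each piece separately, so that it can be checked for the maximal function piece by piece.\<close>

lemma lacunary_lower:
  assumes p: "1 \<le> p" and a: "0 \<le> a" "a \<le> 1" and lac: "lacunary D'"
    and D: "\<And>t m. 0 < t \<Longrightarrow> D' m t \<le> D t"
  shows "lp a (\<lambda>m. lp a (lev p (D' m))) \<le> ennreal (lac_const p a) * lp a (lev p D)"
proof -
  have le: "lev p (D' m) k \<le> lev p D k" for m k using p D by (intro lev_mono) auto
  have "lp a (\<lambda>m. lev p (D' m) k) \<le> ennreal (lac_const p a) * lev p D k" for k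
  proof (cases "a = 0")
    case True
    then show ?thesis using le by (auto simp: lp_zero lac_const_def intro: SUP_least)
  next
    case False
    with a have a0: "0 < a" by simp
    define \<rho> where "\<rho> = 2 powr (1 / (p * a))"
    have \<rho>: "1 < \<rho>" using a0 p by (simp add: \<rho>_def)
    let ?z = "\<lambda>m. epowr (lev p (D' m) k) (1 / a)"
    show ?thesis
    proof (rule lp_leI[OF a0])
      have "(\<integral>\<^sup>+ m. ?z m \<partial>count_space UNIV) = (\<Sum>m. ?z m)" by (rule nn_integral_count_space_nat)
      also have "\<dots> \<le> ennreal (\<rho> / (\<rho> - 1)) * (SUP m. ?z m)"
      proof (rule lacunary_suminf_le[OF \<rho>])
        fix m m' :: nat assume m: "m' < m" "0 < ?z m"
        let ?t = "2 powr real_of_int k"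
        have "0 < D' m ?t" using m by (auto simp: lev_eq_0_iff zero_less_iff_neq_zero)
        then have "2 ^ (m - m') * D' m' ?t \<le> D' m ?t" using lac m by (auto simp: lacunary_def)
        then have "epowr (ennreal ?t * epowr (2 ^ (m - m') * D' m' ?t) (1/p)) (1/a) \<le> ?z m"
          unfolding lev_def using p a0 by (intro epowr_mono mult_left_mono) auto
        also have "epowr (ennreal ?t * epowr (2 ^ (m - m') * D' m' ?t) (1/p)) (1/a) = epowr (2 ^ (m - m')) (1 / (p * a)) * ?z m'"
          using p a0 by (simp add: epowr_mult epowr_epowr lev_def ac_simps)
        also have "epowr (2 ^ (m - m')) (1 / (p * a)) = ennreal (\<rho> ^ (m - m'))"
        proof -
          have "(2::ennreal) ^ (m - m') = ennreal (2 powr real (m - m'))"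
            by (simp add: powr_realpow ennreal_power[symmetric])
          then show ?thesis using p a0 by (simp add: \<rho>_def powr_realpow[symmetric] powr_powr mult.commute)
        qed
        finally show "ennreal (\<rho> ^ (m - m')) * ?z m' \<le> ?z m" .
      qed
      also have "\<dots> \<le> ennreal (\<rho> / (\<rho> - 1)) * epowr (lev p D k) (1 / a)"
        using le a0 by (intro mult_left_mono SUP_least epowr_mono) auto
      also have "\<dots> = epowr (ennreal (lac_const p a) * lev p D k) (1 / a)"
        using a0 \<rho> by (simp add: epowr_mult lac_const_def \<rho>_def powr_powr)
      finally show "(\<integral>\<^sup>+ m. ?z m \<partial>count_space UNIV) \<le> epowr (ennreal (lac_const p a) * lev p D k) (1 / a)" .
    qed
  qed
  then have "lp a (\<lambda>k. lp a (\<lambda>m. lev p (D' m) k)) \<le> lp a (\<lambda>k. ennreal (lac_const p a) * lev p D k)"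
    using a by (intro lp_mono)
  then show ?thesis using a by (simp add: lp_cmult lp_swap[of a "\<lambda>k m. lev p (D' m) k"])
qed

subsection \<open>Interpolation\<close>

text \<open>A discrete layer-cake estimate with ratio \<open>2 powr \<gamma>\<close>; for finite
  \<open>y\<close> the single layer just below \<open>y\<close> already suffices.\<close>

lemma epowr_layer:
  assumes "0 < r" "0 < C" "0 < \<gamma>"
  shows "epowr y r \<le> (\<integral>\<^sup>+ l. ennreal ((C * 2 powr (\<gamma> * (real_of_int l + 1))) powr r) *
     indicator {l. ennreal (C * 2 powr (\<gamma> * real_of_int l)) < y} l \<partial>count_space UNIV)" (is "_ \<le> ?R y")
proof -
  have fin: "ennreal (z powr r) \<le> ?R y" if z: "0 < z" "ennreal z \<le> y" for z
  proof -
    \<comment> \<open>The largest \<open>l\<close> with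
      \<open>C * 2 powr (\<gamma> * l) < z\<close>; the \<open>- 1\<close> secures the strict
      inequality.\<close>
    define l where "l = \<lceil>log 2 (z / C) / \<gamma>\<rceil> - 1"
    have "real_of_int l < log 2 (z / C) / \<gamma>" "log 2 (z / C) / \<gamma> \<le> real_of_int l + 1"
      unfolding l_def by linarith+
    then have "\<gamma> * real_of_int l < log 2 (z / C)" "log 2 (z / C) \<le> \<gamma> * (real_of_int l + 1)"
      using assms by (simp_all add: field_simps)
    then have "2 powr (\<gamma> * real_of_int l) < 2 powr (log 2 (z / C))"
      "2 powr (log 2 (z / C)) \<le> 2 powr (\<gamma> * (real_of_int l + 1))" by simp_all
    then have "2 powr (\<gamma> * real_of_int l) < z / C" "z / C \<le> 2 powr (\<gamma> * (real_of_int l + 1))"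
      using z assms by simp_all
    then have l: "C * 2 powr (\<gamma> * real_of_int l) < z" "z \<le> C * 2 powr (\<gamma> * (real_of_int l + 1))"
      using assms by (simp_all add: field_simps)
    have "ennreal (C * 2 powr (\<gamma> * real_of_int l)) < ennreal z"
      using l(1) assms by (subst ennreal_less_iff) auto
    then have "ennreal (C * 2 powr (\<gamma> * real_of_int l)) < y" using z(2) by (rule less_le_trans)
    moreover have "z powr r \<le> (C * 2 powr (\<gamma> * (real_of_int l + 1))) powr r"
      using l(2) z assms by (intro powr_mono2) auto
    ultimately have "ennreal (z powr r) \<le> ennreal ((C * 2 powr (\<gamma> * (real_of_int l + 1))) powr r) *
     indicator {l. ennreal (C * 2 powr (\<gamma> * real_of_int l)) < y} l" by (simp add: ennreal_leI)
    also have "\<dots> \<le> lp 1 (\<lambda>l. ennreal ((C * 2 powr (\<gamma> * (real_of_int l + 1))) powr r) *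
     indicator {l. ennreal (C * 2 powr (\<gamma> * real_of_int l)) < y} l)" by (rule le_lp) simp
    finally show ?thesis by (simp add: lp_pos)
  qed
  show ?thesis
  proof (cases y)
    case (real z)
    then show ?thesis using fin[of z] by (cases "z = 0") auto
  next
    case top
    have "?R y = top"
    proof (rule ccontr)
      assume "?R y \<noteq> top"
      then obtain c where c: "?R y = ennreal c" "0 \<le> c" by (cases "?R y") auto
      have "ennreal (((c + 1) powr (1 / r)) powr r) \<le> ?R y" using c top by (intro fin) auto
      then show False using c assms by (simp add: powr_powr)
    qed
    then show ?thesis by simp
  qed
qed

text \<open>For nonzero \<open>f x\<close> the index is the integer \<open>j\<close> with
  \<open>2^j < |f x| \<le> 2^(j+1)\<close>, matching the strict level sets of
  \<open>distr_fun\<close>. Thus \<open>K\<close> selects layers of values; the interpolation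
  chooses it from the sizes of the levels.\<close>

definition level_restrict :: "('a \<Rightarrow> real) \<Rightarrow> int set \<Rightarrow> 'a \<Rightarrow> real" where
  "level_restrict f K x = (if f x \<noteq> 0 \<and> \<lceil>log 2 \<bar>f x\<bar>\<rceil> - 1 \<in> K then f x else 0)"

lemma level_restrict_measurable [measurable]:
  assumes [measurable]: "f \<in> borel_measurable M"
  shows "level_restrict f K \<in> borel_measurable M"
proof -
  have "(\<lambda>x. \<lceil>log 2 \<bar>f x\<bar>\<rceil> - 1) \<in> measurable M (count_space UNIV)" by measurable
  then have [measurable]: "Measurable.pred M (\<lambda>x. \<lceil>log 2 \<bar>f x\<bar>\<rceil> - 1 \<in> K)"
    by (rule measurable_compose) simp
  show ?thesis unfolding level_restrict_def by measurable
qed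

lemma level_restrict_split: "f x = level_restrict f K x + level_restrict f (- K) x"
  by (simp add: level_restrict_def)

lemma two_powr_minus_half_le: "(2::real) powr (- (1/2)) \<le> 3 / 4"
proof -
  have "4 / 3 \<le> sqrt 2" by (rule real_le_rsqrt) (simp add: power2_eq_square)
  then have "1 / sqrt 2 \<le> 3 / 4" by (simp add: field_simps)
  then show ?thesis by (simp add: powr_minus_divide powr_half_sqrt)
qed

text \<open>A point where the restricted function exceeds \<open>2^k\<close> has its layer index in
  \<open>K\<close> and at least \<open>k\<close>. So only levels \<open>k + i\<close> in
  \<open>K\<close> enter, with a factor \<open>2 powr (- i)\<close> from the normalisation, and this
  decay pays for the countable union as well as for the passage to the norm.\<close>

lemma dl_level_restrict_le:
  assumes p: "1 \<le> p" and a: "0 \<le> a" "a \<le> 1" and f[measurable]: "f \<in> borel_measurable \<mu>"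
  shows "dl p a \<mu> (\<lambda>x. ennreal \<bar>level_restrict f K x\<bar>)
    \<le> 16 * lp a (\<lambda>k. lev p (distr_fun \<mu> (\<lambda>x. ennreal \<bar>f x\<bar>)) k * indicator K k)"
proof -
  let ?D = "distr_fun \<mu> (\<lambda>x. ennreal \<bar>f x\<bar>)"
  let ?D' = "distr_fun \<mu> (\<lambda>x. ennreal \<bar>level_restrict f K x\<bar>)"
  let ?z = "\<lambda>k. lev p ?D k * indicator K k"
  \<comment> \<open>Half of the decay \<open>2 powr (- i)\<close> goes into this supremum, to be
    summed by \<open>lp_SUP_le\<close>; the other half sums the measures of the sets
    \<open>?E i\<close>.\<close>
  let ?c = "\<lambda>i::nat. ennreal (2 powr (- (1/2) * real i))"
  have lev: "lev p ?D' k \<le> 4 * (SUP i. ?c i * ?z (k + int i))" for k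
  proof -
    define V where "V = (SUP i. ?c i * ?z (k + int i))"
    let ?E = "\<lambda>i. {x \<in> space \<mu>. ennreal (2 powr real_of_int (k + int i)) < ennreal \<bar>f x\<bar> \<and> k + int i \<in> K}"
    have E: "?E i \<in> sets \<mu>" for i by measurable
    have "{x \<in> space \<mu>. ennreal (2 powr real_of_int k) < ennreal \<bar>level_restrict f K x\<bar>} \<subseteq> (\<Union>i. ?E i)"
    proof safe
      fix x assume x: "x \<in> space \<mu>" "ennreal (2 powr real_of_int k) < ennreal \<bar>level_restrict f K x\<bar>"
      then have fx: "f x \<noteq> 0" "\<lceil>log 2 \<bar>f x\<bar>\<rceil> - 1 \<in> K" "2 powr real_of_int k < \<bar>f x\<bar>"
        by (auto simp: level_restrict_def ennreal_less_iff split: if_splits)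
      define j where "j = \<lceil>log 2 \<bar>f x\<bar>\<rceil> - 1"
      have pos: "0 < \<bar>f x\<bar>" using fx by simp
      have j: "2 powr real_of_int j < \<bar>f x\<bar>"
        using ceiling_log2_bounds(2)[OF pos] by (simp add: j_def)
      have "real_of_int k < log 2 \<bar>f x\<bar>" using fx(3) pos by (simp add: less_log_iff)
      then have "k \<le> j" unfolding j_def by linarith
      then obtain i where i: "j = k + int i" using zle_iff_zadd by blast
      have "x \<in> ?E i" using x j fx(2) i by (simp add: j_def[symmetric] ennreal_less_iff)
      then show "x \<in> (\<Union>i. ?E i)" by blast
    qed
    then have "?D' (2 powr real_of_int k) \<le> outer_mu \<mu> (\<Union>i. ?E i)"
      unfolding distr_fun_def by (rule outer_mu_mono)
    also have "\<dots> = emeasure \<mu> (\<Union>i. ?E i)" using E by (intro outer_mu_sets) auto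
    also have "\<dots> \<le> (\<Sum>i. emeasure \<mu> (?E i))" using E by (intro emeasure_subadditive_countably) auto
    also have "\<dots> \<le> (\<Sum>i. ennreal (2 powr (- (p/2) * real i)) * epowr (ennreal (2 powr - real_of_int k) * V) p)"
    proof (intro suminf_le summableI)
      fix i
      show "emeasure \<mu> (?E i) \<le> ennreal (2 powr (- (p/2) * real i)) * epowr (ennreal (2 powr - real_of_int k) * V) p"
      proof (cases "k + int i \<in> K")
        case True
        then have "?E i = {x \<in> space \<mu>. ennreal (2 powr real_of_int (k + int i)) < ennreal \<bar>f x\<bar>}" by auto
        then have eq: "emeasure \<mu> (?E i) = ?D (2 powr real_of_int (k + int i))"
          using E[of i] by (simp add: distr_fun_def outer_mu_sets)
        have "?c i * lev p ?D (k + int i) \<le> V" unfolding V_def using True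
          by (intro SUP_upper2[of i]) auto
        then have "lev p ?D (k + int i) \<le> ennreal (2 powr (real i / 2)) * V"
          by (subst (asm) ennreal_pmult_le_iff) (auto simp: powr_minus_divide)
        then have "?D (2 powr real_of_int (k + int i)) \<le>
          epowr (ennreal (2 powr - real_of_int (k + int i)) * (ennreal (2 powr (real i / 2)) * V)) p"
          using p by (subst (asm) lev_le_iff) auto
        also have "ennreal (2 powr - real_of_int (k + int i)) * (ennreal (2 powr (real i / 2)) * V)
           = ennreal (2 powr (- (1/2) * real i)) * (ennreal (2 powr - real_of_int k) * V)"
          by (simp add: mult.assoc[symmetric] ennreal_mult[symmetric] powr_add[symmetric])
        also have "epowr \<dots> p = ennreal (2 powr (- (p/2) * real i)) * epowr (ennreal (2 powr - real_of_int k) * V) p"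
          using p by (subst epowr_mult) (auto simp: powr_powr ac_simps)
        finally show ?thesis unfolding eq .
      next
        case False
        then have "?E i = {}" by auto
        then show ?thesis by (simp only: emeasure_empty zero_le)
      qed
    qed
    also have "\<dots> = ennreal (1 / (1 - 2 powr (- (p/2)))) * epowr (ennreal (2 powr - real_of_int k) * V) p"
      unfolding ennreal_suminf_multc using p by (subst suminf_geom_powr) auto
    also have "\<dots> \<le> epowr 4 p * epowr (ennreal (2 powr - real_of_int k) * V) p"
    proof (intro mult_right_mono)
      have "2 powr (- (p/2)) \<le> (2::real) powr (- (1/2))" using p by (intro powr_mono) auto
      also have "\<dots> \<le> 3 / 4" by (rule two_powr_minus_half_le)
      finally have "1 / (1 - 2 powr (- (p/2))) \<le> 4" by (simp add: field_simps)
      also have "4 \<le> (4::real) powr p" using p powr_mono[of 1 p 4] by simp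
      finally have "ennreal (1 / (1 - 2 powr (- (p/2)))) \<le> epowr (ennreal 4) p"
        by (subst epowr_ennreal) (auto intro: ennreal_leI)
      then show "ennreal (1 / (1 - 2 powr (- (p/2)))) \<le> epowr 4 p" by simp
    qed simp
    also have "\<dots> = epowr (ennreal (2 powr - real_of_int k) * (4 * V)) p"
      using p by (simp add: epowr_mult ac_simps)
    finally show ?thesis unfolding V_def[symmetric] using p by (subst lev_le_iff) auto
  qed
  have "dl p a \<mu> (\<lambda>x. ennreal \<bar>level_restrict f K x\<bar>) \<le> lp a (\<lambda>k. 4 * (SUP i. ?c i * ?z (k + int i)))"
    unfolding dl_def using a by (intro lp_mono lev)
  also have "\<dots> = 4 * lp a (\<lambda>k. SUP i. ?c i * ?z (k + int i))" using a by (intro lp_cmult)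
  also have "lp a (\<lambda>k. SUP i. ?c i * ?z (k + int i)) \<le> (\<Sum>i. ?c i) * lp a ?z"
    using a by (intro lp_SUP_le) (auto intro: injI)
  also have "(\<Sum>i. ?c i) \<le> 4"
  proof -
    have "1 / (1 - 2 powr (- (1/2))) \<le> (4::real)" using two_powr_minus_half_le by (simp add: field_simps)
    then have "ennreal (1 / (1 - 2 powr (- (1/2)))) \<le> ennreal 4" by (rule ennreal_leI)
    moreover have "(\<Sum>i. ?c i) = ennreal (1 / (1 - 2 powr (- (1/2))))" by (rule suminf_geom_powr) simp
    moreover have "ennreal 4 = 4" by simp
    ultimately show ?thesis by (simp only:)
  qed
  finally show ?thesis by (simp add: mult.assoc[symmetric] mult_left_mono mult_right_mono)
qed

text \<open>Chebyshev's inequality for counting measure, with exponent \<open>1 / b\<close>.\<close>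

lemma count_less_le:
  assumes "0 < b" "0 < s"
  shows "(\<integral>\<^sup>+ k. indicator {k. ennreal s < y k} k \<partial>count_space UNIV) \<le> epowr (ennreal (1 / s) * lp b y) (1 / b)"
proof -
  have "(\<integral>\<^sup>+ k. indicator {k. ennreal s < y k} k \<partial>count_space UNIV)
     \<le> (\<integral>\<^sup>+ k. epowr (ennreal (1 / s)) (1 / b) * epowr (y k) (1 / b) \<partial>count_space UNIV)"
  proof (intro nn_integral_mono)
    fix k
    show "indicator {k. ennreal s < y k} k \<le> epowr (ennreal (1 / s)) (1 / b) * epowr (y k) (1 / b)"
    proof (cases "ennreal s < y k")
      case True
      have "epowr (ennreal s) (1 / b) \<le> epowr (y k) (1 / b)" using True assms by (intro epowr_mono) auto
      then have "epowr (ennreal (1 / s)) (1 / b) * epowr (ennreal s) (1 / b)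
         \<le> epowr (ennreal (1 / s)) (1 / b) * epowr (y k) (1 / b)" by (intro mult_left_mono) auto
      moreover have "epowr (ennreal (1 / s)) (1 / b) * epowr (ennreal s) (1 / b) = 1"
        using assms by (simp add: ennreal_mult[symmetric] powr_mult[symmetric])
      ultimately show ?thesis using True by simp
    qed simp
  qed
  also have "\<dots> = epowr (ennreal (1 / s) * lp b y) (1 / b)"
    using assms(1) by (simp add: nn_integral_cmult epowr_mult epowr_lp)
  finally show ?thesis .
qed

text \<open>The two ways of cutting a sequence at height \<open>2\<^sup>l\<close>: the low part is measured in an
  exponent above \<open>q\<close>, the high part in an exponent below \<open>q\<close>.\<close>

definition level_cut :: "real \<Rightarrow> real \<Rightarrow> (int \<Rightarrow> ennreal) \<Rightarrow> int \<Rightarrow> int set" where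
  "level_cut q q' x l = (if q < q' then {k. x k \<le> ennreal (2 powr real_of_int l)} else {k. ennreal (2 powr real_of_int l) < x k})"

text \<open>In both cases of \<open>level_cut\<close> the entries lie on the side of
  \<open>2^l\<close> on which \<open>x powr (q' - q)\<close> is at most
  \<open>2 powr (l * (q' - q))\<close>.\<close>

lemma level_cut_sum_le:
  assumes q: "0 < q" "0 < q'" "q \<noteq> q'"
  shows "(\<integral>\<^sup>+ k. epowr (x k) q' * indicator (level_cut q q' x l) k \<partial>count_space UNIV)
     \<le> ennreal (2 powr (real_of_int l * (q' - q))) * (\<integral>\<^sup>+ k. epowr (x k) q \<partial>count_space UNIV)"
proof -
  have "epowr (x k) q' * indicator (level_cut q q' x l) k \<le> ennreal (2 powr (real_of_int l * (q' - q))) * epowr (x k) q" for k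
  proof (cases "k \<in> level_cut q q' x l")
    case True
    show ?thesis
    proof (cases "q < q'")
      case less: True
      then have x: "x k \<le> ennreal (2 powr real_of_int l)" using True by (simp add: level_cut_def)
      have "epowr (x k) q' = epowr (x k) (q' - q) * epowr (x k) q" by (simp add: epowr_add[symmetric])
      also have "\<dots> \<le> epowr (ennreal (2 powr real_of_int l)) (q' - q) * epowr (x k) q"
        using x less by (intro mult_right_mono epowr_mono) auto
      finally show ?thesis using True by (simp add: powr_powr)
    next
      case ge: False
      then have x: "ennreal (2 powr real_of_int l) < x k" using True by (simp add: level_cut_def)
      show ?thesis
      proof (cases "x k")
        case (real z)
        then have z: "2 powr real_of_int l < z" using x by (simp add: ennreal_less_iff)
        then have z0: "0 < z" using powr_gt_zero[of 2 "real_of_int l"] by linarith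
        have "z powr q' = z powr (q' - q) * z powr q" using z0 by (simp add: powr_add[symmetric])
        also have "\<dots> \<le> (2 powr real_of_int l) powr (q' - q) * z powr q"
          using z ge by (intro mult_right_mono powr_mono2') auto
        finally show ?thesis using True real by (simp add: powr_powr ennreal_mult[symmetric] ennreal_leI)
      next
        case top
        then show ?thesis by (simp add: ennreal_mult_top)
      qed
    qed
  qed simp
  then show ?thesis by (subst nn_integral_cmult[symmetric]) (auto intro: nn_integral_mono)
qed

text \<open>After exchanging the sums, the \<open>l\<close> for which a given entry \<open>z\<close>
  belongs to the cut form a half line with end point near \<open>log 2 z\<close>, on which the
  weights are a geometric series of size \<open>z powr (q - q')\<close>.\<close>

lemma level_cut_sum_levels_le:
  assumes q: "0 < q" "0 < q'" "q \<noteq> q'"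
  shows "(\<integral>\<^sup>+ l. ennreal (2 powr (real_of_int l * (q - q'))) *
      (\<integral>\<^sup>+ k. epowr (x k) q' * indicator (level_cut q q' x l) k \<partial>count_space UNIV) \<partial>count_space UNIV)
     \<le> ennreal (1 / (1 - 2 powr (- \<bar>q - q'\<bar>))) * (\<integral>\<^sup>+ k. epowr (x k) q \<partial>count_space UNIV)"
    (is "?L \<le> ennreal ?G * _")
proof -
  have G: "0 \<le> ?G" "0 < ?G" using q powr_less_one[of 2 "- \<bar>q - q'\<bar>"] by auto
  have "?L = (\<integral>\<^sup>+ l. \<integral>\<^sup>+ k. ennreal (2 powr (real_of_int l * (q - q'))) *
      (epowr (x k) q' * indicator (level_cut q q' x l) k) \<partial>count_space UNIV \<partial>count_space UNIV)"
    by (simp add: nn_integral_cmult)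
  also have "\<dots> = (\<integral>\<^sup>+ k. \<integral>\<^sup>+ l. ennreal (2 powr (real_of_int l * (q - q'))) *
      (epowr (x k) q' * indicator (level_cut q q' x l) k) \<partial>count_space UNIV \<partial>count_space UNIV)"
    using nn_integral_fst_count_space[of "\<lambda>(l,k). ennreal (2 powr (real_of_int l * (q - q'))) *
      (epowr (x k) q' * indicator (level_cut q q' x l) k)"]
      nn_integral_snd_count_space[of "\<lambda>(l,k). ennreal (2 powr (real_of_int l * (q - q'))) *
      (epowr (x k) q' * indicator (level_cut q q' x l) k)"] by simp
  also have "\<dots> \<le> (\<integral>\<^sup>+ k. ennreal ?G * epowr (x k) q \<partial>count_space UNIV)"
  proof (intro nn_integral_mono)
    fix k
    show "(\<integral>\<^sup>+ l. ennreal (2 powr (real_of_int l * (q - q'))) *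
      (epowr (x k) q' * indicator (level_cut q q' x l) k) \<partial>count_space UNIV) \<le> ennreal ?G * epowr (x k) q"
    proof (cases "x k")
      case top
      then show ?thesis using G q by (cases "q < q'") (auto simp: level_cut_def ennreal_mult_top top_unique)
    next
      case (real z)
      show ?thesis
      proof (cases "z = 0")
        case False
        then have z: "0 < z" using real by simp
        have main: "(\<integral>\<^sup>+ l. ennreal (2 powr (real_of_int l * (q - q'))) * indicator {l. k \<in> level_cut q q' x l} l \<partial>count_space UNIV)
           \<le> ennreal (z powr (q - q') * ?G)"
        proof (cases "q < q'")
          case True
          define L where "L = \<lceil>log 2 z\<rceil>"
          have "(\<integral>\<^sup>+ l. ennreal (2 powr (real_of_int l * (q - q'))) * indicator {l. k \<in> level_cut q q' x l} l \<partial>count_space UNIV)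
             \<le> (\<integral>\<^sup>+ l. ennreal (2 powr (- (q' - q) * real_of_int l)) * indicator {L..} l \<partial>count_space UNIV)"
          proof (intro nn_integral_mono)
            fix l
            have "L \<le> l" if "z \<le> 2 powr real_of_int l"
            proof -
              have "log 2 z \<le> real_of_int l" using that z by (simp add: log_le_iff)
              then show ?thesis by (simp add: L_def ceiling_le_iff)
            qed
            then show "ennreal (2 powr (real_of_int l * (q - q'))) * indicator {l. k \<in> level_cut q q' x l} l
              \<le> ennreal (2 powr (- (q' - q) * real_of_int l)) * indicator {L..} l"
              using True real by (auto simp: level_cut_def algebra_simps split: split_indicator)
          qed
          also have "\<dots> = ennreal (2 powr (- (q' - q) * real_of_int L) / (1 - 2 powr (- (q' - q))))"
            using True by (intro geom_int_up) auto
          also have "\<dots> \<le> ennreal (z powr (q - q') * ?G)"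
          proof (intro ennreal_leI)
            have "2 powr (- (q' - q) * real_of_int L) = (2 powr real_of_int L) powr (q - q')"
              by (simp add: powr_powr algebra_simps)
            also have "\<dots> \<le> z powr (q - q')"
              using True z ceiling_log2_bounds(1)[OF z] by (intro powr_mono2') (auto simp: L_def)
            finally have "2 powr (- (q' - q) * real_of_int L) * ?G \<le> z powr (q - q') * ?G"
              using G by (intro mult_right_mono)
            then show "2 powr (- (q' - q) * real_of_int L) / (1 - 2 powr (- (q' - q))) \<le> z powr (q - q') * ?G"
              using True by simp
          qed
          finally show ?thesis .
        next
          case False
          then have less: "q' < q" using q by simp
          define L where "L = \<lfloor>log 2 z\<rfloor>"
          have "(\<integral>\<^sup>+ l. ennreal (2 powr (real_of_int l * (q - q'))) * indicator {l. k \<in> level_cut q q' x l} l \<partial>count_space UNIV)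
             \<le> (\<integral>\<^sup>+ l. ennreal (2 powr ((q - q') * real_of_int l)) * indicator {..L} l \<partial>count_space UNIV)"
          proof (intro nn_integral_mono)
            fix l
            have "l \<le> L" if "2 powr real_of_int l < z"
            proof -
              have "real_of_int l < log 2 z" using that z by (simp add: less_log_iff)
              then show ?thesis by (simp add: L_def le_floor_iff)
            qed
            then show "ennreal (2 powr (real_of_int l * (q - q'))) * indicator {l. k \<in> level_cut q q' x l} l
              \<le> ennreal (2 powr ((q - q') * real_of_int l)) * indicator {..L} l"
              using False real by (auto simp: level_cut_def ennreal_less_iff mult.commute split: split_indicator)
          qed
          also have "\<dots> = ennreal (2 powr ((q - q') * real_of_int L) / (1 - 2 powr (- (q - q'))))"
            using less by (intro geom_int_down) auto
          also have "\<dots> \<le> ennreal (z powr (q - q') * ?G)"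
          proof (intro ennreal_leI)
            have "2 powr ((q - q') * real_of_int L) = (2 powr real_of_int L) powr (q - q')"
              by (simp add: powr_powr mult.commute)
            also have "\<dots> \<le> z powr (q - q')"
              using less z floor_log2_bounds(1)[OF z] by (intro powr_mono2) (auto simp: L_def)
            finally have "2 powr ((q - q') * real_of_int L) * ?G \<le> z powr (q - q') * ?G"
              using G by (intro mult_right_mono)
            then show "2 powr ((q - q') * real_of_int L) / (1 - 2 powr (- (q - q'))) \<le> z powr (q - q') * ?G"
              using less by simp
          qed
          finally show ?thesis .
        qed
        have "(\<integral>\<^sup>+ l. ennreal (2 powr (real_of_int l * (q - q'))) * (epowr (x k) q' * indicator (level_cut q q' x l) k) \<partial>count_space UNIV)
          = (\<integral>\<^sup>+ l. epowr (x k) q' * (ennreal (2 powr (real_of_int l * (q - q'))) * indicator {l. k \<in> level_cut q q' x l} l) \<partial>count_space UNIV)"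
          by (intro nn_integral_cong) (auto split: split_indicator simp: mult.commute)
        also have "\<dots> = epowr (x k) q' * (\<integral>\<^sup>+ l. ennreal (2 powr (real_of_int l * (q - q'))) * indicator {l. k \<in> level_cut q q' x l} l \<partial>count_space UNIV)"
          by (rule nn_integral_cmult) simp
        also have "\<dots> \<le> epowr (x k) q' * ennreal (z powr (q - q') * ?G)" by (intro mult_left_mono main) simp
        also have "\<dots> = ennreal ?G * epowr (x k) q"
        proof -
          have "z powr q' * (z powr (q - q') * ?G) = ?G * z powr q"
            using z by (simp add: powr_diff)
          then show ?thesis using real G by (simp add: ennreal_mult[symmetric])
        qed
        finally show ?thesis .
      qed (use real in simp)
    qed
  qed
  also have "\<dots> = ennreal ?G * (\<integral>\<^sup>+ k. epowr (x k) q \<partial>count_space UNIV)" by (rule nn_integral_cmult) simp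
  finally show ?thesis .
qed

text \<open>Chebyshev's inequality and the endpoint bound give the power \<open>a' / b'\<close> of
  \<open>A\<close>. One factor \<open>A\<close> is kept for the later sum over \<open>l\<close>; the
  remaining power \<open>a' / b' - 1\<close>, nonnegative because \<open>b' \<le> a'\<close>, is
  spent on the uniform bound for \<open>A\<close>. The identity \<open>iden\<close> makes the powers
  of \<open>2^l\<close> add up to exactly the weight in
  \<open>level_cut_sum_levels_le\<close>.\<close>

lemma interpolation_count:
  fixes y :: "int \<Rightarrow> ennreal"
  assumes a: "0 < a'" and b: "0 < b'" "b' \<le> a'" and C: "0 < C" and N: "0 \<le> N"
    and iden: "\<gamma> * (r - 1 / b') = - (1 / a' - q) * a' / b'"
    and A: "A \<le> ennreal (2 powr (real_of_int l * (1 / a' - q))) * ennreal (2 powr q)"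
    and y: "lp b' y \<le> ennreal (16 * N) * epowr A a'"
  shows "ennreal ((C * 2 powr (\<gamma> * (real_of_int l + 1))) powr r) *
      (\<integral>\<^sup>+ k. indicator {k. ennreal (C * 2 powr (\<gamma> * real_of_int l) / 4) < y (k + - 1)} k \<partial>count_space UNIV)
    \<le> ennreal ((C * 2 powr \<gamma>) powr r * (64 * N / C) powr (1 / b') * 2 powr (q * (a' / b' - 1))) *
      (ennreal (2 powr (real_of_int l * (q - 1 / a'))) * A)"
proof -
  define s where "s = C * 2 powr (\<gamma> * real_of_int l)"
  have s: "0 < s" using C by (simp add: s_def)
  let ?e = "a' / b' - 1"
  have e: "0 \<le> ?e" using a b by simp
  have "(\<integral>\<^sup>+ k. indicator {k. ennreal (s / 4) < y (k + - 1)} k \<partial>count_space UNIV)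
     \<le> epowr (ennreal (1 / (s / 4)) * lp b' (\<lambda>k. y (k + - 1))) (1 / b')"
    using b s by (intro count_less_le) auto
  also have "lp b' (\<lambda>k. y (k + - 1)) = lp b' y" using b by (intro lp_shift) simp
  also have "epowr (ennreal (1 / (s / 4)) * lp b' y) (1 / b')
      \<le> epowr (ennreal (1 / (s / 4)) * (ennreal (16 * N) * epowr A a')) (1 / b')"
    using b by (intro epowr_mono mult_left_mono y) auto
  also have "\<dots> = ennreal ((64 * N / s) powr (1 / b')) * epowr A (a' / b')"
  proof -
    have "ennreal (1 / (s / 4)) * (ennreal (16 * N) * epowr A a') = ennreal (64 * N / s) * epowr A a'"
      using N s by (simp add: mult.assoc[symmetric] ennreal_mult[symmetric])
    then show ?thesis using a b N s by (simp add: epowr_mult epowr_epowr)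
  qed
  also have "epowr A (a' / b') = epowr A ?e * A"
    using epowr_add[of A ?e 1] by simp
  also have "epowr A ?e \<le> epowr (ennreal (2 powr (real_of_int l * (1 / a' - q))) * ennreal (2 powr q)) ?e"
    by (intro epowr_mono A e)
  also have "\<dots> = ennreal ((2 powr (real_of_int l * (1 / a' - q) + q)) powr ?e)"
    by (simp add: ennreal_mult[symmetric] powr_add[symmetric])
  also have "\<dots> = ennreal (2 powr ((real_of_int l * (1 / a' - q) + q) * ?e))" by (simp only: powr_powr)
  finally have cnt: "(\<integral>\<^sup>+ k. indicator {k. ennreal (s / 4) < y (k + - 1)} k \<partial>count_space UNIV)
    \<le> ennreal ((64 * N / s) powr (1 / b')) * (ennreal (2 powr ((real_of_int l * (1 / a' - q) + q) * ?e)) * A)"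
    by (simp add: mult_left_mono mult_right_mono)
  have real: "(C * 2 powr (\<gamma> * (real_of_int l + 1))) powr r * ((64 * N / s) powr (1 / b') * 2 powr ((real_of_int l * (1 / a' - q) + q) * ?e))
    = ((C * 2 powr \<gamma>) powr r * (64 * N / C) powr (1 / b') * 2 powr (q * ?e)) * 2 powr (real_of_int l * (q - 1 / a'))"
  proof -
    have 1: "(C * 2 powr (\<gamma> * (real_of_int l + 1))) powr r = (C * 2 powr \<gamma>) powr r * 2 powr (\<gamma> * real_of_int l * r)"
      using C by (simp add: powr_mult powr_powr powr_add[symmetric] algebra_simps)
    have 2: "(64 * N / s) powr (1 / b') = (64 * N / C) powr (1 / b') * 2 powr (- (\<gamma> * real_of_int l / b'))"
      using C N by (simp add: s_def powr_divide powr_mult powr_powr powr_minus_divide)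
    have 3: "\<gamma> * real_of_int l * r + - (\<gamma> * real_of_int l / b') + (real_of_int l * (1 / a' - q) + q) * ?e
       = q * ?e + real_of_int l * (q - 1 / a')"
    proof -
      have "\<gamma> * real_of_int l * r + - (\<gamma> * real_of_int l / b') = real_of_int l * (\<gamma> * (r - 1 / b'))"
        by (simp add: algebra_simps)
      then show ?thesis unfolding iden using a by (simp add: algebra_simps diff_divide_distrib)
    qed
    have 4: "2 powr (\<gamma> * real_of_int l * r) * 2 powr (- (\<gamma> * real_of_int l / b')) * 2 powr ((real_of_int l * (1 / a' - q) + q) * ?e)
       = 2 powr (q * ?e) * (2::real) powr (real_of_int l * (q - 1 / a'))"
      by (simp only: powr_add[symmetric] 3)
    have 5: "X * E1 * (Y * E2 * E3) = X * Y * F * G" if "E1 * E2 * E3 = F * G" for X Y E1 E2 E3 F G :: real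
    proof -
      have "X * E1 * (Y * E2 * E3) = X * Y * (E1 * E2 * E3)" by (simp only: ac_simps)
      then show ?thesis unfolding that by (simp only: mult.assoc)
    qed
    show ?thesis unfolding 1 2 by (rule 5[OF 4])
  qed
  have "ennreal ((C * 2 powr (\<gamma> * (real_of_int l + 1))) powr r) *
      (\<integral>\<^sup>+ k. indicator {k. ennreal (s / 4) < y (k + - 1)} k \<partial>count_space UNIV)
    \<le> ennreal ((C * 2 powr (\<gamma> * (real_of_int l + 1))) powr r) *
       (ennreal ((64 * N / s) powr (1 / b')) * (ennreal (2 powr ((real_of_int l * (1 / a' - q) + q) * ?e)) * A))"
    by (intro mult_left_mono cnt) simp
  also have "\<dots> = ennreal ((C * 2 powr (\<gamma> * (real_of_int l + 1))) powr r *
       ((64 * N / s) powr (1 / b') * 2 powr ((real_of_int l * (1 / a' - q) + q) * ?e))) * A"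
    by (simp add: ennreal_mult mult.assoc)
  also have "\<dots> = ennreal ((C * 2 powr \<gamma>) powr r * (64 * N / C) powr (1 / b') * 2 powr (q * ?e)) *
      (ennreal (2 powr (real_of_int l * (q - 1 / a'))) * A)"
    unfolding real by (simp add: ennreal_mult mult.assoc)
  finally show ?thesis unfolding s_def .
qed

text \<open>Marcinkiewicz interpolation with equal first exponents: cutting \<open>f\<close> according to the size
  of its normalised level measures, and not of its values, reduces the Lorentz scale to \<open>l\<^sup>q\<close>.\<close>

lemma lorentz_interpolation:
  fixes T :: "('a \<Rightarrow> real) \<Rightarrow> 'a \<Rightarrow> ennreal"
  assumes p: "1 \<le> p"
    and sub: "\<And>f g x. f \<in> borel_measurable \<mu> \<Longrightarrow> g \<in> borel_measurable \<mu> \<Longrightarrow> x \<in> space \<mu> \<Longrightarrow>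
      T (\<lambda>x. f x + g x) x \<le> T f x + T g x"
    and hom: "\<And>c f x. f \<in> borel_measurable \<mu> \<Longrightarrow> 0 < c \<Longrightarrow> x \<in> space \<mu> \<Longrightarrow> T (\<lambda>x. c * f x) x = ennreal c * T f x"
    and a01: "0 \<le> a0" "a0 < a1" "a1 \<le> 1" and b01: "0 \<le> b0" "b0 < b1" "b0 \<le> a0" "b1 \<le> a1"
    and \<theta>: "0 < \<theta>" "\<theta> < 1"
    and ab: "a = a0 + \<theta> * (a1 - a0)" "b = b0 + \<theta> * (b1 - b0)"
    and N: "0 \<le> N0" "0 \<le> N1"
    and T0: "\<And>f. f \<in> borel_measurable \<mu> \<Longrightarrow> dl p a0 \<mu> (\<lambda>x. ennreal \<bar>f x\<bar>) < \<infinity> \<Longrightarrow>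
       dl p b0 \<mu> (T f) \<le> ennreal N0 * dl p a0 \<mu> (\<lambda>x. ennreal \<bar>f x\<bar>)"
    and T1: "\<And>f. f \<in> borel_measurable \<mu> \<Longrightarrow> dl p a1 \<mu> (\<lambda>x. ennreal \<bar>f x\<bar>) < \<infinity> \<Longrightarrow>
       dl p b1 \<mu> (T f) \<le> ennreal N1 * dl p a1 \<mu> (\<lambda>x. ennreal \<bar>f x\<bar>)"
  shows "\<exists>C\<ge>0. \<forall>f \<in> borel_measurable \<mu>. dl p a \<mu> (\<lambda>x. ennreal \<bar>f x\<bar>) < \<infinity> \<longrightarrow>
       dl p b \<mu> (T f) \<le> ennreal C * dl p a \<mu> (\<lambda>x. ennreal \<bar>f x\<bar>)"
proof -
  have da: "0 < a1 - a0" "0 < b1 - b0" using a01 b01 by auto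
  have lt: "a0 < a" "a < a1" "b0 < b" "b < b1"
  proof -
    define u v where "u = \<theta> * (a1 - a0)" and "v = \<theta> * (b1 - b0)"
    have "u < 1 * (a1 - a0)" "v < 1 * (b1 - b0)"
      unfolding u_def v_def using da \<theta> by (intro mult_strict_right_mono; simp)+
    moreover have "0 < u" "0 < v" using da \<theta> by (simp_all add: u_def v_def)
    ultimately show "a0 < a" "a < a1" "b0 < b" "b < b1" unfolding ab u_def[symmetric] v_def[symmetric] by auto
  qed
  have a: "0 < a" "a \<le> 1" and b: "0 < b" "b \<le> 1" using lt a01 b01 by auto
  define q r where "q = 1 / a" and "r = 1 / b"
  have q: "0 < q" and r: "0 < r" and qa: "q * a = 1" and rb: "r * b = 1"
    using a b by (simp_all add: q_def r_def)
  \<comment> \<open>The input height \<open>2^l\<close> is matched with the output height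
    \<open>C * 2 powr (\<gamma> * l)\<close>. This rate makes the cancellation \<open>iden\<close>
    hold at both endpoints, as they lie on one line with \<open>(a, b)\<close>.\<close>
  define \<gamma> where "\<gamma> = q / r * ((a1 - a0) / (b1 - b0))"
  have \<gamma>: "0 < \<gamma>" using q r da by (simp add: \<gamma>_def)
  have iden: "\<gamma> * (r - 1 / b') = - (1 / a' - q) * a' / b'"
    if "0 < a'" "0 < b'" "(a - a') * (b1 - b0) = (a1 - a0) * (b - b')" for a' b'
  proof -
    have "(a1 - a0) * (b - b') / (b1 - b0) = a - a'" unfolding that(3)[symmetric] using da by simp
    moreover have "\<gamma> * (b - b') = q / r * ((a1 - a0) * (b - b') / (b1 - b0))" by (simp add: \<gamma>_def)
    ultimately have gb: "\<gamma> * (b - b') = q / r * (a - a')" by (simp only:)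
    have "r - 1 / b' = r * (b' - b) / b'" using that rb by (simp add: field_simps)
    then have "\<gamma> * (r - 1 / b') = \<gamma> * (r * (b' - b) / b')" by (simp only:)
    also have "\<dots> = - (\<gamma> * (b - b')) * r / b'" by (simp add: algebra_simps)
    also have "\<dots> = - (q / r * (a - a')) * r / b'" unfolding gb ..
    also have "\<dots> = - (q * (a - a')) / b'" using r by simp
    also have "q * (a - a') = (1 / a' - q) * a'" using that(1) by (simp add: left_diff_distrib right_diff_distrib qa)
    also have "- ((1 / a' - q) * a') / b' = - (1 / a' - q) * a' / b'" by (simp only: mult_minus_left)
    finally show ?thesis .
  qed
  \<comment> \<open>For \<open>b0 = 0\<close> the output levels of the low part are bounded
    uniformly by \<open>32 * N0 * 2 powr (\<gamma> * l)\<close>. This \<open>C\<close> keeps that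
    bound below a quarter of the output height, so that no level is counted.\<close>
  define C where "C = 128 * N0 + 1"
  have C: "0 < C" using N by (simp add: C_def)
  define M where "M a' b' N' = ((C * 2 powr \<gamma>) powr r * (64 * N' / C) powr (1 / b') * 2 powr (q * (a' / b' - 1)))
     * (1 / (1 - 2 powr (- \<bar>q - 1 / a'\<bar>)) * 2 powr q)" for a' b' N'
  have M: "0 \<le> M a' b' N'" if "q \<noteq> 1 / a'" for a' b' N'
    using that powr_less_one[of 2 "- \<bar>q - 1 / a'\<bar>"] by (auto simp: M_def intro!: mult_nonneg_nonneg divide_nonneg_nonneg)
  define M0 where "M0 = (if b0 = 0 then 0 else M a0 b0 N0)"
  have q1: "1 / a1 < q" using a lt by (simp add: q_def frac_less2)
  have M0: "0 \<le> M0"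
  proof (cases "b0 = 0")
    case False
    then have "0 < a0" using b01 by linarith
    then have "q \<noteq> 1 / a0" using lt a by (auto simp: q_def)
    then show ?thesis using False M by (simp add: M0_def)
  qed (simp add: M0_def)
  define B where "B = (M0 + M a1 b1 N1) powr b"
  \<comment> \<open>Normalised to norm at most 2 instead of 1, because only scaling by powers of 2
    is at hand.\<close>
  have key: "dl p b \<mu> (T f) \<le> ennreal B"
    if f[measurable]: "f \<in> borel_measurable \<mu>" and f2: "dl p a \<mu> (\<lambda>x. ennreal \<bar>f x\<bar>) \<le> 2" for f
  proof -
    define x where "x = lev p (distr_fun \<mu> (\<lambda>x. ennreal \<bar>f x\<bar>))"
    define y where "y = lev p (distr_fun \<mu> (T f))"
    have "epowr (lp a x) q \<le> epowr 2 q" using f2 q by (intro epowr_mono) (auto simp: dl_def x_def)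
    then have xq: "(\<integral>\<^sup>+ k. epowr (x k) q \<partial>count_space UNIV) \<le> ennreal (2 powr q)"
      using epowr_ennreal[of 2 q] a by (simp add: q_def epowr_lp)
    define f' where "f' a' l = level_restrict f (level_cut q (1 / a') x l)" for a' l
    have f'[measurable]: "f' a' l \<in> borel_measurable \<mu>" for a' l by (simp add: f'_def)
    define K0 where "K0 l = {k. x k \<le> ennreal (2 powr real_of_int l)}" for l :: int
    define f0 f1 where "f0 l = level_restrict f (K0 l)" and "f1 l = level_restrict f (- K0 l)" for l
    have [measurable]: "f0 l \<in> borel_measurable \<mu>" "f1 l \<in> borel_measurable \<mu>" for l by (simp_all add: f0_def f1_def)
    have K1: "- K0 l = level_cut q (1 / a1) x l" for l using q1 by (auto simp: K0_def level_cut_def)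
    have K0': "K0 l = level_cut q (1 / a0) x l" if "0 < a0" for l
      using that lt a by (auto simp: K0_def level_cut_def q_def frac_less2)
    define Z where "Z a' K = lp a' (\<lambda>k. x k * indicator K k)" for a' and K :: "int set"
    define A where "A a' K = (\<integral>\<^sup>+ k. epowr (x k) (1 / a') * indicator K k \<partial>count_space UNIV)" for a' and K :: "int set"
    have ZA: "Z a' K = epowr (A a' K) a'" if "0 < a'" for a' K
    proof -
      have "epowr (x k * indicator K k) (1 / a') = epowr (x k) (1 / a') * indicator K k" for k
        by (simp split: split_indicator)
      then show ?thesis using that by (simp add: Z_def A_def lp_pos)
    qed
    have A_le: "A a' (level_cut q (1 / a') x l) \<le> ennreal (2 powr (real_of_int l * (1 / a' - q))) * ennreal (2 powr q)"
      if "0 < a'" "q \<noteq> 1 / a'" for a' l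
      unfolding A_def using that q by (intro order_trans[OF level_cut_sum_le mult_left_mono[OF xq]]) auto
    have AM: "(\<integral>\<^sup>+ l. ennreal ((C * 2 powr \<gamma>) powr r * (64 * N' / C) powr (1 / b') * 2 powr (q * (a' / b' - 1))) *
        (ennreal (2 powr (real_of_int l * (q - 1 / a'))) * A a' (level_cut q (1 / a') x l)) \<partial>count_space UNIV) \<le> ennreal (M a' b' N')"
      if "0 < a'" "q \<noteq> 1 / a'" for a' b' N'
    proof -
      have g: "0 \<le> 1 / (1 - 2 powr (- \<bar>q - 1 / a'\<bar>))" using that powr_less_one[of 2 "- \<bar>q - 1 / a'\<bar>"] by simp
      have "(\<integral>\<^sup>+ l. ennreal (2 powr (real_of_int l * (q - 1 / a'))) * A a' (level_cut q (1 / a') x l) \<partial>count_space UNIV)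
        \<le> ennreal (1 / (1 - 2 powr (- \<bar>q - 1 / a'\<bar>))) * ennreal (2 powr q)"
        unfolding A_def using that q by (intro order_trans[OF level_cut_sum_levels_le mult_left_mono[OF xq]]) auto
      then have "ennreal ((C * 2 powr \<gamma>) powr r * (64 * N' / C) powr (1 / b') * 2 powr (q * (a' / b' - 1))) *
        (\<integral>\<^sup>+ l. ennreal (2 powr (real_of_int l * (q - 1 / a'))) * A a' (level_cut q (1 / a') x l) \<partial>count_space UNIV)
        \<le> ennreal ((C * 2 powr \<gamma>) powr r * (64 * N' / C) powr (1 / b') * 2 powr (q * (a' / b' - 1))) *
        (ennreal (1 / (1 - 2 powr (- \<bar>q - 1 / a'\<bar>))) * ennreal (2 powr q))" by (intro mult_left_mono) auto
      also have "\<dots> = ennreal (M a' b' N')" unfolding M_def using g by (simp only: ennreal_mult' mult_nonneg_nonneg powr_ge_zero)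
      finally show ?thesis by (subst nn_integral_cmult) auto
    qed
    define y0 y1 where "y0 l = lev p (distr_fun \<mu> (T (f0 l)))" and "y1 l = lev p (distr_fun \<mu> (T (f1 l)))" for l
    have dlf0: "dl p a0 \<mu> (\<lambda>x. ennreal \<bar>f0 l x\<bar>) \<le> 16 * Z a0 (K0 l)" for l
      unfolding f0_def Z_def x_def using p a01 by (intro dl_level_restrict_le) auto
    have dlf1: "dl p a1 \<mu> (\<lambda>x. ennreal \<bar>f1 l x\<bar>) \<le> 16 * Z a1 (- K0 l)" for l
      unfolding f1_def Z_def x_def using p a01 by (intro dl_level_restrict_le) auto
    have a1: "0 < a1" "q \<noteq> 1 / a1" using a lt q1 by auto
    have a0: "q \<noteq> 1 / a0" if "0 < a0" using that lt a by (auto simp: q_def)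
    have finA: "Z a' (level_cut q (1 / a') x l) < top" if "0 < a'" "q \<noteq> 1 / a'" for a' l
      using A_le[OF that, of l] ZA[OF that(1)] by (auto simp: less_top[symmetric] ennreal_mult[symmetric] top_unique)
    \<comment> \<open>At \<open>b0 = 0\<close> the count is not estimated by Chebyshev's inequality;
      instead the low part has a norm of the order of the output height.\<close>
    have Z0: "Z a0 (K0 l) \<le> 2 * ennreal (2 powr (\<gamma> * real_of_int l))" if "b0 = 0" for l
    proof (cases "a0 = 0")
      case True
      have "q / r = b / a" by (simp add: q_def r_def)
      then have "\<gamma> = 1" using \<theta> da that True by (simp add: \<gamma>_def ab)
      then have "Z a0 (K0 l) \<le> ennreal (2 powr (\<gamma> * real_of_int l))"
        using True by (auto simp: Z_def lp_zero K0_def intro!: SUP_least split: split_indicator)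
      also have "\<dots> \<le> 2 * ennreal (2 powr (\<gamma> * real_of_int l))"
        using mult_right_mono[of 1 2 "ennreal (2 powr (\<gamma> * real_of_int l))"] by simp
      finally show ?thesis .
    next
      case False
      then have a0': "0 < a0" using a01 by simp
      have "Z a0 (K0 l) \<le> epowr (ennreal (2 powr (real_of_int l * (1 / a0 - q))) * ennreal (2 powr q)) a0"
        unfolding ZA[OF a0'] K0'[OF a0'] using a0' by (intro epowr_mono A_le a0) auto
      also have "\<dots> = ennreal (2 powr (real_of_int l * ((1 / a0 - q) * a0)) * 2 powr (q * a0))"
        using a0' by (simp add: epowr_mult powr_powr ennreal_mult mult.assoc)
      also have "(1 / a0 - q) * a0 = \<gamma>"
      proof -
        have "(1 / a0 - q) * a0 = q * (a - a0)" using a0' qa by (simp add: field_simps)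
        also have "\<dots> = \<gamma>" using that da r rb \<theta> by (simp add: \<gamma>_def ab r_def)
        finally show ?thesis .
      qed
      also have "ennreal (2 powr (real_of_int l * \<gamma>) * 2 powr (q * a0)) \<le> ennreal (2 powr (real_of_int l * \<gamma>) * 2 powr 1)"
      proof (intro ennreal_leI mult_left_mono)
        have "q * a0 \<le> q * a" using q lt by (intro mult_left_mono) auto
        then show "2 powr (q * a0) \<le> (2::real) powr 1" using qa by (intro powr_mono) auto
      qed simp
      also have "\<dots> = 2 * ennreal (2 powr (\<gamma> * real_of_int l))" by (simp add: ennreal_mult mult.commute)
      finally show ?thesis .
    qed
    have fin0: "Z a0 (K0 l) < top" for l
    proof (cases "0 < a0")
      case True
      then show ?thesis using finA[OF True a0[OF True]] K0' by simp
    next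
      case False
      then have "b0 = 0" using a01 b01 by linarith
      then show ?thesis using Z0[of l] by (auto simp: less_top[symmetric] ennreal_mult_eq_top_iff top_unique)
    qed
    have y0: "lp b0 (y0 l) \<le> ennreal (16 * N0) * Z a0 (K0 l)" for l
    proof -
      have "dl p a0 \<mu> (\<lambda>x. ennreal \<bar>f0 l x\<bar>) < \<infinity>"
        using dlf0[of l] fin0[of l] by (auto simp: ennreal_mult_less_top intro: le_less_trans)
      then have "dl p b0 \<mu> (T (f0 l)) \<le> ennreal N0 * dl p a0 \<mu> (\<lambda>x. ennreal \<bar>f0 l x\<bar>)" by (intro T0) auto
      also have "\<dots> \<le> ennreal N0 * (16 * Z a0 (K0 l))" by (intro mult_left_mono dlf0) simp
      finally show ?thesis using N by (simp add: dl_def y0_def ennreal_mult ac_simps)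
    qed
    have y1: "lp b1 (y1 l) \<le> ennreal (16 * N1) * Z a1 (- K0 l)" for l
    proof -
      have "dl p a1 \<mu> (\<lambda>x. ennreal \<bar>f1 l x\<bar>) < \<infinity>"
        using dlf1[of l] finA[OF a1] K1 by (auto simp: ennreal_mult_less_top intro: le_less_trans)
      then have "dl p b1 \<mu> (T (f1 l)) \<le> ennreal N1 * dl p a1 \<mu> (\<lambda>x. ennreal \<bar>f1 l x\<bar>)" by (intro T1) auto
      also have "\<dots> \<le> ennreal N1 * (16 * Z a1 (- K0 l))" by (intro mult_left_mono dlf1) simp
      finally show ?thesis using N by (simp add: dl_def y1_def ennreal_mult ac_simps)
    qed
    have split: "y k \<le> 2 * (y0 l (k - 1) + y1 l (k - 1))" for k l
    proof -
      have "T f z \<le> T (f0 l) z + T (f1 l) z" if "z \<in> space \<mu>" for z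
      proof -
        have "f = (\<lambda>z. f0 l z + f1 l z)" by (rule ext) (simp add: f0_def f1_def level_restrict_split)
        then show ?thesis using sub[of "f0 l" "f1 l" z] that by simp
      qed
      then show ?thesis unfolding y_def y0_def y1_def using p by (intro lev_add_le distr_fun_add_level)
    qed
    define S where "S l = C * 2 powr (\<gamma> * real_of_int l)" for l :: int
    define S' where "S' l = ennreal ((C * 2 powr (\<gamma> * (real_of_int l + 1))) powr r)" for l :: int
    have S: "0 < S l" for l using C by (simp add: S_def)
    define cnt where "cnt Y l = (\<integral>\<^sup>+ k. indicator {k. ennreal (S l / 4) < Y (k + - 1)} k \<partial>count_space UNIV)"
      for Y :: "int \<Rightarrow> ennreal" and l
    \<comment> \<open>The factor 2 of the quasi-triangle inequality and the two summands together
      account for the quarter.\<close>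
    have ycnt: "(\<integral>\<^sup>+ k. indicator {k. ennreal (S l) < y k} k \<partial>count_space UNIV) \<le> cnt (y0 l) l + cnt (y1 l) l" for l
    proof -
      have "indicator {k. ennreal (S l) < y k} k \<le> indicator {k. ennreal (S l / 4) < y0 l (k + - 1)} k
         + (indicator {k. ennreal (S l / 4) < y1 l (k + - 1)} k :: ennreal)" for k
      proof -
        have "ennreal (S l / 4) < y0 l (k - 1) \<or> ennreal (S l / 4) < y1 l (k - 1)" if "ennreal (S l) < y k"
        proof (rule ccontr)
          assume "\<not> ?thesis"
          then have "2 * (y0 l (k - 1) + y1 l (k - 1)) \<le> 2 * (ennreal (S l / 4) + ennreal (S l / 4))"
            by (intro mult_left_mono add_mono) auto
          also have "\<dots> = ennreal 2 * ennreal (S l / 4 + S l / 4)"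
            using S[of l] by (subst ennreal_plus) auto
          also have "\<dots> = ennreal (2 * (S l / 4 + S l / 4))" by (rule ennreal_mult'[symmetric]) simp
          also have "\<dots> = ennreal (S l)" by simp
          finally show False using split[of k l] that by (meson leD order_trans)
        qed
        then show ?thesis by (auto split: split_indicator)
      qed
      then have "(\<integral>\<^sup>+ k. indicator {k. ennreal (S l) < y k} k \<partial>count_space UNIV)
        \<le> (\<integral>\<^sup>+ k. indicator {k. ennreal (S l / 4) < y0 l (k + - 1)} k
         + indicator {k. ennreal (S l / 4) < y1 l (k + - 1)} k \<partial>count_space UNIV)"
        by (intro nn_integral_mono)
      also have "\<dots> = cnt (y0 l) l + cnt (y1 l) l" unfolding cnt_def by (rule nn_integral_add) auto
      finally show ?thesis .
    qed
    have line: "(a - a1) * (b1 - b0) = (a1 - a0) * (b - b1)" "(a - a0) * (b1 - b0) = (a1 - a0) * (b - b0)"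
      unfolding ab by (simp_all add: algebra_simps)
    have I1: "(\<integral>\<^sup>+ l. S' l * cnt (y1 l) l \<partial>count_space UNIV) \<le> ennreal (M a1 b1 N1)"
    proof -
      have "S' l * cnt (y1 l) l \<le> ennreal ((C * 2 powr \<gamma>) powr r * (64 * N1 / C) powr (1 / b1) * 2 powr (q * (a1 / b1 - 1))) *
        (ennreal (2 powr (real_of_int l * (q - 1 / a1))) * A a1 (level_cut q (1 / a1) x l))" for l
        unfolding S'_def cnt_def S_def
      proof (rule interpolation_count)
        show "\<gamma> * (r - 1 / b1) = - (1 / a1 - q) * a1 / b1" using a1 lt b line by (intro iden) auto
        show "A a1 (level_cut q (1 / a1) x l) \<le> ennreal (2 powr (real_of_int l * (1 / a1 - q))) * ennreal (2 powr q)"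
          by (rule A_le[OF a1])
        show "lp b1 (y1 l) \<le> ennreal (16 * N1) * epowr (A a1 (level_cut q (1 / a1) x l)) a1"
          using y1[of l] ZA[OF a1(1)] K1 by simp
      qed (use a1 b01 C N in auto)
      then show ?thesis by (intro order_trans[OF nn_integral_mono AM[OF a1]])
    qed
    have I0: "(\<integral>\<^sup>+ l. S' l * cnt (y0 l) l \<partial>count_space UNIV) \<le> ennreal M0"
    proof (cases "b0 = 0")
      case False
      then have a0': "0 < a0" and b0': "0 < b0" using b01 by auto
      have "S' l * cnt (y0 l) l \<le> ennreal ((C * 2 powr \<gamma>) powr r * (64 * N0 / C) powr (1 / b0) * 2 powr (q * (a0 / b0 - 1))) *
        (ennreal (2 powr (real_of_int l * (q - 1 / a0))) * A a0 (level_cut q (1 / a0) x l))" for l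
        unfolding S'_def cnt_def S_def
      proof (rule interpolation_count)
        show "\<gamma> * (r - 1 / b0) = - (1 / a0 - q) * a0 / b0" using a0' b0' line by (intro iden) auto
        show "A a0 (level_cut q (1 / a0) x l) \<le> ennreal (2 powr (real_of_int l * (1 / a0 - q))) * ennreal (2 powr q)"
          by (rule A_le[OF a0' a0[OF a0']])
        show "lp b0 (y0 l) \<le> ennreal (16 * N0) * epowr (A a0 (level_cut q (1 / a0) x l)) a0"
          using y0[of l] ZA[OF a0'] K0'[OF a0'] by simp
      qed (use a0' b0' b01 C N in auto)
      then show ?thesis using False unfolding M0_def
        by (auto intro!: order_trans[OF nn_integral_mono AM[OF a0' a0[OF a0']]])
    next
      case True
      have "cnt (y0 l) l = 0" for l
      proof -
        have "\<not> ennreal (S l / 4) < y0 l k" for k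
        proof -
          have "y0 l k \<le> lp b0 (y0 l)" using b01 by (intro le_lp)
          also have "\<dots> \<le> ennreal (16 * N0) * (2 * ennreal (2 powr (\<gamma> * real_of_int l)))"
            by (intro order_trans[OF y0] mult_left_mono Z0 True) simp
          also have "\<dots> = ennreal (32 * N0 * 2 powr (\<gamma> * real_of_int l))"
          proof -
            have "(2::ennreal) = ennreal 2" by simp
            then show ?thesis using N by (simp only: ennreal_mult'[symmetric] mult_nonneg_nonneg) (simp add: ac_simps)
          qed
          also have "\<dots> \<le> ennreal (S l / 4)" by (intro ennreal_leI) (simp add: S_def C_def algebra_simps)
          finally show ?thesis by simp
        qed
        then show ?thesis by (simp add: cnt_def)
      qed
      then show ?thesis by simp
    qed
    have "(\<integral>\<^sup>+ k. epowr (y k) r \<partial>count_space UNIV)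
       \<le> (\<integral>\<^sup>+ k. \<integral>\<^sup>+ l. S' l * indicator {l. ennreal (S l) < y k} l \<partial>count_space UNIV \<partial>count_space UNIV)"
      unfolding S'_def S_def using r C \<gamma> by (intro nn_integral_mono epowr_layer)
    also have "\<dots> = (\<integral>\<^sup>+ l. \<integral>\<^sup>+ k. S' l * indicator {l. ennreal (S l) < y k} l \<partial>count_space UNIV \<partial>count_space UNIV)"
      using nn_integral_fst_count_space[of "\<lambda>(k,l). S' l * indicator {l. ennreal (S l) < y k} l"]
      nn_integral_snd_count_space[of "\<lambda>(k,l). S' l * indicator {l. ennreal (S l) < y k} l"] by simp
    also have "\<dots> = (\<integral>\<^sup>+ l. S' l * (\<integral>\<^sup>+ k. indicator {k. ennreal (S l) < y k} k \<partial>count_space UNIV) \<partial>count_space UNIV)"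
      by (intro nn_integral_cong, subst nn_integral_cmult[symmetric]) (auto intro!: nn_integral_cong split: split_indicator)
    also have "\<dots> \<le> (\<integral>\<^sup>+ l. S' l * cnt (y0 l) l + S' l * cnt (y1 l) l \<partial>count_space UNIV)"
      unfolding distrib_left[symmetric] by (intro nn_integral_mono mult_left_mono ycnt) simp
    also have "\<dots> = (\<integral>\<^sup>+ l. S' l * cnt (y0 l) l \<partial>count_space UNIV) + (\<integral>\<^sup>+ l. S' l * cnt (y1 l) l \<partial>count_space UNIV)"
      by (rule nn_integral_add) auto
    also have "\<dots> \<le> ennreal M0 + ennreal (M a1 b1 N1)" by (intro add_mono I0 I1)
    also have "\<dots> = ennreal (M0 + M a1 b1 N1)" using M0 M[OF a1(2)] by simp
    also have "\<dots> = epowr (ennreal B) r"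
      using M0 M[OF a1(2)] rb by (simp add: B_def powr_powr mult.commute)
    finally show ?thesis unfolding dl_def y_def[symmetric] using b by (intro lp_leI) (auto simp: r_def)
  qed
  show ?thesis
  proof (intro exI[of _ B] conjI ballI impI)
    show "0 \<le> B" by (simp add: B_def)
    fix f assume f[measurable]: "f \<in> borel_measurable \<mu>" and fin: "dl p a \<mu> (\<lambda>x. ennreal \<bar>f x\<bar>) < \<infinity>"
    let ?F = "dl p a \<mu> (\<lambda>x. ennreal \<bar>f x\<bar>)"
    have scaled: "dl p b \<mu> (T f) \<le> ennreal (2 powr real_of_int j) * ennreal B"
      if "?F \<le> ennreal (2 powr real_of_int j) * 2" for j :: int
    proof -
      let ?c = "2 powr real_of_int (- j)"
      have "(\<lambda>x. ennreal \<bar>?c * f x\<bar>) = (\<lambda>x. ennreal ?c * ennreal \<bar>f x\<bar>)"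
        by (rule ext) (simp add: abs_mult ennreal_mult)
      then have "dl p a \<mu> (\<lambda>x. ennreal \<bar>?c * f x\<bar>) = ennreal ?c * ?F"
        using dl_cmult[of a p \<mu> "- j"] a by simp
      also have "\<dots> \<le> 2" using that by (subst ennreal_pmult_le_iff) (auto simp: powr_minus_divide)
      finally have "dl p b \<mu> (T (\<lambda>x. ?c * f x)) \<le> ennreal B" by (intro key) auto
      moreover have "dl p b \<mu> (\<lambda>x. ennreal ?c * T f x) \<le> dl p b \<mu> (T (\<lambda>x. ?c * f x))"
        using p b by (intro dl_mono) (auto simp: hom)
      ultimately have "ennreal ?c * dl p b \<mu> (T f) \<le> ennreal B"
        using dl_cmult[of b p \<mu> "- j" "T f"] b by simp
      then show ?thesis by (subst (asm) ennreal_pmult_le_iff) (auto simp: powr_minus_divide)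
    qed
    show "dl p b \<mu> (T f) \<le> ennreal B * ?F"
    proof (cases "?F = 0")
      case True
      \<comment> \<open>A function of norm 0 stays in the normalised class under every rescaling, so
        the norm of its image is below every positive bound.\<close>
      have "dl p b \<mu> (T f) \<le> 0 + ennreal B * ennreal \<eta>" if "0 < \<eta>" for \<eta>
      proof -
        have "dl p b \<mu> (T f) \<le> ennreal (2 powr real_of_int \<lfloor>log 2 \<eta>\<rfloor>) * ennreal B" by (rule scaled) (simp add: True)
        also have "\<dots> \<le> ennreal \<eta> * ennreal B" by (intro mult_right_mono ennreal_leI floor_log2_bounds that) auto
        finally show ?thesis by (simp add: mult.commute)
      qed
      then have "dl p b \<mu> (T f) \<le> 0" by (rule ennreal_le_add_small) auto
      then show ?thesis by simp
    next
      case False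
      then obtain c where c: "?F = ennreal c" "0 < c" using fin by (cases ?F) (auto simp: ennreal_eq_0_iff not_le)
      have "c \<le> 2 powr real_of_int \<lfloor>log 2 c\<rfloor> * 2" using floor_log2_bounds(2)[OF c(2)] by (simp add: powr_add)
      then have "?F \<le> ennreal (2 powr real_of_int \<lfloor>log 2 c\<rfloor> * 2)" unfolding c(1) by (rule ennreal_leI)
      then have "?F \<le> ennreal (2 powr real_of_int \<lfloor>log 2 c\<rfloor>) * 2" by (simp add: ennreal_mult)
      then have "dl p b \<mu> (T f) \<le> ennreal (2 powr real_of_int \<lfloor>log 2 c\<rfloor>) * ennreal B" by (rule scaled)
      also have "\<dots> \<le> ennreal c * ennreal B" by (intro mult_right_mono ennreal_leI floor_log2_bounds c) auto
      finally show ?thesis unfolding c(1) by (simp add: mult.commute)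
    qed
  qed
qed

subsection \<open>The region of a metric measure space\<close>

lemma mm_spaceD:
  assumes "mm_space X \<rho> \<mu>"
  shows "X \<noteq> {}" "Metric_space X \<rho>" "space \<mu> = X"
    "\<And>U. openin (Metric_space.mtopology X \<rho>) U \<Longrightarrow> U \<in> sets \<mu>"
  using assms by (auto simp: mm_space_def intro: sigma_sets.Basic)

locale mm = Metric_space X \<rho> for X :: "'a set" and \<rho> :: "'a \<Rightarrow> 'a \<Rightarrow> real" +
  fixes \<mu> :: "'a measure"
  assumes space_mu: "space \<mu> = X" and open_sets: "\<And>U. openin mtopology U \<Longrightarrow> U \<in> sets \<mu>"
begin

section \<open>Sublinearity of the maximal operator and the points on which it acts\<close>

lemma oball_eq: "x \<in> X \<Longrightarrow> oball X \<rho> x s = mball x s"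
  by (auto simp: oball_def)

lemma oball_sets: "x \<in> X \<Longrightarrow> oball X \<rho> x s \<in> sets \<mu>"
  by (simp add: oball_eq open_sets)

lemma maxc_add_le:
  assumes [measurable]: "f \<in> borel_measurable \<mu>" "g \<in> borel_measurable \<mu>" and x: "x \<in> X"
  shows "maxc X \<rho> \<mu> (\<lambda>x. f x + g x) x \<le> maxc X \<rho> \<mu> f x + maxc X \<rho> \<mu> g x"
  unfolding maxc_def[of _ _ _ "\<lambda>x. f x + g x"]
proof (intro SUP_least)
  fix s assume s: "s \<in> {s. 0 < s \<and> 0 < emeasure \<mu> (oball X \<rho> x s) \<and> emeasure \<mu> (oball X \<rho> x s) < \<infinity>}"
  let ?B = "oball X \<rho> x s"
  have [measurable]: "?B \<in> sets \<mu>" by (rule oball_sets[OF x])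
  have "(\<integral>\<^sup>+ y \<in> ?B. ennreal \<bar>f y + g y\<bar> \<partial>\<mu>) \<le> (\<integral>\<^sup>+ y. ennreal \<bar>f y\<bar> * indicator ?B y + ennreal \<bar>g y\<bar> * indicator ?B y \<partial>\<mu>)"
    by (intro nn_integral_mono) (auto split: split_indicator simp: ennreal_plus[symmetric] simp del: ennreal_plus intro: ennreal_leI)
  also have "\<dots> = (\<integral>\<^sup>+ y \<in> ?B. ennreal \<bar>f y\<bar> \<partial>\<mu>) + (\<integral>\<^sup>+ y \<in> ?B. ennreal \<bar>g y\<bar> \<partial>\<mu>)"
    by (rule nn_integral_add) measurable
  finally have "(\<integral>\<^sup>+ y \<in> ?B. ennreal \<bar>f y + g y\<bar> \<partial>\<mu>) / emeasure \<mu> ?B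
     \<le> (\<integral>\<^sup>+ y \<in> ?B. ennreal \<bar>f y\<bar> \<partial>\<mu>) / emeasure \<mu> ?B + (\<integral>\<^sup>+ y \<in> ?B. ennreal \<bar>g y\<bar> \<partial>\<mu>) / emeasure \<mu> ?B"
    unfolding add_divide_distrib_ennreal[symmetric] by (rule divide_right_mono_ennreal)
  also have "\<dots> \<le> maxc X \<rho> \<mu> f x + maxc X \<rho> \<mu> g x"
    unfolding maxc_def using s by (intro add_mono SUP_upper2[of s]) auto
  finally show "(\<integral>\<^sup>+ y \<in> ?B. ennreal \<bar>f y + g y\<bar> \<partial>\<mu>) / emeasure \<mu> ?B \<le> maxc X \<rho> \<mu> f x + maxc X \<rho> \<mu> g x" .
qed

lemma maxc_cmult:
  assumes [measurable]: "f \<in> borel_measurable \<mu>" and c: "0 < c" and x: "x \<in> X"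
  shows "maxc X \<rho> \<mu> (\<lambda>x. c * f x) x = ennreal c * maxc X \<rho> \<mu> f x"
proof -
  have "(\<integral>\<^sup>+ y \<in> oball X \<rho> x s. ennreal \<bar>c * f y\<bar> \<partial>\<mu>) / emeasure \<mu> (oball X \<rho> x s)
     = ennreal c * ((\<integral>\<^sup>+ y \<in> oball X \<rho> x s. ennreal \<bar>f y\<bar> \<partial>\<mu>) / emeasure \<mu> (oball X \<rho> x s))" for s
  proof -
    have [measurable]: "oball X \<rho> x s \<in> sets \<mu>" by (rule oball_sets[OF x])
    have "(\<integral>\<^sup>+ y \<in> oball X \<rho> x s. ennreal \<bar>c * f y\<bar> \<partial>\<mu>) = (\<integral>\<^sup>+ y. ennreal c * (ennreal \<bar>f y\<bar> * indicator (oball X \<rho> x s) y) \<partial>\<mu>)"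
      using c by (intro nn_integral_cong) (simp add: abs_mult ennreal_mult mult.assoc)
    also have "\<dots> = ennreal c * (\<integral>\<^sup>+ y \<in> oball X \<rho> x s. ennreal \<bar>f y\<bar> \<partial>\<mu>)" by (rule nn_integral_cmult) measurable
    finally show ?thesis by (simp add: ennreal_times_divide)
  qed
  then show ?thesis unfolding maxc_def by (simp add: SUP_mult_left_ennreal)
qed

text \<open>At a point of \<open>X\<close> outside this set every ball has infinite measure and is
  omitted, so \<open>maxc\<close> is 0 there as an empty supremum.\<close>

definition fin_ball :: "'a set" where
  "fin_ball = {x \<in> X. \<exists>s>0. emeasure \<mu> (oball X \<rho> x s) < \<infinity>}"

text \<open>If the complement of the support is null, this is \<open>fin_ball\<close> up to a null
  set. Whether it is finite separates the full square from the regions below the diagonal.\<close>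

definition core :: "'a set" where "core = fin_ball \<inter> supp_mu X \<rho> \<mu>"

lemma emeasure_mball_mono: "mball x s \<subseteq> mball y t \<Longrightarrow> emeasure \<mu> (mball x s) \<le> emeasure \<mu> (mball y t)"
  by (intro emeasure_mono open_sets) auto

lemma emeasure_mball_le: "s \<le> t \<Longrightarrow> emeasure \<mu> (mball x s) \<le> emeasure \<mu> (mball x t)"
  by (intro emeasure_mball_mono mball_subset_concentric)

lemma open_ball_inside: "y \<in> mball x s \<Longrightarrow> \<exists>t>0. mball y t \<subseteq> mball x s"
  using openin_mball[of x s] unfolding openin_mtopology by blast

lemma fin_ballI: assumes "x \<in> X" "emeasure \<mu> (mball x s) < \<infinity>" shows "mball x s \<subseteq> fin_ball"
proof
  fix y assume y: "y \<in> mball x s"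
  then obtain t where t: "0 < t" "mball y t \<subseteq> mball x s" using open_ball_inside by blast
  then have "emeasure \<mu> (mball y t) < \<infinity>" using emeasure_mball_mono assms by (meson le_less_trans)
  then show "y \<in> fin_ball" using t y by (auto simp: fin_ball_def oball_eq)
qed

lemma fin_ball_open: "openin mtopology fin_ball"
  unfolding openin_mtopology
proof (intro conjI allI impI)
  fix x assume "x \<in> fin_ball"
  then obtain s where "x \<in> X" "0 < s" "emeasure \<mu> (mball x s) < \<infinity>" by (auto simp: fin_ball_def oball_eq)
  then show "\<exists>r>0. mball x r \<subseteq> fin_ball" using fin_ballI by blast
qed (auto simp: fin_ball_def)

lemma supp_compl_open: "openin mtopology (X - supp_mu X \<rho> \<mu>)"
  unfolding openin_mtopology
proof (intro conjI allI impI)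
  fix x assume x: "x \<in> X - supp_mu X \<rho> \<mu>"
  then obtain s where s: "0 < s" "emeasure \<mu> (mball x s) = 0" by (auto simp: supp_mu_def oball_eq zero_less_iff_neq_zero)
  have "y \<notin> supp_mu X \<rho> \<mu>" if y: "y \<in> mball x s" for y
  proof -
    obtain t where t: "0 < t" "mball y t \<subseteq> mball x s" using open_ball_inside y by blast
    then have "emeasure \<mu> (mball y t) = 0" using emeasure_mball_mono s by (metis le_zero_eq)
    then show ?thesis using t y by (auto simp: supp_mu_def oball_eq)
  qed
  then show "\<exists>r>0. mball x r \<subseteq> X - supp_mu X \<rho> \<mu>" using s mball_subset_mspace by blast
qed auto

lemma supp_pos: "x \<in> supp_mu X \<rho> \<mu> \<Longrightarrow> 0 < s \<Longrightarrow> 0 < emeasure \<mu> (mball x s)"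
  by (auto simp: supp_mu_def oball_eq)

text \<open>Averages over balls inside \<open>U\<close> of finite positive measure. For test
  functions that are constant on open sets this does the work of a differentiation theorem.\<close>

lemma maxc_ge:
  fixes f :: "'a \<Rightarrow> real"
  assumes x: "x \<in> core" and U: "openin mtopology U" "x \<in> U" and c: "\<And>y. y \<in> U \<Longrightarrow> c \<le> \<bar>f y\<bar>"
  shows "ennreal c \<le> maxc X \<rho> \<mu> f x"
proof -
  obtain s where s: "x \<in> X" "0 < s" "emeasure \<mu> (mball x s) < \<infinity>"
    using x by (auto simp: core_def fin_ball_def oball_eq)
  obtain r where r: "0 < r" "mball x r \<subseteq> U" using U unfolding openin_mtopology by blast
  define t where "t = min r s"
  let ?B = "oball X \<rho> x t"
  have t: "0 < t" "?B \<subseteq> U" using r s by (auto simp: t_def oball_eq)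
  have [measurable]: "?B \<in> sets \<mu>" by (rule oball_sets) fact
  have pos: "0 < emeasure \<mu> ?B" using x t s supp_pos by (auto simp: core_def oball_eq)
  have "emeasure \<mu> (mball x t) \<le> emeasure \<mu> (mball x s)" by (rule emeasure_mball_le) (simp add: t_def)
  then have fin: "emeasure \<mu> ?B < \<infinity>" using s by (simp add: oball_eq le_less_trans)
  have "ennreal c * emeasure \<mu> ?B = (\<integral>\<^sup>+ y. ennreal c * indicator ?B y \<partial>\<mu>)" by (simp add: nn_integral_cmult_indicator)
  also have "\<dots> \<le> (\<integral>\<^sup>+ y \<in> ?B. ennreal \<bar>f y\<bar> \<partial>\<mu>)"
    using t c by (intro nn_integral_mono) (auto split: split_indicator intro!: ennreal_leI)
  finally have "ennreal c * emeasure \<mu> ?B / emeasure \<mu> ?B \<le> (\<integral>\<^sup>+ y \<in> ?B. ennreal \<bar>f y\<bar> \<partial>\<mu>) / emeasure \<mu> ?B"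
    by (rule divide_right_mono_ennreal)
  also have "ennreal c * emeasure \<mu> ?B / emeasure \<mu> ?B = ennreal c"
    using pos fin by (simp add: mult_divide_eq_ennreal)
  also have "(\<integral>\<^sup>+ y \<in> ?B. ennreal \<bar>f y\<bar> \<partial>\<mu>) / emeasure \<mu> ?B \<le> maxc X \<rho> \<mu> f x"
    unfolding maxc_def using t pos fin by (intro SUP_upper) auto
  finally show ?thesis .
qed

section \<open>Monotonicity and convexity of the region\<close>

lemma maxc_bounded_mono:
  assumes p: "1 < p" and B: "maxc_bounded X \<rho> \<mu> p a b"
    and ab: "0 \<le> a" "a \<le> a'" "a' \<le> 1" "0 \<le> b'" "b' \<le> b" "b \<le> 1"
  shows "maxc_bounded X \<rho> \<mu> p a' b'"
proof -
  obtain C where C: "0 \<le> C" "\<And>f. f \<in> borel_measurable \<mu> \<Longrightarrow> dl p a \<mu> (\<lambda>x. ennreal \<bar>f x\<bar>) < \<infinity> \<Longrightarrow>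
     dl p b \<mu> (maxc X \<rho> \<mu> f) \<le> ennreal C * dl p a \<mu> (\<lambda>x. ennreal \<bar>f x\<bar>)"
    using B ab p by (subst (asm) maxc_bounded_iff) auto
  show ?thesis
  proof (subst maxc_bounded_iff)
    show "\<exists>C\<ge>0. \<forall>f\<in>borel_measurable \<mu>. dl p a' \<mu> (\<lambda>x. ennreal \<bar>f x\<bar>) < \<infinity> \<longrightarrow>
       dl p b' \<mu> (maxc X \<rho> \<mu> f) \<le> ennreal C * dl p a' \<mu> (\<lambda>x. ennreal \<bar>f x\<bar>)"
    proof (intro exI[of _ C] conjI ballI impI C(1))
      fix f assume f: "f \<in> borel_measurable \<mu>" "dl p a' \<mu> (\<lambda>x. ennreal \<bar>f x\<bar>) < \<infinity>"
      have le: "dl p a \<mu> (\<lambda>x. ennreal \<bar>f x\<bar>) \<le> dl p a' \<mu> (\<lambda>x. ennreal \<bar>f x\<bar>)"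
        unfolding dl_def using ab by (intro lp_antimono_exponent)
      have "dl p b' \<mu> (maxc X \<rho> \<mu> f) \<le> dl p b \<mu> (maxc X \<rho> \<mu> f)"
        unfolding dl_def using ab by (intro lp_antimono_exponent)
      also have "\<dots> \<le> ennreal C * dl p a \<mu> (\<lambda>x. ennreal \<bar>f x\<bar>)" using f le by (intro C) (auto intro: le_less_trans)
      also have "\<dots> \<le> ennreal C * dl p a' \<mu> (\<lambda>x. ennreal \<bar>f x\<bar>)" by (intro mult_left_mono le) simp
      finally show "dl p b' \<mu> (maxc X \<rho> \<mu> f) \<le> ennreal C * dl p a' \<mu> (\<lambda>x. ennreal \<bar>f x\<bar>)" .
    qed
  qed (use p ab in auto)
qed

text \<open>The conditions \<open>b0 \<le> a0\<close> and \<open>b1 \<le> a1\<close> are those of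
  the interpolation lemma; in a space with infinite \<open>core\<close> they come from
  \<open>core_infinite_le\<close>.\<close>

lemma maxc_bounded_convex:
  assumes p: "1 < p" and B: "maxc_bounded X \<rho> \<mu> p a0 b0" "maxc_bounded X \<rho> \<mu> p a1 b1"
    and ab: "0 \<le> a0" "a0 < a1" "a1 \<le> 1" "0 \<le> b0" "b0 < b1" "b0 \<le> a0" "b1 \<le> a1"
    and \<theta>: "0 < \<theta>" "\<theta> < 1"
  shows "maxc_bounded X \<rho> \<mu> p (a0 + \<theta> * (a1 - a0)) (b0 + \<theta> * (b1 - b0))"
proof -
  obtain C0 where C0: "0 \<le> C0" "\<And>f. f \<in> borel_measurable \<mu> \<Longrightarrow> dl p a0 \<mu> (\<lambda>x. ennreal \<bar>f x\<bar>) < \<infinity> \<Longrightarrow>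
     dl p b0 \<mu> (maxc X \<rho> \<mu> f) \<le> ennreal C0 * dl p a0 \<mu> (\<lambda>x. ennreal \<bar>f x\<bar>)"
    using B(1) ab p by (subst (asm) maxc_bounded_iff) auto
  obtain C1 where C1: "0 \<le> C1" "\<And>f. f \<in> borel_measurable \<mu> \<Longrightarrow> dl p a1 \<mu> (\<lambda>x. ennreal \<bar>f x\<bar>) < \<infinity> \<Longrightarrow>
     dl p b1 \<mu> (maxc X \<rho> \<mu> f) \<le> ennreal C1 * dl p a1 \<mu> (\<lambda>x. ennreal \<bar>f x\<bar>)"
    using B(2) ab p by (subst (asm) maxc_bounded_iff) auto
  have u: "0 \<le> a0 + \<theta> * (a1 - a0)" "0 \<le> b0 + \<theta> * (b1 - b0)"
    using ab \<theta> by (auto intro!: add_nonneg_nonneg mult_nonneg_nonneg)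
  have "a0 + \<theta> * (a1 - a0) \<le> a0 + 1 * (a1 - a0)" using ab \<theta> by (intro add_left_mono mult_right_mono) auto
  also have "\<dots> \<le> 1" using ab by simp
  finally have v1: "a0 + \<theta> * (a1 - a0) \<le> 1" .
  have "b0 + \<theta> * (b1 - b0) \<le> b0 + 1 * (b1 - b0)" using ab \<theta> by (intro add_left_mono mult_right_mono) auto
  also have "\<dots> \<le> 1" using ab by simp
  finally have v2: "b0 + \<theta> * (b1 - b0) \<le> 1" .
  have p1: "1 \<le> p" using p by simp
  show ?thesis
    unfolding maxc_bounded_iff[OF p u(1) v1 u(2) v2]
    by (rule lorentz_interpolation[OF p1 _ _ ab(1,2,3,4,5,6,7) \<theta> refl refl C0(1) C1(1)])
      (use C0(2) C1(2) maxc_add_le maxc_cmult space_mu in simp_all)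
qed

text \<open>Points of a finite \<open>core\<close> are atoms, so the values of \<open>f\<close>
  there are bounded by multiples of its norm. Almost everywhere on \<open>fin_ball\<close> the
  function is at most the sum \<open>H\<close> of these values; hence the maximal function is at
  most \<open>H\<close> on \<open>fin_ball\<close>, a set of finite measure, and 0
  elsewhere.\<close>

lemma core_finite_bounded:
  assumes p: "1 < p" and null: "emeasure \<mu> (X - supp_mu X \<rho> \<mu>) = 0" and fin: "finite core"
    and ab: "0 \<le> a" "a \<le> 1" "0 \<le> b" "b \<le> 1"
  shows "maxc_bounded X \<rho> \<mu> p a b"
proof -
  have coreX: "core \<subseteq> X" by (auto simp: core_def fin_ball_def)
  have Ns: "X - supp_mu X \<rho> \<mu> \<in> sets \<mu>" by (intro open_sets supp_compl_open)
  have single: "{x} \<in> sets \<mu>" if "x \<in> X" for x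
  proof -
    have "openin mtopology (X - {x})"
      unfolding openin_mtopology
    proof (intro conjI allI impI)
      fix y assume y: "y \<in> X - {x}"
      then have "0 < \<rho> y x" using that zero[of y x] nonneg[of y x] by (auto simp: less_le)
      then show "\<exists>r>0. mball y r \<subseteq> X - {x}" by (intro exI[of _ "\<rho> y x"]) auto
    qed auto
    then have "X - (X - {x}) \<in> sets \<mu>" using open_sets space_mu by (metis sets.compl_sets)
    moreover have "X - (X - {x}) = {x}" using that by auto
    ultimately show ?thesis by simp
  qed
  have pt: "emeasure \<mu> {x} < \<infinity>" "0 < emeasure \<mu> {x}" if x: "x \<in> core" for x
  proof -
    obtain s where s: "x \<in> X" "0 < s" "emeasure \<mu> (mball x s) < \<infinity>"
      using x by (auto simp: core_def fin_ball_def oball_eq)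
    have "emeasure \<mu> {x} \<le> emeasure \<mu> (mball x s)" using s by (intro emeasure_mono open_sets) auto
    then show "emeasure \<mu> {x} < \<infinity>" using s by (auto intro: le_less_trans)
    have "\<exists>r>0. mball x r \<inter> core \<subseteq> {x}"
    proof (cases "core \<subseteq> {x}")
      case True then show ?thesis by (intro exI[of _ 1]) auto
    next
      case False
      let ?R = "(\<lambda>y. \<rho> x y) ` (core - {x})"
      have "finite ?R" "?R \<noteq> {}" using fin False by auto
      moreover have "\<forall>r\<in>?R. 0 < r" using coreX s zero nonneg by (force simp: less_le)
      ultimately have "0 < Min ?R" by simp
      moreover have "mball x (Min ?R) \<inter> core \<subseteq> {x}"
      proof
        fix y assume y: "y \<in> mball x (Min ?R) \<inter> core"
        show "y \<in> {x}"
        proof (rule ccontr)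
          assume "y \<notin> {x}"
          then have "Min ?R \<le> \<rho> x y" using y \<open>finite ?R\<close> by (intro Min_le) auto
          then show False using y by auto
        qed
      qed
      ultimately show ?thesis by blast
    qed
    then obtain r where r: "0 < r" "mball x r \<inter> core \<subseteq> {x}" by blast
    let ?t = "min r s"
    \<comment> \<open>The ball isolates \<open>x\<close> in \<open>core\<close>, so up to a null set
      it is the point itself, which therefore carries its positive measure.\<close>
    have "mball x ?t \<subseteq> {x} \<union> (X - supp_mu X \<rho> \<mu>)"
    proof
      fix y assume y: "y \<in> mball x ?t"
      have "y \<in> fin_ball" using fin_ballI[OF s(1,3)] y by auto
      then show "y \<in> {x} \<union> (X - supp_mu X \<rho> \<mu>)" using r y by (auto simp: core_def)
    qed
    then have "emeasure \<mu> (mball x ?t) \<le> emeasure \<mu> ({x} \<union> (X - supp_mu X \<rho> \<mu>))"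
      using s by (intro emeasure_mono sets.Un single Ns) auto
    also have "\<dots> \<le> emeasure \<mu> {x} + emeasure \<mu> (X - supp_mu X \<rho> \<mu>)"
      using single s Ns by (intro emeasure_subadditive) auto
    finally have "emeasure \<mu> (mball x ?t) \<le> emeasure \<mu> {x}" using null by simp
    moreover have "0 < emeasure \<mu> (mball x ?t)" using x r s by (intro supp_pos) (auto simp: core_def)
    ultimately show "0 < emeasure \<mu> {x}" by (rule less_le_trans[rotated])
  qed
  have cs: "core \<in> sets \<mu>"
    by (rule sets.countable) (use single coreX fin in \<open>auto intro: countable_finite\<close>)
  have fs: "fin_ball \<in> sets \<mu>" by (intro open_sets fin_ball_open)
  have "fin_ball \<subseteq> core \<union> (X - supp_mu X \<rho> \<mu>)" by (auto simp: core_def fin_ball_def)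
  then have "emeasure \<mu> fin_ball \<le> emeasure \<mu> (core \<union> (X - supp_mu X \<rho> \<mu>))"
    using cs Ns by (intro emeasure_mono) auto
  also have "\<dots> \<le> emeasure \<mu> core + 0" using cs Ns null emeasure_subadditive[of core \<mu> "X - supp_mu X \<rho> \<mu>"] by simp
  also have "emeasure \<mu> core = (\<Sum>x\<in>core. emeasure \<mu> {x})"
    by (rule emeasure_eq_sum_singleton) (use fin coreX single in auto)
  also have "\<dots> < \<infinity>" using fin pt by simp
  finally obtain V where V: "emeasure \<mu> fin_ball = ennreal V" "0 \<le> V" by (cases "emeasure \<mu> fin_ball") auto
  define m where "m x = enn2real (emeasure \<mu> {x})" for x
  have m: "emeasure \<mu> {x} = ennreal (m x)" "0 < m x" if "x \<in> core" for x
    using pt[OF that] by (auto simp: m_def enn2real_positive_iff)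
  \<comment> \<open>By \<open>le_lp_lev\<close> the value of \<open>f\<close> at the atom
    \<open>x\<close> is at most \<open>2 / m x powr (1 / p)\<close> times the norm.\<close>
  define K where "K = (\<Sum>x\<in>core. 2 / m x powr (1 / p))"
  have K: "0 \<le> K" using m by (auto simp: K_def intro!: sum_nonneg)
  show ?thesis
  proof (subst maxc_bounded_iff)
    show "\<exists>C\<ge>0. \<forall>f\<in>borel_measurable \<mu>. dl p a \<mu> (\<lambda>x. ennreal \<bar>f x\<bar>) < \<infinity> \<longrightarrow>
       dl p b \<mu> (maxc X \<rho> \<mu> f) \<le> ennreal C * dl p a \<mu> (\<lambda>x. ennreal \<bar>f x\<bar>)"
    proof (intro exI[of _ "2 * V powr (1 / p) * K"] conjI ballI impI)
      fix f :: "'a \<Rightarrow> real" assume f[measurable]: "f \<in> borel_measurable \<mu>"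
      let ?F = "dl p a \<mu> (\<lambda>x. ennreal \<bar>f x\<bar>)"
      define H where "H = (\<Sum>x\<in>core. \<bar>f x\<bar>)"
      have H0: "0 \<le> H" by (auto simp: H_def intro: sum_nonneg)
      have fle: "\<bar>f x\<bar> \<le> H" if "x \<in> core" for x using that fin by (auto simp: H_def intro: member_le_sum)
      have fx: "ennreal \<bar>f x\<bar> \<le> ennreal (2 / m x powr (1 / p)) * ?F" if x: "x \<in> core" for x
      proof (cases "f x = 0")
        case False
        have "emeasure \<mu> {x} \<le> distr_fun \<mu> (\<lambda>x. ennreal \<bar>f x\<bar>) t" if "0 < t" "t < \<bar>f x\<bar>" for t
          unfolding distr_fun_def outer_mu_def
          using that x coreX space_mu by (intro INF_greatest emeasure_mono) (auto simp: ennreal_less_iff)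
        then have "ennreal \<bar>f x\<bar> * epowr (emeasure \<mu> {x}) (1 / p) \<le> 2 * ?F"
          unfolding dl_def using False p ab by (intro le_lp_lev) auto
        then have "ennreal (m x powr (1 / p)) * ennreal \<bar>f x\<bar> \<le> 2 * ?F"
          using m[OF x] by (simp add: mult.commute)
        then have "ennreal \<bar>f x\<bar> \<le> ennreal (1 / m x powr (1 / p)) * (2 * ?F)"
          using m[OF x] by (subst (asm) ennreal_pmult_le_iff) auto
        also have "\<dots> = ennreal (2 / m x powr (1 / p)) * ?F"
        proof -
          have "2 / m x powr (1 / p) = (1 / m x powr (1 / p)) * 2" by simp
          then show ?thesis by (simp only: ennreal_mult' mult.assoc divide_nonneg_nonneg powr_ge_zero zero_le_one) simp
        qed
        finally show ?thesis .
      qed simp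
      have "ennreal H = (\<Sum>x\<in>core. ennreal \<bar>f x\<bar>)" by (simp add: H_def sum_ennreal)
      also have "\<dots> \<le> (\<Sum>x\<in>core. ennreal (2 / m x powr (1 / p)) * ?F)" by (intro sum_mono fx)
      also have "\<dots> = ennreal K * ?F" using m by (simp add: K_def sum_distrib_right[symmetric] sum_ennreal)
      finally have H: "ennreal H \<le> ennreal K * ?F" .
      have Mle: "maxc X \<rho> \<mu> f x \<le> ennreal H * indicator fin_ball x" if x: "x \<in> X" for x
        unfolding maxc_def
      proof (intro SUP_least)
        fix s assume s: "s \<in> {s. 0 < s \<and> 0 < emeasure \<mu> (oball X \<rho> x s) \<and> emeasure \<mu> (oball X \<rho> x s) < \<infinity>}"
        let ?B = "oball X \<rho> x s"
        have [measurable]: "?B \<in> sets \<mu>" by (rule oball_sets[OF x])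
        have B: "?B \<subseteq> fin_ball" "x \<in> fin_ball"
          using s x fin_ballI[OF x, of s] by (auto simp: oball_eq)
        have "AE y in \<mu>. y \<notin> X - supp_mu X \<rho> \<mu>" using null Ns by (intro AE_not_in) (auto simp: null_sets_def)
        then have "AE y in \<mu>. ennreal \<bar>f y\<bar> * indicator ?B y \<le> ennreal H * indicator ?B y"
        proof (eventually_elim)
          case (elim y)
          show ?case
          proof (cases "y \<in> ?B")
            case True
            then have "y \<in> core" using B elim by (auto simp: core_def fin_ball_def)
            then show ?thesis using fle by (intro mult_right_mono ennreal_leI) auto
          qed simp
        qed
        then have "(\<integral>\<^sup>+ y \<in> ?B. ennreal \<bar>f y\<bar> \<partial>\<mu>) \<le> (\<integral>\<^sup>+ y. ennreal H * indicator ?B y \<partial>\<mu>)"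
          by (rule nn_integral_mono_AE)
        also have "\<dots> = ennreal H * emeasure \<mu> ?B" by (simp add: nn_integral_cmult_indicator)
        finally have "(\<integral>\<^sup>+ y \<in> ?B. ennreal \<bar>f y\<bar> \<partial>\<mu>) / emeasure \<mu> ?B \<le> ennreal H * emeasure \<mu> ?B / emeasure \<mu> ?B"
          by (rule divide_right_mono_ennreal)
        also have "\<dots> = ennreal H" using s by (intro mult_divide_eq_ennreal) auto
        finally show "(\<integral>\<^sup>+ y \<in> ?B. ennreal \<bar>f y\<bar> \<partial>\<mu>) / emeasure \<mu> ?B \<le> ennreal H * indicator fin_ball x"
          using B by simp
      qed
      have "dl p b \<mu> (maxc X \<rho> \<mu> f) \<le> ennreal (2 * H) * epowr (ennreal V) (1 / p)"
        unfolding dl_def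
      proof (intro lp_lev_indicator_le)
        fix k :: int
        show "distr_fun \<mu> (maxc X \<rho> \<mu> f) (2 powr real_of_int k) \<le> (if 2 powr real_of_int k < H then ennreal V else 0)"
        proof (cases "2 powr real_of_int k < H")
          case True
          have "{x \<in> space \<mu>. ennreal (2 powr real_of_int k) < maxc X \<rho> \<mu> f x} \<subseteq> fin_ball"
          proof
            fix x assume "x \<in> {x \<in> space \<mu>. ennreal (2 powr real_of_int k) < maxc X \<rho> \<mu> f x}"
            then have "ennreal (2 powr real_of_int k) < ennreal H * indicator fin_ball x"
              using Mle[of x] space_mu by (auto intro: less_le_trans)
            then show "x \<in> fin_ball" by (auto split: split_indicator_asm)
          qed
          then show ?thesis using True V outer_mu_mono[of _ fin_ball \<mu>] outer_mu_sets[OF fs] by (auto simp: distr_fun_def)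
        next
          case False
          have "\<not> ennreal (2 powr real_of_int k) < maxc X \<rho> \<mu> f x" if "x \<in> space \<mu>" for x
          proof -
            have "maxc X \<rho> \<mu> f x \<le> ennreal H" using Mle[of x] that space_mu by (auto split: split_indicator_asm intro: order_trans)
            also have "\<dots> \<le> ennreal (2 powr real_of_int k)" using False by (intro ennreal_leI) auto
            finally show ?thesis by simp
          qed
          then have "{x \<in> space \<mu>. ennreal (2 powr real_of_int k) < maxc X \<rho> \<mu> f x} = {}" by auto
          then have "distr_fun \<mu> (maxc X \<rho> \<mu> f) (2 powr real_of_int k) = outer_mu \<mu> {}"
            unfolding distr_fun_def by (simp only:)
          then show ?thesis using False outer_mu_sets[of "{}" \<mu>] by simp
        qed
      qed (use p ab H0 in auto)
      also have "\<dots> = ennreal (2 * V powr (1 / p)) * ennreal H"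
      proof -
        have "2 * H * V powr (1 / p) = 2 * V powr (1 / p) * H" by simp
        then show ?thesis using V H0 by (simp only: epowr_ennreal ennreal_mult'[symmetric] mult_nonneg_nonneg powr_ge_zero zero_le_numeral)
      qed
      also have "\<dots> \<le> ennreal (2 * V powr (1 / p)) * (ennreal K * ?F)" by (intro mult_left_mono H) simp
      also have "\<dots> = ennreal (2 * V powr (1 / p) * K) * ?F" using K by (simp add: ennreal_mult mult.assoc)
      finally show "dl p b \<mu> (maxc X \<rho> \<mu> f) \<le> ennreal (2 * V powr (1 / p) * K) * ?F" .
    qed (use K in simp)
  qed (use p ab in auto)
qed

text \<open>Sorting \<open>2\<^sup>N\<close> disjoint balls by measure and grouping them in dyadic blocks makes the
  measures of the groups at least double from one group to the next.\<close>

lemma doubling_open_sets: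
  assumes inf: "infinite core"
  obtains U V where "\<And>j. j < N \<Longrightarrow> openin mtopology (U j)" "\<And>j. j < N \<Longrightarrow> U j \<subseteq> fin_ball"
    "\<And>j. j < N \<Longrightarrow> emeasure \<mu> (U j) = ennreal (V j)" "\<And>j. j < N \<Longrightarrow> 0 < V j"
    "\<And>j. Suc j < N \<Longrightarrow> 2 * V j \<le> V (Suc j)" "disjoint_family_on U {..<N}"
proof -
  obtain F where F: "finite F" "card F = 2 ^ N" "F \<subseteq> core" using infinite_arbitrarily_large[OF inf] by blast
  have FX: "F \<subseteq> X" using F by (auto simp: core_def fin_ball_def)
  have "\<exists>t. 0 < t \<and> emeasure \<mu> (mball x t) < \<infinity>" if "x \<in> F" for x
  proof -
    have "x \<in> X" "x \<in> fin_ball" using that F FX by (auto simp: core_def)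
    then show ?thesis by (auto simp: fin_ball_def oball_eq)
  qed
  then have "\<exists>r. \<forall>x\<in>F. 0 < r x \<and> emeasure \<mu> (mball x (r x)) < \<infinity>" by (intro bchoice) blast
  then obtain r where r: "\<And>x. x \<in> F \<Longrightarrow> 0 < r x" "\<And>x. x \<in> F \<Longrightarrow> emeasure \<mu> (mball x (r x)) < \<infinity>" by blast
  \<comment> \<open>Half the mutual distances keep the balls of radius \<open>s\<close> disjoint,
    the radii \<open>r x\<close> keep their measures finite, and 1 makes the set nonempty.\<close>
  define R where "R = insert 1 (r ` F \<union> (\<lambda>(x, y). \<rho> x y / 2) ` {z \<in> F \<times> F. fst z \<noteq> snd z})"
  define s where "s = Min R"
  have finR: "finite R" using F by (simp add: R_def)
  have rho_pos: "0 < \<rho> x y" if "x \<in> F" "y \<in> F" "x \<noteq> y" for x y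
  proof -
    have "x \<in> X" "y \<in> X" using that FX by auto
    then show ?thesis using that(3) zero[of x y] nonneg[of x y] by (auto simp: less_le)
  qed
  have s0: "0 < s" unfolding s_def using finR r rho_pos by (subst Min_gr_iff) (auto simp: R_def)
  have sr: "s \<le> r x" if "x \<in> F" for x unfolding s_def using finR that by (intro Min_le) (auto simp: R_def)
  have sd: "s + s \<le> \<rho> x y" if "x \<in> F" "y \<in> F" "x \<noteq> y" for x y
  proof -
    have "s \<le> \<rho> x y / 2" unfolding s_def using finR that by (intro Min_le) (force simp: R_def)+
    then show ?thesis by simp
  qed
  define v where "v x = enn2real (emeasure \<mu> (mball x s))" for x
  have v: "emeasure \<mu> (mball x s) = ennreal (v x)" "0 < v x" if x: "x \<in> F" for x
  proof -
    have "emeasure \<mu> (mball x s) \<le> emeasure \<mu> (mball x (r x))" by (intro emeasure_mball_le sr x)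
    then have fin: "emeasure \<mu> (mball x s) < top" using r(2)[OF x] by simp
    moreover have "0 < emeasure \<mu> (mball x s)" using x F s0 by (intro supp_pos) (auto simp: core_def)
    ultimately show "emeasure \<mu> (mball x s) = ennreal (v x)" "0 < v x" by (auto simp: v_def enn2real_positive_iff)
  qed
  obtain l where l: "set l = F" "distinct l" using finite_distinct_list[OF F(1)] by blast
  define xs where "xs = sort_key v l"
  have xs: "set xs = F" "distinct xs" "sorted (map v xs)" using l by (auto simp: xs_def)
  have len: "length xs = 2 ^ N" using distinct_card[OF xs(2)] xs F by simp
  \<comment> \<open>Blocks of length \<open>2^j\<close>; index 0 is left out, and the blocks with
    \<open>j < N\<close> stay below \<open>2^N\<close>.\<close>
  define I where "I j = {2 ^ j ..< 2 ^ Suc j :: nat}" for j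
  have I: "i < 2 ^ N" if "i \<in> I j" "j < N" for i j
  proof -
    have "i < 2 ^ Suc j" using that by (simp add: I_def)
    also have "(2::nat) ^ Suc j \<le> 2 ^ N" using that by (intro power_increasing) auto
    finally show ?thesis .
  qed
  have Iuniq: "j = j'" if "i \<in> I j" "i \<in> I j'" for i j j'
  proof -
    have i: "2 ^ j \<le> i" "i < 2 ^ Suc j" "2 ^ j' \<le> i" "i < 2 ^ Suc j'"
      using that unfolding I_def by (auto simp del: power_Suc)
    have "j < Suc j'" by (rule power_less_imp_less_exp[OF _ le_less_trans[OF i(1,4)]]) simp
    moreover have "j' < Suc j" by (rule power_less_imp_less_exp[OF _ le_less_trans[OF i(3,2)]]) simp
    ultimately show ?thesis by simp
  qed
  have inF: "xs ! i \<in> F" if "i < 2 ^ N" for i using that len xs by (metis nth_mem)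
  define B where "B i = mball (xs ! i) s" for i
  have disjB: "B i \<inter> B i' = {}" if "i < 2 ^ N" "i' < 2 ^ N" "i \<noteq> i'" for i i'
  proof -
    have "xs ! i \<noteq> xs ! i'" using that len xs by (simp add: nth_eq_iff_index_eq)
    then have "disjnt (B i) (B i')" unfolding B_def using that inF by (intro disjoint_mball sd) auto
    then show ?thesis by (simp add: disjnt_def)
  qed
  have Bs: "B i \<in> sets \<mu>" for i by (auto simp: B_def intro: open_sets)
  define U where "U j = (\<Union>i\<in>I j. B i)" for j
  define V where "V j = (\<Sum>i\<in>I j. v (xs ! i))" for j
  show ?thesis
  proof (rule that[of U V])
    fix j assume j: "j < N"
    show "openin mtopology (U j)" by (auto simp: U_def B_def)
    show "U j \<subseteq> fin_ball"
    proof -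
      have "B i \<subseteq> fin_ball" if "i \<in> I j" for i
        unfolding B_def using inF[OF I[OF that j]] FX v by (intro fin_ballI) auto
      then show ?thesis by (auto simp: U_def)
    qed
    have "disjoint_family_on B (I j)" unfolding disjoint_family_on_def by (intro ballI impI disjB I[OF _ j])
    then have "emeasure \<mu> (U j) = (\<Sum>i\<in>I j. emeasure \<mu> (B i))" unfolding U_def
      using Bs by (intro sum_emeasure[symmetric]) (auto simp: I_def)
    also have "\<dots> = (\<Sum>i\<in>I j. ennreal (v (xs ! i)))"
      using I[OF _ j] inF v by (intro sum.cong) (auto simp: B_def)
    also have "\<dots> = ennreal (V j)"
      unfolding V_def using I[OF _ j] inF v by (intro sum_ennreal) (auto intro: less_imp_le)
    finally show "emeasure \<mu> (U j) = ennreal (V j)" .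
    show "0 < V j" unfolding V_def using I[OF _ j] inF v by (intro sum_pos) (auto simp: I_def)
  next
    fix j assume j: "Suc j < N"
    have "2 ^ Suc j < (2::nat) ^ N" using j by (intro power_strict_increasing) auto
    \<comment> \<open>The measure at the first index of the next block separates the two blocks:
      those in block \<open>j\<close> are at most \<open>w\<close>, those in block
      \<open>Suc j\<close> at least \<open>w\<close>, and the latter block is twice as long.\<close>
    define w where "w = v (xs ! (2 ^ Suc j))"
    have mono: "v (xs ! i) \<le> v (xs ! i')" if "i \<le> i'" "i' < 2 ^ N" for i i'
      using sorted_nth_mono[OF xs(3), of i i'] that len by simp
    have "V j \<le> (\<Sum>i\<in>I j. w)" unfolding V_def w_def
      using \<open>2 ^ Suc j < 2 ^ N\<close> by (intro sum_mono mono) (auto simp: I_def)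
    also have "\<dots> = 2 ^ j * w" by (simp add: I_def)
    finally have 1: "V j \<le> 2 ^ j * w" .
    have "2 ^ Suc j * w = (\<Sum>i\<in>I (Suc j). w)" by (simp add: I_def)
    also have "\<dots> \<le> V (Suc j)" unfolding V_def w_def
      using I[OF _ j] by (intro sum_mono mono) (auto simp: I_def)
    finally show "2 * V j \<le> V (Suc j)" using 1 by simp
  next
    show "disjoint_family_on U {..<N}"
    proof (unfold disjoint_family_on_def, intro ballI impI)
      fix j j' assume j: "j \<in> {..<N}" "j' \<in> {..<N}" "j \<noteq> j'"
      have "B i \<inter> B i' = {}" if "i \<in> I j" "i' \<in> I j'" for i i'
        using that j Iuniq I by (intro disjB) auto
      then show "U j \<inter> U j' = {}" unfolding U_def by blast
    qed
  qed
qed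

text \<open>The test function has \<open>N\<close> lacunary pieces, each of norm of order 1. Its own
  norm is at most of order \<open>N powr a\<close>, while the maximal function dominates each piece
  almost everywhere and has norm at least of order \<open>N powr b\<close>; with \<open>N\<close>
  free this forces \<open>b \<le> a\<close>.\<close>

lemma core_infinite_le:
  assumes p: "1 < p" and null: "emeasure \<mu> (X - supp_mu X \<rho> \<mu>) = 0" and inf: "infinite core"
    and ab: "0 \<le> a" "a \<le> 1" "0 \<le> b" "b \<le> 1" and bdd: "maxc_bounded X \<rho> \<mu> p a b"
  shows "b \<le> a"
proof (rule ccontr)
  assume "\<not> b \<le> a"
  then have less: "a < b" by simp
  obtain C where C0: "0 \<le> C" and C: "\<And>f. f \<in> borel_measurable \<mu> \<Longrightarrow> dl p a \<mu> (\<lambda>x. ennreal \<bar>f x\<bar>) < \<infinity> \<Longrightarrow>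
     dl p b \<mu> (maxc X \<rho> \<mu> f) \<le> ennreal C * dl p a \<mu> (\<lambda>x. ennreal \<bar>f x\<bar>)"
    using bdd ab p by (subst (asm) maxc_bounded_iff) auto
  define L where "L = lac_const p b"
  have L: "0 \<le> L" by (simp add: L_def lac_const_nonneg)
  have Ns: "X - supp_mu X \<rho> \<mu> \<in> sets \<mu>" by (intro open_sets supp_compl_open)
  have main: "real N powr b \<le> 8 * L * C * real N powr a" if N: "0 < N" for N :: nat
  proof -
    obtain U V where U: "\<And>j. j < N \<Longrightarrow> openin mtopology (U j)" "\<And>j. j < N \<Longrightarrow> U j \<subseteq> fin_ball"
      and V: "\<And>j. j < N \<Longrightarrow> emeasure \<mu> (U j) = ennreal (V j)" "\<And>j. j < N \<Longrightarrow> 0 < V j"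
      and dbl: "\<And>j. Suc j < N \<Longrightarrow> 2 * V j \<le> V (Suc j)" and disj: "disjoint_family_on U {..<N}"
      using doubling_open_sets[OF inf] by metis
    have Us[measurable]: "U j \<in> sets \<mu>" if "j < N" for j using U open_sets that by blast
    have V2: "2 ^ (m - m') * V m' \<le> V m" if "m' \<le> m" "m < N" for m m'
      using that
    proof (induction m rule: dec_induct)
      case (step n)
      have "2 ^ (Suc n - m') * V m' = 2 * (2 ^ (n - m') * V m')" using step by (simp add: Suc_diff_le)
      also have "\<dots> \<le> 2 * V n" using step by simp
      also have "\<dots> \<le> V (Suc n)" using step by (intro dbl) simp
      finally show ?case .
    qed simp
    define c where "c j = V j powr (- (1 / p))" for j
    have c: "0 < c j" if "j < N" for j using V(2)[OF that] by (simp add: c_def)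
    define f where "f x = (\<Sum>j<N. c j * indicator (U j) x)" for x
    have [measurable]: "f \<in> borel_measurable \<mu>" unfolding f_def using Us by measurable
    have fU: "f x = c j" if "j < N" "x \<in> U j" for x j
    proof -
      have "c i * indicator (U i) x = (if i = j then c i else 0)" if "i < N" for i
        using disj \<open>j < N\<close> \<open>x \<in> U j\<close> that by (auto simp: disjoint_family_on_def indicator_def)
      then have "f x = (\<Sum>i<N. if i = j then c i else 0)" unfolding f_def by (intro sum.cong) auto
      then show ?thesis using \<open>j < N\<close> by simp
    qed
    have f0: "f x = 0" if "\<And>j. j < N \<Longrightarrow> x \<notin> U j" for x using that by (auto simp: f_def)
    let ?D = "distr_fun \<mu> (\<lambda>x. ennreal \<bar>f x\<bar>)"
    define D' where "D' j t = (if j < N \<and> t < c j then ennreal (V j) else 0)" for j t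
    have level: "{x \<in> space \<mu>. ennreal t < ennreal \<bar>f x\<bar>} = (\<Union>j\<in>{j. j < N \<and> t < c j}. U j)" if t: "0 < t" for t
    proof safe
      fix x assume x: "x \<in> space \<mu>" "ennreal t < ennreal \<bar>f x\<bar>"
      then have tx: "t < \<bar>f x\<bar>" using t by (simp add: ennreal_less_iff)
      then obtain j where j: "j < N" "x \<in> U j" using f0[of x] t by fastforce
      then show "x \<in> (\<Union>j\<in>{j. j < N \<and> t < c j}. U j)" using fU[OF j] c[OF j(1)] tx by auto
    next
      fix x j assume j: "j < N" "t < c j" "x \<in> U j"
      then show "x \<in> space \<mu>" using U(2) space_mu by (auto simp: fin_ball_def)
      show "ennreal t < ennreal \<bar>f x\<bar>" using j fU[OF j(1,3)] t by (simp add: ennreal_less_iff)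
    qed
    have D: "?D t = (\<Sum>j. D' j t)" if t: "0 < t" for t
    proof -
      have "?D t = emeasure \<mu> (\<Union>j\<in>{j. j < N \<and> t < c j}. U j)"
        unfolding distr_fun_def level[OF t] by (intro outer_mu_sets sets.finite_UN) auto
      also have "\<dots> = (\<Sum>j\<in>{j. j < N \<and> t < c j}. emeasure \<mu> (U j))"
        using disj by (intro sum_emeasure[symmetric]) (auto simp: disjoint_family_on_def)
      also have "\<dots> = (\<Sum>j<N. D' j t)"
        using V by (intro sum.mono_neutral_cong_left) (auto simp: D'_def)
      also have "\<dots> = (\<Sum>j. D' j t)" by (intro suminf_finite[symmetric]) (auto simp: D'_def)
      finally show ?thesis .
    qed
    have lac: "lacunary D'"
      unfolding lacunary_def
    proof (intro allI impI)
      fix t :: real and m m' :: nat assume h: "0 < t" "m' < m" "0 < D' m t"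
      then have m: "m < N" "t < c m" by (auto simp: D'_def split: if_splits)
      have "D' m' t \<le> ennreal (V m')" by (auto simp: D'_def)
      then have "2 ^ (m - m') * D' m' t \<le> 2 ^ (m - m') * ennreal (V m')" by (rule mult_left_mono) simp
      also have "\<dots> = ennreal (2 ^ (m - m') * V m')"
        using V(2)[of m'] h m by (simp add: ennreal_mult ennreal_power[symmetric])
      also have "\<dots> \<le> ennreal (V m)" using V2[of m' m] h m by (intro ennreal_leI) auto
      finally show "2 ^ (m - m') * D' m' t \<le> D' m t" using m by (simp add: D'_def)
    qed
    have cV: "c j * V j powr (1 / p) = 1" if "j < N" for j
      using V(2)[OF that] by (simp add: c_def powr_add[symmetric])
    have up: "lp a (lev p (D' j)) \<le> 2 * indicator {..<N} j" for j
    proof (cases "j < N")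
      case True
      have "lp a (lev p (D' j)) \<le> ennreal (2 * c j) * epowr (ennreal (V j)) (1 / p)"
        using p ab c[OF True] by (intro lp_lev_indicator_le) (auto simp: D'_def)
      also have "\<dots> = ennreal (2 * (c j * V j powr (1 / p)))"
        using V(2)[OF True] c[OF True] by (simp add: ennreal_mult[symmetric] mult.assoc)
      also have "\<dots> = 2" unfolding cV[OF True] by simp
      finally show ?thesis using True by simp
    next
      case False
      then have "lev p (D' j) = (\<lambda>k. 0)" by (auto simp: lev_def D'_def)
      then show ?thesis by simp
    qed
    have lo: "ennreal (1 / 2) \<le> lp b (lev p (D' j))" if j: "j < N" for j
    proof -
      have "ennreal (c j) * epowr (ennreal (V j)) (1 / p) \<le> 2 * lp b (lev p (D' j))"
        using p ab c[OF j] j by (intro le_lp_lev) (auto simp: D'_def)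
      also have "ennreal (c j) * epowr (ennreal (V j)) (1 / p) = ennreal (c j * V j powr (1 / p))"
        using V(2)[OF j] c[OF j] by (simp add: ennreal_mult)
      finally have "1 \<le> ennreal 2 * lp b (lev p (D' j))" unfolding cV[OF j] by simp
      then have "ennreal (1 / 2) * 1 \<le> ennreal (1 / 2) * (ennreal 2 * lp b (lev p (D' j)))" by (rule mult_left_mono) simp
      also have "\<dots> = ennreal (2 / 2) * lp b (lev p (D' j))" by (rule half_mult)
      finally show ?thesis by (simp only: mult_1_right) simp
    qed
    have "dl p a \<mu> (\<lambda>x. ennreal \<bar>f x\<bar>) \<le> 2 * lp a (\<lambda>j. lp a (lev p (D' j)))"
      unfolding dl_def using p ab lac D by (intro lacunary_upper) auto
    also have "\<dots> \<le> 2 * lp a (\<lambda>j. 2 * indicator {..<N} j)" using ab by (intro mult_left_mono lp_mono up) auto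
    also have "\<dots> \<le> 2 * (ennreal (real (card {..<N}) powr a) * 2)" using ab by (intro mult_left_mono lp_const_le) auto
    also have "\<dots> = ennreal (4 * real N powr a)"
    proof -
      have "2 * (z * 2) = 4 * (z::ennreal)" for z by (simp add: mult.left_commute[of 2 z] mult.commute[of z])
      then show ?thesis by (simp add: ennreal_mult)
    qed
    finally have fa: "dl p a \<mu> (\<lambda>x. ennreal \<bar>f x\<bar>) \<le> ennreal (4 * real N powr a)" .
    have Mf: "D' m t \<le> distr_fun \<mu> (maxc X \<rho> \<mu> f) t" if t: "0 < t" for m t
    proof (cases "m < N \<and> t < c m")
      case True
      \<comment> \<open>Points of \<open>U m\<close> outside the support are removed, as
        \<open>maxc_ge\<close> speaks of points of \<open>core\<close>; they form a null
        set.\<close>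
      let ?S = "U m \<inter> (space \<mu> - (X - supp_mu X \<rho> \<mu>))"
      have "?S \<subseteq> {x \<in> space \<mu>. ennreal t < maxc X \<rho> \<mu> f x}"
      proof
        fix x assume x: "x \<in> ?S"
        then have "x \<in> core" using U(2)[of m] True space_mu by (auto simp: core_def)
        then have "ennreal (c m) \<le> maxc X \<rho> \<mu> f x"
          using x True U(1) fU by (intro maxc_ge[of x "U m"]) auto
        moreover have "ennreal t < ennreal (c m)" using True t by (simp add: ennreal_less_iff)
        ultimately show "x \<in> {x \<in> space \<mu>. ennreal t < maxc X \<rho> \<mu> f x}" using x by auto
      qed
      then have "outer_mu \<mu> ?S \<le> distr_fun \<mu> (maxc X \<rho> \<mu> f) t" unfolding distr_fun_def by (rule outer_mu_mono)
      moreover have "outer_mu \<mu> ?S = emeasure \<mu> ?S" using True Ns by (intro outer_mu_sets) auto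
      moreover have "emeasure \<mu> (U m) \<le> emeasure \<mu> (?S \<union> (X - supp_mu X \<rho> \<mu>))"
        using True Ns U(2)[of m] space_mu by (intro emeasure_mono) (auto simp: fin_ball_def)
      moreover have "emeasure \<mu> (?S \<union> (X - supp_mu X \<rho> \<mu>)) \<le> emeasure \<mu> ?S + emeasure \<mu> (X - supp_mu X \<rho> \<mu>)"
        using True Ns by (intro emeasure_subadditive) auto
      ultimately have "emeasure \<mu> (U m) \<le> distr_fun \<mu> (maxc X \<rho> \<mu> f) t" using null by auto
      then show ?thesis using True V by (simp add: D'_def)
    qed (auto simp: D'_def)
    have "ennreal (real (card {..<N}) powr b) * ennreal (1 / 2) \<le> lp b (\<lambda>j. lp b (lev p (D' j)))"
      using ab N by (intro const_le_lp lo) auto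
    also have "\<dots> \<le> ennreal L * dl p b \<mu> (maxc X \<rho> \<mu> f)"
      unfolding dl_def L_def using p ab lac Mf by (intro lacunary_lower) auto
    also have "\<dots> \<le> ennreal L * (ennreal C * ennreal (4 * real N powr a))"
    proof -
      have "dl p a \<mu> (\<lambda>x. ennreal \<bar>f x\<bar>) < \<infinity>" using fa by (rule le_less_trans) simp
      then have "dl p b \<mu> (maxc X \<rho> \<mu> f) \<le> ennreal C * dl p a \<mu> (\<lambda>x. ennreal \<bar>f x\<bar>)" by (intro C) auto
      also have "\<dots> \<le> ennreal C * ennreal (4 * real N powr a)" by (intro mult_left_mono fa) simp
      finally show ?thesis by (rule mult_left_mono) simp
    qed
    also have "\<dots> = ennreal (L * (C * (4 * real N powr a)))" using L C0 by (simp add: ennreal_mult)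
    also have "ennreal (real (card {..<N}) powr b) * ennreal (1 / 2) = ennreal (real N powr b * (1/2))"
      by (rule ennreal_mult'[symmetric, THEN trans]) auto
    finally have "real N powr b * (1/2) \<le> L * (C * (4 * real N powr a))"
      using L C0 by (subst (asm) ennreal_le_iff) auto
    then show ?thesis by simp
  qed
  define K where "K = 8 * L * C + 1"
  have K: "0 < K" using L C0 by (simp add: K_def add_nonneg_pos)
  \<comment> \<open>Large enough that \<open>N powr (b - a)\<close> is at least \<open>K\<close>,
    which exceeds \<open>8 * L * C\<close>.\<close>
  define N where "N = Suc (nat \<lceil>K powr (1 / (b - a))\<rceil>)"
  have N: "0 < N" "K powr (1 / (b - a)) \<le> real N" unfolding N_def using of_nat_ceiling[of "K powr (1 / (b - a))"] by (simp, linarith)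
  have "real N powr b \<le> 8 * L * C * real N powr a" by (rule main[OF N(1)])
  then have "real N powr (b - a) \<le> 8 * L * C" using N(1) by (simp add: powr_diff divide_le_eq)
  moreover have "K = (K powr (1 / (b - a))) powr (b - a)" using K less by (simp add: powr_powr)
  moreover have "\<dots> \<le> real N powr (b - a)" using N less by (intro powr_mono2) auto
  ultimately show False by (simp add: K_def)
qed

end

subsection \<open>Boundaries of convex regions below the diagonal\<close>

lemma sq_boundary_eq:
  assumes "S \<subseteq> {0..1} \<times> {0..1}"
  shows "sq_boundary S = ({0..1} \<times> {0..1}) \<inter> closure S \<inter> closure ({0..1} \<times> {0..1} - S)"
proof -
  have "({0..1} \<times> {0..1}) \<inter> S = S" using assms by auto
  moreover have "({0..1} \<times> {0..1}) \<inter> ({0..1} \<times> {0..1} - S) = {0..1} \<times> {0..1} - S" by auto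
  ultimately show ?thesis
    unfolding sq_boundary_def frontier_of_closures closure_of_subtopology
    by (simp add: Int_ac Int_left_absorb)
qed

lemma closure_pairI:
  fixes S :: "(real \<times> real) set"
  assumes "\<And>e. 0 < e \<Longrightarrow> \<exists>x y. (x, y) \<in> S \<and> \<bar>x - u\<bar> < e \<and> \<bar>y - b\<bar> < e"
  shows "(u, b) \<in> closure S"
  unfolding closure_approachable
proof (intro allI impI)
  fix e :: real assume "0 < e"
  then obtain x y where xy: "(x, y) \<in> S" "\<bar>x - u\<bar> < e / 2" "\<bar>y - b\<bar> < e / 2" using assms[of "e / 2"] by auto
  have "dist (x, y) (u, b) \<le> \<bar>x - u\<bar> + \<bar>y - b\<bar>"
    unfolding dist_Pair_Pair dist_real_def using sqrt_sum_squares_le_sum_abs[of "\<bar>x - u\<bar>" "\<bar>y - b\<bar>"] by simp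
  then have "dist (x, y) (u, b) < e" using xy by linarith
  then show "\<exists>z\<in>S. dist z (u, b) < e" using xy by blast
qed

lemma not_closure_pairI:
  fixes S :: "(real \<times> real) set"
  assumes "open W" "(u, b) \<in> W" "W \<inter> S = {}"
  shows "(u, b) \<notin> closure S"
  using assms by (meson disjoint_iff open_Int_closure_eq_empty)

text \<open>Over \<open>u > \<delta>\<close> the region fills each section up to its supremum
  \<open>G u\<close>, except perhaps for the end point, which the boundary does not see. Segments
  are assumed only for pairs increasing in both coordinates, the form in which interpolation
  supplies them. \<open>diag\<close> gives \<open>F u \<le> u\<close> and the exterior points at the
  corners.\<close>

lemma convex_region_boundary:
  fixes S :: "(real \<times> real) set"
  assumes sub: "S \<subseteq> {0..1} \<times> {0..1}" and ne: "S \<noteq> {}"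
    and mono: "\<And>a b a' b'. (a, b) \<in> S \<Longrightarrow> a \<le> a' \<Longrightarrow> a' \<le> 1 \<Longrightarrow> 0 \<le> b' \<Longrightarrow> b' \<le> b \<Longrightarrow> (a', b') \<in> S"
    and diag: "\<And>a b. (a, b) \<in> S \<Longrightarrow> b \<le> a"
    and cvx0: "\<And>a0 b0 a1 b1 \<theta>. (a0, b0) \<in> S \<Longrightarrow> (a1, b1) \<in> S \<Longrightarrow> a0 < a1 \<Longrightarrow> b0 < b1 \<Longrightarrow> 0 < \<theta> \<Longrightarrow> \<theta> < 1 \<Longrightarrow>
       (a0 + \<theta> * (a1 - a0), b0 + \<theta> * (b1 - b0)) \<in> S"
  shows "\<exists>\<delta> F. admissible \<delta> F \<and> sq_boundary S = {\<delta>} \<times> {0..edge_lim \<delta> F} \<union> {(u, F u) | u. u \<in> {\<delta><..1}}"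
proof -
  have S01: "0 \<le> a" "a \<le> 1" "0 \<le> b" "b \<le> 1" if "(a, b) \<in> S" for a b using sub that by auto
  \<comment> \<open>The pairs that \<open>cvx0\<close> omits follow from monotonicity: for
    \<open>b1 \<le> b0\<close> the segment runs to the right of \<open>a0\<close> and not above
    \<open>b0\<close>, and for \<open>a0 = a1\<close> it is vertical and lies under
    \<open>b1\<close>.\<close>
  have cvx: "((1 - t) * a0 + t * a1, (1 - t) * b0 + t * b1) \<in> S"
    if s: "(a0, b0) \<in> S" "(a1, b1) \<in> S" "a0 \<le> a1" "0 \<le> t" "t \<le> 1" for a0 b0 a1 b1 t
  proof -
    have 1: "(1 - t) * a0 + t * a1 = a0 + t * (a1 - a0)" "(1 - t) * b0 + t * b1 = b0 + t * (b1 - b0)"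
      by (simp_all add: algebra_simps)
    have ge: "a0 \<le> a0 + t * (a1 - a0)" using s by simp
    have le: "a0 + t * (a1 - a0) \<le> a0 + 1 * (a1 - a0)" using s by (intro add_left_mono mult_right_mono) auto
    have le1: "a0 + t * (a1 - a0) \<le> 1" using le S01[OF s(2)] by simp
    have nn: "0 \<le> (1 - t) * b0 + t * b1" using s S01 by (intro add_nonneg_nonneg mult_nonneg_nonneg) auto
    consider "t = 0" | "t = 1" | "b1 \<le> b0" | "a0 = a1" "b0 < b1" | "a0 < a1" "b0 < b1" "0 < t" "t < 1" using s by linarith
    then show ?thesis
    proof cases
      case 3
      have "b0 + t * (b1 - b0) \<le> b0" using 3 s by (simp add: mult_nonneg_nonpos)
      then show ?thesis using mono[OF s(1) ge le1, of "(1 - t) * b0 + t * b1"] nn unfolding 1 by simp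
    next
      case 4
      have "b0 + t * (b1 - b0) \<le> b0 + 1 * (b1 - b0)" using 4 s by (intro add_left_mono mult_right_mono) auto
      then show ?thesis using mono[OF s(2), of a1 "(1 - t) * b0 + t * b1"] S01[OF s(2)] nn 4 unfolding 1 by simp
    next
      case 5
      then show ?thesis unfolding 1 using s by (intro cvx0) auto
    qed (use s in auto)
  qed
  define A where "A = {a. \<exists>b. (a, b) \<in> S}"
  define \<delta> where "\<delta> = Inf A"
  define G where "G u = Sup {b. (u, b) \<in> S}" for u
  have Ane: "A \<noteq> {}" using ne by (auto simp: A_def)
  have A01: "0 \<le> x" "x \<le> 1" if "x \<in> A" for x using that S01 by (auto simp: A_def)
  have bddA: "bdd_below A" using A01 by (intro bdd_belowI[of _ 0])
  have \<delta>le: "\<delta> \<le> a" if "(a, b) \<in> S" for a b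
    unfolding \<delta>_def using that bddA by (intro cInf_lower) (auto simp: A_def)
  have \<delta>0: "0 \<le> \<delta>" unfolding \<delta>_def using Ane A01 by (intro cInf_greatest) auto
  have \<delta>1: "\<delta> \<le> 1" using Ane \<delta>le A01 by (auto simp: A_def) (meson order_trans)
  have ex: "\<exists>a<u. (a, 0) \<in> S" if u: "\<delta> < u" for u
  proof -
    obtain a where "a \<in> A" "a < u" using u cInf_lessD[OF Ane] by (auto simp: \<delta>_def)
    then show ?thesis using mono S01 unfolding A_def by blast
  qed
  have one: "(1, 0) \<in> S" using ne mono S01 by (metis order_refl equals0I surj_pair)
  have u0: "(u, 0) \<in> S" if "\<delta> < u" "u \<le> 1" for u
    using ex[OF that(1)] mono that by (meson less_imp_le order_refl)
  \<comment> \<open>The abscissas whose section is known to be nonempty: those above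
    \<open>\<delta>\<close>, and 1 itself, which matters when \<open>\<delta> = 1\<close>.\<close>
  define ok where "ok u \<longleftrightarrow> (\<delta> < u \<and> u \<le> 1) \<or> u = 1" for u
  have ok0: "(u, 0) \<in> S" if "ok u" for u using that u0 one by (auto simp: ok_def)
  have bddG: "bdd_above {b. (u, b) \<in> S}" for u using S01 by (intro bdd_aboveI[of _ 1]) auto
  have Gub: "b \<le> G u" if "(u, b) \<in> S" for u b unfolding G_def using that bddG by (intro cSup_upper) auto
  have Gin: "(u, b) \<in> S" if "ok u" "0 \<le> b" "b < G u" for u b
  proof -
    have "\<exists>b'\<in>{b. (u, b) \<in> S}. b < b'" using that ok0 bddG
      by (intro less_cSupD) (auto simp: G_def)
    then show ?thesis using mono that by (auto simp: ok_def intro: less_imp_le)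
  qed
  have G0: "0 \<le> G u" if "ok u" for u using Gub ok0 that by blast
  have Gle: "G u \<le> u" if "ok u" for u unfolding G_def using ok0[OF that] diag by (intro cSup_least) auto
  have Gmono: "G u \<le> G v" if "ok u" "u \<le> v" "v \<le> 1" for u v
    unfolding G_def[of u]
  proof (rule cSup_least)
    show "{b. (u, b) \<in> S} \<noteq> {}" using ok0[OF that(1)] by auto
    fix b assume "b \<in> {b. (u, b) \<in> S}"
    then have b: "(u, b) \<in> S" by simp
    then show "b \<le> G v" using mono[OF b that(2,3), of b] S01[OF b] by (intro Gub) simp
  qed
  have okmono: "ok v" if "ok u" "u \<le> v" "v \<le> 1" for u v using that by (auto simp: ok_def)
  have Gapprox: "\<exists>b. (u, b) \<in> S \<and> G u - e < b" if "ok u" "0 < e" for u e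
  proof -
    have "\<exists>b\<in>{b. (u, b) \<in> S}. G u - e < b" using that ok0 bddG by (intro less_cSupD) (auto simp: G_def)
    then show ?thesis by auto
  qed
  have Gconc: "(1 - t) * G u + t * G v \<le> G ((1 - t) * u + t * v)"
    if uv: "ok u" "ok v" "u \<le> v" "0 \<le> t" "t \<le> 1" for u v t
  proof (rule field_le_epsilon)
    fix e :: real assume e: "0 < e"
    obtain b where b: "(u, b) \<in> S" "G u - e < b" using Gapprox uv e by blast
    obtain c where c: "(v, c) \<in> S" "G v - e < c" using Gapprox uv e by blast
    have "(1 - t) * (G u - e) + t * (G v - e) \<le> (1 - t) * b + t * c"
      using uv b c by (intro add_mono mult_left_mono) auto
    also have "\<dots> \<le> G ((1 - t) * u + t * v)" using cvx[OF b(1) c(1)] uv by (intro Gub) auto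
    finally show "(1 - t) * G u + t * G v \<le> G ((1 - t) * u + t * v) + e" by (simp add: algebra_simps)
  qed
  \<comment> \<open>At \<open>\<delta> < 1\<close> the value is the right limit of \<open>G\<close>,
    written as an infimum because \<open>G\<close> is nondecreasing. The section over
    \<open>\<delta>\<close> itself may be empty or lower, which the closure does not see.\<close>
  define F where "F u = (if \<delta> < u \<or> \<delta> = 1 then G u else Inf (G ` {\<delta><..1}))" for u
  have FG: "F u = G u" if "ok u" for u using that \<delta>1 by (auto simp: F_def ok_def)
  have okI: "ok u" if "\<delta> < u" "u \<le> 1" for u using that by (simp add: ok_def)
  have bddI: "bdd_below (G ` {\<delta><..1})" using G0 okI by (intro bdd_belowI[of _ 0]) auto
  have F\<delta>le: "F \<delta> \<le> G u" if "\<delta> < u" "u \<le> 1" for u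
    using that bddI by (auto simp: F_def intro!: cInf_lower)
  have F\<delta>ge: "x \<le> F \<delta>" if "\<And>u. \<delta> < u \<Longrightarrow> u \<le> 1 \<Longrightarrow> x \<le> G u" "\<delta> < 1" for x
    using that by (auto simp: F_def intro!: cInf_greatest)
  have F\<delta>less: "\<exists>u. \<delta> < u \<and> u \<le> 1 \<and> G u < x" if "F \<delta> < x" "\<delta> < 1" for x
  proof (rule ccontr)
    assume "\<not> ?thesis"
    then have "x \<le> F \<delta>" using that by (intro F\<delta>ge) (auto simp: not_less)
    then show False using that by simp
  qed
  have F\<delta>0: "0 \<le> F \<delta>"
  proof (cases "\<delta> = 1")
    case True then show ?thesis using FG[of 1] G0[of 1] by (simp add: ok_def)
  next
    case False then show ?thesis using G0 okI \<delta>1 by (intro F\<delta>ge) auto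
  qed
  have F0: "0 \<le> F u" if "\<delta> \<le> u" "u \<le> 1" for u
    using that F\<delta>0 G0 FG okI by (cases "u = \<delta>") auto
  have Fle: "F u \<le> u" if "\<delta> \<le> u" "u \<le> 1" for u
  proof (cases "u = \<delta> \<and> \<delta> \<noteq> 1")
    case True
    have "F \<delta> \<le> \<delta>"
    proof (rule dense_ge_bounded[of \<delta> 1])
      show "\<delta> < 1" using True \<delta>1 by simp
      fix w assume "\<delta> < w" "w < 1"
      then show "F \<delta> \<le> w" using F\<delta>le[of w] Gle[of w] okI by fastforce
    qed
    then show ?thesis using True by simp
  next
    case False
    then have "ok u" using that by (auto simp: ok_def)
    then show ?thesis using Gle FG by simp
  qed
  have Fmono: "F u \<le> F v" if "\<delta> \<le> u" "u \<le> v" "v \<le> 1" for u v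
  proof (cases "ok u")
    case True
    then show ?thesis using Gmono okmono FG that by metis
  next
    case False
    then have "u = \<delta>" "u \<noteq> 1" using that by (auto simp: ok_def)
    then show ?thesis using that F\<delta>le FG okI by (cases "v = \<delta>") auto
  qed
  have Fconc: "(1 - t) * F u + t * F v \<le> F ((1 - t) * u + t * v)"
    if uv: "\<delta> \<le> u" "u \<le> v" "v \<le> 1" "0 \<le> t" "t \<le> 1" for u v t
  proof (cases "ok u")
    case True
    then have v: "ok v" using okmono uv by blast
    have "u \<le> (1 - t) * u + t * v" "(1 - t) * u + t * v \<le> v"
      using uv convex_bound_le[of u v v "1 - t" t] mult_left_mono[of u v t] by (auto simp: algebra_simps)
    then have "ok ((1 - t) * u + t * v)" using okmono[OF True] uv by auto
    then show ?thesis using Gconc[OF True v uv(2,4,5)] FG True v by simp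
  next
    case False
    then have u: "u = \<delta>" "\<delta> < 1" using uv \<delta>1 by (auto simp: ok_def)
    show ?thesis
    proof (cases "v = \<delta> \<or> t = 0")
      case True
      then show ?thesis using u by (auto simp: algebra_simps)
    next
      case vt: False
      then have v: "\<delta> < v" "0 < t" using uv u by auto
      define w where "w = (1 - t) * \<delta> + t * v"
      have w: "\<delta> < w" "w \<le> v"
      proof -
        have "w = \<delta> + t * (v - \<delta>)" by (simp add: w_def algebra_simps)
        moreover have "0 < t * (v - \<delta>)" using v by simp
        moreover have "t * (v - \<delta>) \<le> 1 * (v - \<delta>)" using v uv by (intro mult_right_mono) auto
        ultimately show "\<delta> < w" "w \<le> v" by auto
      qed
      \<comment> \<open>Concavity at the end point \<open>\<delta>\<close>, whose section may be
        empty: for \<open>t' < t\<close> the point \<open>w\<close> is a combination, with weight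
        \<open>t'\<close>, of \<open>v\<close> and some \<open>u' > \<delta>\<close>, and
        \<open>F \<delta> \<le> G u'\<close>. Afterwards \<open>t'\<close> is moved up to
        \<open>t\<close>.\<close>
      have step: "F \<delta> + t' * (G v - F \<delta>) \<le> G w" if t': "0 < t'" "t' < t" for t'
      proof -
        define u' where "u' = (w - t' * v) / (1 - t')"
        have t1: "0 < 1 - t'" using t' uv by simp
        have wu: "(1 - t') * u' + t' * v = w" using t1 by (simp add: u'_def)
        have "0 < (t - t') * (v - \<delta>)" using t' v by simp
        then have "\<delta> * (1 - t') < w - t' * v" by (simp add: w_def algebra_simps)
        then have u'1: "\<delta> < u'" using t1 by (simp add: u'_def less_divide_eq)
        have "w - t' * v \<le> v * (1 - t')" using w by (simp add: algebra_simps)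
        then have u'2: "u' \<le> v" using t1 by (simp add: u'_def divide_le_eq)
        have "F \<delta> + t' * (G v - F \<delta>) = (1 - t') * F \<delta> + t' * G v" by (simp add: algebra_simps)
        also have "\<dots> \<le> (1 - t') * G u' + t' * G v"
          using F\<delta>le[of u'] u'1 u'2 uv t1 t' by (intro add_mono mult_left_mono) auto
        also have "\<dots> \<le> G ((1 - t') * u' + t' * v)"
          using u'1 u'2 uv v t' t1 by (intro Gconc okI) auto
        finally show ?thesis unfolding wu .
      qed
      have "F \<delta> + t * (G v - F \<delta>) \<le> G w"
      proof (rule ccontr)
        assume n: "\<not> ?thesis"
        have "F \<delta> \<le> G w" using F\<delta>le w uv by simp
        then have D: "0 < t * (G v - F \<delta>)" using n by simp
        then have D: "0 < G v - F \<delta>" using v by (simp add: zero_less_mult_iff)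
        have "(G w - F \<delta>) / (G v - F \<delta>) < t" using n D by (simp add: divide_less_eq)
        then have "max 0 ((G w - F \<delta>) / (G v - F \<delta>)) < t" using v by simp
        then obtain t' where t': "max 0 ((G w - F \<delta>) / (G v - F \<delta>)) < t'" "t' < t" using dense by blast
        then have "G w - F \<delta> < t' * (G v - F \<delta>)" using D by (simp add: divide_less_eq)
        then show False using step[of t'] t' by simp
      qed
      moreover have "F \<delta> + t * (G v - F \<delta>) = (1 - t) * F \<delta> + t * G v" by (simp add: algebra_simps)
      ultimately have "(1 - t) * F \<delta> + t * G v \<le> G w" by simp
      then show ?thesis using FG[of v] FG[of w] okI v w uv unfolding u(1) w_def[symmetric] by simp
    qed
  qed
  have adm: "admissible \<delta> F"
    unfolding admissible_def
  proof (intro conjI ballI \<delta>0 \<delta>1)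
    show "concave_on {\<delta>..1} F"
      unfolding concave_on_iff
    proof (intro conjI ballI allI impI)
      fix x y a b :: real assume h: "x \<in> {\<delta>..1}" "y \<in> {\<delta>..1}" "0 \<le> a" "0 \<le> b" "a + b = 1"
      then have ab: "a \<le> 1" "b \<le> 1" by auto
      show "a * F x + b * F y \<le> F (a *\<^sub>R x + b *\<^sub>R y)"
      proof (cases "x \<le> y")
        case True
        have a: "a = 1 - b" using h by simp
        show ?thesis using True Fconc[of x y b] h(1,2,4) ab(2) unfolding a by simp
      next
        case False
        have b: "b = 1 - a" using h by simp
        show ?thesis using False Fconc[of y x a] h(1,2,3) ab(1) unfolding b by (simp add: add.commute)
      qed
    qed (rule convex_real_interval)
    show "mono_on {\<delta>..1} F" using Fmono by (auto simp: mono_on_def)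
  qed (use F0 Fle in auto)
  have edge: "edge_lim \<delta> F = F \<delta>"
  proof (cases "\<delta> = 1")
    case False
    then have d1: "\<delta> < 1" using \<delta>1 by simp
    have "(F \<longlongrightarrow> F \<delta>) (at_right \<delta>)"
    proof (rule order_tendstoI)
      fix x assume x: "x < F \<delta>"
      show "\<forall>\<^sub>F u in at_right \<delta>. x < F u"
        unfolding eventually_at_right_field
      proof (intro exI[of _ 1] conjI allI impI d1)
        fix y assume "\<delta> < y" "y < 1" then show "x < F y" using x Fmono[of \<delta> y] by simp
      qed
    next
      fix x assume "F \<delta> < x"
      then obtain u where u: "\<delta> < u" "u \<le> 1" "G u < x" using F\<delta>less d1 by blast
      show "\<forall>\<^sub>F u in at_right \<delta>. F u < x"
        unfolding eventually_at_right_field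
      proof (intro exI[of _ u] conjI allI impI u)
        fix y assume "\<delta> < y" "y < u" then show "F y < x" using u Fmono[of y u] FG[of u] okI by simp
      qed
    qed
    then have "Lim (at_right \<delta>) F = F \<delta>" by (intro tendsto_Lim) auto
    then show ?thesis using False by (simp add: edge_lim_def)
  qed (simp add: edge_lim_def)
  \<comment> \<open>Moving from a point between \<open>(u, b)\<close> and the graph towards some
    \<open>(a, 0)\<close> with \<open>a < u\<close> gives a point of the region to the left of and
    above \<open>(u, b)\<close>; by monotonicity it covers a neighbourhood.\<close>
  have int: "(u, b) \<notin> closure ({0..1} \<times> {0..1} - S)" if u: "\<delta> < u" "u \<le> 1" and b: "0 \<le> b" "b < F u" for u b
  proof -
    obtain a where a: "a < u" "(a, 0) \<in> S" using ex u by blast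
    obtain b' where b': "b < b'" "b' < F u" using b dense by blast
    have "0 < b'" using b b' by simp
    have "(u, b') \<in> S" using b b' FG[of u] okI u by (intro Gin) auto
    define t where "t = (1 + b / b') / 2"
    have t: "b / b' < t" "t < 1" "0 \<le> t" using b b' \<open>0 < b'\<close> by (auto simp: t_def field_simps)
    have P: "((1 - t) * a + t * u, (1 - t) * 0 + t * b') \<in> S" using a \<open>(u, b') \<in> S\<close> t by (intro cvx) auto
    have "b < t * b'" using t \<open>0 < b'\<close> by (simp add: field_simps)
    moreover have "(1 - t) * a + t * u < u"
    proof -
      have "(1 - t) * a < (1 - t) * u" using t a by simp
      then show ?thesis by (simp add: algebra_simps)
    qed
    ultimately show ?thesis
      using mono[OF P]
      by (intro not_closure_pairI[of "{(1 - t) * a + t * u<..} \<times> {..<t * b'}"] open_Times) auto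
  qed
  have out1: "(u, b) \<notin> closure S" if "u < \<delta>" for u b
    using \<delta>le that by (intro not_closure_pairI[of "{..<\<delta>} \<times> UNIV"] open_Times) (auto, fastforce)
  \<comment> \<open>For \<open>u < 1\<close> it suffices to find \<open>v > u\<close> with
    \<open>G v < b\<close>: no point left of \<open>v\<close> and above \<open>G v\<close> is in the
    region. For \<open>u = \<delta>\<close> such a \<open>v\<close> comes from the definition of
    \<open>F\<close>, otherwise concavity limits the growth of \<open>G\<close> to the right of
    \<open>u\<close>.\<close>
  have out2: "(u, b) \<notin> closure S" if u: "\<delta> \<le> u" "u \<le> 1" and b: "F u < b" for u b
  proof (cases "u = 1")
    case True
    have "b' \<le> F 1" if "(a', b') \<in> S" for a' b'
      using that mono[OF that, of 1 b'] S01[OF that] Gub[of 1 b'] FG[of 1] by (auto simp: ok_def)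
    then show ?thesis using b True
      by (intro not_closure_pairI[of "UNIV \<times> {F 1<..}"] open_Times) (auto, fastforce)
  next
    case False
    have "\<exists>v>u. v \<le> 1 \<and> G v < b"
    proof (cases "u = \<delta>")
      case True then show ?thesis using F\<delta>less b False u by auto
    next
      case ud: False
      then have ud: "\<delta> < u" using u by simp
      obtain a where a: "a < u" "(a, 0) \<in> S" using ex ud by blast
      have b0: "0 < b" using F0[OF u] b by simp
      have Gu: "0 \<le> G u" "G u < b" using b FG[of u] okI ud u G0 by auto
      obtain c where c: "G u < c" "c < b" using Gu dense by blast
      \<comment> \<open>Chosen so that \<open>t = (u - a) / (v - a)\<close> satisfies
        \<open>c \<le> t * b\<close>; concavity along the segment from \<open>(a, 0)\<close> gives
        \<open>t * G v \<le> G u < c\<close>.\<close>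
      define v where "v = min 1 (a + (u - a) * (b / c))"
      have cb: "1 < b / c" using c Gu by simp
      have "u - a < (u - a) * (b / c)" using mult_strict_left_mono[OF cb, of "u - a"] a by simp
      then have v: "u < v" "v \<le> 1" using False u by (auto simp: v_def)
      define t where "t = (u - a) / (v - a)"
      have va: "0 < v - a" using v a by simp
      have t: "0 < t" "t \<le> 1" using a v va by (auto simp: t_def)
      have "v - a \<le> (u - a) * (b / c)" by (simp add: v_def)
      then have tb: "c \<le> t * b" using va c Gu by (simp add: t_def field_simps)
      have comb: "(1 - t) * a + t * v = u"
      proof -
        have "(1 - t) * a + t * v = a + t * (v - a)" by (simp add: algebra_simps)
        then show ?thesis using va by (simp add: t_def)
      qed
      have "t * G v \<le> G u"
      proof (rule field_le_epsilon)
        fix e :: real assume e: "0 < e"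
        obtain d where d: "(v, d) \<in> S" "G v - e < d" using Gapprox[OF okI[of v] e] v ud by auto
        have "((1 - t) * a + t * v, (1 - t) * 0 + t * d) \<in> S" using a d t v by (intro cvx) auto
        then have "t * d \<le> G u" unfolding comb by (intro Gub) simp
        moreover have "t * (G v - e) \<le> t * d" using d t by (intro mult_left_mono) auto
        moreover have "t * e \<le> 1 * e" using e t by (intro mult_right_mono) auto
        ultimately show "t * G v \<le> G u + e" unfolding right_diff_distrib by linarith
      qed
      then have "t * G v < t * b" using c tb by linarith
      then have "G v < b" using t by simp
      then show ?thesis using v by auto
    qed
    then obtain v where v: "u < v" "v \<le> 1" "G v < b" by blast
    have "b' \<le> G v" if "(a', b') \<in> S" "a' < v" for a' b'
      using mono[OF that(1), of v b'] that v S01[OF that(1)] by (intro Gub) auto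
    then show ?thesis using v
      by (intro not_closure_pairI[of "{..<v} \<times> {G v<..}"] open_Times) (auto, fastforce)
  qed
  have inS: "(u, b) \<in> closure S" if u: "\<delta> \<le> u" "u \<le> 1" and b: "0 \<le> b" "b \<le> F u" for u b
  proof (rule closure_pairI)
    fix e :: real assume e: "0 < e"
    show "\<exists>x y. (x, y) \<in> S \<and> \<bar>x - u\<bar> < e \<and> \<bar>y - b\<bar> < e"
    proof -
      have "\<exists>x. ok x \<and> u \<le> x \<and> \<bar>x - u\<bar> < e \<and> b \<le> G x"
      proof (cases "ok u")
        case True then show ?thesis using e b FG by (intro exI[of _ u]) auto
      next
        case False
        then have "u = \<delta>" "\<delta> < 1" using u by (auto simp: ok_def)
        define x where "x = min 1 (\<delta> + e / 2)"
        have x: "\<delta> < x" "x \<le> 1" "\<bar>x - \<delta>\<bar> < e" using e \<open>\<delta> < 1\<close> by (auto simp: x_def)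
        then show ?thesis using F\<delta>le[of x] b \<open>u = \<delta>\<close> okI by (intro exI[of _ x]) auto
      qed
      then obtain x where x: "ok x" "\<bar>x - u\<bar> < e" "b \<le> G x" by blast
      define y where "y = max 0 (b - e / 2)"
      have y: "0 \<le> y" "\<bar>y - b\<bar> < e" using b e by (auto simp: y_def)
      have "(x, y) \<in> S"
      proof (cases "y = 0")
        case True then show ?thesis using ok0 x by simp
      next
        case False then show ?thesis using x y e by (intro Gin) (auto simp: y_def max_def split: if_splits)
      qed
      then show ?thesis using x y by blast
    qed
  qed
  have outS1: "(\<delta>, b) \<in> closure ({0..1} \<times> {0..1} - S)" if b: "0 \<le> b" "b \<le> F \<delta>" for b
  proof (rule closure_pairI)
    fix e :: real assume e: "0 < e"
    have b1: "b \<le> 1" using b Fle[of \<delta>] \<delta>1 by simp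
    show "\<exists>x y. (x, y) \<in> {0..1} \<times> {0..1} - S \<and> \<bar>x - \<delta>\<bar> < e \<and> \<bar>y - b\<bar> < e"
    \<comment> \<open>For \<open>\<delta> = 0\<close> the square has nothing to the left, but
      \<open>F \<delta> \<le> \<delta>\<close> leaves only the corner, and the points above it
      violate \<open>diag\<close>.\<close>
    proof (cases "\<delta> = 0")
      case True
      then have "b = 0" using b Fle[of \<delta>] \<delta>1 by simp
      have "(0, min 1 (e / 2)) \<notin> S" using diag[of 0 "min 1 (e / 2)"] e by auto
      then show ?thesis using e True \<open>b = 0\<close> by (intro exI[of _ 0] exI[of _ "min 1 (e / 2)"]) auto
    next
      case False
      define x where "x = max 0 (\<delta> - e / 2)"
      have x: "0 \<le> x" "x < \<delta>" "\<bar>x - \<delta>\<bar> < e" using e False \<delta>0 by (auto simp: x_def)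
      then have "(x, b) \<notin> S" using \<delta>le by fastforce
      then show ?thesis using x b b1 e \<delta>1 by (intro exI[of _ x] exI[of _ b]) auto
    qed
  qed
  have outS2: "(u, F u) \<in> closure ({0..1} \<times> {0..1} - S)" if u: "\<delta> < u" "u \<le> 1" for u
  proof (rule closure_pairI)
    fix e :: real assume e: "0 < e"
    have Fu: "0 \<le> F u" "F u \<le> u" using F0 Fle u by auto
    have u0: "0 < u" using u \<delta>0 by simp
    show "\<exists>x y. (x, y) \<in> {0..1} \<times> {0..1} - S \<and> \<bar>x - u\<bar> < e \<and> \<bar>y - F u\<bar> < e"
    proof (cases "F u < 1")
      case True
      define y where "y = min 1 (F u + e / 2)"
      have y: "F u < y" "y \<le> 1" "\<bar>y - F u\<bar> < e" using True e by (auto simp: y_def)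
      have "(u, y) \<notin> S" using Gub[of u y] FG[of u] okI u y by auto
      then show ?thesis using y u u0 Fu e by (intro exI[of _ u] exI[of _ y]) auto
    next
      case False
      \<comment> \<open>At the corner \<open>(1, 1)\<close> the square has nothing above; the points
        to the left of it violate \<open>diag\<close>.\<close>
      then have 1: "F u = 1" "u = 1" using Fu u by auto
      define x where "x = max 0 (1 - e / 2)"
      have x: "0 \<le> x" "x < 1" "\<bar>x - 1\<bar> < e" using e by (auto simp: x_def)
      have "(x, 1) \<notin> S" using diag[of x 1] x by auto
      then show ?thesis using x 1 e by (intro exI[of _ x] exI[of _ 1]) auto
    qed
  qed
  have "sq_boundary S = {\<delta>} \<times> {0..edge_lim \<delta> F} \<union> {(u, F u) | u. u \<in> {\<delta><..1}}"
    unfolding sq_boundary_eq[OF sub] edge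
  proof (intro equalityI subsetI)
    fix z assume z: "z \<in> {0..1} \<times> {0..1} \<inter> closure S \<inter> closure ({0..1} \<times> {0..1} - S)"
    obtain u b where ub: "z = (u, b)" by (cases z)
    have h: "0 \<le> u" "u \<le> 1" "0 \<le> b" "(u, b) \<in> closure S" "(u, b) \<in> closure ({0..1} \<times> {0..1} - S)" using z ub by auto
    have "\<delta> \<le> u" using out1[of u b] h by (cases "u < \<delta>") auto
    moreover have "b \<le> F u" using out2[OF calculation h(2), of b] h by (cases "F u < b") auto
    moreover have "F u \<le> b" if "\<delta> < u" using int[OF that h(2,3)] h by (cases "b < F u") auto
    ultimately show "z \<in> {\<delta>} \<times> {0..F \<delta>} \<union> {(u, F u) | u. u \<in> {\<delta><..1}}"
      using h ub by (cases "u = \<delta>") auto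
  next
    fix z assume "z \<in> {\<delta>} \<times> {0..F \<delta>} \<union> {(u, F u) | u. u \<in> {\<delta><..1}}"
    then consider b where "z = (\<delta>, b)" "0 \<le> b" "b \<le> F \<delta>" | u where "z = (u, F u)" "\<delta> < u" "u \<le> 1" by auto
    then show "z \<in> {0..1} \<times> {0..1} \<inter> closure S \<inter> closure ({0..1} \<times> {0..1} - S)"
    proof cases
      case 1
      then show ?thesis using inS[of \<delta> b] outS1[of b] \<delta>0 \<delta>1 Fle[of \<delta>] by auto
    next
      case 2
      then show ?thesis using inS[of u "F u"] outS2[of u] \<delta>0 F0[of u] Fle[of u] by auto
    qed
  qed
  then show ?thesis using adm by blast
qed

section \<open>The direct half: the shape of the boundary\<close>

lemma boundary_dichotomy:
  assumes p: "1 < p" and X: "mm_space X \<rho> \<mu>" and null: "emeasure \<mu> (X - supp_mu X \<rho> \<mu>) = 0"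
  shows "(sq_boundary (Omega_HL X \<rho> \<mu> p) = {} \<and>
               (Omega_HL X \<rho> \<mu> p = {} \<or> Omega_HL X \<rho> \<mu> p = {0..1} \<times> {0..1}))
          \<or> (\<exists>\<delta> F. admissible \<delta> F \<and>
               sq_boundary (Omega_HL X \<rho> \<mu> p) =
                 {\<delta>} \<times> {0..edge_lim \<delta> F} \<union> {(u, F u) | u. u \<in> {\<delta><..1}})"
proof -
  interpret Metric_space X \<rho> using mm_spaceD[OF X] by simp
  interpret mm X \<rho> \<mu> by unfold_locales (use mm_spaceD[OF X] in auto)
  let ?S = "Omega_HL X \<rho> \<mu> p"
  have sub: "?S \<subseteq> {0..1} \<times> {0..1}" by (auto simp: Omega_HL_def)
  show ?thesis
  proof (cases "finite core")
    case True
    then have eq: "?S = {0..1} \<times> {0..1}" using core_finite_bounded[OF p null] by (auto simp: Omega_HL_def)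
    have "sq_boundary ?S = {}" unfolding sq_boundary_eq[OF sub] by (simp add: eq)
    then show ?thesis using eq by blast
  next
    case inf: False
    show ?thesis
    proof (cases "?S = {}")
      case True
      have "sq_boundary ?S = {}" unfolding sq_boundary_eq[OF sub] by (simp add: True)
      then show ?thesis using True by blast
    next
      case False
      have diag: "b \<le> a" if "(a, b) \<in> ?S" for a b
        using that core_infinite_le[OF p null inf] by (auto simp: Omega_HL_def)
      have "\<exists>\<delta> F. admissible \<delta> F \<and> sq_boundary ?S = {\<delta>} \<times> {0..edge_lim \<delta> F} \<union> {(u, F u) | u. u \<in> {\<delta><..1}}"
      proof (rule convex_region_boundary[OF sub False])
        fix a b a' b' assume "(a, b) \<in> ?S" "a \<le> a'" "a' \<le> 1" "0 \<le> b'" "b' \<le> b"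
        then show "(a', b') \<in> ?S" using maxc_bounded_mono[OF p, of a b a' b'] by (auto simp: Omega_HL_def)
      next
        fix a0 b0 a1 b1 \<theta> :: real
        assume h: "(a0, b0) \<in> ?S" "(a1, b1) \<in> ?S" "a0 < a1" "b0 < b1" "0 < \<theta>" "\<theta> < 1"
        have "maxc_bounded X \<rho> \<mu> p (a0 + \<theta> * (a1 - a0)) (b0 + \<theta> * (b1 - b0))"
          using h diag[OF h(1)] diag[OF h(2)] by (intro maxc_bounded_convex p) (auto simp: Omega_HL_def)
        moreover have "a0 + \<theta> * (a1 - a0) \<le> a0 + 1 * (a1 - a0)" "b0 + \<theta> * (b1 - b0) \<le> b0 + 1 * (b1 - b0)"
          using h by (intro add_left_mono mult_right_mono; simp)+
        moreover have "0 \<le> \<theta> * (a1 - a0)" "0 \<le> \<theta> * (b1 - b0)" using h by auto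
        ultimately show "(a0 + \<theta> * (a1 - a0), b0 + \<theta> * (b1 - b0)) \<in> ?S"
          using h(1,2) by (auto simp: Omega_HL_def)
      qed (use diag in auto)
      then show ?thesis by blast
    qed
  qed
qed

section \<open>Distribution functions and layers for the triangle inequalities\<close>

lemma distr_fun_measurable:
  assumes [measurable]: "g \<in> borel_measurable M"
  shows "distr_fun M g t = emeasure M {x \<in> space M. ennreal t < g x}"
  unfolding distr_fun_def by (intro outer_mu_sets) measurable

lemma lp_epowr:
  assumes "0 \<le> b" "0 < p"
  shows "lp (b * p) (\<lambda>k. epowr (x k) p) = epowr (lp b x) p"
proof (cases "b = 0")
  case True
  show ?thesis
  proof (rule antisym)
    show "lp (b * p) (\<lambda>k. epowr (x k) p) \<le> epowr (lp b x) p"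
      using True assms by (auto simp: lp_zero intro!: SUP_least epowr_mono SUP_upper)
    have "x k \<le> epowr (SUP k. epowr (x k) p) (1 / p)" for k
      using assms by (subst le_epowr_iff) (auto intro: SUP_upper)
    then have "(SUP k. x k) \<le> epowr (SUP k. epowr (x k) p) (1 / p)" by (intro SUP_least)
    then show "epowr (lp b x) p \<le> lp (b * p) (\<lambda>k. epowr (x k) p)"
      using True assms by (simp add: lp_zero epowr_le_iff)
  qed
next
  case False
  then have "0 < b" "0 < b * p" using assms by auto
  then show ?thesis using assms by (simp add: lp_pos epowr_epowr mult.commute)
qed

lemma layer_above:
  assumes "0 \<le> z"
  shows "ennreal z * indicator {z. 2 powr real_of_int j < z} z
    \<le> (\<Sum>l. ennreal (2 powr real_of_int (j + int l + 1)) * indicator {z. 2 powr real_of_int (j + int l) < z} z)"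
proof (cases "2 powr real_of_int j < z")
  case True
  then have z: "0 < z" using powr_gt_zero[of 2 "real_of_int j"] by linarith
  define i where "i = \<lceil>log 2 z\<rceil> - 1"
  have i: "2 powr real_of_int i < z" "z \<le> 2 powr real_of_int (i + 1)"
    using ceiling_log2_bounds[OF z] by (auto simp: i_def)
  have "real_of_int j < log 2 z" using True z by (simp add: less_log_iff)
  then have "j \<le> i" unfolding i_def by linarith
  then obtain l where l: "i = j + int l" using zle_iff_zadd by blast
  let ?h = "\<lambda>l. ennreal (2 powr real_of_int (j + int l + 1)) * indicator {z. 2 powr real_of_int (j + int l) < z} z"
  have "ennreal z \<le> ennreal (2 powr real_of_int (i + 1))" using i(2) by (rule ennreal_leI)
  then have "ennreal z \<le> ?h l" using i(1) unfolding l by simp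
  also have "?h l \<le> lp 1 ?h" by (rule le_lp) simp
  also have "\<dots> = (\<Sum>l. ?h l)" by (simp add: lp_pos nn_integral_count_space_nat)
  finally show ?thesis using True by simp
qed simp

subsection \<open>The triangle inequality, second exponent at least the first\<close>

text \<open>Each \<open>g i\<close> is cut at its own height \<open>2^(k + \<omega> i)\<close>. As
  the weights sum to at most 1, the low parts add up to at most \<open>2^k\<close>, so where the
  whole sum exceeds \<open>2^(k+1)\<close> the high parts add up to at least \<open>2^k\<close>.
  Markov's inequality and \<open>layer_above\<close> finish.\<close>

lemma truncation_level:
  fixes g :: "'i \<Rightarrow> 'a \<Rightarrow> real" and \<omega> :: "'i \<Rightarrow> int"
  assumes I: "finite I" and g[measurable]: "\<And>i. i \<in> I \<Longrightarrow> g i \<in> borel_measurable M" and g0: "\<And>i x. i \<in> I \<Longrightarrow> 0 \<le> g i x"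
    and \<omega>: "(\<Sum>i\<in>I. 2 powr real_of_int (\<omega> i)) \<le> 1"
  shows "distr_fun M (\<lambda>x. ennreal (\<Sum>i\<in>I. g i x)) (2 powr real_of_int (k + 1))
    \<le> (\<Sum>i\<in>I. \<Sum>l. ennreal (2 powr real_of_int (\<omega> i + int l + 1)) * distr_fun M (\<lambda>x. ennreal (g i x)) (2 powr real_of_int (k + \<omega> i + int l)))"
proof -
  let ?ind = "\<lambda>i j x. indicator {z. 2 powr real_of_int j < z} (g i x) :: ennreal"
  define h where "h x = (\<Sum>i\<in>I. ennreal (g i x) * ?ind i (k + \<omega> i) x)" for x
  have [measurable]: "(\<lambda>x. ?ind i j x) \<in> borel_measurable M" if "i \<in> I" for i j
    using g[OF that] by measurable
  have hm[measurable]: "h \<in> borel_measurable M" unfolding h_def by measurable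
  have large: "1 \<le> ennreal (2 powr - real_of_int k) * h x" if "2 powr real_of_int (k + 1) < (\<Sum>i\<in>I. g i x)" for x
  proof -
    let ?A = "{i \<in> I. 2 powr real_of_int (k + \<omega> i) < g i x}"
    have "(\<Sum>i\<in>I. g i x) \<le> (\<Sum>i\<in>I. 2 powr real_of_int (k + \<omega> i) + (if i \<in> ?A then g i x else 0))"
      using g0 by (intro sum_mono) auto
    also have "\<dots> = 2 powr real_of_int k * (\<Sum>i\<in>I. 2 powr real_of_int (\<omega> i)) + (\<Sum>i\<in>I. if i \<in> ?A then g i x else 0)"
      by (simp add: sum.distrib sum_distrib_left powr_add)
    also have "\<dots> \<le> 2 powr real_of_int k * 1 + (\<Sum>i\<in>I. if i \<in> ?A then g i x else 0)"
      using \<omega> by (intro add_right_mono mult_left_mono) auto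
    finally have "2 powr real_of_int k \<le> (\<Sum>i\<in>I. if i \<in> ?A then g i x else 0)"
      using that by (simp add: powr_add)
    then have "ennreal (2 powr real_of_int k) \<le> ennreal (\<Sum>i\<in>I. if i \<in> ?A then g i x else 0)" by (rule ennreal_leI)
    also have "\<dots> = (\<Sum>i\<in>I. ennreal (if i \<in> ?A then g i x else 0))" using g0 by (intro sum_ennreal[symmetric]) auto
    also have "\<dots> = h x" unfolding h_def by (intro sum.cong) auto
    finally have "ennreal (2 powr - real_of_int k) * ennreal (2 powr real_of_int k) \<le> ennreal (2 powr - real_of_int k) * h x"
      by (rule mult_left_mono) simp
    then show ?thesis by (simp add: ennreal_mult[symmetric] powr_add[symmetric])
  qed
  have "distr_fun M (\<lambda>x. ennreal (\<Sum>i\<in>I. g i x)) (2 powr real_of_int (k + 1))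
     \<le> outer_mu M {x \<in> space M. 1 \<le> ennreal (2 powr - real_of_int k) * h x}"
    unfolding distr_fun_def using large by (intro outer_mu_mono) (auto simp: ennreal_less_iff)
  also have "\<dots> = emeasure M {x \<in> space M. 1 \<le> ennreal (2 powr - real_of_int k) * h x}"
    by (intro outer_mu_sets) measurable
  also have "\<dots> \<le> ennreal (2 powr - real_of_int k) * (\<integral>\<^sup>+ x. h x * indicator (space M) x \<partial>M)"
    by (rule nn_integral_Markov_inequality) auto
  also have "(\<integral>\<^sup>+ x. h x * indicator (space M) x \<partial>M) = (\<integral>\<^sup>+ x. h x \<partial>M)"
    by (intro nn_integral_cong) simp
  also have "\<dots> = (\<Sum>i\<in>I. \<integral>\<^sup>+ x. ennreal (g i x) * ?ind i (k + \<omega> i) x \<partial>M)"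
    unfolding h_def by (rule nn_integral_sum) measurable
  also have "\<dots> \<le> (\<Sum>i\<in>I. \<Sum>l. ennreal (2 powr real_of_int (k + \<omega> i + int l + 1)) * distr_fun M (\<lambda>x. ennreal (g i x)) (2 powr real_of_int (k + \<omega> i + int l)))"
  proof (rule sum_mono)
    fix i assume i: "i \<in> I"
    note [measurable] = g[OF i]
    have "(\<integral>\<^sup>+ x. ennreal (g i x) * ?ind i (k + \<omega> i) x \<partial>M)
       \<le> (\<integral>\<^sup>+ x. (\<Sum>l. ennreal (2 powr real_of_int (k + \<omega> i + int l + 1)) * ?ind i (k + \<omega> i + int l) x) \<partial>M)"
      using g0[OF i] by (intro nn_integral_mono layer_above)
    also have "\<dots> = (\<Sum>l. \<integral>\<^sup>+ x. ennreal (2 powr real_of_int (k + \<omega> i + int l + 1)) * ?ind i (k + \<omega> i + int l) x \<partial>M)"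
      by (rule nn_integral_suminf) measurable
    also have "\<dots> = (\<Sum>l. ennreal (2 powr real_of_int (k + \<omega> i + int l + 1)) * distr_fun M (\<lambda>x. ennreal (g i x)) (2 powr real_of_int (k + \<omega> i + int l)))"
    proof (rule suminf_cong)
      fix l
      let ?E = "{x \<in> space M. ennreal (2 powr real_of_int (k + \<omega> i + int l)) < ennreal (g i x)}"
      have "(\<integral>\<^sup>+ x. ennreal (2 powr real_of_int (k + \<omega> i + int l + 1)) * ?ind i (k + \<omega> i + int l) x \<partial>M)
        = (\<integral>\<^sup>+ x. ennreal (2 powr real_of_int (k + \<omega> i + int l + 1)) * indicator ?E x \<partial>M)"
        by (intro nn_integral_cong) (auto simp: ennreal_less_iff split: split_indicator)
      also have "\<dots> = ennreal (2 powr real_of_int (k + \<omega> i + int l + 1)) * emeasure M ?E"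
        by (rule nn_integral_cmult_indicator) measurable
      finally show "(\<integral>\<^sup>+ x. ennreal (2 powr real_of_int (k + \<omega> i + int l + 1)) * ?ind i (k + \<omega> i + int l) x \<partial>M)
        = ennreal (2 powr real_of_int (k + \<omega> i + int l + 1)) * distr_fun M (\<lambda>x. ennreal (g i x)) (2 powr real_of_int (k + \<omega> i + int l))"
        by (simp add: distr_fun_measurable)
    qed
    finally show "(\<integral>\<^sup>+ x. ennreal (g i x) * ?ind i (k + \<omega> i) x \<partial>M)
      \<le> (\<Sum>l. ennreal (2 powr real_of_int (k + \<omega> i + int l + 1)) * distr_fun M (\<lambda>x. ennreal (g i x)) (2 powr real_of_int (k + \<omega> i + int l)))" .
  qed
  finally have "distr_fun M (\<lambda>x. ennreal (\<Sum>i\<in>I. g i x)) (2 powr real_of_int (k + 1))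
    \<le> ennreal (2 powr - real_of_int k) * (\<Sum>i\<in>I. \<Sum>l. ennreal (2 powr real_of_int (k + \<omega> i + int l + 1)) * distr_fun M (\<lambda>x. ennreal (g i x)) (2 powr real_of_int (k + \<omega> i + int l)))"
    by (simp add: mult_left_mono)
  also have "\<dots> = (\<Sum>i\<in>I. \<Sum>l. ennreal (2 powr real_of_int (\<omega> i + int l + 1)) * distr_fun M (\<lambda>x. ennreal (g i x)) (2 powr real_of_int (k + \<omega> i + int l)))"
  proof -
    have "ennreal (2 powr - real_of_int k) * ennreal (2 powr real_of_int (k + \<omega> i + int l + 1)) = ennreal (2 powr real_of_int (\<omega> i + int l + 1))" for i l
      by (simp add: ennreal_mult[symmetric] powr_add[symmetric] add.assoc)
    then show ?thesis by (simp only: sum_distrib_left ennreal_suminf_cmult[symmetric] mult.assoc[symmetric])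
  qed
  finally show ?thesis .
qed

text \<open>The second exponent is at least \<open>p\<close>, so \<open>p\<close>-th powers of
  levels lie in a sequence space with a genuine triangle inequality. With
  \<open>2 powr \<omega> i\<close> about \<open>y i / Y\<close>, the term \<open>i\<close>
  contributes about \<open>2 powr \<omega> i * Y powr p\<close>, and these add up to at most
  \<open>Y powr p\<close>: the constant is independent of the number of terms.\<close>

lemma dl_sum_le_weak:
  fixes g :: "'i \<Rightarrow> 'a \<Rightarrow> real"
  assumes p: "1 < p" and b: "0 \<le> b" "b * p \<le> 1"
    and I: "finite I" and g[measurable]: "\<And>i. i \<in> I \<Longrightarrow> g i \<in> borel_measurable M" and g0: "\<And>i x. i \<in> I \<Longrightarrow> 0 \<le> g i x"
    and y: "\<And>i. i \<in> I \<Longrightarrow> 0 < y i" "\<And>i. i \<in> I \<Longrightarrow> dl p b M (\<lambda>x. ennreal (g i x)) \<le> ennreal (y i)"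
  shows "dl p b M (\<lambda>x. ennreal (\<Sum>i\<in>I. g i x))
    \<le> ennreal ((2 powr (2 * p + 1) * (1 / (1 - 2 powr (- ((p - 1) / 2))))\<^sup>2) powr (1 / p) * (\<Sum>i\<in>I. y i))"
proof (cases "I = {}")
  case True
  have "lev p (distr_fun M (\<lambda>x. 0)) = (\<lambda>k. 0)" by (rule ext) (simp add: lev_def distr_fun_measurable)
  then show ?thesis using True by (simp add: dl_def)
next
  case ne: False
  define Y where "Y = (\<Sum>i\<in>I. y i)"
  have Y: "0 < Y" unfolding Y_def using ne I y by (intro sum_pos) auto
  define \<omega> where "\<omega> i = \<lfloor>log 2 (y i / Y)\<rfloor>" for i
  have \<omega>: "2 powr real_of_int (\<omega> i) \<le> y i / Y" "y i \<le> 2 * 2 powr real_of_int (\<omega> i) * Y" if i: "i \<in> I" for i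
  proof -
    have pos: "0 < y i / Y" using y Y i by simp
    show "2 powr real_of_int (\<omega> i) \<le> y i / Y" using floor_log2_bounds(1)[OF pos] by (simp add: \<omega>_def)
    have "y i / Y < 2 * 2 powr real_of_int (\<omega> i)" using floor_log2_bounds(2)[OF pos] by (simp add: \<omega>_def powr_add)
    then show "y i \<le> 2 * 2 powr real_of_int (\<omega> i) * Y" using Y by (simp add: divide_less_eq)
  qed
  have sum\<omega>: "(\<Sum>i\<in>I. 2 powr real_of_int (\<omega> i)) \<le> 1"
  proof -
    have "(\<Sum>i\<in>I. 2 powr real_of_int (\<omega> i)) \<le> (\<Sum>i\<in>I. y i / Y)" by (intro sum_mono \<omega>)
    also have "\<dots> = 1" using Y by (simp add: sum_divide_distrib[symmetric] Y_def)
    finally show ?thesis .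
  qed
  \<comment> \<open>The tail over \<open>l\<close> decays like
    \<open>2 powr (- (p - 1) * l)\<close>; half of this decay sums the series in
    \<open>inner\<close>, the other half stays in the supremum \<open>S\<close>.\<close>
  define \<tau> where "\<tau> = (p - 1) / 2"
  have \<tau>: "0 < \<tau>" and \<tau>2: "2 * \<tau> = p - 1" using p by (simp_all add: \<tau>_def)
  define \<Gamma> where "\<Gamma> = 1 / (1 - 2 powr (- \<tau>))"
  have \<Gamma>: "0 \<le> \<Gamma>" using \<tau> powr_less_one[of 2 "- \<tau>"] by (simp add: \<Gamma>_def)
  have \<Gamma>sum: "(\<Sum>l. ennreal (2 powr (- \<tau> * real l))) = ennreal \<Gamma>" unfolding \<Gamma>_def by (rule suminf_geom_powr[OF \<tau>])
  let ?D = "distr_fun M (\<lambda>x. ennreal (\<Sum>i\<in>I. g i x))"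
  let ?d = "\<lambda>i. distr_fun M (\<lambda>x. ennreal (g i x))"
  define z where "z i k = epowr (lev p (?d i) k) p" for i k
  have d_z: "?d i (2 powr real_of_int k) = ennreal (2 powr (- p * real_of_int k)) * z i k" for i k
    unfolding z_def lev_def using p
    by (simp add: epowr_mult epowr_inverse powr_powr mult.assoc[symmetric] ennreal_mult[symmetric] powr_add[symmetric] mult.commute)
  define S where "S i k = (SUP l. ennreal (2 powr (- \<tau> * real l)) * z i (k + int l))" for i and k :: int
  have inner: "(\<Sum>l. ennreal (2 powr (- (2 * \<tau>) * real l)) * z i (k + int l)) \<le> ennreal \<Gamma> * S i k" for i k
  proof -
    have "(\<Sum>l. ennreal (2 powr (- (2 * \<tau>) * real l)) * z i (k + int l)) \<le> (\<Sum>l. ennreal (2 powr (- \<tau> * real l)) * S i k)"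
    proof (intro suminf_le summableI)
      fix l
      have "ennreal (2 powr (- (2 * \<tau>) * real l)) * z i (k + int l) = ennreal (2 powr (- \<tau> * real l)) * (ennreal (2 powr (- \<tau> * real l)) * z i (k + int l))"
        by (simp add: mult.assoc[symmetric] ennreal_mult[symmetric] powr_add[symmetric])
      also have "\<dots> \<le> ennreal (2 powr (- \<tau> * real l)) * S i k"
        unfolding S_def by (intro mult_left_mono SUP_upper) auto
      finally show "ennreal (2 powr (- (2 * \<tau>) * real l)) * z i (k + int l) \<le> ennreal (2 powr (- \<tau> * real l)) * S i k" .
    qed
    also have "\<dots> = ennreal \<Gamma> * S i k" unfolding ennreal_suminf_multc \<Gamma>sum ..
    finally show ?thesis .
  qed
  have level: "epowr (lev p ?D (k + 1)) p \<le> ennreal (2 powr (p + 1)) *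
     (\<Sum>i\<in>I. ennreal (2 powr ((1 - p) * real_of_int (\<omega> i))) * (ennreal \<Gamma> * S i (k + \<omega> i)))" for k
  proof -
    have "epowr (lev p ?D (k + 1)) p = ennreal (2 powr (p * real_of_int (k + 1))) * ?D (2 powr real_of_int (k + 1))"
      unfolding lev_def using p by (simp add: epowr_mult epowr_inverse powr_powr mult.commute)
    also have "\<dots> \<le> ennreal (2 powr (p * real_of_int (k + 1))) *
      (\<Sum>i\<in>I. \<Sum>l. ennreal (2 powr real_of_int (\<omega> i + int l + 1)) * ?d i (2 powr real_of_int (k + \<omega> i + int l)))"
      by (intro mult_left_mono truncation_level I g g0 sum\<omega>) auto
    also have "\<dots> = (\<Sum>i\<in>I. \<Sum>l. ennreal (2 powr (p + 1)) * (ennreal (2 powr ((1 - p) * real_of_int (\<omega> i))) *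
         (ennreal (2 powr (- (2 * \<tau>) * real l)) * z i (k + \<omega> i + int l))))"
    proof -
      have "ennreal (2 powr (p * real_of_int (k + 1))) * (ennreal (2 powr real_of_int (\<omega> i + int l + 1)) * ?d i (2 powr real_of_int (k + \<omega> i + int l)))
        = ennreal (2 powr (p + 1)) * (ennreal (2 powr ((1 - p) * real_of_int (\<omega> i))) *
         (ennreal (2 powr (- (2 * \<tau>) * real l)) * z i (k + \<omega> i + int l)))" for i l
      proof -
        have "p * real_of_int (k + 1) + (real_of_int (\<omega> i + int l + 1) + (- p * real_of_int (k + \<omega> i + int l)))
           = (p + 1) + ((1 - p) * real_of_int (\<omega> i) + (- (2 * \<tau>) * real l))"
          unfolding \<tau>2 by (simp add: algebra_simps)
        then have "2 powr (p * real_of_int (k + 1)) * (2 powr real_of_int (\<omega> i + int l + 1) * 2 powr (- p * real_of_int (k + \<omega> i + int l)))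
           = 2 powr (p + 1) * (2 powr ((1 - p) * real_of_int (\<omega> i)) * (2::real) powr (- (2 * \<tau>) * real l))"
          by (simp only: powr_add[symmetric])
        then have "ennreal (2 powr (p * real_of_int (k + 1))) * (ennreal (2 powr real_of_int (\<omega> i + int l + 1)) * ennreal (2 powr (- p * real_of_int (k + \<omega> i + int l))))
           = ennreal (2 powr (p + 1)) * (ennreal (2 powr ((1 - p) * real_of_int (\<omega> i))) * ennreal (2 powr (- (2 * \<tau>) * real l)))"
          by (simp only: ennreal_mult[symmetric] powr_ge_zero mult_nonneg_nonneg)
        then have "ennreal (2 powr (p * real_of_int (k + 1))) * (ennreal (2 powr real_of_int (\<omega> i + int l + 1)) * ennreal (2 powr (- p * real_of_int (k + \<omega> i + int l)))) * z i (k + \<omega> i + int l)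
           = ennreal (2 powr (p + 1)) * (ennreal (2 powr ((1 - p) * real_of_int (\<omega> i))) * ennreal (2 powr (- (2 * \<tau>) * real l))) * z i (k + \<omega> i + int l)"
          by (simp only:)
        then show ?thesis unfolding d_z by (simp only: mult.assoc)
      qed
      then show ?thesis by (simp only: sum_distrib_left ennreal_suminf_cmult[symmetric])
    qed
    also have "\<dots> = ennreal (2 powr (p + 1)) * (\<Sum>i\<in>I. ennreal (2 powr ((1 - p) * real_of_int (\<omega> i))) *
         (\<Sum>l. ennreal (2 powr (- (2 * \<tau>) * real l)) * z i (k + \<omega> i + int l)))"
      by (simp only: sum_distrib_left ennreal_suminf_cmult)
    also have "\<dots> \<le> ennreal (2 powr (p + 1)) * (\<Sum>i\<in>I. ennreal (2 powr ((1 - p) * real_of_int (\<omega> i))) * (ennreal \<Gamma> * S i (k + \<omega> i)))"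
      by (intro mult_left_mono sum_mono inner) auto
    finally show ?thesis .
  qed
  have bp: "0 \<le> b * p" using b p by simp
  have "epowr (dl p b M (\<lambda>x. ennreal (\<Sum>i\<in>I. g i x))) p = lp (b * p) (\<lambda>k. epowr (lev p ?D k) p)"
    unfolding dl_def using b p by (intro lp_epowr[symmetric]) auto
  also have "\<dots> = lp (b * p) (\<lambda>k. epowr (lev p ?D (k + 1)) p)"
    using lp_shift[OF bp, of "\<lambda>k. epowr (lev p ?D k) p" 1] by simp
  also have "\<dots> \<le> lp (b * p) (\<lambda>k. ennreal (2 powr (p + 1)) *
     (\<Sum>i\<in>I. ennreal (2 powr ((1 - p) * real_of_int (\<omega> i))) * (ennreal \<Gamma> * S i (k + \<omega> i))))"
    by (intro lp_mono level bp)
  also have "\<dots> = ennreal (2 powr (p + 1)) * lp (b * p) (\<lambda>k.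
     (\<Sum>i\<in>I. ennreal (2 powr ((1 - p) * real_of_int (\<omega> i))) * (ennreal \<Gamma> * S i (k + \<omega> i))))"
    by (rule lp_cmult[OF bp])
  also have "\<dots> \<le> ennreal (2 powr (p + 1)) * (\<Sum>i\<in>I. lp (b * p) (\<lambda>k. ennreal (2 powr ((1 - p) * real_of_int (\<omega> i))) * (ennreal \<Gamma> * S i (k + \<omega> i))))"
    using bp b by (intro mult_left_mono lp_sum_le I) auto
  also have "\<dots> \<le> ennreal (2 powr (p + 1)) * (\<Sum>i\<in>I. ennreal (2 powr p * 2 powr real_of_int (\<omega> i) * \<Gamma>\<^sup>2 * Y powr p))"
  proof (intro mult_left_mono sum_mono)
    fix i assume i: "i \<in> I"
    have "lp (b * p) (z i) = epowr (dl p b M (\<lambda>x. ennreal (g i x))) p"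
      unfolding z_def dl_def using b p by (intro lp_epowr) auto
    also have "\<dots> \<le> epowr (ennreal (2 * 2 powr real_of_int (\<omega> i) * Y)) p"
      using p by (intro epowr_mono order_trans[OF y(2)[OF i]] ennreal_leI \<omega>(2)[OF i]) auto
    also have "\<dots> = ennreal ((2 * 2 powr real_of_int (\<omega> i) * Y) powr p)"
      using Y by (intro epowr_ennreal) auto
    finally have zi: "lp (b * p) (z i) \<le> ennreal ((2 * 2 powr real_of_int (\<omega> i) * Y) powr p)" .
    have "lp (b * p) (\<lambda>k. S i (k + \<omega> i)) = lp (b * p) (S i)" by (rule lp_shift[OF bp])
    also have "\<dots> \<le> (\<Sum>l. ennreal (2 powr (- \<tau> * real l))) * lp (b * p) (z i)"
      unfolding S_def using bp b by (intro lp_SUP_le) (auto intro: injI)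
    also have "\<dots> \<le> ennreal \<Gamma> * ennreal ((2 * 2 powr real_of_int (\<omega> i) * Y) powr p)"
      unfolding \<Gamma>sum by (intro mult_left_mono zi) simp
    finally have "lp (b * p) (\<lambda>k. S i (k + \<omega> i)) \<le> ennreal \<Gamma> * ennreal ((2 * 2 powr real_of_int (\<omega> i) * Y) powr p)" .
    then have "ennreal (2 powr ((1 - p) * real_of_int (\<omega> i))) * (ennreal \<Gamma> * lp (b * p) (\<lambda>k. S i (k + \<omega> i)))
      \<le> ennreal (2 powr ((1 - p) * real_of_int (\<omega> i))) * (ennreal \<Gamma> * (ennreal \<Gamma> * ennreal ((2 * 2 powr real_of_int (\<omega> i) * Y) powr p)))"
      by (intro mult_left_mono) auto
    also have "\<dots> = ennreal (2 powr ((1 - p) * real_of_int (\<omega> i)) * (\<Gamma> * (\<Gamma> * (2 * 2 powr real_of_int (\<omega> i) * Y) powr p)))"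
      using \<Gamma> by (simp add: ennreal_mult)
    also have "2 powr ((1 - p) * real_of_int (\<omega> i)) * (\<Gamma> * (\<Gamma> * (2 * 2 powr real_of_int (\<omega> i) * Y) powr p))
        = 2 powr p * 2 powr real_of_int (\<omega> i) * \<Gamma>\<^sup>2 * Y powr p"
    proof -
      have "(2 * 2 powr real_of_int (\<omega> i) * Y) powr p = 2 powr p * 2 powr (real_of_int (\<omega> i) * p) * Y powr p"
        using Y by (simp add: powr_mult powr_powr)
      moreover have "2 powr ((1 - p) * real_of_int (\<omega> i)) * 2 powr (real_of_int (\<omega> i) * p) = (2::real) powr real_of_int (\<omega> i)"
        by (simp add: powr_add[symmetric] algebra_simps)
      moreover have "u * (\<Gamma> * (\<Gamma> * (x * y * w))) = x * (u * y) * \<Gamma>\<^sup>2 * w" for u x y w :: real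
        by (simp add: power2_eq_square)
      ultimately show ?thesis by (simp only:)
    qed
    finally show "lp (b * p) (\<lambda>k. ennreal (2 powr ((1 - p) * real_of_int (\<omega> i))) * (ennreal \<Gamma> * S i (k + \<omega> i)))
      \<le> ennreal (2 powr p * 2 powr real_of_int (\<omega> i) * \<Gamma>\<^sup>2 * Y powr p)"
      by (simp only: lp_cmult[OF bp])
  qed simp
  also have "\<dots> = ennreal (2 powr (p + 1) * (\<Sum>i\<in>I. 2 powr p * 2 powr real_of_int (\<omega> i) * \<Gamma>\<^sup>2 * Y powr p))"
  proof -
    have "(\<Sum>i\<in>I. ennreal (2 powr p * 2 powr real_of_int (\<omega> i) * \<Gamma>\<^sup>2 * Y powr p))
       = ennreal (\<Sum>i\<in>I. 2 powr p * 2 powr real_of_int (\<omega> i) * \<Gamma>\<^sup>2 * Y powr p)" by (rule sum_ennreal) simp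
    then show ?thesis by (simp only: ennreal_mult' powr_ge_zero)
  qed
  also have "\<dots> \<le> ennreal (2 powr (2 * p + 1) * \<Gamma>\<^sup>2 * Y powr p)"
  proof (rule ennreal_leI)
    have "2 powr (p + 1) * (\<Sum>i\<in>I. 2 powr p * 2 powr real_of_int (\<omega> i) * \<Gamma>\<^sup>2 * Y powr p)
      = (2 powr (p + 1) * 2 powr p * \<Gamma>\<^sup>2 * Y powr p) * (\<Sum>i\<in>I. 2 powr real_of_int (\<omega> i))"
      by (simp add: sum_distrib_left mult.assoc mult.left_commute mult.commute)
    also have "\<dots> \<le> (2 powr (p + 1) * 2 powr p * \<Gamma>\<^sup>2 * Y powr p) * 1"
      by (intro mult_left_mono sum\<omega>) auto
    also have "\<dots> = 2 powr (2 * p + 1) * \<Gamma>\<^sup>2 * Y powr p"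
      by (simp add: powr_add[symmetric])
    finally show "2 powr (p + 1) * (\<Sum>i\<in>I. 2 powr p * 2 powr real_of_int (\<omega> i) * \<Gamma>\<^sup>2 * Y powr p) \<le> 2 powr (2 * p + 1) * \<Gamma>\<^sup>2 * Y powr p" .
  qed
  finally have "dl p b M (\<lambda>x. ennreal (\<Sum>i\<in>I. g i x)) \<le> epowr (ennreal (2 powr (2 * p + 1) * \<Gamma>\<^sup>2 * Y powr p)) (1 / p)"
    using p by (subst (asm) epowr_le_iff) auto
  also have "\<dots> = ennreal ((2 powr (2 * p + 1) * \<Gamma>\<^sup>2) powr (1 / p) * Y)"
    using Y p by (simp add: powr_mult powr_powr)
  finally show ?thesis unfolding \<Gamma>_def Y_def \<tau>_def .
qed

subsection \<open>The triangle inequality, second exponent below the first\<close>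

text \<open>With indices bounded below by \<open>- n\<close> the union is the set of least index, as
  the sets decrease; then \<open>n\<close> tends to infinity. \<open>K\<close> may be unbounded
  below, in which case the union need not be one of the sets.\<close>

lemma emeasure_nested_Union_le:
  fixes E :: "int \<Rightarrow> 'a set"
  assumes E: "\<And>k. E k \<in> sets M" and anti: "\<And>j k. j \<le> k \<Longrightarrow> E k \<subseteq> E j" and B: "\<And>k. k \<in> K \<Longrightarrow> emeasure M (E k) \<le> B"
  shows "emeasure M (\<Union>k\<in>K. E k) \<le> B"
proof -
  define F where "F n = (\<Union>k\<in>{k\<in>K. - int n \<le> k}. E k)" for n :: nat
  have F: "F n \<in> sets M" for n unfolding F_def using E by (intro sets.countable_UN'') auto
  have "emeasure M (F n) \<le> B" for n
  proof (cases "\<exists>k. k \<in> K \<and> - int n \<le> k")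
    case True
    then obtain k0 where k0: "k0 \<in> K \<and> - int n \<le> k0" "\<And>k. k \<in> K \<and> - int n \<le> k \<Longrightarrow> nat (k0 + int n) \<le> nat (k + int n)"
      using ex_has_least_nat[of "\<lambda>k. k \<in> K \<and> - int n \<le> k" _ "\<lambda>k. nat (k + int n)"] by metis
    have "E k \<subseteq> E k0" if k: "k \<in> K \<and> - int n \<le> k" for k
    proof (rule anti)
      have "nat (k0 + int n) \<le> nat (k + int n)" using k0(2)[OF k] .
      then show "k0 \<le> k" using k0(1) k by linarith
    qed
    then have "F n \<subseteq> E k0" by (auto simp: F_def)
    then have "emeasure M (F n) \<le> emeasure M (E k0)" by (intro emeasure_mono E)
    then show ?thesis using B k0 order_trans by blast
  next
    case False
    then have "F n = {}" by (auto simp: F_def)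
    then show ?thesis by simp
  qed
  then have "(SUP n. emeasure M (F n)) \<le> B" by (intro SUP_least)
  moreover have "(SUP n. emeasure M (F n)) = emeasure M (\<Union>n. F n)"
    using F by (intro SUP_emeasure_incseq) (auto simp: incseq_def F_def)
  moreover have "(\<Union>n. F n) = (\<Union>k\<in>K. E k)"
  proof -
    have "\<exists>n. - int n \<le> k" for k :: int by (intro exI[of _ "nat (- k)"]) simp
    then show ?thesis by (fastforce simp: F_def)
  qed
  ultimately show ?thesis by simp
qed

text \<open>Kolmogorov's inequality: the hypothesis places \<open>v\<close> in weak
  \<open>L^(1/\<sigma>)\<close>. Low layers are bounded by the measure of \<open>U\<close>, high
  ones by the weak bound.\<close>

lemma weak_weight_integral_le:
  fixes v :: "'a \<Rightarrow> ennreal"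
  assumes [measurable]: "v \<in> borel_measurable M" and U[measurable]: "U \<in> sets M" and \<sigma>: "0 < \<sigma>" "\<sigma> < 1"
    and v: "\<And>j::int. emeasure M {x \<in> space M. ennreal (2 powr real_of_int j) < v x} \<le> ennreal (2 powr (- (1 / \<sigma>) * real_of_int j))"
  shows "(\<integral>\<^sup>+ x. v x * indicator U x \<partial>M) \<le> ennreal (4 + 2 / (1 - 2 powr (- (1 / \<sigma> - 1)))) * epowr (emeasure M U) (1 - \<sigma>)"
proof -
  define \<tau> where "\<tau> = 1 / \<sigma> - 1"
  have \<tau>: "0 < \<tau>" using \<sigma> by (simp add: \<tau>_def)
  have \<Gamma>: "0 \<le> 2 / (1 - 2 powr (- \<tau>))" using \<tau> powr_less_one[of 2 "- \<tau>"] by simp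
  show ?thesis
  proof (cases "emeasure M U")
    case top
    have "0 < 4 + 2 / (1 - 2 powr (- \<tau>))" using \<Gamma> by (intro add_pos_nonneg) auto
    then show ?thesis using top by (simp add: \<tau>_def ennreal_mult_top)
  next
    case (real w)
    show ?thesis
    proof (cases "w = 0")
      case True
      then have "U \<in> null_sets M" using real by (auto simp: null_sets_def)
      then have "AE x in M. v x * indicator U x = 0" using AE_not_in[of U M] by (auto elim!: eventually_mono)
      then have "(\<integral>\<^sup>+ x. v x * indicator U x \<partial>M) = (\<integral>\<^sup>+ x. 0 \<partial>M)" by (rule nn_integral_cong_AE)
      then show ?thesis by simp
    next
      case False
      then have w: "0 < w" using real by simp
      let ?V = "\<lambda>j. {x \<in> space M. ennreal (2 powr real_of_int j) < v x}"
      \<comment> \<open>\<open>w powr - \<sigma>\<close> is the height at which the two bounds for a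
        layer agree.\<close>
      define J where "J = \<lfloor>log 2 (w powr - \<sigma>)\<rfloor>"
      have J: "2 powr real_of_int J \<le> w powr - \<sigma>" "w powr - \<sigma> \<le> 2 powr real_of_int (J + 1)"
        using floor_log2_bounds[of "w powr - \<sigma>"] w by (auto simp: J_def less_imp_le)
      have "(\<integral>\<^sup>+ x. v x * indicator U x \<partial>M)
        \<le> (\<integral>\<^sup>+ x. \<integral>\<^sup>+ j. ennreal (2 powr real_of_int (j + 1)) * indicator (U \<inter> ?V j) x \<partial>count_space UNIV \<partial>M)"
      proof (intro nn_integral_mono)
        fix x assume x: "x \<in> space M"
        have "epowr (v x) 1 \<le> (\<integral>\<^sup>+ l. ennreal ((1 * 2 powr (1 * (real_of_int l + 1))) powr 1) *
          indicator {l. ennreal (1 * 2 powr (1 * real_of_int l)) < v x} l \<partial>count_space UNIV)" by (rule epowr_layer) auto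
        then have "v x \<le> (\<integral>\<^sup>+ j. ennreal (2 powr real_of_int (j + 1)) * indicator (?V j) x \<partial>count_space UNIV)"
          using x by (simp add: indicator_def)
        then have "v x * indicator U x \<le> (\<integral>\<^sup>+ j. ennreal (2 powr real_of_int (j + 1)) * indicator (?V j) x \<partial>count_space UNIV) * indicator U x"
          by (rule mult_right_mono) simp
        then show "v x * indicator U x \<le> (\<integral>\<^sup>+ j. ennreal (2 powr real_of_int (j + 1)) * indicator (U \<inter> ?V j) x \<partial>count_space UNIV)"
          by (cases "x \<in> U") (auto simp: indicator_def)
      qed
      also have "\<dots> = (\<integral>\<^sup>+ j. \<integral>\<^sup>+ x. ennreal (2 powr real_of_int (j + 1)) * indicator (U \<inter> ?V j) x \<partial>M \<partial>count_space UNIV)"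
        by (rule nn_integral_count_space_nn_integral) auto
      also have "\<dots> = (\<integral>\<^sup>+ j. ennreal (2 powr real_of_int (j + 1)) * emeasure M (U \<inter> ?V j) \<partial>count_space UNIV)"
        by (intro nn_integral_cong nn_integral_cmult_indicator) measurable
      also have "\<dots> \<le> (\<integral>\<^sup>+ j. ennreal (2 * w) * (ennreal (2 powr (1 * real_of_int j)) * indicator {..J} j)
          + 2 * (ennreal (2 powr (- \<tau> * real_of_int j)) * indicator {J + 1..} j) \<partial>count_space UNIV)"
      proof (intro nn_integral_mono)
        fix j :: int
        have two: "ennreal (2 powr real_of_int (j + 1)) = 2 * ennreal (2 powr real_of_int j)"
          by (simp add: powr_add ennreal_mult mult.commute)
        have 1: "emeasure M (U \<inter> ?V j) \<le> ennreal w" using emeasure_mono[of "U \<inter> ?V j" U M] real by simp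
        have 2: "emeasure M (U \<inter> ?V j) \<le> ennreal (2 powr (- (1 / \<sigma>) * real_of_int j))"
          by (rule order_trans[OF emeasure_mono v]) auto
        show "ennreal (2 powr real_of_int (j + 1)) * emeasure M (U \<inter> ?V j)
          \<le> ennreal (2 * w) * (ennreal (2 powr (1 * real_of_int j)) * indicator {..J} j) + 2 * (ennreal (2 powr (- \<tau> * real_of_int j)) * indicator {J + 1..} j)"
        proof (cases "j \<le> J")
          case True
          have "ennreal (2 powr real_of_int (j + 1)) * emeasure M (U \<inter> ?V j) \<le> ennreal (2 powr real_of_int (j + 1)) * ennreal w"
            using 1 by (rule mult_left_mono) simp
          also have "\<dots> = ennreal (2 * w) * ennreal (2 powr (1 * real_of_int j))"
            unfolding two using w by (simp add: ennreal_mult ac_simps)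
          finally show ?thesis using True by simp
        next
          case False
          have "ennreal (2 powr real_of_int (j + 1)) * emeasure M (U \<inter> ?V j) \<le> ennreal (2 powr real_of_int (j + 1)) * ennreal (2 powr (- (1 / \<sigma>) * real_of_int j))"
            using 2 by (rule mult_left_mono) simp
          also have "\<dots> = 2 * ennreal (2 powr real_of_int j * 2 powr (- (1 / \<sigma>) * real_of_int j))"
            unfolding two by (simp add: ennreal_mult mult.assoc)
          also have "2 powr real_of_int j * 2 powr (- (1 / \<sigma>) * real_of_int j) = (2::real) powr (- \<tau> * real_of_int j)"
            unfolding powr_add[symmetric] by (simp add: \<tau>_def algebra_simps)
          finally show ?thesis using False by simp
        qed
      qed
      also have "\<dots> = ennreal (2 * w) * ennreal (2 powr (1 * real_of_int J) / (1 - 2 powr (- 1)))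
          + 2 * ennreal (2 powr (- \<tau> * real_of_int (J + 1)) / (1 - 2 powr (- \<tau>)))"
        unfolding geom_int_up[OF \<tau>, symmetric] geom_int_down[OF zero_less_one, symmetric]
        by (subst nn_integral_add) (simp_all add: nn_integral_cmult)
      also have "\<dots> \<le> ennreal (4 * w powr (1 - \<sigma>)) + ennreal (2 / (1 - 2 powr (- \<tau>)) * w powr (1 - \<sigma>))"
      proof (intro add_mono)
        have "2 * w * (2 powr (1 * real_of_int J) / (1 - 2 powr (- 1))) = 4 * w * 2 powr real_of_int J"
          by (simp add: powr_minus)
        also have "\<dots> \<le> 4 * w * w powr - \<sigma>" using J w by (intro mult_left_mono) auto
        also have "\<dots> = 4 * w powr (1 - \<sigma>)" using w by (simp add: powr_diff powr_minus_divide)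
        finally have "ennreal (2 * w * (2 powr (1 * real_of_int J) / (1 - 2 powr (- 1)))) \<le> ennreal (4 * w powr (1 - \<sigma>))" by (rule ennreal_leI)
        then show "ennreal (2 * w) * ennreal (2 powr (1 * real_of_int J) / (1 - 2 powr (- 1))) \<le> ennreal (4 * w powr (1 - \<sigma>))"
          using w by (subst ennreal_mult'[symmetric]) auto
      next
        have "2 powr (- \<tau> * real_of_int (J + 1)) = (2 powr real_of_int (J + 1)) powr - \<tau>" by (simp add: powr_powr mult.commute)
        also have "\<dots> \<le> (w powr - \<sigma>) powr - \<tau>" using J w \<tau> by (intro powr_mono2') auto
        also have "\<dots> = w powr (1 - \<sigma>)" using \<sigma> by (simp add: powr_powr \<tau>_def algebra_simps)
        finally have "2 * (2 powr (- \<tau> * real_of_int (J + 1)) / (1 - 2 powr (- \<tau>))) \<le> 2 / (1 - 2 powr (- \<tau>)) * w powr (1 - \<sigma>)"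
          using mult_left_mono[of _ "w powr (1 - \<sigma>)" "2 / (1 - 2 powr (- \<tau>))"] \<Gamma> by fastforce
        then have "ennreal (2 * (2 powr (- \<tau> * real_of_int (J + 1)) / (1 - 2 powr (- \<tau>)))) \<le> ennreal (2 / (1 - 2 powr (- \<tau>)) * w powr (1 - \<sigma>))"
          by (rule ennreal_leI)
        then show "2 * ennreal (2 powr (- \<tau> * real_of_int (J + 1)) / (1 - 2 powr (- \<tau>))) \<le> ennreal (2 / (1 - 2 powr (- \<tau>)) * w powr (1 - \<sigma>))"
          by (subst (asm) ennreal_mult') auto
      qed
      also have "\<dots> = ennreal ((4 + 2 / (1 - 2 powr (- \<tau>))) * w powr (1 - \<sigma>))"
        using \<Gamma> by (subst ennreal_plus[symmetric]) (auto simp: distrib_right)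
      also have "\<dots> = ennreal (4 + 2 / (1 - 2 powr (- \<tau>))) * epowr (emeasure M U) (1 - \<sigma>)"
        using \<Gamma> w real by (simp add: ennreal_mult)
      finally show ?thesis unfolding \<tau>_def .
    qed
  qed
qed

text \<open>For second exponent \<open>s = 1/b < p\<close> the norm is linearised by a weight
  \<open>v\<close> built from the sum \<open>G\<close> itself. The \<open>s\<close>-th power of the
  norm of \<open>G\<close> is at most twice the integral of \<open>v * G powr s\<close>, and for any
  function the corresponding integral is at most a constant times the \<open>s\<close>-th power of
  its norm, because \<open>v\<close> is in weak \<open>L^(1/\<sigma>)\<close>. What remains is
  Minkowski's inequality in \<open>L^s\<close> with density \<open>v\<close>.\<close>

lemma dl_sum_le_strong:
  fixes g :: "'i \<Rightarrow> 'a \<Rightarrow> real"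
  assumes p: "1 < p" and b: "b \<le> 1" "1 < b * p"
    and I: "finite I" and gm[measurable]: "\<And>i. i \<in> I \<Longrightarrow> g i \<in> borel_measurable M" and g0: "\<And>i x. i \<in> I \<Longrightarrow> 0 \<le> g i x"
    and fin: "\<And>t. 0 < t \<Longrightarrow> distr_fun M (\<lambda>x. ennreal (\<Sum>i\<in>I. g i x)) t < \<infinity>"
  shows "dl p b M (\<lambda>x. ennreal (\<Sum>i\<in>I. g i x))
    \<le> ennreal ((2 * 2 powr (1 / b) * (4 + 2 / (1 - 2 powr (- (1 / (1 - 1 / (b * p)) - 1))))) powr b) * (\<Sum>i\<in>I. dl p b M (\<lambda>x. ennreal (g i x)))"
proof -
  define s where "s = 1 / b"
  have b0: "0 < b" using b p by (smt (verit) mult_nonpos_nonneg)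
  have s: "1 \<le> s" "s < p" "0 < s" using b b0 p by (auto simp: s_def field_simps)
  define \<sigma> where "\<sigma> = 1 - s / p"
  have \<sigma>: "0 < \<sigma>" "\<sigma> < 1" using s p by (auto simp: \<sigma>_def)
  define K where "K = 4 + 2 / (1 - 2 powr (- (1 / \<sigma> - 1)))"
  have K: "0 \<le> K"
  proof -
    have "0 < 1 / \<sigma> - 1" using \<sigma> by simp
    then have "2 powr (- (1 / \<sigma> - 1)) < (1::real)" by (intro powr_less_one) auto
    then show ?thesis by (simp add: K_def)
  qed
  define G where "G x = (\<Sum>i\<in>I. g i x)" for x
  have [measurable]: "G \<in> borel_measurable M" unfolding G_def by measurable
  have G0: "0 \<le> G x" for x unfolding G_def using g0 by (intro sum_nonneg)
  define E where "E k = {x \<in> space M. 2 powr real_of_int k < G x}" for k :: int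
  have E[measurable]: "E k \<in> sets M" for k unfolding E_def by measurable
  define m where "m k = emeasure M (E k)" for k
  have mD: "m k = distr_fun M (\<lambda>x. ennreal (G x)) (2 powr real_of_int k)" for k
    by (simp add: distr_fun_measurable m_def E_def ennreal_less_iff)
  have mfin: "m k < top" for k unfolding mD G_def using fin[of "2 powr real_of_int k"] by simp
  \<comment> \<open>The weight that turns the measure \<open>m k\<close> into its power
    \<open>s / p\<close>, which is what the norm contains; \<open>mfin\<close> makes
    \<open>enn2real\<close> faithful here.\<close>
  define c where "c k = (if m k = 0 then 0 else ennreal (enn2real (m k) powr (- \<sigma>)))" for k
  have cm: "c k * m k = epowr (m k) (s / p)" for k
  proof (cases "m k = 0")
    case False
    define w where "w = enn2real (m k)"
    have w: "m k = ennreal w" "0 < w" using False mfin[of k]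
      by (auto simp: w_def enn2real_positive_iff zero_less_iff_neq_zero)
    have "w powr (- \<sigma>) * w = w powr (1 - \<sigma>)" using w by (simp add: powr_diff powr_minus_divide)
    then show ?thesis using False w by (simp add: c_def w_def[symmetric] ennreal_mult[symmetric] \<sigma>_def)
  qed simp
  define v where "v x = (SUP k. c k * indicator (E k) x)" for x
  have [measurable]: "v \<in> borel_measurable M" unfolding v_def by measurable
  have anti: "E k \<subseteq> E j" if "j \<le> k" for j k
  proof -
    have "2 powr real_of_int j \<le> 2 powr real_of_int k" using that by simp
    from le_less_trans[OF this] show ?thesis unfolding E_def by blast
  qed
  \<comment> \<open>Where \<open>v\<close> exceeds \<open>2^j\<close>, the point lies in some
    \<open>E k\<close> with \<open>c k > 2^j\<close>, hence of measure at most
    \<open>2 powr (- j / \<sigma>)\<close>; the sets \<open>E k\<close> are nested.\<close>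
  have vlevel: "emeasure M {x \<in> space M. ennreal (2 powr real_of_int j) < v x} \<le> ennreal (2 powr (- (1 / \<sigma>) * real_of_int j))" for j :: int
  proof -
    let ?K = "{k. ennreal (2 powr real_of_int j) < c k}"
    have "{x \<in> space M. ennreal (2 powr real_of_int j) < v x} \<subseteq> (\<Union>k\<in>?K. E k)"
    proof
      fix x assume "x \<in> {x \<in> space M. ennreal (2 powr real_of_int j) < v x}"
      then obtain k where "ennreal (2 powr real_of_int j) < c k * indicator (E k) x" unfolding v_def by (auto simp: less_SUP_iff)
      then show "x \<in> (\<Union>k\<in>?K. E k)" by (cases "x \<in> E k") auto
    qed
    then have "emeasure M {x \<in> space M. ennreal (2 powr real_of_int j) < v x} \<le> emeasure M (\<Union>k\<in>?K. E k)"
      by (intro emeasure_mono sets.countable_UN'') auto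
    also have "\<dots> \<le> ennreal (2 powr (- (1 / \<sigma>) * real_of_int j))"
    proof (rule emeasure_nested_Union_le[OF E anti])
      fix k assume k: "k \<in> ?K"
      define w where "w = enn2real (m k)"
      have nz: "m k \<noteq> 0" using k by (auto simp: c_def)
      then have w: "m k = ennreal w" "0 < w" using mfin[of k]
        by (auto simp: w_def enn2real_positive_iff zero_less_iff_neq_zero)
      have "2 powr real_of_int j < w powr (- \<sigma>)" using k nz by (simp add: c_def w_def ennreal_less_iff)
      then have "(w powr (- \<sigma>)) powr (- (1 / \<sigma>)) \<le> (2 powr real_of_int j) powr (- (1 / \<sigma>))"
        using \<sigma> by (intro powr_mono2') auto
      then have "w \<le> 2 powr (- (1 / \<sigma>) * real_of_int j)" using w \<sigma> by (simp add: powr_powr mult.commute)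
      then show "emeasure M (E k) \<le> ennreal (2 powr (- (1 / \<sigma>) * real_of_int j))"
        using w by (simp add: m_def[symmetric] ennreal_leI)
    qed
    finally show ?thesis .
  qed
  have upper: "(\<integral>\<^sup>+ x. v x * epowr (ennreal (u x)) s \<partial>M) \<le> ennreal (2 powr s * K) * epowr (dl p b M (\<lambda>x. ennreal (u x))) s"
    if u[measurable]: "u \<in> borel_measurable M" and u0: "\<And>x. 0 \<le> u x" for u :: "'a \<Rightarrow> real"
  proof -
    let ?U = "\<lambda>j. {x \<in> space M. 2 powr real_of_int j < u x}"
    have "(\<integral>\<^sup>+ x. v x * epowr (ennreal (u x)) s \<partial>M)
       \<le> (\<integral>\<^sup>+ x. \<integral>\<^sup>+ j. ennreal (2 powr (s * real_of_int (j + 1))) * (v x * indicator (?U j) x) \<partial>count_space UNIV \<partial>M)"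
    proof (intro nn_integral_mono)
      fix x assume x: "x \<in> space M"
      have "epowr (ennreal (u x)) s \<le> (\<integral>\<^sup>+ l. ennreal ((1 * 2 powr (1 * (real_of_int l + 1))) powr s) *
          indicator {l. ennreal (1 * 2 powr (1 * real_of_int l)) < ennreal (u x)} l \<partial>count_space UNIV)" using s by (intro epowr_layer) auto
      also have "\<dots> = (\<integral>\<^sup>+ j. ennreal (2 powr (s * real_of_int (j + 1))) * indicator (?U j) x \<partial>count_space UNIV)"
        using x by (intro nn_integral_cong) (simp add: indicator_def ennreal_less_iff powr_powr mult.commute)
      finally have "v x * epowr (ennreal (u x)) s \<le> v x * (\<integral>\<^sup>+ j. ennreal (2 powr (s * real_of_int (j + 1))) * indicator (?U j) x \<partial>count_space UNIV)"
        by (rule mult_left_mono) simp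
      also have "\<dots> = (\<integral>\<^sup>+ j. ennreal (2 powr (s * real_of_int (j + 1))) * (v x * indicator (?U j) x) \<partial>count_space UNIV)"
        by (subst nn_integral_cmult[symmetric]) (auto intro!: nn_integral_cong simp: ac_simps)
      finally show "v x * epowr (ennreal (u x)) s \<le> (\<integral>\<^sup>+ j. ennreal (2 powr (s * real_of_int (j + 1))) * (v x * indicator (?U j) x) \<partial>count_space UNIV)" .
    qed
    also have "\<dots> = (\<integral>\<^sup>+ j. \<integral>\<^sup>+ x. ennreal (2 powr (s * real_of_int (j + 1))) * (v x * indicator (?U j) x) \<partial>M \<partial>count_space UNIV)"
      by (rule nn_integral_count_space_nn_integral) auto
    also have "\<dots> = (\<integral>\<^sup>+ j. ennreal (2 powr (s * real_of_int (j + 1))) * (\<integral>\<^sup>+ x. v x * indicator (?U j) x \<partial>M) \<partial>count_space UNIV)"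
      by (intro nn_integral_cong nn_integral_cmult) measurable
    also have "\<dots> \<le> (\<integral>\<^sup>+ j. ennreal (2 powr (s * real_of_int (j + 1))) * (ennreal K * epowr (emeasure M (?U j)) (1 - \<sigma>)) \<partial>count_space UNIV)"
      unfolding K_def by (intro nn_integral_mono mult_left_mono weak_weight_integral_le vlevel \<sigma>) auto
    also have "\<dots> = (\<integral>\<^sup>+ j. ennreal (2 powr s * K) * epowr (lev p (distr_fun M (\<lambda>x. ennreal (u x))) j) (1 / b) \<partial>count_space UNIV)"
    proof (intro nn_integral_cong)
      fix j :: int
      have "distr_fun M (\<lambda>x. ennreal (u x)) (2 powr real_of_int j) = emeasure M (?U j)"
        by (simp add: distr_fun_measurable ennreal_less_iff)
      moreover have "2 powr (s * real_of_int (j + 1)) = 2 powr s * (2::real) powr (real_of_int j * s)"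
        by (simp add: powr_add[symmetric] algebra_simps)
      ultimately show "ennreal (2 powr (s * real_of_int (j + 1))) * (ennreal K * epowr (emeasure M (?U j)) (1 - \<sigma>))
         = ennreal (2 powr s * K) * epowr (lev p (distr_fun M (\<lambda>x. ennreal (u x))) j) (1 / b)"
        using s p K by (simp add: lev_def s_def[symmetric] epowr_mult epowr_epowr powr_powr \<sigma>_def ennreal_mult ac_simps)
    qed
    also have "\<dots> = ennreal (2 powr s * K) * epowr (dl p b M (\<lambda>x. ennreal (u x))) s"
      unfolding dl_def s_def using b0 by (simp add: nn_integral_cmult epowr_lp)
    finally show ?thesis .
  qed
  \<comment> \<open>At a point \<open>x\<close> the sum over \<open>k\<close> runs over
    \<open>2^k < G x\<close>, a geometric series of size \<open>G x powr s\<close>, in which every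
    \<open>c k\<close> is at most \<open>v x\<close>.\<close>
  have lower: "epowr (dl p b M (\<lambda>x. ennreal (G x))) s \<le> 2 * (\<integral>\<^sup>+ x. v x * epowr (ennreal (G x)) s \<partial>M)"
  proof -
    have "epowr (dl p b M (\<lambda>x. ennreal (G x))) s = (\<integral>\<^sup>+ k. epowr (lev p (distr_fun M (\<lambda>x. ennreal (G x))) k) (1 / b) \<partial>count_space UNIV)"
      unfolding dl_def s_def using b0 by (rule epowr_lp)
    also have "\<dots> = (\<integral>\<^sup>+ k. \<integral>\<^sup>+ x. ennreal (2 powr (s * real_of_int k)) * c k * indicator (E k) x \<partial>M \<partial>count_space UNIV)"
    proof (intro nn_integral_cong)
      fix k :: int
      have "epowr (lev p (distr_fun M (\<lambda>x. ennreal (G x))) k) (1 / b) = ennreal (2 powr (s * real_of_int k)) * epowr (m k) (s / p)"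
        using s p by (simp add: lev_def s_def[symmetric] epowr_mult epowr_epowr powr_powr mD mult.commute)
      also have "\<dots> = (ennreal (2 powr (s * real_of_int k)) * c k) * emeasure M (E k)"
        unfolding cm[symmetric] by (simp add: m_def mult.assoc)
      also have "\<dots> = (\<integral>\<^sup>+ x. ennreal (2 powr (s * real_of_int k)) * c k * indicator (E k) x \<partial>M)"
        by (rule nn_integral_cmult_indicator[symmetric]) measurable
      finally show "epowr (lev p (distr_fun M (\<lambda>x. ennreal (G x))) k) (1 / b) = (\<integral>\<^sup>+ x. ennreal (2 powr (s * real_of_int k)) * c k * indicator (E k) x \<partial>M)" .
    qed
    also have "\<dots> = (\<integral>\<^sup>+ x. \<integral>\<^sup>+ k. ennreal (2 powr (s * real_of_int k)) * c k * indicator (E k) x \<partial>count_space UNIV \<partial>M)"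
      by (rule nn_integral_count_space_nn_integral[symmetric]) auto
    also have "\<dots> \<le> (\<integral>\<^sup>+ x. 2 * (v x * epowr (ennreal (G x)) s) \<partial>M)"
    proof (intro nn_integral_mono)
      fix x assume x: "x \<in> space M"
      show "(\<integral>\<^sup>+ k. ennreal (2 powr (s * real_of_int k)) * c k * indicator (E k) x \<partial>count_space UNIV) \<le> 2 * (v x * epowr (ennreal (G x)) s)"
      proof (cases "G x = 0")
        case True
        then have "x \<notin> E k" for k by (auto simp: E_def)
        then show ?thesis by simp
      next
        case False
        then have z: "0 < G x" using G0[of x] by simp
        define L where "L = \<lfloor>log 2 (G x)\<rfloor>"
        have "(\<integral>\<^sup>+ k. ennreal (2 powr (s * real_of_int k)) * c k * indicator (E k) x \<partial>count_space UNIV)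
          \<le> (\<integral>\<^sup>+ k. v x * (ennreal (2 powr (s * real_of_int k)) * indicator {..L} k) \<partial>count_space UNIV)"
        proof (intro nn_integral_mono)
          fix k :: int
          show "ennreal (2 powr (s * real_of_int k)) * c k * indicator (E k) x \<le> v x * (ennreal (2 powr (s * real_of_int k)) * indicator {..L} k)"
          proof (cases "x \<in> E k")
            case True
            then have "real_of_int k < log 2 (G x)" using z by (simp add: E_def less_log_iff)
            then have k: "k \<le> L" by (simp add: L_def le_floor_iff)
            have "c k * indicator (E k) x \<le> v x" unfolding v_def by (rule SUP_upper) simp
            then have "c k \<le> v x" using True by simp
            then show ?thesis using True k by (simp add: mult.commute mult_right_mono)
          qed simp
        qed
        also have "\<dots> = v x * ennreal (2 powr (s * real_of_int L) / (1 - 2 powr (- s)))"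
          unfolding geom_int_down[OF s(3), symmetric] by (rule nn_integral_cmult) simp
        also have "\<dots> \<le> v x * ennreal (2 * G x powr s)"
        proof (intro mult_left_mono ennreal_leI)
          have "2 powr (s * real_of_int L) = (2 powr real_of_int L) powr s" by (simp add: powr_powr mult.commute)
          also have "\<dots> \<le> G x powr s" using floor_log2_bounds(1)[OF z] s by (intro powr_mono2) (auto simp: L_def)
          finally have 1: "2 powr (s * real_of_int L) \<le> G x powr s" .
          have "2 powr (- s) \<le> (2::real) powr (- 1)" using s by (intro powr_mono) auto
          then have 2: "1 / 2 \<le> 1 - (2::real) powr (- s)" by (simp add: powr_minus)
          have "2 powr (s * real_of_int L) / (1 - 2 powr (- s)) \<le> G x powr s / (1 / 2)"
            using 1 2 by (intro frac_le) auto
          then show "2 powr (s * real_of_int L) / (1 - 2 powr (- s)) \<le> 2 * G x powr s" by simp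
        qed simp
        also have "\<dots> = 2 * (v x * epowr (ennreal (G x)) s)" using z by (simp add: ennreal_mult ac_simps)
        finally show ?thesis .
      qed
    qed
    also have "\<dots> = 2 * (\<integral>\<^sup>+ x. v x * epowr (ennreal (G x)) s \<partial>M)" by (rule nn_integral_cmult) measurable
    finally show ?thesis .
  qed
  let ?N = "\<lambda>u. epowr (\<integral>\<^sup>+ x. epowr (ennreal (u x)) s \<partial>density M v) (1 / s)"
  have dens: "(\<integral>\<^sup>+ x. epowr (ennreal (u x)) s \<partial>density M v) = (\<integral>\<^sup>+ x. v x * epowr (ennreal (u x)) s \<partial>M)"
    if [measurable]: "u \<in> borel_measurable M" for u :: "'a \<Rightarrow> real" by (rule nn_integral_density) measurable
  have "dl p b M (\<lambda>x. ennreal (G x)) \<le> epowr (2 * (\<integral>\<^sup>+ x. v x * epowr (ennreal (G x)) s \<partial>M)) (1 / s)"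
    using lower s by (subst (asm) epowr_le_iff) auto
  also have "\<dots> = epowr 2 (1 / s) * ?N G" using s by (simp add: epowr_mult dens)
  also have "?N G \<le> (\<Sum>i\<in>I. ?N (g i))"
  proof -
    have "ennreal (G x) = (\<Sum>i\<in>I. ennreal (g i x))" for x unfolding G_def using g0 by (simp add: sum_ennreal)
    then have "?N G = epowr (\<integral>\<^sup>+ x. epowr (\<Sum>i\<in>I. ennreal (g i x)) s \<partial>density M v) (1 / s)" by simp
    also have "\<dots> \<le> (\<Sum>i\<in>I. ?N (g i))" using I s by (intro minkowski_sum) auto
    finally show ?thesis .
  qed
  also have "(\<Sum>i\<in>I. ?N (g i)) \<le> (\<Sum>i\<in>I. epowr (ennreal (2 powr s * K)) (1 / s) * dl p b M (\<lambda>x. ennreal (g i x)))"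
  proof (rule sum_mono)
    fix i assume i: "i \<in> I"
    have "?N (g i) \<le> epowr (ennreal (2 powr s * K) * epowr (dl p b M (\<lambda>x. ennreal (g i x))) s) (1 / s)"
      unfolding dens[OF gm[OF i]] using s upper[OF gm[OF i] g0[OF i]] by (intro epowr_mono) auto
    also have "\<dots> = epowr (ennreal (2 powr s * K)) (1 / s) * dl p b M (\<lambda>x. ennreal (g i x))"
      using s by (simp add: epowr_mult epowr_inverse)
    finally show "?N (g i) \<le> epowr (ennreal (2 powr s * K)) (1 / s) * dl p b M (\<lambda>x. ennreal (g i x))" .
  qed
  finally have "dl p b M (\<lambda>x. ennreal (G x)) \<le> epowr 2 (1 / s) * (epowr (ennreal (2 powr s * K)) (1 / s) * (\<Sum>i\<in>I. dl p b M (\<lambda>x. ennreal (g i x))))"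
    by (simp add: mult_left_mono sum_distrib_left)
  also have "epowr 2 (1 / s) * (epowr (ennreal (2 powr s * K)) (1 / s) * (\<Sum>i\<in>I. dl p b M (\<lambda>x. ennreal (g i x))))
     = epowr (ennreal (2 * 2 powr s * K)) (1 / s) * (\<Sum>i\<in>I. dl p b M (\<lambda>x. ennreal (g i x)))"
    using s K by (simp add: epowr_mult ennreal_mult mult.assoc)
  also have "epowr (ennreal (2 * 2 powr s * K)) (1 / s) = ennreal ((2 * 2 powr s * K) powr b)"
    using K by (simp add: s_def)
  finally show ?thesis unfolding G_def K_def \<sigma>_def s_def by (simp add: divide_divide_eq_left)
qed

text \<open>The order of quantifiers is the point: a single constant for all numbers of summands,
  since the numbers of input pieces in the blocks are unbounded.\<close>

lemma dl_sum_le: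
  fixes g :: "'i \<Rightarrow> 'a \<Rightarrow> real"
  assumes p: "1 < p" and b: "0 \<le> b" "b \<le> 1"
  obtains C where "0 \<le> C" "\<And>(M :: 'a measure) (I :: 'i set) g. finite I \<Longrightarrow> (\<And>i. i \<in> I \<Longrightarrow> g i \<in> borel_measurable M) \<Longrightarrow>
    (\<And>i x. i \<in> I \<Longrightarrow> 0 \<le> g i x) \<Longrightarrow> (\<And>t. 0 < t \<Longrightarrow> distr_fun M (\<lambda>x. ennreal (\<Sum>i\<in>I. g i x)) t < \<infinity>) \<Longrightarrow>
    dl p b M (\<lambda>x. ennreal (\<Sum>i\<in>I. g i x)) \<le> ennreal C * (\<Sum>i\<in>I. dl p b M (\<lambda>x. ennreal (g i x)))"
proof (cases "b * p \<le> 1")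
  case False
  show ?thesis by (rule that[OF _ dl_sum_le_strong[OF p b(2)]]) (use False in auto)
next
  case True
  define C where "C = (2 powr (2 * p + 1) * (1 / (1 - 2 powr (- ((p - 1) / 2))))\<^sup>2) powr (1 / p)"
  have C: "0 < C"
  proof -
    have "2 powr (- ((p - 1) / 2)) < (1::real)" using p by (intro powr_less_one) auto
    then show ?thesis using p by (simp add: C_def)
  qed
  show ?thesis
  proof (rule that[of C])
    fix M :: "'a measure" and I :: "'i set" and g :: "'i \<Rightarrow> 'a \<Rightarrow> real"
    assume I: "finite I" and g: "\<And>i. i \<in> I \<Longrightarrow> g i \<in> borel_measurable M" "\<And>i x. i \<in> I \<Longrightarrow> 0 \<le> g i x"
    let ?d = "\<lambda>i. dl p b M (\<lambda>x. ennreal (g i x))"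
    show "dl p b M (\<lambda>x. ennreal (\<Sum>i\<in>I. g i x)) \<le> ennreal C * (\<Sum>i\<in>I. ?d i)"
    proof (cases "\<exists>i\<in>I. ?d i = top")
      case True
      then obtain i where "i \<in> I" "?d i = top" by blast
      then have "(\<Sum>i\<in>I. ?d i) = top" using member_le_sum[of i I ?d] I by (simp add: top_unique)
      then show ?thesis using C by (simp add: ennreal_mult_top)
    next
      case fin: False
      show ?thesis
      \<comment> \<open>\<open>dl_sum_le_weak\<close> asks for positive bounds \<open>y i\<close>,
        so the norms are raised by \<open>\<eta>\<close>, which then tends to 0.\<close>
      proof (rule ennreal_le_add_small[where c = "ennreal (C * card I)"])
        fix \<eta> :: real assume \<eta>: "0 < \<eta>"
        have eq: "ennreal (enn2real (?d i) + \<eta>) = ?d i + ennreal \<eta>" if "i \<in> I" for i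
          using fin that \<eta> by (simp add: less_top)
        have "dl p b M (\<lambda>x. ennreal (\<Sum>i\<in>I. g i x)) \<le> ennreal (C * (\<Sum>i\<in>I. enn2real (?d i) + \<eta>))"
          unfolding C_def using I g \<eta> eq True by (intro dl_sum_le_weak p b) (auto intro: add_nonneg_pos)
        also have "\<dots> = ennreal C * (\<Sum>i\<in>I. ennreal (enn2real (?d i) + \<eta>))"
        proof -
          have "(\<Sum>i\<in>I. ennreal (enn2real (?d i) + \<eta>)) = ennreal (\<Sum>i\<in>I. enn2real (?d i) + \<eta>)"
            using \<eta> by (intro sum_ennreal) simp
          then show ?thesis using C by (simp only: ennreal_mult' less_imp_le)
        qed
        also have "\<dots> = ennreal C * (\<Sum>i\<in>I. ?d i + ennreal \<eta>)" using eq by simp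
        also have "\<dots> = ennreal C * (\<Sum>i\<in>I. ?d i) + ennreal (C * card I) * ennreal \<eta>"
          using C \<eta> by (simp add: sum.distrib distrib_left ennreal_mult ennreal_of_nat_eq_real_of_nat mult.assoc)
        finally show "dl p b M (\<lambda>x. ennreal (\<Sum>i\<in>I. g i x)) \<le> ennreal C * (\<Sum>i\<in>I. ?d i) + ennreal (C * card I) * ennreal \<eta>" .
      qed simp
    qed
  qed (use C in simp)
qed

subsection \<open>Spaces made of blocks\<close>

text \<open>The space is a graph metric with values 0, 1, 2 on points carrying atoms. The points are
  grouped in pieces of equal atoms, of strongly increasing size; a block \<open>n\<close> consists of \<open>MM n\<close>
  input pieces and \<open>KK n\<close> output pieces, and every output point has exactly one neighbour in each
  input piece of its block. As the total measure is infinite, the only balls that count are the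
  points and the closed neighbourhoods.\<close>

locale blocks =
  fixes p :: real and X :: "'a set" and pc el :: "'a \<Rightarrow> nat" and N :: "nat \<Rightarrow> nat" and w :: "nat \<Rightarrow> real"
    and isA isD :: "nat \<Rightarrow> bool" and bl :: "nat \<Rightarrow> nat" and hh :: "nat \<Rightarrow> real" and MM KK :: "nat \<Rightarrow> nat"
  assumes p: "1 < p"
    and bij: "bij_betw (\<lambda>x. (pc x, el x)) X (Sigma UNIV (\<lambda>m. {..<N m}))"
    and w: "\<And>m. 0 < w m"
    and N0: "\<And>m. 0 < N m \<longleftrightarrow> isA m \<or> isD m"
    and excl: "\<And>m. \<not> (isA m \<and> isD m)"
    and massA: "\<And>m. isA m \<Longrightarrow> N m * w m = w m powr p"
    and massD: "\<And>m. isD m \<Longrightarrow> N m * w m = (hh (bl m) * w m) powr p"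
    and dvd: "\<And>m m'. isA m \<Longrightarrow> isD m' \<Longrightarrow> bl m = bl m' \<Longrightarrow> N m dvd N m'"
    and sep: "\<And>m m'. m' < m \<Longrightarrow> 0 < N m \<Longrightarrow> 2 ^ (m - m') * (N m' * w m') \<le> w m"
    and ord: "\<And>m m'. isA m \<Longrightarrow> isD m' \<Longrightarrow> bl m = bl m' \<Longrightarrow> m < m'"
    and finA: "\<And>n. finite {m. isA m \<and> bl m = n}" and cardA: "\<And>n. card {m. isA m \<and> bl m = n} = MM n"
    and finD: "\<And>n. finite {m. isD m \<and> bl m = n}" and cardD: "\<And>n. card {m. isD m \<and> bl m = n} = KK n"
    and MM: "\<And>n. 1 \<le> MM n" and KK: "\<And>n. 1 \<le> KK n" and hh: "\<And>n. 0 < hh n"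
begin

abbreviation "AA n \<equiv> {m. isA m \<and> bl m = n}"
abbreviation "DD n \<equiv> {m. isD m \<and> bl m = n}"

section \<open>The graph metric and the atomic measure\<close>

definition P where "P m = {x \<in> X. pc x = m}"

definition adj where
  "adj x y \<longleftrightarrow> x \<in> X \<and> y \<in> X \<and> isA (pc x) \<and> isD (pc y) \<and> bl (pc x) = bl (pc y) \<and> el x = el y mod N (pc x)"

definition \<rho> :: "'a \<Rightarrow> 'a \<Rightarrow> real" where
  "\<rho> x y = (if x = y then 0 else if adj x y \<or> adj y x then 1 else 2)"

definition \<mu> where "\<mu> = point_measure X (\<lambda>x. ennreal (w (pc x)))"

definition nb where "nb x = {y \<in> X. y = x \<or> adj x y \<or> adj y x}"

definition pt where "pt m e = inv_into X (\<lambda>x. (pc x, el x)) (m, e)"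

lemma pt: assumes "e < N m" shows "pt m e \<in> X" "pc (pt m e) = m" "el (pt m e) = e"
proof -
  have "(m, e) \<in> (\<lambda>x. (pc x, el x)) ` X" using bij assms by (auto simp: bij_betw_def)
  from inv_into_into[OF this] f_inv_into_f[OF this] show "pt m e \<in> X" "pc (pt m e) = m" "el (pt m e) = e"
    by (auto simp: pt_def)
qed

lemma el_less: "x \<in> X \<Longrightarrow> el x < N (pc x)"
  using bij by (auto simp: bij_betw_def)

lemma pt_eq: "x \<in> X \<Longrightarrow> pt (pc x) (el x) = x"
  unfolding pt_def using bij inv_into_f_f[of "\<lambda>x. (pc x, el x)" X x] by (simp add: bij_betw_def)

lemma bij_P: "bij_betw (pt m) {..<N m} (P m)"
  by (rule bij_betwI[where g = el]) (auto simp: P_def pt el_less pt_eq)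

lemma finite_P [simp]: "finite (P m)"
  using bij_betw_finite[OF bij_P[of m]] by simp

lemma card_P: "card {x \<in> P m. Q (el x)} = card {e. e < N m \<and> Q e}"
  by (rule bij_betw_same_card[of el], rule bij_betwI[where g = "pt m"]) (auto simp: P_def pt el_less pt_eq)

lemma P_empty: "\<not> 0 < N m \<Longrightarrow> P m = {}"
  using card_P[of m "\<lambda>_. True"] by (simp add: card_eq_0_iff)

sublocale Metric_space X \<rho>
proof
  fix x y z assume "x \<in> X" "y \<in> X" "z \<in> X"
  have "\<rho> x z \<le> 2" "0 \<le> \<rho> x y" "0 \<le> \<rho> y z" "x \<noteq> y \<Longrightarrow> 1 \<le> \<rho> x y" "y \<noteq> z \<Longrightarrow> 1 \<le> \<rho> y z"
    "\<rho> x x = 0" for x y z by (auto simp: \<rho>_def)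
  then show "\<rho> x z \<le> \<rho> x y + \<rho> y z"
    by (cases "x = y"; cases "y = z") (smt (verit))+
qed (auto simp: \<rho>_def)

lemma openin_any: "S \<subseteq> X \<Longrightarrow> openin mtopology S"
  unfolding openin_mtopology
proof (intro conjI allI impI)
  fix x assume "S \<subseteq> X" "x \<in> S"
  moreover have "mball x 1 \<subseteq> {x}" by (auto simp: \<rho>_def split: if_splits)
  ultimately show "\<exists>r>0. mball x r \<subseteq> S" by (intro exI[of _ 1]) auto
qed

lemma space_mu [simp]: "space \<mu> = X" by (simp add: \<mu>_def space_point_measure)

lemma sets_mu [simp]: "sets \<mu> = Pow X" by (simp add: \<mu>_def sets_point_measure)

lemma borel_mu [measurable, simp]: "f \<in> borel_measurable \<mu>" for f :: "'a \<Rightarrow> 'b::topological_space"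
  by (simp add: \<mu>_def)

sublocale mm X \<rho> \<mu> by unfold_locales (auto simp: openin_mtopology)

lemma X_ne: "X \<noteq> {}"
proof -
  have "AA 0 \<noteq> {}" using cardA[of 0] MM[of 0] by (metis card.empty not_one_le_zero)
  then obtain m where "isA m" by auto
  then have "0 < N m" using N0 by blast
  then show ?thesis using pt(1) by blast
qed

lemma mm_space_X: "mm_space X \<rho> \<mu>"
proof -
  have "{U. openin mtopology U} = Pow X" using openin_any openin_mtopology by auto
  then have "sigma_sets X {U. openin mtopology U} = Pow X"
    by (metis (no_types, lifting) sigma_sets_into_sp sigma_sets.Basic subset_antisym subsetI Pow_iff)
  then show ?thesis unfolding mm_space_def using X_ne Metric_space_axioms by simp
qed

lemma emeasure_finite: "S \<subseteq> X \<Longrightarrow> finite S \<Longrightarrow> emeasure \<mu> S = (\<Sum>x\<in>S. ennreal (w (pc x)))"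
  unfolding \<mu>_def by (rule emeasure_point_measure_finite2)

lemma emeasure_P_sub: assumes "S \<subseteq> P m" shows "emeasure \<mu> S = ennreal (card S * w m)"
proof -
  have "finite S" by (rule finite_subset[OF assms finite_P])
  moreover have "S \<subseteq> X" using assms by (auto simp: P_def)
  ultimately have "emeasure \<mu> S = (\<Sum>x\<in>S. ennreal (w (pc x)))" by (intro emeasure_finite)
  also have "\<dots> = (\<Sum>x\<in>S. ennreal (w m))" using assms by (intro sum.cong) (auto simp: P_def)
  finally show ?thesis using w[of m] by (simp add: ennreal_mult ennreal_of_nat_eq_real_of_nat)
qed

lemma emeasure_single: "x \<in> X \<Longrightarrow> emeasure \<mu> {x} = ennreal (w (pc x))"
  by (subst emeasure_finite) auto

text \<open>On an input piece \<open>massA\<close> makes \<open>mass m powr (1 / p)\<close> equal to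
  \<open>w m\<close>, so the constant \<open>1 / w m\<close> has norm of order 1 there. On an output
  piece \<open>massD\<close> makes it \<open>hh (bl m) * w m\<close>, so a value
  \<open>MM / w m\<close> has norm of order \<open>hh * MM\<close>.\<close>

definition mass where "mass m = N m * w m"

lemma card_P_all: "card (P m) = N m"
  using card_P[of m "\<lambda>_. True"] by simp

lemma emeasure_P: "emeasure \<mu> (P m) = ennreal (mass m)"
  by (simp add: emeasure_P_sub[OF subset_refl] card_P_all mass_def)

lemma mass_nonneg: "0 \<le> mass m" using w[of m] by (simp add: mass_def)

lemma mass_ge: "0 < N m \<Longrightarrow> w m \<le> mass m"
  using w[of m] by (simp add: mass_def)

section \<open>Decoupling of the norm into pieces\<close>

definition dp where "dp h m t = emeasure \<mu> {x \<in> P m. ennreal t < h x}"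

lemma dp_le: "dp h m t \<le> ennreal (mass m)"
  unfolding dp_def emeasure_P[symmetric] by (intro emeasure_mono) (auto simp: P_def)

lemma dp_ge: assumes "0 < dp h m t" shows "ennreal (w m) \<le> dp h m t" "0 < N m"
proof -
  let ?S = "{x \<in> P m. ennreal t < h x}"
  have "?S \<noteq> {}" using assms unfolding dp_def by fastforce
  then obtain x where x: "x \<in> ?S" by blast
  then have "emeasure \<mu> {x} \<le> emeasure \<mu> ?S" by (intro emeasure_mono) (auto simp: P_def)
  then show "ennreal (w m) \<le> dp h m t" using x emeasure_single[of x] by (auto simp: P_def dp_def)
  show "0 < N m" using x el_less[of x] by (auto simp: P_def)
qed

text \<open>A nonempty level set in piece \<open>m\<close> contains an atom of weight
  \<open>w m\<close>, and by \<open>sep\<close> one such atom outweighs each earlier piece by the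
  required power of 2.\<close>

lemma lacunary_dp: "lacunary (dp h)"
  unfolding lacunary_def
proof (intro allI impI)
  fix t :: real and m m' :: nat assume h: "0 < t" "m' < m" "0 < dp h m t"
  have "2 ^ (m - m') * dp h m' t \<le> 2 ^ (m - m') * ennreal (mass m')" by (intro mult_left_mono dp_le) simp
  also have "\<dots> = ennreal (2 ^ (m - m') * mass m')"
    using mass_nonneg[of m'] by (simp add: ennreal_mult ennreal_power[symmetric])
  also have "\<dots> \<le> ennreal (w m)" using sep[OF h(2)] dp_ge(2)[OF h(3)] by (intro ennreal_leI) (simp add: mass_def)
  also have "\<dots> \<le> dp h m t" by (rule dp_ge[OF h(3)])
  finally show "2 ^ (m - m') * dp h m' t \<le> dp h m t" .
qed

lemma distr_fun_mu: "distr_fun \<mu> h t = emeasure \<mu> {x \<in> X. ennreal t < h x}"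
  unfolding distr_fun_def by (subst outer_mu_sets) auto

lemma distr_fun_eq: "distr_fun \<mu> h t = (\<Sum>m. dp h m t)"
proof -
  have "(\<Sum>m. dp h m t) = emeasure \<mu> (\<Union>m. {x \<in> P m. ennreal t < h x})"
    unfolding dp_def by (rule suminf_emeasure) (auto simp: P_def disjoint_family_on_def)
  also have "(\<Union>m. {x \<in> P m. ennreal t < h x}) = {x \<in> X. ennreal t < h x}" by (auto simp: P_def)
  finally show ?thesis by (simp add: distr_fun_mu)
qed

text \<open>The discrete Lorentz norm of \<open>h\<close> cut down to the piece \<open>m\<close>;
  see \<open>pn_eq_dl\<close>.\<close>

definition pn where "pn a h m = lp a (lev p (dp h m))"

lemma dl_le_pieces: "0 \<le> a \<Longrightarrow> a \<le> 1 \<Longrightarrow> dl p a \<mu> h \<le> 2 * lp a (pn a h)"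
  unfolding dl_def pn_def[abs_def] using p by (intro lacunary_upper lacunary_dp) (auto simp: distr_fun_eq)

lemma pieces_le_dl: "0 \<le> a \<Longrightarrow> a \<le> 1 \<Longrightarrow> lp a (pn a h) \<le> ennreal (lac_const p a) * dl p a \<mu> h"
  unfolding dl_def pn_def[abs_def] using p
proof (intro lacunary_lower lacunary_dp)
  show "dp h m t \<le> distr_fun \<mu> h t" for m t
    unfolding distr_fun_mu dp_def by (intro emeasure_mono) (auto simp: P_def)
qed auto

text \<open>Every block has an input piece, so nonempty pieces of arbitrarily large index exist, and
  by \<open>sep\<close> their atoms are arbitrarily heavy. Hence balls of radius above 2 are omitted
  in \<open>maxc\<close>.\<close>

lemma emeasure_X: "emeasure \<mu> X = \<infinity>"
proof (rule ccontr)
  assume "emeasure \<mu> X \<noteq> \<infinity>"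
  then obtain c where c: "emeasure \<mu> X = ennreal c" "0 \<le> c" by (cases "emeasure \<mu> X") auto
  have ne: "\<exists>m. isA m \<and> bl m = n" for n
    using cardA[of n] MM[of n] by (metis (mono_tags, lifting) card.empty empty_Collect_eq not_one_le_zero)
  obtain m0 where m0: "isA m0" using ne[of 0] by blast
  then have w0: "w m0 \<le> mass m0" using N0 mass_ge by blast
  obtain k where k: "c / w m0 < 2 ^ k" using real_arch_pow[of 2 "c / w m0"] by auto
  have "infinite {m. isA m}"
  proof
    assume "finite {m. isA m}"
    moreover have "UNIV \<subseteq> bl ` {m. isA m}"
    proof
      fix n obtain m where "isA m" "bl m = n" using ne[of n] by blast
      then show "n \<in> bl ` {m. isA m}" by blast
    qed
    ultimately show False using finite_surj infinite_UNIV_nat by blast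
  qed
  then obtain m where m: "isA m" "m0 + k < m" unfolding infinite_nat_iff_unbounded by blast
  then have Nm: "0 < N m" using N0 by blast
  have "c < 2 ^ k * w m0" using k w[of m0] by (simp add: divide_less_eq)
  also have "\<dots> \<le> 2 ^ (m - m0) * mass m0" using m w0 w[of m0] by (intro mult_mono power_increasing) auto
  also have "\<dots> \<le> w m" using sep[of m0 m] m Nm by (simp add: mass_def)
  finally have "c < w m" .
  moreover have "emeasure \<mu> {pt m 0} \<le> emeasure \<mu> X" using pt(1)[OF Nm] by (intro emeasure_mono) auto
  then have "ennreal (w m) \<le> ennreal c" using pt[OF Nm] by (simp add: emeasure_single c)
  ultimately show False using c by (simp add: ennreal_le_iff)
qed

section \<open>Neighbourhoods, balls and the diagonal constraint\<close>

lemma nb_A: assumes "x \<in> X" "isA (pc x)" "y \<in> nb x" "y \<noteq> x" shows "isD (pc y)" "bl (pc y) = bl (pc x)"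
  using assms excl by (auto simp: nb_def adj_def)

lemma nb_D: assumes x: "x \<in> X" "isD (pc x)"
  shows "nb x = insert x ((\<lambda>m. pt m (el x mod N m)) ` AA (bl (pc x)))"
proof (intro equalityI subsetI)
  fix y assume y: "y \<in> nb x"
  show "y \<in> insert x ((\<lambda>m. pt m (el x mod N m)) ` AA (bl (pc x)))"
  proof (cases "y = x")
    case False
    then have "adj y x" using y x excl by (auto simp: nb_def adj_def)
    then have h: "y \<in> X" "isA (pc y)" "bl (pc y) = bl (pc x)" "el y = el x mod N (pc y)" by (auto simp: adj_def)
    then have "y = pt (pc y) (el x mod N (pc y))" using pt_eq[of y] by simp
    then show ?thesis using h by blast
  qed simp
next
  fix y assume "y \<in> insert x ((\<lambda>m. pt m (el x mod N m)) ` AA (bl (pc x)))"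
  then consider "y = x" | m where "isA m" "bl m = bl (pc x)" "y = pt m (el x mod N m)" by auto
  then show "y \<in> nb x"
  proof cases
    case 2
    then have "el x mod N m < N m" using N0 by simp
    from pt[OF this] show ?thesis using 2 x by (auto simp: nb_def adj_def)
  qed (use x in \<open>simp add: nb_def\<close>)
qed

lemma oball_cases:
  assumes "x \<in> X" "0 < s"
  obtains "oball X \<rho> x s = {x}" | "oball X \<rho> x s = nb x" | "emeasure \<mu> (oball X \<rho> x s) = \<infinity>"
proof -
  consider "s \<le> 1" | "1 < s" "s \<le> 2" | "2 < s" by linarith
  then show ?thesis
  proof cases
    case 1
    then have "oball X \<rho> x s = {x}" using assms by (auto simp: oball_def \<rho>_def split: if_splits)
    then show ?thesis by (rule that(1))
  next
    case 2
    then have "oball X \<rho> x s = nb x" using assms by (auto simp: oball_def \<rho>_def nb_def split: if_splits)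
    then show ?thesis by (rule that(2))
  next
    case 3
    then have "oball X \<rho> x s = X" by (auto simp: oball_def \<rho>_def)
    then show ?thesis using emeasure_X that(3) by simp
  qed
qed

lemma maxc_le:
  assumes x: "x \<in> X" and 1: "ennreal \<bar>f x\<bar> \<le> W"
    and 2: "0 < emeasure \<mu> (nb x) \<Longrightarrow> emeasure \<mu> (nb x) < \<infinity> \<Longrightarrow> (\<integral>\<^sup>+ y \<in> nb x. ennreal \<bar>f y\<bar> \<partial>\<mu>) / emeasure \<mu> (nb x) \<le> W"
  shows "maxc X \<rho> \<mu> f x \<le> W"
  unfolding maxc_def
proof (intro SUP_least)
  fix s assume "s \<in> {s. 0 < s \<and> 0 < emeasure \<mu> (oball X \<rho> x s) \<and> emeasure \<mu> (oball X \<rho> x s) < \<infinity>}"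
  then have s: "0 < s" "0 < emeasure \<mu> (oball X \<rho> x s)" "emeasure \<mu> (oball X \<rho> x s) < \<infinity>" by auto
  show "(\<integral>\<^sup>+ y \<in> oball X \<rho> x s. ennreal \<bar>f y\<bar> \<partial>\<mu>) / emeasure \<mu> (oball X \<rho> x s) \<le> W"
  proof (cases rule: oball_cases[OF x s(1)])
    case 1
    have "(\<integral>\<^sup>+ y \<in> {x}. ennreal \<bar>f y\<bar> \<partial>\<mu>) = ennreal \<bar>f x\<bar> * emeasure \<mu> {x}"
      by (rule nn_integral_indicator_singleton) (use x in auto)
    moreover have "emeasure \<mu> {x} \<noteq> 0" "emeasure \<mu> {x} \<noteq> top" using s 1 by auto
    ultimately show ?thesis unfolding 1 using assms(2) by (simp add: mult_divide_eq_ennreal)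
  next
    case 2
    then show ?thesis using assms(3) s by simp
  next
    case 3
    then show ?thesis using s by simp
  qed
qed

lemma maxc_ge_nb:
  assumes x: "x \<in> X" and nb: "0 < emeasure \<mu> (nb x)" "emeasure \<mu> (nb x) < \<infinity>"
  shows "(\<integral>\<^sup>+ y \<in> nb x. ennreal \<bar>f y\<bar> \<partial>\<mu>) / emeasure \<mu> (nb x) \<le> maxc X \<rho> \<mu> f x"
proof -
  have "oball X \<rho> x 2 = nb x" using x by (auto simp: oball_def \<rho>_def nb_def split: if_splits)
  then show ?thesis unfolding maxc_def using nb by (intro SUP_upper2[of 2]) auto
qed

lemma core_eq: "core = X"
proof -
  have "oball X \<rho> x s = {x} \<or> 0 < emeasure \<mu> (oball X \<rho> x s)" if "x \<in> X" "0 < s" for x s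
  proof -
    have "emeasure \<mu> {x} \<le> emeasure \<mu> (oball X \<rho> x s)" using that by (intro emeasure_mono) (auto simp: oball_def \<rho>_def)
    then show ?thesis using emeasure_single[OF that(1)] w[of "pc x"] by (auto simp: zero_less_iff_neq_zero)
  qed
  moreover have "emeasure \<mu> {x} > 0" if "x \<in> X" for x using emeasure_single[OF that] w[of "pc x"] by simp
  ultimately have "x \<in> supp_mu X \<rho> \<mu>" if "x \<in> X" for x using that unfolding supp_mu_def by fastforce
  moreover have "x \<in> fin_ball" if "x \<in> X" for x
  proof -
    have "oball X \<rho> x 1 = {x}" using that by (auto simp: oball_def \<rho>_def split: if_splits)
    then show ?thesis using emeasure_single[OF that] that by (auto simp: fin_ball_def intro!: exI[of _ 1])
  qed
  ultimately show ?thesis by (auto simp: core_def supp_mu_def)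
qed

lemma bounded_diag:
  assumes ab: "0 \<le> a" "a \<le> 1" "0 \<le> b" "b \<le> 1" and bdd: "maxc_bounded X \<rho> \<mu> p a b"
  shows "b \<le> a"
proof (rule core_infinite_le[OF p _ _ ab bdd])
  have "X - supp_mu X \<rho> \<mu> = {}" using core_eq by (auto simp: core_def)
  then show "emeasure \<mu> (X - supp_mu X \<rho> \<mu>) = 0" by (simp only: emeasure_empty)
  show "infinite core"
  proof
    assume "finite core"
    then have "emeasure \<mu> X < \<infinity>" unfolding core_eq by (subst emeasure_finite) auto
    then show False using emeasure_X by simp
  qed
qed

section \<open>Norm estimates on input pieces and single pieces\<close>

lemma pn_antimono: "0 \<le> b \<Longrightarrow> b \<le> a \<Longrightarrow> pn b h m \<le> pn a h m"
  unfolding pn_def by (rule lp_antimono_exponent)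

lemma pn_indicator_le:
  assumes "0 \<le> a" "a \<le> 1" "0 \<le> v" "\<And>x. x \<in> P m \<Longrightarrow> h x \<le> ennreal v"
  shows "pn a h m \<le> ennreal (2 * v) * ennreal (mass m powr (1 / p))"
proof -
  have "pn a h m \<le> ennreal (2 * v) * epowr (ennreal (mass m)) (1 / p)"
    unfolding pn_def
  proof (rule lp_lev_indicator_le)
    fix k :: int
    show "dp h m (2 powr real_of_int k) \<le> (if 2 powr real_of_int k < v then ennreal (mass m) else 0)"
    proof (cases "2 powr real_of_int k < v")
      case False
      have "{x \<in> P m. ennreal (2 powr real_of_int k) < h x} = {}"
      proof -
        have "ennreal v \<le> ennreal (2 powr real_of_int k)" using False by (intro ennreal_leI) simp
        then have "\<not> ennreal (2 powr real_of_int k) < h x" if "x \<in> P m" for x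
          using assms(4)[OF that] by (meson leD le_less_trans less_le_trans)
        then show ?thesis by blast
      qed
      then have "dp h m (2 powr real_of_int k) = emeasure \<mu> {}" unfolding dp_def by (simp only:)
      then show ?thesis by simp
    qed (simp add: dp_le)
  qed (use p assms in auto)
  then show ?thesis using mass_nonneg[of m] by simp
qed

lemma pn_ge:
  assumes "0 \<le> a" "0 < v" "\<And>x. x \<in> P m \<Longrightarrow> ennreal v \<le> h x"
  shows "ennreal v * ennreal (mass m powr (1 / p)) \<le> 2 * pn a h m"
proof -
  have "ennreal (mass m) \<le> dp h m t" if "0 < t" "t < v" for t
  proof -
    have "{x \<in> P m. ennreal t < h x} = P m"
    proof -
      have "ennreal t < h x" if "x \<in> P m" for x
        using assms(3)[OF that] \<open>0 < t\<close> \<open>t < v\<close> by (auto simp: ennreal_less_iff intro: less_le_trans[of _ "ennreal v"])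
      then show ?thesis by blast
    qed
    then show ?thesis unfolding dp_def by (simp add: emeasure_P)
  qed
  then have "ennreal v * epowr (ennreal (mass m)) (1 / p) \<le> 2 * pn a h m"
    unfolding pn_def using p assms by (intro le_lp_lev) auto
  then show ?thesis using mass_nonneg[of m] by simp
qed

lemma pn_add_le:
  assumes "0 \<le> a" "a \<le> 1" "\<And>x. x \<in> P m \<Longrightarrow> h x \<le> u x + v x"
  shows "pn a h m \<le> 2 * (pn a u m + pn a v m)"
  unfolding pn_def
proof (rule lp_lev_add_le)
  fix k :: int
  let ?t = "2 powr real_of_int (k - 1)"
  have "ennreal ?t < u x \<or> ennreal ?t < v x" if "x \<in> P m" "ennreal (2 powr real_of_int k) < h x" for x
  proof (rule ccontr)
    assume "\<not> ?thesis"
    then have "u x + v x \<le> ennreal ?t + ennreal ?t" by (intro add_mono) auto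
    also have "\<dots> = ennreal (2 powr real_of_int k)" by (simp add: ennreal_plus[symmetric] powr_diff del: ennreal_plus)
    finally show False using assms(3)[OF that(1)] that(2) by (meson leD order_trans)
  qed
  then have "{x \<in> P m. ennreal (2 powr real_of_int k) < h x} \<subseteq> {x \<in> P m. ennreal ?t < u x} \<union> {x \<in> P m. ennreal ?t < v x}" by blast
  then have "dp h m (2 powr real_of_int k) \<le> emeasure \<mu> ({x \<in> P m. ennreal ?t < u x} \<union> {x \<in> P m. ennreal ?t < v x})"
    unfolding dp_def by (intro emeasure_mono) (auto simp: P_def)
  also have "\<dots> \<le> dp u m ?t + dp v m ?t" unfolding dp_def by (intro emeasure_subadditive) (auto simp: P_def)
  finally show "dp h m (2 powr real_of_int k) \<le> dp u m ?t + dp v m ?t" .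
qed (use p assms in auto)

text \<open>A single point of the piece already carries mass \<open>w m\<close>, so its value is
  controlled by the norm on the piece.\<close>

lemma le_pn:
  assumes "0 \<le> a" "x \<in> P m" "ennreal v \<le> h x" "0 \<le> v"
  shows "ennreal v \<le> ennreal (2 * w m powr (- (1 / p))) * pn a h m"
proof (cases "v = 0")
  case False
  with assms have v: "0 < v" by simp
  have "ennreal (w m) \<le> dp h m t" if "0 < t" "t < v" for t
  proof (rule dp_ge)
    have "ennreal t < h x" using assms(3) that by (auto simp: ennreal_less_iff intro: less_le_trans[of _ "ennreal v"])
    then have "emeasure \<mu> {x} \<le> dp h m t" unfolding dp_def using assms(2) by (intro emeasure_mono) (auto simp: P_def)
    then show "0 < dp h m t" using assms(2) emeasure_single[of x] w[of m] by (auto simp: P_def zero_less_iff_neq_zero)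
  qed
  then have "ennreal v * epowr (ennreal (w m)) (1 / p) \<le> 2 * pn a h m"
    unfolding pn_def using p v assms by (intro le_lp_lev) auto
  then have "ennreal (w m powr (1 / p)) * ennreal v \<le> 2 * pn a h m"
    using w[of m] by (simp add: mult.commute)
  then have "ennreal v \<le> ennreal (1 / w m powr (1 / p)) * (2 * pn a h m)"
    using w[of m] by (subst (asm) ennreal_pmult_le_iff) auto
  also have "\<dots> = ennreal (2 * w m powr (- (1 / p))) * pn a h m"
  proof -
    have "2 * w m powr (- (1 / p)) = (1 / w m powr (1 / p)) * 2" by (simp add: powr_minus_divide)
    then show ?thesis by (simp only: ennreal_mult' divide_nonneg_nonneg powr_ge_zero zero_le_one mult.assoc ennreal_numeral)
  qed
  finally show ?thesis .
qed simp

text \<open>Output points are much heavier than input points, so averages around input points are harmless.\<close>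

lemma pn_maxc_A:
  assumes ab: "0 \<le> a" "a \<le> 1" "0 \<le> b" "b \<le> a" and m: "isA m"
  shows "pn b (maxc X \<rho> \<mu> f) m \<le> 2 * (pn a (\<lambda>x. ennreal \<bar>f x\<bar>) m
    + 4 * (SUP i. ennreal (2 powr (- (1 / p) * real i)) * pn a (\<lambda>x. ennreal \<bar>f x\<bar>) (m + i)))"
proof -
  let ?f = "\<lambda>x. ennreal \<bar>f x\<bar>"
  let ?S = "SUP i. ennreal (2 powr (- (1 / p) * real i)) * pn a ?f (m + i)"
  have Nm: "0 < N m" using m N0 by blast
  have mass: "0 < mass m" using Nm w[of m] by (simp add: mass_def)
  show ?thesis
  proof (cases "?S = top")
    case True show ?thesis unfolding True by (simp add: ennreal_mult_top)
  next
    case False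
    then obtain s where s: "?S = ennreal s" "0 \<le> s" by (cases ?S) auto
    \<comment> \<open>A common bound for \<open>|f|\<close> on the output points of the block.
      \<open>le_pn\<close> brings the power \<open>- 1 / p\<close> of the weight in the output
      piece, and \<open>sep\<close> compares it with the same power of the mass of the input piece
      \<open>m\<close>, gaining a geometric factor in the difference of the indices.\<close>
    define v where "v = 2 * s * mass m powr (- (1 / p))"
    have v: "0 \<le> v" using s by (simp add: v_def)
    have fD: "?f y \<le> ennreal v" if y: "y \<in> X" "isD (pc y)" "bl (pc y) = bl m" for y
    proof -
      let ?m = "pc y"
      have less: "m < ?m" using ord[OF m y(2)] y(3) by simp
      have N': "0 < N ?m" using y N0 by blast
      have "2 ^ (?m - m) * mass m \<le> w ?m" using sep[OF less N'] by (simp add: mass_def)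
      then have "w ?m powr (- (1 / p)) \<le> (2 ^ (?m - m) * mass m) powr (- (1 / p))"
        using p mass by (intro powr_mono2') auto
      also have "\<dots> = 2 powr (- (1 / p) * real (?m - m)) * mass m powr (- (1 / p))"
        using mass by (simp add: powr_mult powr_realpow[symmetric] powr_powr mult.commute)
      finally have wm: "2 * w ?m powr (- (1 / p)) \<le> (2 * mass m powr (- (1 / p))) * 2 powr (- (1 / p) * real (?m - m))" by (simp add: mult.commute)
      have "?f y \<le> ennreal (2 * w ?m powr (- (1 / p))) * pn a ?f ?m"
        using y ab by (intro le_pn[where x = y]) (auto simp: P_def)
      also have "\<dots> \<le> ennreal ((2 * mass m powr (- (1 / p))) * 2 powr (- (1 / p) * real (?m - m))) * pn a ?f ?m"
        by (intro mult_right_mono ennreal_leI wm) simp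
      also have "\<dots> = ennreal (2 * mass m powr (- (1 / p))) * (ennreal (2 powr (- (1 / p) * real (?m - m))) * pn a ?f (m + (?m - m)))"
        using less by (simp add: ennreal_mult mult.assoc)
      also have "\<dots> \<le> ennreal (2 * mass m powr (- (1 / p))) * ?S"
        by (intro mult_left_mono SUP_upper) auto
      also have "\<dots> = ennreal v" unfolding s(1) v_def using s(2) by (simp add: ennreal_mult[symmetric] ac_simps)
      finally show ?thesis .
    qed
    have M: "maxc X \<rho> \<mu> f x \<le> ?f x + ennreal v" if x: "x \<in> P m" for x
    proof (rule maxc_le)
      show "x \<in> X" using x by (simp add: P_def)
      show "(\<integral>\<^sup>+ y \<in> nb x. ?f y \<partial>\<mu>) / emeasure \<mu> (nb x) \<le> ?f x + ennreal v"
        if pos: "0 < emeasure \<mu> (nb x)" "emeasure \<mu> (nb x) < \<infinity>"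
      proof -
        have nbs: "nb x \<in> sets \<mu>" by (auto simp: nb_def)
        have "(\<integral>\<^sup>+ y \<in> nb x. ?f y \<partial>\<mu>) \<le> (\<integral>\<^sup>+ y. (?f x + ennreal v) * indicator (nb x) y \<partial>\<mu>)"
        proof (intro nn_integral_mono)
          fix y
          show "?f y * indicator (nb x) y \<le> (?f x + ennreal v) * indicator (nb x) y"
          proof (cases "y \<in> nb x \<and> y \<noteq> x")
            case True
            then have "y \<in> X" "isD (pc y)" "bl (pc y) = bl m" using x m nb_A[of x y] by (auto simp: P_def nb_def)
            then have "?f y \<le> ennreal v" by (rule fD)
            then show ?thesis using True by (simp add: add_increasing)
          qed (auto split: split_indicator)
        qed
        also have "\<dots> = (?f x + ennreal v) * emeasure \<mu> (nb x)" by (rule nn_integral_cmult_indicator[OF nbs])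
        finally have "(\<integral>\<^sup>+ y \<in> nb x. ?f y \<partial>\<mu>) / emeasure \<mu> (nb x) \<le> (?f x + ennreal v) * emeasure \<mu> (nb x) / emeasure \<mu> (nb x)"
          by (rule divide_right_mono_ennreal)
        also have "\<dots> = ?f x + ennreal v" using pos by (intro mult_divide_eq_ennreal) auto
        finally show ?thesis .
      qed
    qed simp
    have "pn b (maxc X \<rho> \<mu> f) m \<le> 2 * (pn b ?f m + pn b (\<lambda>_. ennreal v) m)"
      using ab M by (intro pn_add_le) auto
    also have "\<dots> \<le> 2 * (pn a ?f m + ennreal (2 * v) * ennreal (mass m powr (1 / p)))"
      using ab v by (intro mult_left_mono add_mono pn_antimono pn_indicator_le) auto
    also have "ennreal (2 * v) * ennreal (mass m powr (1 / p)) = 4 * ?S"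
    proof -
      have vm: "2 * v * mass m powr (1 / p) = 4 * s"
        using mass by (simp add: v_def powr_minus_divide)
      have "ennreal (2 * v) * ennreal (mass m powr (1 / p)) = ennreal (2 * v * mass m powr (1 / p))"
        using v by (intro ennreal_mult'[symmetric]) simp
      then have "ennreal (2 * v) * ennreal (mass m powr (1 / p)) = ennreal (4 * s)" unfolding vm .
      then show ?thesis unfolding s(1) using s(2) by (simp add: ennreal_mult)
    qed
    finally show ?thesis .
  qed
qed

text \<open>Each residue has \<open>n div d\<close> representatives below \<open>n\<close>: the pair
  \<open>(k, c)\<close> corresponds to \<open>k * d + c\<close>.\<close>

lemma card_mod_eq:
  fixes n d :: nat
  assumes "d dvd n" "0 < d"
  shows "card {e. e < n \<and> Q (e mod d)} = (n div d) * card {c. c < d \<and> Q c}"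
proof -
  have "bij_betw (\<lambda>(k, c). k * d + c) ({..<n div d} \<times> {c. c < d \<and> Q c}) {e. e < n \<and> Q (e mod d)}"
  proof (rule bij_betwI[where g = "\<lambda>e. (e div d, e mod d)"])
    show "(\<lambda>(k, c). k * d + c) \<in> {..<n div d} \<times> {c. c < d \<and> Q c} \<rightarrow> {e. e < n \<and> Q (e mod d)}"
    proof safe
      fix k c assume h: "k < n div d" "c < d" "Q c"
      have "k * d + c < Suc k * d" using h by simp
      also have "\<dots> \<le> (n div d) * d" using h by (intro mult_right_mono) auto
      also have "\<dots> = n" using assms by simp
      finally show "k * d + c < n" .
      show "Q ((k * d + c) mod d)" using h by simp
    qed
    show "(\<lambda>e. (e div d, e mod d)) \<in> {e. e < n \<and> Q (e mod d)} \<rightarrow> {..<n div d} \<times> {c. c < d \<and> Q c}"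
      using assms by (auto simp: less_mult_imp_div_less)
  qed (use assms in auto)
  from bij_betw_same_card[OF this] show ?thesis by (simp add: card_cartesian_product)
qed

text \<open>The map \<open>x \<mapsto> pt m' (el x mod N m')\<close> takes an output point of the piece \<open>m\<close> to its unique neighbour
  in the input piece \<open>m'\<close>. Its fibres have equal size, so every level set is scaled by the same factor.\<close>

lemma pn_pullback:
  assumes a: "0 \<le> a" "a \<le> 1" and m: "isD m" and m': "isA m'" "bl m' = bl m" and f0: "\<And>x. 0 \<le> f x"
  shows "pn a (\<lambda>x. ennreal (w m' / w m * f (pt m' (el x mod N m')))) m \<le> ennreal (2 * hh (bl m)) * pn a (\<lambda>x. ennreal (f x)) m'"
proof -
  have N': "0 < N m'" "0 < N m" using m m' N0 by blast+
  \<comment> \<open>Heights are rescaled by the ratio of the two atoms. It need not be a power of 2,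
    and rounding it down to \<open>2^L\<close> costs the factor 2 in the statement.\<close>
  define c where "c = w m / w m'"
  have c: "0 < c" "w m = c * w m'" using w[of m] w[of m'] by (auto simp: c_def)
  define L where "L = \<lfloor>log 2 c\<rfloor>"
  have L: "2 powr real_of_int L \<le> c" "c < 2 * 2 powr real_of_int L"
    using floor_log2_bounds[OF c(1)] by (auto simp: L_def powr_add)
  let ?g = "\<lambda>x. ennreal (w m' / w m * f (pt m' (el x mod N m')))"
  let ?f = "\<lambda>x. ennreal (f x)"
  \<comment> \<open>Heights lose the factor \<open>c\<close>, while the \<open>p\<close>-th root of
    the mass gains \<open>hh (bl m) * c\<close>; what remains is \<open>hh (bl m)\<close>.\<close>
  have mass': "mass m = (hh (bl m) * c) powr p * mass m'"
  proof -
    have "mass m = (hh (bl m) * w m) powr p" using massD[OF m] by (simp add: mass_def)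
    also have "\<dots> = ((hh (bl m) * c) * w m') powr p" by (simp add: c(2) mult.assoc)
    also have "\<dots> = (hh (bl m) * c) powr p * w m' powr p" using hh[of "bl m"] c w[of m'] by (intro powr_mult)
    finally show ?thesis using massA[OF m'(1)] by (simp add: mass_def)
  qed
  have dist: "dp ?g m t = ennreal ((hh (bl m) * c) powr p) * dp ?f m' (t * c)" if t: "0 < t" for t
  proof -
    let ?Q = "\<lambda>e. t * c < f (pt m' e)"
    have iff: "ennreal t < ?g x \<longleftrightarrow> ?Q (el x mod N m')" for x
    proof -
      have "ennreal t < ?g x \<longleftrightarrow> t < w m' / w m * f (pt m' (el x mod N m'))" using t by (simp add: ennreal_less_iff)
      also have "\<dots> \<longleftrightarrow> t * c < f (pt m' (el x mod N m'))" using w[of m] w[of m'] by (simp add: c_def field_simps)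
      finally show ?thesis .
    qed
    have "dp ?g m t = ennreal (card {x \<in> P m. ?Q (el x mod N m')} * w m)"
      unfolding dp_def iff by (rule emeasure_P_sub) auto
    also have "card {x \<in> P m. ?Q (el x mod N m')} = card {e. e < N m \<and> ?Q (e mod N m')}"
      by (rule card_P[of m "\<lambda>e. ?Q (e mod N m')"])
    also have "\<dots> = (N m div N m') * card {e. e < N m' \<and> ?Q e}"
      using dvd[OF m'(1) m m'(2)] N' by (intro card_mod_eq)
    finally have 1: "dp ?g m t = ennreal (real ((N m div N m') * card {e. e < N m' \<and> ?Q e}) * w m)" .
    have "dp ?f m' (t * c) = emeasure \<mu> {x \<in> P m'. ?Q (el x)}"
    proof -
      have "ennreal (t * c) < ?f x \<longleftrightarrow> ?Q (el x)" if "x \<in> P m'" for x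
        using that t c pt_eq[of x] by (auto simp: P_def ennreal_less_iff)
      then show ?thesis unfolding dp_def by (intro arg_cong[of _ _ "emeasure \<mu>"]) auto
    qed
    also have "\<dots> = ennreal (card {x \<in> P m'. ?Q (el x)} * w m')" by (rule emeasure_P_sub) auto
    also have "card {x \<in> P m'. ?Q (el x)} = card {e. e < N m' \<and> ?Q e}" by (rule card_P)
    finally have 2: "dp ?f m' (t * c) = ennreal (card {e. e < N m' \<and> ?Q e} * w m')" .
    have "real (N m div N m') * w m = (hh (bl m) * c) powr p * w m'"
    proof -
      have "real (N m) = real (N m div N m') * real (N m')"
        using dvd[OF m'(1) m m'(2)] by (metis dvd_div_mult_self of_nat_mult)
      then have "real (N m div N m') * w m * real (N m') = (hh (bl m) * c) powr p * w m' * real (N m')"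
        using mass' by (simp add: mass_def ac_simps)
      then show ?thesis using N' by simp
    qed
    then have key: "real ((N m div N m') * card {e. e < N m' \<and> ?Q e}) * w m = (hh (bl m) * c) powr p * (card {e. e < N m' \<and> ?Q e} * w m')"
      by (simp add: ac_simps)
    show ?thesis unfolding 1 2 key by (rule ennreal_mult') simp
  qed
  have "lev p (dp ?g m) k \<le> ennreal (2 * hh (bl m)) * lev p (dp ?f m') (k + L)" for k
  proof -
    have "lev p (dp ?g m) k = ennreal (2 powr real_of_int k) * (ennreal (hh (bl m) * c) * epowr (dp ?f m' (2 powr real_of_int k * c)) (1 / p))"
      unfolding lev_def using dist[of "2 powr real_of_int k"] p c hh[of "bl m"] by (simp add: epowr_mult powr_powr)
    also have "\<dots> \<le> ennreal (2 powr real_of_int k) * (ennreal (hh (bl m) * (2 * 2 powr real_of_int L)) * epowr (dp ?f m' (2 powr real_of_int (k + L))) (1 / p))"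
    proof -
      have h1: "hh (bl m) * c \<le> hh (bl m) * (2 * 2 powr real_of_int L)" using L hh[of "bl m"] by (intro mult_left_mono) auto
      have "2 powr real_of_int (k + L) \<le> 2 powr real_of_int k * c" using L by (simp add: powr_add)
      then have "ennreal (2 powr real_of_int (k + L)) \<le> ennreal (2 powr real_of_int k * c)" by (rule ennreal_leI)
      then have h2: "dp ?f m' (2 powr real_of_int k * c) \<le> dp ?f m' (2 powr real_of_int (k + L))"
        unfolding dp_def by (intro emeasure_mono) (auto simp: P_def intro: le_less_trans)
      show ?thesis
        by (rule mult_left_mono[OF mult_mono[OF ennreal_leI[OF h1] epowr_mono[OF h2]]]) (use p in auto)
    qed
    also have "\<dots> = ennreal (2 * hh (bl m)) * lev p (dp ?f m') (k + L)"
    proof -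
      have "2 powr real_of_int k * (hh (bl m) * (2 * 2 powr real_of_int L)) = 2 * hh (bl m) * 2 powr real_of_int (k + L)"
        by (simp add: powr_add)
      then have "ennreal (2 powr real_of_int k) * ennreal (hh (bl m) * (2 * 2 powr real_of_int L)) = ennreal (2 * hh (bl m)) * ennreal (2 powr real_of_int (k + L))"
        using hh[of "bl m"] by (simp add: ennreal_mult[symmetric])
      then show ?thesis unfolding lev_def by (simp only: mult.assoc[symmetric])
    qed
    finally show ?thesis .
  qed
  then have "pn a ?g m \<le> lp a (\<lambda>k. ennreal (2 * hh (bl m)) * lev p (dp ?f m') (k + L))"
    unfolding pn_def using a by (intro lp_mono) auto
  also have "\<dots> = ennreal (2 * hh (bl m)) * pn a ?f m'"
    unfolding pn_def lp_cmult[OF a(1)] lp_shift[OF a(1)] ..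
  finally show ?thesis .
qed

lemma pn_eq_dl: "pn a h m = dl p a \<mu> (\<lambda>x. h x * indicator (P m) x)"
proof -
  have "distr_fun \<mu> (\<lambda>x. h x * indicator (P m) x) t = dp h m t" if "0 < t" for t
  proof -
    have "{x \<in> X. ennreal t < h x * indicator (P m) x} = {x \<in> P m. ennreal t < h x}"
      using that by (auto simp: P_def split: split_indicator_asm split_indicator)
    then show ?thesis by (simp add: distr_fun_mu dp_def)
  qed
  then have "lev p (dp h m) = lev p (distr_fun \<mu> (\<lambda>x. h x * indicator (P m) x))" by (auto simp: lev_def)
  then show ?thesis by (simp add: pn_def dl_def)
qed

text \<open>\<open>dl_sum_le\<close> for functions cut down to one piece; its finiteness condition
  holds because a piece has finite mass.\<close>

lemma pn_sum_le:
  assumes a: "0 \<le> a" "a \<le> 1"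
  obtains C where "0 \<le> C" "\<And>(I :: nat set) g m. finite I \<Longrightarrow> (\<And>i x. i \<in> I \<Longrightarrow> 0 \<le> g i x) \<Longrightarrow>
    pn a (\<lambda>x. ennreal (\<Sum>i\<in>I. g i x)) m \<le> ennreal C * (\<Sum>i\<in>I. pn a (\<lambda>x. ennreal (g i x)) m)"
proof -
  obtain C where C: "0 \<le> C" "\<And>(M :: 'a measure) (I :: nat set) g. finite I \<Longrightarrow> (\<And>i. i \<in> I \<Longrightarrow> g i \<in> borel_measurable M) \<Longrightarrow>
    (\<And>i x. i \<in> I \<Longrightarrow> 0 \<le> g i x) \<Longrightarrow> (\<And>t. 0 < t \<Longrightarrow> distr_fun M (\<lambda>x. ennreal (\<Sum>i\<in>I. g i x)) t < \<infinity>) \<Longrightarrow>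
    dl p a M (\<lambda>x. ennreal (\<Sum>i\<in>I. g i x)) \<le> ennreal C * (\<Sum>i\<in>I. dl p a M (\<lambda>x. ennreal (g i x)))"
    using dl_sum_le[OF p a] by metis
  show ?thesis
  proof (rule that[OF C(1)])
    fix I :: "nat set" and g :: "nat \<Rightarrow> 'a \<Rightarrow> real" and m
    assume I: "finite I" and g: "\<And>i x. i \<in> I \<Longrightarrow> 0 \<le> g i x"
    let ?g = "\<lambda>i x. g i x * indicator (P m) x"
    have 1: "ennreal (\<Sum>i\<in>I. g i x) * indicator (P m) x = ennreal (\<Sum>i\<in>I. ?g i x)" for x
      by (auto split: split_indicator)
    have 2: "ennreal (g i x) * indicator (P m) x = ennreal (?g i x)" for i x
      by (auto split: split_indicator)
    have "dl p a \<mu> (\<lambda>x. ennreal (\<Sum>i\<in>I. ?g i x)) \<le> ennreal C * (\<Sum>i\<in>I. dl p a \<mu> (\<lambda>x. ennreal (?g i x)))"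
    proof (rule C(2)[OF I])
      fix t :: real assume t: "0 < t"
      have "{x \<in> X. ennreal t < ennreal (\<Sum>i\<in>I. ?g i x)} \<subseteq> P m" using t by (auto simp: ennreal_less_iff split: split_indicator_asm)
      then have "distr_fun \<mu> (\<lambda>x. ennreal (\<Sum>i\<in>I. ?g i x)) t \<le> emeasure \<mu> (P m)"
        unfolding distr_fun_mu by (intro emeasure_mono) (auto simp: P_def)
      then show "distr_fun \<mu> (\<lambda>x. ennreal (\<Sum>i\<in>I. ?g i x)) t < \<infinity>" by (simp add: emeasure_P le_less_trans)
    qed (use g in \<open>auto split: split_indicator\<close>)
    then show "pn a (\<lambda>x. ennreal (\<Sum>i\<in>I. g i x)) m \<le> ennreal C * (\<Sum>i\<in>I. pn a (\<lambda>x. ennreal (g i x)) m)"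
      unfolding pn_eq_dl 1 2 .
  qed
qed

section \<open>The maximal operator on output pieces, and boundedness\<close>

lemma nb_D_sum:
  assumes x: "x \<in> P m" and m: "isD m"
  shows "(\<integral>\<^sup>+ y \<in> nb x. g y \<partial>\<mu>) = ennreal (w m) * g x + (\<Sum>m'\<in>AA (bl m). ennreal (w m') * g (pt m' (el x mod N m')))"
    and "emeasure \<mu> (nb x) = ennreal (w m + (\<Sum>m'\<in>AA (bl m). w m'))"
proof -
  have xX: "x \<in> X" "pc x = m" using x by (auto simp: P_def)
  let ?y = "\<lambda>m'. pt m' (el x mod N m')"
  have y: "?y m' \<in> X" "pc (?y m') = m'" if "isA m'" for m'
    using that N0[of m'] by (auto intro!: pt)
  have nb: "nb x = insert x (?y ` AA (bl m))" using nb_D[of x] xX m by simp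
  have notin: "x \<notin> ?y ` AA (bl m)" using y xX m excl by force
  have inj: "inj_on ?y (AA (bl m))" by (rule inj_onI) (metis (mono_tags, lifting) mem_Collect_eq y(2))
  have fin: "finite (nb x)" unfolding nb using finA by simp
  have sub: "nb x \<subseteq> X" by (auto simp: nb_def)
  have int: "(\<integral>\<^sup>+ y \<in> nb x. g y \<partial>\<mu>) = (\<Sum>y\<in>nb x. ennreal (w (pc y)) * g y)" for g
  proof -
    have "(\<integral>\<^sup>+ y \<in> nb x. g y \<partial>\<mu>) = (\<Sum>y\<in>nb x. g y * emeasure \<mu> {y})"
      using fin sub by (intro nn_integral_indicator_finite) auto
    also have "\<dots> = (\<Sum>y\<in>nb x. ennreal (w (pc y)) * g y)"
      using sub by (intro sum.cong) (auto simp: emeasure_single mult.commute)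
    finally show ?thesis .
  qed
  show "(\<integral>\<^sup>+ y \<in> nb x. g y \<partial>\<mu>) = ennreal (w m) * g x + (\<Sum>m'\<in>AA (bl m). ennreal (w m') * g (?y m'))"
    unfolding int unfolding nb using notin inj finA xX y by (simp add: sum.reindex)
  have "emeasure \<mu> (nb x) = (\<Sum>y\<in>nb x. ennreal (w (pc y)))" using sub fin by (rule emeasure_finite)
  also have "\<dots> = ennreal (w m) + (\<Sum>m'\<in>AA (bl m). ennreal (w m'))"
    unfolding nb using notin inj finA xX y by (simp add: sum.reindex)
  also have "\<dots> = ennreal (w m + (\<Sum>m'\<in>AA (bl m). w m'))"
    using w by (simp add: sum_ennreal sum_nonneg less_imp_le)
  finally show "emeasure \<mu> (nb x) = ennreal (w m + (\<Sum>m'\<in>AA (bl m). w m'))" .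
qed

text \<open>The neighbourhood of an output point weighs at least \<open>w m\<close>, so the average
  over it is at most \<open>|f x|\<close> plus the sum over the input pieces of
  \<open>w m' / w m\<close> times the value at the neighbour. The constant \<open>C\<close> adds up
  the pieces and \<open>pn_pullback\<close> evaluates each.\<close>

lemma pn_maxc_D:
  assumes ab: "0 \<le> a" "a \<le> 1" "0 \<le> b" "b \<le> a" and m: "isD m"
    and C: "0 \<le> C" "\<And>(I :: nat set) g m. finite I \<Longrightarrow> (\<And>i x. i \<in> I \<Longrightarrow> 0 \<le> g i x) \<Longrightarrow>
    pn a (\<lambda>x. ennreal (\<Sum>i\<in>I. g i x)) m \<le> ennreal C * (\<Sum>i\<in>I. pn a (\<lambda>x. ennreal (g i x)) m)"
  shows "pn b (maxc X \<rho> \<mu> f) m \<le> 2 * (pn a (\<lambda>x. ennreal \<bar>f x\<bar>) m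
    + ennreal (2 * C * hh (bl m)) * (\<Sum>m'\<in>AA (bl m). pn a (\<lambda>x. ennreal \<bar>f x\<bar>) m'))"
proof -
  let ?f = "\<lambda>x. ennreal \<bar>f x\<bar>"
  define g where "g m' x = w m' / w m * \<bar>f (pt m' (el x mod N m'))\<bar>" for m' x
  have g0: "0 \<le> g m' x" for m' x using w[of m] w[of m'] by (simp add: g_def)
  define T where "T x = (\<Sum>m'\<in>AA (bl m). g m' x)" for x
  have T0: "0 \<le> T x" for x unfolding T_def using g0 by (intro sum_nonneg) auto
  have M: "maxc X \<rho> \<mu> f x \<le> ?f x + ennreal (T x)" if x: "x \<in> P m" for x
  proof (rule maxc_le)
    show "x \<in> X" using x by (simp add: P_def)
    show "(\<integral>\<^sup>+ y \<in> nb x. ?f y \<partial>\<mu>) / emeasure \<mu> (nb x) \<le> ?f x + ennreal (T x)"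
    proof -
      have "(\<integral>\<^sup>+ y \<in> nb x. ?f y \<partial>\<mu>) = ennreal (w m * \<bar>f x\<bar> + (\<Sum>m'\<in>AA (bl m). w m' * \<bar>f (pt m' (el x mod N m'))\<bar>))"
        unfolding nb_D_sum(1)[OF x m] using w by (simp add: ennreal_mult[symmetric] sum_ennreal sum_nonneg less_imp_le)
      moreover have "w m * \<bar>f x\<bar> + (\<Sum>m'\<in>AA (bl m). w m' * \<bar>f (pt m' (el x mod N m'))\<bar>) = w m * (\<bar>f x\<bar> + T x)"
        unfolding T_def g_def using w[of m] by (simp add: distrib_left sum_distrib_left)
      ultimately have int: "(\<integral>\<^sup>+ y \<in> nb x. ?f y \<partial>\<mu>) = ennreal (w m * (\<bar>f x\<bar> + T x))" by simp
      have s: "0 \<le> (\<Sum>m'\<in>AA (bl m). w m')" using w by (intro sum_nonneg) (auto intro: less_imp_le)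
      have "(\<integral>\<^sup>+ y \<in> nb x. ?f y \<partial>\<mu>) / emeasure \<mu> (nb x) = ennreal (w m * (\<bar>f x\<bar> + T x) / (w m + (\<Sum>m'\<in>AA (bl m). w m')))"
        unfolding int nb_D_sum(2)[OF x m] using w[of m] s T0[of x] by (intro divide_ennreal) auto
      also have "\<dots> \<le> ennreal (\<bar>f x\<bar> + T x)"
      proof (rule ennreal_leI)
        have "w m * (\<bar>f x\<bar> + T x) \<le> (w m + (\<Sum>m'\<in>AA (bl m). w m')) * (\<bar>f x\<bar> + T x)"
          using s T0[of x] by (intro mult_right_mono) auto
        then show "w m * (\<bar>f x\<bar> + T x) / (w m + (\<Sum>m'\<in>AA (bl m). w m')) \<le> \<bar>f x\<bar> + T x"
          using w[of m] s by (simp add: divide_le_eq mult.commute)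
      qed
      also have "\<dots> = ?f x + ennreal (T x)" using T0[of x] by simp
      finally show ?thesis .
    qed
  qed simp
  have "pn b (maxc X \<rho> \<mu> f) m \<le> 2 * (pn b ?f m + pn b (\<lambda>x. ennreal (T x)) m)"
    using ab M by (intro pn_add_le) auto
  also have "\<dots> \<le> 2 * (pn a ?f m + pn a (\<lambda>x. ennreal (T x)) m)"
    using ab by (intro mult_left_mono add_mono pn_antimono) auto
  also have "\<dots> \<le> 2 * (pn a ?f m + ennreal (2 * C * hh (bl m)) * (\<Sum>m'\<in>AA (bl m). pn a ?f m'))"
  proof (intro mult_left_mono add_left_mono)
    have "pn a (\<lambda>x. ennreal (T x)) m \<le> ennreal C * (\<Sum>m'\<in>AA (bl m). pn a (\<lambda>x. ennreal (g m' x)) m)"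
      unfolding T_def using g0 finA by (intro C(2)) auto
    also have "\<dots> \<le> ennreal C * (\<Sum>m'\<in>AA (bl m). ennreal (2 * hh (bl m)) * pn a ?f m')"
      unfolding g_def using ab m by (intro mult_left_mono sum_mono pn_pullback) auto
    also have "\<dots> = ennreal (2 * C * hh (bl m)) * (\<Sum>m'\<in>AA (bl m). pn a ?f m')"
      using C(1) hh[of "bl m"] by (simp add: sum_distrib_left[symmetric] ennreal_mult ac_simps)
    finally show "pn a (\<lambda>x. ennreal (T x)) m \<le> ennreal (2 * C * hh (bl m)) * (\<Sum>m'\<in>AA (bl m). pn a ?f m')" .
  qed simp
  finally show ?thesis .
qed

text \<open>In block \<open>n\<close> all \<open>KK n\<close> output entries are equal, which gives
  \<open>KK n powr b\<close>, and Hoelder's inequality over the \<open>MM n\<close> inputs gives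
  \<open>MM n powr (1 - a)\<close>. Across the blocks \<open>b \<le> a\<close> lets the norm with
  parameter \<open>b\<close> be replaced by the larger one with parameter \<open>a\<close>.\<close>

lemma lp_blocks_le:
  assumes ab: "0 \<le> a" "a \<le> 1" "0 \<le> b" "b \<le> a"
    and C: "0 \<le> C" "\<And>n. hh n * real (KK n) powr b * real (MM n) powr (1 - a) \<le> C"
  shows "lp b (\<lambda>m. if isD m then ennreal (hh (bl m)) * (\<Sum>m'\<in>AA (bl m). x m') else 0) \<le> ennreal C * lp a x"
proof -
  define s where "s n = ennreal (hh n) * (\<Sum>m'\<in>AA n. x m')" for n
  define \<xi> where "\<xi> n = lp a (\<lambda>m. x m * indicator (AA n) m)" for n
  have "(if isD m then ennreal (hh (bl m)) * (\<Sum>m'\<in>AA (bl m). x m') else 0) \<le> lp b (\<lambda>n. s n * indicator (DD n) m)" for m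
  proof (cases "isD m")
    case True
    then show ?thesis using le_lp[OF ab(3), of "\<lambda>n. s n * indicator (DD n) m" "bl m"] by (simp add: s_def)
  qed simp
  then have "lp b (\<lambda>m. if isD m then ennreal (hh (bl m)) * (\<Sum>m'\<in>AA (bl m). x m') else 0)
     \<le> lp b (\<lambda>m. lp b (\<lambda>n. s n * indicator (DD n) m))" using ab by (intro lp_mono)
  also have "\<dots> = lp b (\<lambda>n. lp b (\<lambda>m. s n * indicator (DD n) m))" by (rule lp_swap[OF ab(3)])
  also have "\<dots> \<le> lp b (\<lambda>n. ennreal C * \<xi> n)"
  proof (rule lp_mono[OF _ ab(3)])
    fix n
    have "lp b (\<lambda>m. s n * indicator (DD n) m) \<le> ennreal (real (card (DD n)) powr b) * s n"
      using finD ab by (intro lp_const_le) auto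
    also have "\<dots> \<le> ennreal (real (KK n) powr b) * (ennreal (hh n) * (ennreal (real (card (AA n)) powr (1 - a)) * \<xi> n))"
      unfolding s_def cardD \<xi>_def using finA ab by (intro mult_left_mono sum_le_card_lp) auto
    also have "\<dots> = ennreal (hh n * real (KK n) powr b * real (MM n) powr (1 - a)) * \<xi> n"
      unfolding cardA using hh[of n] by (simp add: ennreal_mult ac_simps)
    also have "\<dots> \<le> ennreal C * \<xi> n" by (intro mult_right_mono ennreal_leI C(2)) simp
    finally show "lp b (\<lambda>m. s n * indicator (DD n) m) \<le> ennreal C * \<xi> n" .
  qed
  also have "\<dots> = ennreal C * lp b \<xi>" by (rule lp_cmult[OF ab(3)])
  also have "\<dots> \<le> ennreal C * lp a \<xi>" using ab by (intro mult_left_mono lp_antimono_exponent) auto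
  also have "lp a \<xi> = lp a (\<lambda>m. lp a (\<lambda>n. x m * indicator (AA n) m))" unfolding \<xi>_def by (rule lp_swap[OF ab(1)])
  also have "\<dots> \<le> lp a x"
  proof (rule lp_mono[OF _ ab(1)])
    fix m
    have "lp a (\<lambda>n. x m * indicator (AA n) m) \<le> lp a (\<lambda>n. x m * indicator {bl m} n)"
      using ab by (intro lp_mono) (auto split: split_indicator)
    also have "\<dots> \<le> ennreal (real (card {bl m}) powr a) * x m" using ab by (intro lp_const_le) auto
    finally show "lp a (\<lambda>n. x m * indicator (AA n) m) \<le> x m" by simp
  qed
  finally show ?thesis by (simp add: mult_left_mono)
qed

lemma bounded_if:
  assumes ab: "0 \<le> a" "a \<le> 1" "0 \<le> b" "b \<le> a"
    and C0: "0 \<le> C0" "\<And>n. hh n * real (KK n) powr b * real (MM n) powr (1 - a) \<le> C0"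
  shows "maxc_bounded X \<rho> \<mu> p a b"
proof -
  obtain C where C: "0 \<le> C" "\<And>(I :: nat set) g m. finite I \<Longrightarrow> (\<And>i x. i \<in> I \<Longrightarrow> 0 \<le> g i x) \<Longrightarrow>
    pn a (\<lambda>x. ennreal (\<Sum>i\<in>I. g i x)) m \<le> ennreal C * (\<Sum>i\<in>I. pn a (\<lambda>x. ennreal (g i x)) m)"
    using pn_sum_le[OF ab(1,2)] by metis
  define \<Gamma> where "\<Gamma> = 1 / (1 - 2 powr (- (1 / p)))"
  have \<Gamma>: "0 \<le> \<Gamma>"
  proof -
    have "2 powr (- (1 / p)) < (1::real)" using p by (intro powr_less_one) auto
    then show ?thesis by (simp add: \<Gamma>_def)
  qed
  have b1: "b \<le> 1" using ab by simp
  \<comment> \<open>The outer factors come from \<open>dl_le_pieces\<close> and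
    \<open>pieces_le_dl\<close>. The three summands belong to the point itself, to output neighbours
    of input points, and to input neighbours of output points.\<close>
  define K where "K = 2 * (2 + 8 * \<Gamma> + 4 * C * C0) * lac_const p a"
  have K: "0 \<le> K" using \<Gamma> C C0 lac_const_nonneg[of p a] by (simp add: K_def)
  show ?thesis
    unfolding maxc_bounded_iff[OF p ab(1,2,3) b1]
  proof (intro exI[of _ K] conjI K ballI impI)
    fix f :: "'a \<Rightarrow> real"
    let ?f = "\<lambda>x. ennreal \<bar>f x\<bar>"
    define x where "x = pn a ?f"
    define S where "S m = (SUP i. ennreal (2 powr (- (1 / p) * real i)) * x (m + i))" for m
    define U where "U m = (if isD m then ennreal (hh (bl m)) * (\<Sum>m'\<in>AA (bl m). x m') else 0)" for m
    have piece: "pn b (maxc X \<rho> \<mu> f) m \<le> 2 * x m + 8 * S m + ennreal (4 * C) * U m" for m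
    proof -
      consider "isA m" | "isD m" | "\<not> 0 < N m" using N0 by blast
      then show ?thesis
      proof cases
        case 1
        have "pn b (maxc X \<rho> \<mu> f) m \<le> 2 * (x m + 4 * S m)"
          unfolding x_def S_def by (rule pn_maxc_A[OF ab 1])
        also have "\<dots> = 2 * x m + 8 * S m" by (simp add: distrib_left mult.assoc[symmetric])
        also have "\<dots> \<le> 2 * x m + 8 * S m + ennreal (4 * C) * U m" by simp
        finally show ?thesis .
      next
        case 2
        have "pn b (maxc X \<rho> \<mu> f) m \<le> 2 * (x m + ennreal (2 * C * hh (bl m)) * (\<Sum>m'\<in>AA (bl m). x m'))"
          unfolding x_def by (rule pn_maxc_D[OF ab 2 C])
        also have "\<dots> = 2 * x m + ennreal (4 * C) * U m"
        proof -
          have "2 * ennreal (2 * C * hh (bl m)) = ennreal (4 * C) * ennreal (hh (bl m))"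
          proof -
            have "2 * ennreal (2 * C * hh (bl m)) = ennreal 2 * ennreal (2 * C * hh (bl m))" by simp
            also have "\<dots> = ennreal (2 * (2 * C * hh (bl m)))" by (rule ennreal_mult'[symmetric]) simp
            also have "2 * (2 * C * hh (bl m)) = 4 * C * hh (bl m)" by simp
            also have "ennreal (4 * C * hh (bl m)) = ennreal (4 * C) * ennreal (hh (bl m))" using C by (intro ennreal_mult') simp
            finally show ?thesis .
          qed
          then show ?thesis using 2 by (simp add: U_def distrib_left mult.assoc[symmetric])
        qed
        also have "\<dots> \<le> 2 * x m + 8 * S m + ennreal (4 * C) * U m" by (intro add_right_mono) simp
        finally show ?thesis .
      next
        case 3
        then have "dp (maxc X \<rho> \<mu> f) m t = 0" for t using P_empty[of m] by (simp add: dp_def)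
        then have "lev p (dp (maxc X \<rho> \<mu> f) m) = (\<lambda>k. 0)" by (auto simp: lev_def)
        then show ?thesis by (simp add: pn_def)
      qed
    qed
    have lpx: "lp b x \<le> lp a x" using ab by (intro lp_antimono_exponent)
    have lpS: "lp b S \<le> ennreal \<Gamma> * lp a x"
    proof -
      have "lp b S \<le> (\<Sum>i. ennreal (2 powr (- (1 / p) * real i))) * lp b x"
        unfolding S_def using ab b1 by (intro lp_SUP_le) (auto intro: injI)
      also have "(\<Sum>i. ennreal (2 powr (- (1 / p) * real i))) = ennreal \<Gamma>"
        unfolding \<Gamma>_def using p by (intro suminf_geom_powr) simp
      also have "ennreal \<Gamma> * lp b x \<le> ennreal \<Gamma> * lp a x" by (intro mult_left_mono lpx) simp
      finally show ?thesis .
    qed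
    have lpU: "lp b U \<le> ennreal C0 * lp a x" unfolding U_def by (rule lp_blocks_le[OF ab C0])
    have "dl p b \<mu> (maxc X \<rho> \<mu> f) \<le> 2 * lp b (pn b (maxc X \<rho> \<mu> f))" using ab b1 by (intro dl_le_pieces)
    also have "\<dots> \<le> 2 * lp b (\<lambda>m. 2 * x m + 8 * S m + ennreal (4 * C) * U m)"
      using ab by (intro mult_left_mono lp_mono piece) auto
    also have "\<dots> \<le> 2 * (2 * lp b x + 8 * lp b S + ennreal (4 * C) * lp b U)"
    proof (intro mult_left_mono)
      have "lp b (\<lambda>m. 2 * x m + 8 * S m + ennreal (4 * C) * U m) \<le> lp b (\<lambda>m. 2 * x m + 8 * S m) + lp b (\<lambda>m. ennreal (4 * C) * U m)"
        by (rule lp_add_le[OF ab(3) b1])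
      also have "\<dots> \<le> lp b (\<lambda>m. 2 * x m) + lp b (\<lambda>m. 8 * S m) + lp b (\<lambda>m. ennreal (4 * C) * U m)"
        by (intro add_right_mono lp_add_le[OF ab(3) b1])
      also have "\<dots> = 2 * lp b x + 8 * lp b S + ennreal (4 * C) * lp b U" by (simp only: lp_cmult[OF ab(3)])
      finally show "lp b (\<lambda>m. 2 * x m + 8 * S m + ennreal (4 * C) * U m) \<le> 2 * lp b x + 8 * lp b S + ennreal (4 * C) * lp b U" .
    qed simp
    also have "\<dots> \<le> 2 * (2 * lp a x + 8 * (ennreal \<Gamma> * lp a x) + ennreal (4 * C) * (ennreal C0 * lp a x))"
      by (intro mult_left_mono add_mono lpx lpS lpU) auto
    also have "\<dots> = ennreal (2 * (2 + 8 * \<Gamma> + 4 * C * C0)) * lp a x"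
    proof -
      have "ennreal (2 * (2 + 8 * \<Gamma> + 4 * C * C0)) = 2 * (2 + 8 * ennreal \<Gamma> + ennreal (4 * C) * ennreal C0)"
      proof -
        have "ennreal (2 * (2 + 8 * \<Gamma> + 4 * C * C0)) = ennreal 2 * ennreal (2 + 8 * \<Gamma> + 4 * C * C0)"
          by (rule ennreal_mult') simp
        also have "ennreal (2 + 8 * \<Gamma> + 4 * C * C0) = ennreal 2 + ennreal (8 * \<Gamma>) + ennreal (4 * C * C0)"
        proof -
          have "ennreal (2 + 8 * \<Gamma> + 4 * C * C0) = ennreal (2 + 8 * \<Gamma>) + ennreal (4 * C * C0)"
            using \<Gamma> C C0 by (intro ennreal_plus) auto
          moreover have "ennreal (2 + 8 * \<Gamma>) = ennreal 2 + ennreal (8 * \<Gamma>)" using \<Gamma> by (intro ennreal_plus) auto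
          ultimately show ?thesis by (simp only:)
        qed
        also have "ennreal (8 * \<Gamma>) = 8 * ennreal \<Gamma>" by (simp add: ennreal_mult')
        also have "ennreal (4 * C * C0) = ennreal (4 * C) * ennreal C0" using C by (intro ennreal_mult') simp
        finally show ?thesis by simp
      qed
      then show ?thesis by (simp add: distrib_left distrib_right mult.assoc)
    qed
    also have "\<dots> \<le> ennreal (2 * (2 + 8 * \<Gamma> + 4 * C * C0)) * (ennreal (lac_const p a) * dl p a \<mu> ?f)"
      unfolding x_def using ab by (intro mult_left_mono pieces_le_dl) auto
    also have "\<dots> = ennreal K * dl p a \<mu> ?f"
      unfolding K_def using \<Gamma> C C0 lac_const_nonneg[of p a] by (simp add: ennreal_mult' mult.assoc)
    finally show "dl p b \<mu> (maxc X \<rho> \<mu> f) \<le> ennreal K * dl p a \<mu> ?f" .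
  qed
qed

text \<open>\<open>sep\<close> bounds the earlier masses by a geometric series. In particular, the
  input neighbours of an output point together weigh no more than the point itself.\<close>

lemma sum_w_less:
  assumes "0 < N m" shows "(\<Sum>m'<m. N m' * w m') \<le> w m"
proof -
  have geo: "(\<Sum>i<m. (1 / 2::real) ^ (m - i)) = 1 - (1 / 2) ^ m" for m
  proof (induction m)
    case (Suc m)
    have "(\<Sum>i<Suc m. (1 / 2::real) ^ (Suc m - i)) = (\<Sum>i<m. (1 / 2) * (1 / 2::real) ^ (m - i)) + 1 / 2"
      by (simp add: Suc_diff_le)
    also have "\<dots> = (1 / 2) * (1 - (1 / 2) ^ m) + 1 / 2" unfolding Suc[symmetric] by (simp add: sum_distrib_left)
    finally show ?case by simp
  qed simp
  have "(\<Sum>m'<m. N m' * w m') \<le> (\<Sum>m'<m. (1 / 2) ^ (m - m') * w m)"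
  proof (rule sum_mono)
    fix m' assume "m' \<in> {..<m}"
    then show "N m' * w m' \<le> (1 / 2) ^ (m - m') * w m" using sep[of m' m] assms by (simp add: power_one_over field_simps)
  qed
  also have "\<dots> = (1 - (1 / 2) ^ m) * w m" by (simp add: sum_distrib_right[symmetric] geo)
  also have "\<dots> \<le> 1 * w m" using w[of m] by (intro mult_right_mono) auto
  finally show ?thesis by simp
qed

text \<open>The test function is \<open>1 / w\<close> on the input pieces of block \<open>n\<close>,
  each of norm of order 1, so its norm is at most of order \<open>MM n powr a\<close>. At an output
  point each input neighbour contributes 1 to an integral over a set of measure at most
  \<open>2 * w m\<close>, so each of the \<open>KK n\<close> output pieces carries norm at least of
  order \<open>hh n * MM n\<close>.\<close>

lemma bounded_only_if:
  assumes ab: "0 \<le> a" "a \<le> 1" "0 \<le> b" "b \<le> 1" and bdd: "maxc_bounded X \<rho> \<mu> p a b"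
  shows "\<exists>C. \<forall>n. hh n * real (KK n) powr b * real (MM n) powr (1 - a) \<le> C"
proof -
  obtain C where C0: "0 \<le> C" and C: "\<And>f. f \<in> borel_measurable \<mu> \<Longrightarrow> dl p a \<mu> (\<lambda>x. ennreal \<bar>f x\<bar>) < \<infinity> \<Longrightarrow>
     dl p b \<mu> (maxc X \<rho> \<mu> f) \<le> ennreal C * dl p a \<mu> (\<lambda>x. ennreal \<bar>f x\<bar>)"
    using bdd unfolding maxc_bounded_iff[OF p ab] by blast
  define L where "L = lac_const p b"
  have L: "0 \<le> L" by (simp add: L_def lac_const_nonneg)
  show ?thesis
  proof (intro exI[of _ "16 * L * C"] allI)
    fix n
    define f where "f x = (if isA (pc x) \<and> bl (pc x) = n then 1 / w (pc x) else 0)" for x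
    let ?f = "\<lambda>x. ennreal \<bar>f x\<bar>"
    have up: "pn a ?f m \<le> 2 * indicator (AA n) m" for m
    proof (cases "m \<in> AA n")
      case True
      have "pn a ?f m \<le> ennreal (2 * (1 / w m)) * ennreal (mass m powr (1 / p))"
        using ab True w[of m] by (intro pn_indicator_le) (auto simp: P_def f_def)
      also have "mass m powr (1 / p) = w m" using massA[of m] True w[of m] p by (simp add: mass_def powr_powr)
      also have "ennreal (2 * (1 / w m)) * ennreal (w m) = 2" using w[of m] by (simp add: ennreal_mult[symmetric])
      finally show ?thesis using True by simp
    next
      case False
      have "pn a ?f m \<le> ennreal (2 * 0) * ennreal (mass m powr (1 / p))"
        using ab False by (intro pn_indicator_le) (auto simp: P_def f_def)
      then show ?thesis by simp
    qed
    have "dl p a \<mu> ?f \<le> 2 * lp a (pn a ?f)" using ab by (intro dl_le_pieces)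
    also have "\<dots> \<le> 2 * lp a (\<lambda>m. 2 * indicator (AA n) m)" using ab by (intro mult_left_mono lp_mono up) auto
    also have "\<dots> \<le> 2 * (ennreal (real (card (AA n)) powr a) * 2)" using ab finA by (intro mult_left_mono lp_const_le) auto
    also have "\<dots> = ennreal (4 * real (MM n) powr a)"
    proof -
      have "ennreal 2 * (ennreal u * ennreal 2) = ennreal (4 * u)" if "0 \<le> u" for u
        using that by (simp only: ennreal_mult'[symmetric] zero_le_numeral mult_nonneg_nonneg) simp
      then show ?thesis unfolding cardA by simp
    qed
    finally have fa: "dl p a \<mu> ?f \<le> ennreal (4 * real (MM n) powr a)" .
    have lo: "ennreal (real (MM n) * hh n / 4) \<le> pn b (maxc X \<rho> \<mu> f) m" if m: "m \<in> DD n" for m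
    proof -
      have Nm: "0 < N m" using m N0 by blast
      have Mge: "ennreal (real (MM n) / (2 * w m)) \<le> maxc X \<rho> \<mu> f x" if x: "x \<in> P m" for x
      proof -
        have mD: "isD m" and mn: "bl m = n" using m by auto
        have s0: "0 \<le> (\<Sum>m'\<in>AA n. w m')" using w by (intro sum_nonneg) (auto intro: less_imp_le)
        have "(\<Sum>m'\<in>AA n. w m') \<le> (\<Sum>m'\<in>AA n. N m' * w m')"
          using w N0 by (intro sum_mono) (auto simp: Suc_le_eq)
        also have "\<dots> \<le> (\<Sum>m'<m. N m' * w m')"
          using ord[OF _ mD] mn w by (intro sum_mono2) (auto intro!: mult_nonneg_nonneg intro: less_imp_le)
        also have "\<dots> \<le> w m" by (rule sum_w_less[OF Nm])
        finally have s1: "(\<Sum>m'\<in>AA n. w m') \<le> w m" .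
        have fy: "w m' * \<bar>f (pt m' (el x mod N m'))\<bar> = 1" if "m' \<in> AA n" for m'
          using that N0[of m'] w[of m'] pt[of "el x mod N m'" m'] by (auto simp: f_def)
        have fx: "f x = 0" using x mD excl by (auto simp: f_def P_def)
        have "(\<integral>\<^sup>+ y \<in> nb x. ?f y \<partial>\<mu>) = (\<Sum>m'\<in>AA n. ennreal (w m') * ?f (pt m' (el x mod N m')))"
          unfolding nb_D_sum(1)[OF x mD] mn fx by simp
        also have "\<dots> = (\<Sum>m'\<in>AA n. ennreal (w m' * \<bar>f (pt m' (el x mod N m'))\<bar>))"
          using w by (intro sum.cong) (auto simp: ennreal_mult less_imp_le)
        also have "\<dots> = (\<Sum>m'\<in>AA n. 1)" using fy by (intro sum.cong) auto
        also have "\<dots> = ennreal (real (MM n))" by (simp add: cardA ennreal_of_nat_eq_real_of_nat)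
        finally have int: "(\<integral>\<^sup>+ y \<in> nb x. ?f y \<partial>\<mu>) = ennreal (real (MM n))" .
        have em: "emeasure \<mu> (nb x) = ennreal (w m + (\<Sum>m'\<in>AA n. w m'))" using nb_D_sum(2)[OF x mD] mn by simp
        have "real (MM n) / (2 * w m) \<le> real (MM n) / (w m + (\<Sum>m'\<in>AA n. w m'))"
          using w[of m] s0 s1 by (intro divide_left_mono) auto
        then have "ennreal (real (MM n) / (2 * w m)) \<le> ennreal (real (MM n) / (w m + (\<Sum>m'\<in>AA n. w m')))" by (rule ennreal_leI)
        also have "\<dots> = (\<integral>\<^sup>+ y \<in> nb x. ?f y \<partial>\<mu>) / emeasure \<mu> (nb x)"
          unfolding int em using w[of m] s0 by (intro divide_ennreal[symmetric]) auto
        also have "\<dots> \<le> maxc X \<rho> \<mu> f x" using x em w[of m] s0 by (intro maxc_ge_nb) (auto simp: P_def zero_less_iff_neq_zero)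
        finally show ?thesis .
      qed
      have "ennreal (real (MM n) / (2 * w m)) * ennreal (mass m powr (1 / p)) \<le> 2 * pn b (maxc X \<rho> \<mu> f) m"
        using ab Mge MM[of n] w[of m] by (intro pn_ge) auto
      also have "mass m powr (1 / p) = hh n * w m"
        using massD[of m] m w[of m] hh[of n] p by (simp add: mass_def powr_powr)
      also have "ennreal (real (MM n) / (2 * w m)) * ennreal (hh n * w m) = ennreal (real (MM n) * hh n / 2)"
        using w[of m] hh[of n] by (simp add: ennreal_mult[symmetric])
      finally have "ennreal (real (MM n) * hh n / 2) \<le> ennreal 2 * pn b (maxc X \<rho> \<mu> f) m" by simp
      then have "ennreal (1 / 2) * ennreal (real (MM n) * hh n / 2) \<le> ennreal (1 / 2) * (ennreal 2 * pn b (maxc X \<rho> \<mu> f) m)"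
        by (rule mult_left_mono) simp
      moreover have "ennreal (1 / 2) * (ennreal 2 * pn b (maxc X \<rho> \<mu> f) m) = pn b (maxc X \<rho> \<mu> f) m"
        unfolding half_mult by simp
      moreover have "ennreal (1 / 2) * ennreal (real (MM n) * hh n / 2) = ennreal (real (MM n) * hh n / 4)"
      proof -
        have "ennreal (1 / 2) * ennreal (real (MM n) * hh n / 2) = ennreal (1 / 2 * (real (MM n) * hh n / 2))"
          by (rule ennreal_mult'[symmetric]) simp
        then show ?thesis by simp
      qed
      ultimately show ?thesis by (simp only:)
    qed
    have ne: "DD n \<noteq> {}" using cardD[of n] KK[of n] by (metis card.empty not_one_le_zero)
    have "ennreal (real (card (DD n)) powr b) * ennreal (real (MM n) * hh n / 4) \<le> lp b (pn b (maxc X \<rho> \<mu> f))"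
      by (rule const_le_lp[OF finD ab(3) lo ne])
    also have "\<dots> \<le> ennreal L * dl p b \<mu> (maxc X \<rho> \<mu> f)" unfolding L_def using ab by (intro pieces_le_dl)
    also have "\<dots> \<le> ennreal L * (ennreal C * ennreal (4 * real (MM n) powr a))"
    proof -
      have "dl p a \<mu> ?f < \<infinity>" using fa by (rule le_less_trans) simp
      then have "dl p b \<mu> (maxc X \<rho> \<mu> f) \<le> ennreal C * dl p a \<mu> ?f" by (intro C) auto
      also have "\<dots> \<le> ennreal C * ennreal (4 * real (MM n) powr a)" by (intro mult_left_mono fa) simp
      finally show ?thesis by (rule mult_left_mono) simp
    qed
    also have "\<dots> = ennreal (L * (C * (4 * real (MM n) powr a)))" using L C0 by (simp add: ennreal_mult)
    also have "ennreal (real (card (DD n)) powr b) * ennreal (real (MM n) * hh n / 4) = ennreal (real (KK n) powr b * (real (MM n) * hh n / 4))"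
      unfolding cardD by (rule ennreal_mult'[symmetric]) simp
    finally have "real (KK n) powr b * (real (MM n) * hh n / 4) \<le> L * (C * (4 * real (MM n) powr a))"
      using L C0 by (subst (asm) ennreal_le_iff) auto
    then have "hh n * real (KK n) powr b * real (MM n) \<le> 16 * L * C * real (MM n) powr a" by (simp add: ac_simps)
    moreover have "hh n * real (KK n) powr b * real (MM n) powr (1 - a) = hh n * real (KK n) powr b * real (MM n) / real (MM n) powr a"
      using MM[of n] by (simp add: powr_diff)
    moreover have "0 < real (MM n) powr a" using MM[of n] by simp
    ultimately show "hh n * real (KK n) powr b * real (MM n) powr (1 - a) \<le> 16 * L * C"
      by (simp add: divide_le_eq)
  qed
qed

lemma bounded_iff:
  assumes ab: "0 \<le> a" "a \<le> 1" "0 \<le> b" "b \<le> 1"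
  shows "maxc_bounded X \<rho> \<mu> p a b \<longleftrightarrow> b \<le> a \<and> (\<exists>C. \<forall>n. hh n * real (KK n) powr b * real (MM n) powr (1 - a) \<le> C)"
proof
  assume "maxc_bounded X \<rho> \<mu> p a b"
  then show "b \<le> a \<and> (\<exists>C. \<forall>n. hh n * real (KK n) powr b * real (MM n) powr (1 - a) \<le> C)"
    using bounded_diag bounded_only_if ab by blast
next
  assume h: "b \<le> a \<and> (\<exists>C. \<forall>n. hh n * real (KK n) powr b * real (MM n) powr (1 - a) \<le> C)"
  then obtain C where C: "\<And>n. hh n * real (KK n) powr b * real (MM n) powr (1 - a) \<le> C" by blast
  have "0 \<le> hh 0 * real (KK 0) powr b * real (MM 0) powr (1 - a)" using hh[of 0] by (intro mult_nonneg_nonneg) auto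
  then have "0 \<le> C" using C[of 0] by linarith
  then show "maxc_bounded X \<rho> \<mu> p a b" using bounded_if[OF ab(1,2,3)] h C by blast
qed

end

section \<open>Construction of the block parameters\<close>

lemma prod_encode_less: "i < j \<Longrightarrow> prod_encode (n, i) < prod_encode (n, j)"
proof -
  have tri: "triangle k < triangle (Suc k)" for k by simp
  have "strict_mono triangle" by (rule strict_mono_Suc_iff[THEN iffD2]) (use tri in blast)
  then show "i < j \<Longrightarrow> prod_encode (n, i) < prod_encode (n, j)" by (simp add: prod_encode_def strict_mono_less)
qed

locale block_data =
  fixes p :: real and hh :: "nat \<Rightarrow> real" and MM KK :: "nat \<Rightarrow> nat"
  assumes p: "1 < p" and hh: "\<And>n. 0 < hh n" and MM: "\<And>n. 1 \<le> MM n" and KK: "\<And>n. 1 \<le> KK n"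
begin

text \<open>A piece is coded by its block and its index there. Inputs take the first indices, so
  \<open>prod_encode_less\<close> places them before the outputs of the block; indices from
  \<open>MM + KK\<close> on belong to empty pieces.\<close>

definition bl :: "nat \<Rightarrow> nat" where "bl m = fst (prod_decode m)"
definition ix :: "nat \<Rightarrow> nat" where "ix m = snd (prod_decode m)"
definition isA where "isA m \<longleftrightarrow> ix m < MM (bl m)"
definition isD where "isD m \<longleftrightarrow> MM (bl m) \<le> ix m \<and> ix m < MM (bl m) + KK (bl m)"

lemma enc [simp]: "bl (prod_encode (n, i)) = n" "ix (prod_encode (n, i)) = i"
  by (simp_all add: bl_def ix_def)

lemma dec: "prod_encode (bl m, ix m) = m"
  by (simp add: bl_def ix_def)

text \<open>\<open>r\<close> is the free parameter of piece \<open>m\<close>. The size of an output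
  piece is a multiple of all input parameters of its block, which provides the assumption
  \<open>dvd\<close> of \<open>blocks\<close>.\<close>

definition sz :: "(nat \<Rightarrow> nat) \<Rightarrow> nat \<Rightarrow> nat \<Rightarrow> nat" where
  "sz t m r = (if isA m then r else if isD m then (\<Prod>i<MM (bl m). t (prod_encode (bl m, i))) * r else 0)"

text \<open>The solution \<open>w\<close> of \<open>N w = w powr p\<close> on input pieces and of
  \<open>N w = (h w) powr p\<close> on output pieces. Empty pieces get weight 1 to keep weights
  positive.\<close>

definition wt :: "(nat \<Rightarrow> nat) \<Rightarrow> nat \<Rightarrow> nat \<Rightarrow> real" where
  "wt t m r = (if isA m then real r powr (1 / (p - 1))
     else if isD m then (real (sz t m r) / hh (bl m) powr p) powr (1 / (p - 1)) else 1)"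

text \<open>The assumption \<open>sep\<close> of \<open>blocks\<close> for piece \<open>m\<close>,
  relative to the parameters already chosen for earlier pieces.\<close>

definition large :: "(nat \<Rightarrow> nat) \<Rightarrow> nat \<Rightarrow> nat \<Rightarrow> bool" where
  "large t m r \<longleftrightarrow> 1 \<le> r \<and> (isA m \<or> isD m \<longrightarrow> (\<forall>m'<m. 2 ^ (m - m') * (sz t m' (t m') * wt t m' (t m')) \<le> wt t m r))"

lemma input_less: "isD m \<Longrightarrow> i < MM (bl m) \<Longrightarrow> prod_encode (bl m, i) < m"
  using prod_encode_less[of i "ix m" "bl m"] by (simp add: isD_def dec)

lemma sz_cong: "(\<And>z. z < m \<Longrightarrow> t z = t' z) \<Longrightarrow> sz t m r = sz t' m r"
  unfolding sz_def using input_less[of m] by (auto intro!: prod.cong)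

lemma large_cong: assumes "\<And>z. z < m \<Longrightarrow> t z = t' z" shows "large t m r = large t' m r"
proof -
  have sz: "sz t m' r = sz t' m' r" if "m' \<le> m" for m' r using assms that by (intro sz_cong) auto
  then have wt: "wt t m' r = wt t' m' r" if "m' \<le> m" for m' r using that by (simp add: wt_def)
  have "sz t m' (t m') * wt t m' (t m') = sz t' m' (t' m') * wt t' m' (t' m')" if "m' < m" for m'
    using sz[of m' "t m'"] wt[of m' "t m'"] assms[OF that] that by simp
  then show ?thesis unfolding large_def using wt[of m r] by auto
qed

text \<open>With the earlier pieces fixed, the weight grows like
  \<open>r powr (1 / (p - 1))\<close>, so a large \<open>r\<close> meets all requirements; an output
  size is at least \<open>r\<close> because the earlier parameters are at least 1.\<close>

lemma large_exists: assumes "\<And>y. y < m \<Longrightarrow> large t y (t y)" shows "\<exists>r. large t m r"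
proof -
  define B where "B = (\<Sum>m'<m. 2 ^ (m - m') * (sz t m' (t m') * wt t m' (t m')))"
  have nn: "0 \<le> wt t m' r" for m' r by (simp add: wt_def)
  have Bge: "2 ^ (m - m') * (sz t m' (t m') * wt t m' (t m')) \<le> B" if "m' < m" for m'
    unfolding B_def using that nn by (intro member_le_sum) auto
  have B0: "0 \<le> B" unfolding B_def using nn by (intro sum_nonneg) auto
  have root: "B \<le> x powr (1 / (p - 1))" if "B powr (p - 1) \<le> x" for x
  proof -
    have "B = (B powr (p - 1)) powr (1 / (p - 1))" using B0 p by (simp add: powr_powr)
    also have "\<dots> \<le> x powr (1 / (p - 1))" using that p by (intro powr_mono2) auto
    finally show ?thesis .
  qed
  \<comment> \<open>Serves both kinds of pieces: inputs ask for \<open>B powr (p - 1)\<close>,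
    outputs for \<open>hh (bl m) powr p\<close> times that.\<close>
  define r where "r = Suc (nat \<lceil>max 1 (hh (bl m) powr p) * B powr (p - 1)\<rceil>)"
  have r: "max 1 (hh (bl m) powr p) * B powr (p - 1) \<le> real r" unfolding r_def
    using of_nat_ceiling[of "max 1 (hh (bl m) powr p) * B powr (p - 1)"] by linarith
  have r1: "B powr (p - 1) \<le> real r" using r mult_right_mono[of 1 "max 1 (hh (bl m) powr p)" "B powr (p - 1)"] by simp
  have r2: "hh (bl m) powr p * B powr (p - 1) \<le> real r"
    using r mult_right_mono[of "hh (bl m) powr p" "max 1 (hh (bl m) powr p)" "B powr (p - 1)"] by simp
  have "B \<le> wt t m r" if "isA m \<or> isD m"
  proof (cases "isA m")
    case True then show ?thesis using root[OF r1] by (simp add: wt_def)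
  next
    case False
    then have D: "isD m" using that by simp
    have "1 \<le> (\<Prod>i<MM (bl m). t (prod_encode (bl m, i)))"
      using assms[OF input_less[OF D]] by (intro prod_ge_1) (auto simp: large_def)
    then have "1 * r \<le> sz t m r" using False D unfolding sz_def by (simp only: if_True if_False mult_le_mono1)
    then have "hh (bl m) powr p * B powr (p - 1) \<le> real (sz t m r)" using r2 by simp
    then have "B powr (p - 1) \<le> real (sz t m r) / hh (bl m) powr p" using hh[of "bl m"] by (simp add: le_divide_eq mult.commute)
    then show ?thesis using root False D by (simp add: wt_def)
  qed
  then have "large t m r" unfolding large_def using Bge by (auto simp: r_def intro: order_trans)
  then show ?thesis ..
qed

text \<open>Well-founded choice, as the condition on a piece refers to all earlier ones;
  \<open>large_cong\<close> expresses that it refers to nothing else.\<close>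

lemma large_sequence: obtains t where "\<And>m. large t m (t m)"
proof -
  have "\<exists>t. \<forall>m. large t m (t m)"
  proof (rule dependent_wf_choice[OF wf_less_than])
    show "large f x r = large g x r" if "\<And>z. (z, x) \<in> less_than \<Longrightarrow> f z = g z" for f g x r
      using that by (intro large_cong) simp
    show "\<exists>r. large f x r" if "\<And>y. (y, x) \<in> less_than \<Longrightarrow> large f y (f y)" for x f
      using that by (intro large_exists) simp
  qed
  then show ?thesis using that by blast
qed

lemma block_set: "{m. isA m \<and> bl m = n} = (\<lambda>i. prod_encode (n, i)) ` {..<MM n}"
  "{m. isD m \<and> bl m = n} = (\<lambda>i. prod_encode (n, i)) ` {MM n..<MM n + KK n}"
proof -
  have *: "m = prod_encode (bl m, ix m)" for m by (simp add: dec)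
  show "{m. isA m \<and> bl m = n} = (\<lambda>i. prod_encode (n, i)) ` {..<MM n}"
    using * by (auto simp: isA_def)
  show "{m. isD m \<and> bl m = n} = (\<lambda>i. prod_encode (n, i)) ` {MM n..<MM n + KK n}"
  proof (intro equalityI subsetI)
    fix m assume "m \<in> {m. isD m \<and> bl m = n}"
    then have "MM n \<le> ix m" "ix m < MM n + KK n" "bl m = n" by (auto simp: isD_def)
    then show "m \<in> (\<lambda>i. prod_encode (n, i)) ` {MM n..<MM n + KK n}"
      using dec[of m] by (intro image_eqI[of _ _ "ix m"]) auto
  qed (auto simp: isD_def)
qed

lemma exists_space:
  "\<exists>(X :: real set) \<rho> \<mu>. mm_space X \<rho> \<mu> \<and> (\<forall>a\<in>{0..1}. \<forall>b\<in>{0..1}. maxc_bounded X \<rho> \<mu> p a b \<longleftrightarrow>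
     b \<le> a \<and> (\<exists>C. \<forall>n. hh n * real (KK n) powr b * real (MM n) powr (1 - a) \<le> C))"
proof -
  obtain t where t: "\<And>m. large t m (t m)" using large_sequence by blast
  define N where "N m = sz t m (t m)" for m
  define w where "w m = wt t m (t m)" for m
  \<comment> \<open>The points \<open>(m, e)\<close> are coded as natural numbers inside
    \<open>real\<close>, the carrier type named in the theorem.\<close>
  define X where "X = {real (prod_encode (m, e)) | m e. e < N m}"
  define pc where "pc x = fst (prod_decode (nat \<lfloor>x\<rfloor>))" for x :: real
  define el where "el x = snd (prod_decode (nat \<lfloor>x\<rfloor>))" for x :: real
  have t1: "1 \<le> t m" for m using t[of m] by (simp add: large_def)
  have excl: "\<not> (isA m \<and> isD m)" for m by (auto simp: isA_def isD_def)
  have NA: "N m = t m" "w m = real (t m) powr (1 / (p - 1))" if "isA m" for m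
    using that by (auto simp: N_def w_def sz_def wt_def)
  have ND: "N m = (\<Prod>i<MM (bl m). t (prod_encode (bl m, i))) * t m" "w m = (real (N m) / hh (bl m) powr p) powr (1 / (p - 1))"
    if "isD m" for m
    using that excl by (auto simp: N_def w_def sz_def wt_def)
  have Npos: "0 < N m \<longleftrightarrow> isA m \<or> isD m" for m
  proof (cases "isA m \<or> isD m")
    case True
    have pos: "0 < t m" for m using t1[of m] by simp
    then show ?thesis using True NA(1)[of m] ND(1)[of m] by auto
  next
    case False then show ?thesis by (simp add: N_def sz_def)
  qed
  have wpos: "0 < w m" for m
  proof -
    consider "isA m" | "isD m" | "\<not> isA m" "\<not> isD m" by blast
    then show ?thesis
    proof cases
      case 1 then show ?thesis using NA(2)[OF 1] t1[of m] by simp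
    next
      case 2
      then have "0 < N m" using Npos by blast
      then show ?thesis using ND(2)[OF 2] hh[of "bl m"] by simp
    next
      case 3 then show ?thesis by (simp add: w_def wt_def)
    qed
  qed
  interpret blocks p X pc el N w isA isD bl hh MM KK
  proof
    show "1 < p" by (rule p)
    show "bij_betw (\<lambda>x. (pc x, el x)) X (Sigma UNIV (\<lambda>m. {..<N m}))"
      by (rule bij_betwI[where g = "\<lambda>(m, e). real (prod_encode (m, e))"]) (auto simp: X_def pc_def el_def)
    show "0 < w m" for m by (rule wpos)
    show "0 < N m \<longleftrightarrow> isA m \<or> isD m" for m by (rule Npos)
    show "\<not> (isA m \<and> isD m)" for m by (rule excl)
    show "real (N m) * w m = w m powr p" if "isA m" for m
    proof -
      have tm: "0 < real (t m)" using t1[of m] by simp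
      have "real (t m) * real (t m) powr (1 / (p - 1)) = real (t m) powr (1 + 1 / (p - 1))"
        using tm by (simp add: powr_add)
      also have "1 + 1 / (p - 1) = (1 / (p - 1)) * p" using p by (simp add: field_simps)
      finally show ?thesis using NA[OF that] by (simp add: powr_powr)
    qed
    show "real (N m) * w m = (hh (bl m) * w m) powr p" if "isD m" for m
    proof -
      have Nm: "0 < real (N m)" using Npos that by simp
      have "w m powr (p - 1) = real (N m) / hh (bl m) powr p"
        unfolding ND(2)[OF that] using p Nm hh[of "bl m"] by (simp add: powr_powr)
      then have "real (N m) = hh (bl m) powr p * w m powr (p - 1)" using hh[of "bl m"] by simp
      then have "real (N m) * w m = hh (bl m) powr p * (w m powr (p - 1) * w m)" by simp
      also have "w m powr (p - 1) * w m = w m powr p" using wpos[of m] by (simp add: powr_diff)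
      finally show ?thesis using hh[of "bl m"] wpos[of m] by (simp add: powr_mult)
    qed
    show "N m dvd N m'" if "isA m" "isD m'" "bl m = bl m'" for m m'
    proof -
      have "t (prod_encode (bl m', ix m)) dvd (\<Prod>i<MM (bl m'). t (prod_encode (bl m', i)))"
        using that by (intro dvd_prodI) (auto simp: isA_def)
      then have "t m dvd (\<Prod>i<MM (bl m'). t (prod_encode (bl m', i)))" using dec[of m] that by simp
      then show ?thesis using NA(1)[OF that(1)] ND(1)[OF that(2)] by simp
    qed
    show "2 ^ (m - m') * (real (N m') * w m') \<le> w m" if "m' < m" "0 < N m" for m m'
      using t[of m] that Npos[of m] unfolding large_def N_def w_def by blast
    show "m < m'" if "isA m" "isD m'" "bl m = bl m'" for m m'
      using prod_encode_less[of "ix m" "ix m'" "bl m"] that dec[of m] dec[of m'] by (simp add: isA_def isD_def)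
    have inj: "inj_on (\<lambda>i. prod_encode (n, i)) I" for n I by (auto intro!: inj_onI)
    show "finite {m. isA m \<and> bl m = n}" "card {m. isA m \<and> bl m = n} = MM n"
      "finite {m. isD m \<and> bl m = n}" "card {m. isD m \<and> bl m = n} = KK n" for n
      unfolding block_set using inj by (simp_all add: card_image)
  qed (use MM KK hh in auto)
  show ?thesis using mm_space_X bounded_iff by (intro exI[of _ X] exI[of _ \<rho>] exI[of _ \<mu>]) auto
qed

end

subsection \<open>Cutting out half planes\<close>

text \<open>\<open>s\<close> is the supremum of the difference quotients to the right of
  \<open>a\<close>; by concavity these lie below all quotients to the left. A point on the left
  keeps the supremum finite, one on the right makes it nonnegative by monotonicity.\<close>

lemma concave_support:
  fixes F :: "real \<Rightarrow> real"
  assumes conc: "concave_on {\<delta>..1} F" and mono: "mono_on {\<delta>..1} F" and a: "\<delta> < a" "a < 1"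
  obtains s where "0 \<le> s" "\<And>u. u \<in> {\<delta>..1} \<Longrightarrow> F u \<le> F a + s * (u - a)"
proof -
  have c: "r * F x + t * F y \<le> F (r *\<^sub>R x + t *\<^sub>R y)"
    if "x \<in> {\<delta>..1}" "y \<in> {\<delta>..1}" "0 \<le> r" "0 \<le> t" "r + t = 1" for x y r t
    using conc that unfolding concave_on_iff by blast
  have three: "(v - a) * F u + (a - u) * F v \<le> (v - u) * F a" if u: "\<delta> \<le> u" "u < a" and v: "a < v" "v \<le> 1" for u v
  proof -
    have d: "0 < v - u" using u v by simp
    let ?x = "(v - a) / (v - u)" and ?y = "(a - u) / (v - u)"
    have xy: "0 \<le> ?x" "0 \<le> ?y" "?x + ?y = 1" using u v d by (auto simp: add_divide_distrib[symmetric])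
    have "?x * F u + ?y * F v \<le> F (?x *\<^sub>R u + ?y *\<^sub>R v)"
      by (rule c[OF _ _ xy]) (use u v in auto)
    also have "?x *\<^sub>R u + ?y *\<^sub>R v = a"
    proof -
      have "(v - a) * u + (a - u) * v = a * (v - u)" by (simp add: algebra_simps)
      then show ?thesis using d by (simp add: add_divide_distrib[symmetric])
    qed
    finally have "((v - a) * F u + (a - u) * F v) / (v - u) \<le> F a" by (simp add: add_divide_distrib)
    then show ?thesis using d by (simp add: divide_le_eq mult.commute)
  qed
  define R where "R = (\<lambda>v. (F v - F a) / (v - a)) ` {a<..1}"
  have ne: "R \<noteq> {}" using a by (auto simp: R_def)
  have Rle: "r \<le> (F a - F u) / (a - u)" if r: "r \<in> R" and u: "\<delta> \<le> u" "u < a" for r u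
  proof -
    obtain v where v: "a < v" "v \<le> 1" "r = (F v - F a) / (v - a)" using r by (auto simp: R_def)
    have "(F v - F a) * (a - u) \<le> (F a - F u) * (v - a)" using three[OF u v(1,2)] by (simp add: algebra_simps)
    then show ?thesis using v u by (simp add: divide_le_eq le_divide_eq mult.commute)
  qed
  have bdd: "bdd_above R" using Rle[of _ \<delta>] a by (intro bdd_aboveI[of _ "(F a - F \<delta>) / (a - \<delta>)"]) auto
  define s where "s = Sup R"
  show ?thesis
  proof (rule that[of s])
    have "(F 1 - F a) / (1 - a) \<in> R" using a by (auto simp: R_def)
    then have "(F 1 - F a) / (1 - a) \<le> s" unfolding s_def using bdd by (intro cSup_upper)
    moreover have "0 \<le> (F 1 - F a) / (1 - a)" using a monotone_onD[OF mono, of a 1] by simp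
    ultimately show "0 \<le> s" by simp
  next
    fix u assume u: "u \<in> {\<delta>..1}"
    consider "u < a" | "u = a" | "a < u" by linarith
    then show "F u \<le> F a + s * (u - a)"
    proof cases
      case 1
      have "s \<le> (F a - F u) / (a - u)" unfolding s_def using ne Rle u 1 by (intro cSup_least) auto
      then have "s * (a - u) \<le> F a - F u" using 1 by (simp add: le_divide_eq)
      then show ?thesis by (simp add: algebra_simps)
    next
      case 3
      have "(F u - F a) / (u - a) \<in> R" using u 3 by (auto simp: R_def)
      then have "(F u - F a) / (u - a) \<le> s" unfolding s_def using bdd by (intro cSup_upper)
      then show ?thesis using 3 by (simp add: divide_le_eq)
    qed simp
  qed
qed

text \<open>Rational coefficients keep the family of half planes countable. A supporting line is
  perturbed upwards; at \<open>a = 1\<close> the horizontal line at height \<open>F 1\<close>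
  serves, as \<open>F\<close> is nondecreasing.\<close>

lemma rational_support:
  assumes adm: "admissible \<delta> F" and a: "\<delta> < a" "a \<le> 1" and b: "F a < b"
  obtains c S :: rat where "0 \<le> S" "\<And>u. u \<in> {\<delta>..1} \<Longrightarrow> F u \<le> of_rat c + of_rat S * u" "of_rat c + of_rat S * a < b"
proof -
  have h: "0 \<le> \<delta>" "\<delta> \<le> 1" "concave_on {\<delta>..1} F" "mono_on {\<delta>..1} F" using adm by (auto simp: admissible_def)
  have "\<exists>s\<ge>0. \<forall>u\<in>{\<delta>..1}. F u \<le> F a + s * (u - a)"
  proof (cases "a = 1")
    case True
    then show ?thesis using a monotone_onD[OF h(4), of _ 1] by (intro exI[of _ 0]) auto
  next
    case False
    then show ?thesis using concave_support[OF h(3,4) a(1)] a by (metis less_eq_real_def)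
  qed
  then obtain s where s: "0 \<le> s" "\<And>u. u \<in> {\<delta>..1} \<Longrightarrow> F u \<le> F a + s * (u - a)" by blast
  \<comment> \<open>Slope and intercept are each raised by less than \<open>\<eta>\<close>; since
    \<open>a \<le> 1\<close>, the value at \<open>a\<close> rises by less than
    \<open>2 * \<eta> = b - F a\<close>.\<close>
  define \<eta> where "\<eta> = (b - F a) / 2"
  have \<eta>: "0 < \<eta>" using b by (simp add: \<eta>_def)
  obtain S :: rat where S: "s < of_rat S" "of_rat S < s + \<eta>" using of_rat_dense[of s "s + \<eta>"] \<eta> by auto
  obtain c :: rat where c: "F a - s * a < of_rat c" "of_rat c < F a - s * a + \<eta>" using of_rat_dense[of "F a - s * a" "F a - s * a + \<eta>"] \<eta> by auto
  show ?thesis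
  proof (rule that[of S c])
    have "(0::real) \<le> of_rat S" using S s by linarith
    then show "0 \<le> S" by (simp add: zero_le_of_rat_iff)
  next
    fix u assume u: "u \<in> {\<delta>..1}"
    then have "0 \<le> u" using h by auto
    have "F u \<le> (F a - s * a) + s * u" using s(2)[OF u] by (simp add: algebra_simps)
    also have "\<dots> \<le> of_rat c + of_rat S * u" using c S \<open>0 \<le> u\<close> by (intro add_mono mult_right_mono) auto
    finally show "F u \<le> of_rat c + of_rat S * u" .
  next
    have "of_rat S * a \<le> (s + \<eta>) * a" using S a h by (intro mult_right_mono) auto
    also have "\<dots> \<le> s * a + \<eta>" using \<eta> a by (simp add: distrib_right)
    finally have "of_rat c + of_rat S * a < F a + 2 * \<eta>" using c(2) by linarith
    moreover have "F a + 2 * \<eta> = b" by (simp add: \<eta>_def field_simps)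
    ultimately show "of_rat c + of_rat S * a < b" by simp
  qed
qed

lemma powr_unbounded: assumes "0 < (\<epsilon>::real)" obtains k :: nat where "C < real (k + 2) powr \<epsilon>" "k0 \<le> real k"
proof -
  define k where "k = nat \<lceil>max k0 ((\<bar>C\<bar> + 1) powr (1 / \<epsilon>))\<rceil>"
  have k: "k0 \<le> real k" "(\<bar>C\<bar> + 1) powr (1 / \<epsilon>) \<le> real k"
    unfolding k_def using of_nat_ceiling[of "max k0 ((\<bar>C\<bar> + 1) powr (1 / \<epsilon>))"] by linarith+
  have "C < ((\<bar>C\<bar> + 1) powr (1 / \<epsilon>)) powr \<epsilon>" using assms by (simp add: powr_powr)
  also have "\<dots> \<le> real (k + 2) powr \<epsilon>" using k assms by (intro powr_mono2) auto
  finally show ?thesis using k(1) by (rule that)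
qed

text \<open>The region is cut out by countably many half planes \<open>b \<le> c + S a\<close>. Those of the second family
  turn around the corner \<open>(\<delta>, F \<delta>)\<close> and exclude what lies above it on the line \<open>a = \<delta>\<close>, where the
  region need not be closed.\<close>

lemma half_planes:
  assumes adm: "admissible \<delta> F"
  obtains c S :: "nat \<Rightarrow> real" and K :: "nat \<Rightarrow> nat" where "\<And>n. 0 \<le> S n" "\<And>n. 1 \<le> K n"
    "\<And>a b. a \<in> {0..1} \<Longrightarrow> b \<in> {0..1} \<Longrightarrow>
       (\<exists>C. \<forall>n. real (K n) powr (b - c n - S n * a) \<le> C) \<longleftrightarrow> \<delta> \<le> a \<and> b \<le> F a"
proof -
  have h: "0 \<le> \<delta>" "\<delta> \<le> 1" and F: "\<And>u. u \<in> {\<delta>..1} \<Longrightarrow> 0 \<le> F u \<and> F u \<le> u"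
    using adm by (auto simp: admissible_def)
  have F\<delta>: "0 \<le> F \<delta>" "F \<delta> \<le> 1" using F[of \<delta>] h by auto
  define valid where "valid z \<longleftrightarrow> 0 \<le> fst (snd z) \<and> (\<forall>u\<in>{\<delta>..1}. F u \<le> of_rat (fst z) + of_rat (fst (snd z)) * u)"
    for z :: "rat \<times> rat \<times> nat"
  \<comment> \<open>Triples \<open>(c, S, K)\<close>. Even indices give the lines of slope
    \<open>k\<close> through \<open>(\<delta>, F \<delta>)\<close>, with base \<open>k + 2\<close>.
    Odd indices run through all rational lines, each with every base \<open>k + 2\<close>, so that
    boundedness forces a nonpositive exponent. A line that is not above \<open>F\<close> or has
    negative slope is replaced by base 1, all of whose powers are 1.\<close>
  define tri where "tri n = (if even n then (F \<delta> - real (n div 2) * \<delta>, real (n div 2), n div 2 + 2)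
     else let z = from_nat (n div 2) :: rat \<times> rat \<times> nat in
       if valid z then (of_rat (fst z), of_rat (fst (snd z)), snd (snd z) + 2) else (0, 0, 1 :: nat))" for n
  define c S K where "c n = fst (tri n)" and "S n = fst (snd (tri n))" and "K n = snd (snd (tri n))" for n
  have ev: "c (2 * k) = F \<delta> - real k * \<delta>" "S (2 * k) = real k" "K (2 * k) = k + 2" for k
    by (simp_all add: c_def S_def K_def tri_def)
  have od: "c (2 * k + 1) = of_rat (fst z)" "S (2 * k + 1) = of_rat (fst (snd z))" "K (2 * k + 1) = snd (snd z) + 2"
    if "z = from_nat k" "valid z" for k z
    using that by (simp_all add: c_def S_def K_def tri_def Let_def)
  have od': "c (2 * k + 1) = 0" "S (2 * k + 1) = 0" "K (2 * k + 1) = 1"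
    if "\<not> valid (from_nat k)" for k
    using that by (simp_all add: c_def S_def K_def tri_def Let_def)
  have evod: "(\<exists>k. n = 2 * k) \<or> (\<exists>k. n = 2 * k + 1)" for n :: nat by presburger
  have SK: "0 \<le> S n \<and> 1 \<le> K n" for n
  proof -
    consider k where "n = 2 * k" | k where "n = 2 * k + 1" using evod[of n] by blast
    then show ?thesis
    proof cases
      case (1 k) then show ?thesis by (simp only: ev) simp
    next
      case (2 k)
      show ?thesis
      proof (cases "valid (from_nat k)")
        case True
        then show ?thesis unfolding 2 od[OF refl True] by (auto simp: valid_def)
      next
        case False
        then show ?thesis unfolding 2 od'[OF False] by simp
      qed
    qed
  qed
  show ?thesis
  proof (rule that[of S K c])
    fix n :: nat
    show "0 \<le> S n" "1 \<le> K n" using SK by auto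
  next
    fix a b :: real assume ab: "a \<in> {0..1}" "b \<in> {0..1}"
    show "(\<exists>C. \<forall>n. real (K n) powr (b - c n - S n * a) \<le> C) \<longleftrightarrow> \<delta> \<le> a \<and> b \<le> F a"
    proof
      assume R: "\<delta> \<le> a \<and> b \<le> F a"
      \<comment> \<open>For \<open>a > \<delta>\<close> an even exponent can be positive only while
        \<open>k * (a - \<delta>) < 1\<close>, and it is at most 1, so those powers are at most
        \<open>1 / (a - \<delta>) + 2\<close>.\<close>
      define C where "C = (if a = \<delta> then 1 else 1 / (a - \<delta>) + 3)"
      have C1: "1 \<le> C" using R by (auto simp: C_def)
      have "real (K n) powr (b - c n - S n * a) \<le> C" for n
      proof -
        have neg: "real (K n) powr x \<le> C" if "x \<le> 0" "1 \<le> K n" for x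
        proof -
          have "real (K n) powr x \<le> real (K n) powr 0" using that by (intro powr_mono) auto
          then show ?thesis using that C1 by simp
        qed
        consider k where "n = 2 * k" | k where "n = 2 * k + 1" using evod[of n] by blast
        then show ?thesis
        proof cases
          case (1 k)
          have e: "b - c n - S n * a = b - F \<delta> - real k * (a - \<delta>)" unfolding 1 ev by (simp add: algebra_simps)
          show ?thesis
          proof (cases "a = \<delta>")
            case True
            then show ?thesis using R unfolding e by (intro neg) (auto simp: 1 ev)
          next
            case False
            then have ad: "0 < a - \<delta>" using R by simp
            show ?thesis
            proof (cases "1 \<le> real k * (a - \<delta>)")
              case True
              then show ?thesis using ab F\<delta> unfolding e by (intro neg) (auto simp: 1 ev)
            next
              case small: False
              then have k: "real k \<le> 1 / (a - \<delta>)" using ad by (simp add: le_divide_eq)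
              have "real (K n) powr (b - c n - S n * a) \<le> real (K n) powr 1"
              proof (rule powr_mono)
                have "0 \<le> real k * (a - \<delta>)" using ad by simp
                then show "b - c n - S n * a \<le> 1" unfolding e using ab F\<delta> by auto
              qed (use SK[of n] in auto)
              also have "\<dots> = real k + 2" by (simp add: 1 ev)
              also have "\<dots> \<le> C" using k False by (simp add: C_def)
              finally show ?thesis .
            qed
          qed
        next
          case (2 k)
          show ?thesis
          proof (cases "valid (from_nat k)")
            case True
            note od = od[OF refl True]
            have "b \<le> F a" using R by simp
            also have "\<dots> \<le> c n + S n * a" unfolding 2 od using True R ab by (auto simp: valid_def)
            finally show ?thesis using SK by (intro neg) auto
          next
            case False
            then show ?thesis using C1 unfolding 2 od'[OF False] by simp
          qed
        qed
      qed
      then show "\<exists>C. \<forall>n. real (K n) powr (b - c n - S n * a) \<le> C" by blast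
    next
      assume "\<exists>C. \<forall>n. real (K n) powr (b - c n - S n * a) \<le> C"
      then obtain C where C: "\<And>n. real (K n) powr (b - c n - S n * a) \<le> C" by blast
      have even: "real (k + 2) powr (b - F \<delta> + real k * (\<delta> - a)) \<le> C" for k
        using C[of "2 * k"] unfolding ev by (simp add: algebra_simps)
      show "\<delta> \<le> a \<and> b \<le> F a"
      proof (rule ccontr)
        assume "\<not> (\<delta> \<le> a \<and> b \<le> F a)"
        then consider "a < \<delta>" | "a = \<delta>" "F \<delta> < b" | "\<delta> < a" "F a < b" by fastforce
        then show False
        proof cases
          case 1
          \<comment> \<open>Once \<open>k * (\<delta> - a) \<ge> 2\<close> the exponent is at least
            1, because \<open>b - F \<delta> \<ge> - 1\<close>.\<close>
          obtain k :: nat where k: "C < real (k + 2) powr 1" "2 / (\<delta> - a) \<le> real k" using powr_unbounded[of 1 C "2 / (\<delta> - a)"] by auto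
          have "2 \<le> real k * (\<delta> - a)" using k(2) 1 by (simp add: divide_le_eq)
          then have "real (k + 2) powr 1 \<le> real (k + 2) powr (b - F \<delta> + real k * (\<delta> - a))"
            using ab F\<delta> by (intro powr_mono) auto
          then show False using even[of k] k(1) by linarith
        next
          case 2
          obtain k :: nat where "C < real (k + 2) powr (b - F \<delta>)" "0 \<le> real k" using powr_unbounded[of "b - F \<delta>" C 0] 2 by auto
          then show False using even[of k] 2 by simp
        next
          case 3
          have a1: "a \<le> 1" using ab by simp
          obtain c' S' :: rat where l: "0 \<le> S'" "\<And>u. u \<in> {\<delta>..1} \<Longrightarrow> F u \<le> of_rat c' + of_rat S' * u" "of_rat c' + of_rat S' * a < b"
            using rational_support[OF adm 3(1) a1 3(2)] by blast
          obtain k :: nat where k: "C < real (k + 2) powr (b - of_rat c' - of_rat S' * a)" "0 \<le> real k"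
            using powr_unbounded[of "b - of_rat c' - of_rat S' * a" C 0] l(3) by auto
          let ?z = "(c', S', k)"
          have z: "?z = from_nat (to_nat ?z)" by simp
          have "valid ?z" using l by (simp add: valid_def)
          from od[OF z this] have "real (k + 2) powr (b - of_rat c' - of_rat S' * a) \<le> C"
            using C[of "2 * to_nat ?z + 1"] by simp
          then show False using k by simp
        qed
      qed
    qed
  qed
qed

text \<open>With \<open>K\<close> outputs, about \<open>K powr S\<close> inputs and
  \<open>h = K powr (- (c + S))\<close>, the block quantity of \<open>exists_space\<close> is
  comparable to \<open>K powr (b - c - S * a)\<close>; \<open>S \<ge> 0\<close> ensures at least one
  input. The diagonal condition \<open>b \<le> a\<close> there follows from
  \<open>F a \<le> a\<close>.\<close>

lemma realization:
  assumes p: "1 < p" and adm: "admissible \<delta> F"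
  shows "\<exists>(X :: real set) \<rho> \<mu>. mm_space X \<rho> \<mu> \<and>
    (\<forall>a \<in> {0..1}. \<forall>b \<in> {0..1}. maxc_bounded X \<rho> \<mu> p a b \<longleftrightarrow> \<delta> \<le> a \<and> b \<le> F a)"
proof -
  obtain c S :: "nat \<Rightarrow> real" and K :: "nat \<Rightarrow> nat" where S: "\<And>n. 0 \<le> S n" and K: "\<And>n. 1 \<le> K n" and
    reg: "\<And>a b. a \<in> {0..1} \<Longrightarrow> b \<in> {0..1} \<Longrightarrow>
       (\<exists>C. \<forall>n. real (K n) powr (b - c n - S n * a) \<le> C) \<longleftrightarrow> \<delta> \<le> a \<and> b \<le> F a"
    using half_planes[OF adm] by metis
  \<comment> \<open>Rounding down loses at most a factor 2, because \<open>K powr S\<close> is at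
    least 1.\<close>
  define M where "M n = nat \<lfloor>real (K n) powr S n\<rfloor>" for n
  define h where "h n = real (K n) powr (- (c n + S n))" for n
  have K1: "1 \<le> real (K n)" for n using K[of n] by simp
  have KS: "1 \<le> real (K n) powr S n" for n using K1 S by (intro ge_one_powr_ge_zero)
  have M: "real (M n) \<le> real (K n) powr S n" "real (K n) powr S n \<le> 2 * real (M n)" "1 \<le> M n" for n
  proof -
    have fl: "1 \<le> \<lfloor>real (K n) powr S n\<rfloor>" using KS[of n] by (simp add: le_floor_iff)
    then have "real (M n) = of_int \<lfloor>real (K n) powr S n\<rfloor>" by (simp add: M_def)
    moreover have "1 \<le> M n" unfolding M_def using fl by linarith
    moreover have "of_int \<lfloor>real (K n) powr S n\<rfloor> \<le> real (K n) powr S n" "real (K n) powr S n < of_int \<lfloor>real (K n) powr S n\<rfloor> + 1"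
      by linarith+
    ultimately show "real (M n) \<le> real (K n) powr S n" "real (K n) powr S n \<le> 2 * real (M n)" "1 \<le> M n" by linarith+
  qed
  interpret block_data p h M K
    by unfold_locales (use p M K in \<open>auto simp: h_def Suc_le_eq\<close>)
  obtain X :: "real set" and \<rho> \<mu> where X: "mm_space X \<rho> \<mu>" "\<And>a b. a \<in> {0..1} \<Longrightarrow> b \<in> {0..1} \<Longrightarrow> maxc_bounded X \<rho> \<mu> p a b \<longleftrightarrow>
     b \<le> a \<and> (\<exists>C. \<forall>n. h n * real (K n) powr b * real (M n) powr (1 - a) \<le> C)"
    using exists_space by blast
  have "maxc_bounded X \<rho> \<mu> p a b \<longleftrightarrow> \<delta> \<le> a \<and> b \<le> F a" if ab: "a \<in> {0..1}" "b \<in> {0..1}" for a b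
  proof -
    have val: "real (K n) powr (- (c n + S n)) * real (K n) powr b * (real (K n) powr S n) powr (1 - a) = real (K n) powr (b - c n - S n * a)" for n
      by (simp add: powr_powr powr_add[symmetric] algebra_simps)
    have up: "h n * real (K n) powr b * real (M n) powr (1 - a) \<le> real (K n) powr (b - c n - S n * a)" for n
      unfolding val[symmetric] h_def using ab M[of n] by (intro mult_left_mono powr_mono2) auto
    have lo: "real (K n) powr (b - c n - S n * a) \<le> 2 * (h n * real (K n) powr b * real (M n) powr (1 - a))" for n
    proof -
      have "(real (K n) powr S n) powr (1 - a) \<le> (2 * real (M n)) powr (1 - a)"
        using ab M[of n] by (intro powr_mono2) auto
      also have "\<dots> = 2 powr (1 - a) * real (M n) powr (1 - a)" by (simp add: powr_mult)
      also have "\<dots> \<le> 2 * real (M n) powr (1 - a)"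
        using ab powr_mono[of "1 - a" 1 2] by (intro mult_right_mono) auto
      finally have "h n * real (K n) powr b * (real (K n) powr S n) powr (1 - a) \<le> h n * real (K n) powr b * (2 * real (M n) powr (1 - a))"
        by (intro mult_left_mono) (auto simp: h_def)
      then show ?thesis unfolding val[symmetric] h_def[symmetric] by simp
    qed
    have "(\<exists>C. \<forall>n. h n * real (K n) powr b * real (M n) powr (1 - a) \<le> C) \<longleftrightarrow> (\<exists>C. \<forall>n. real (K n) powr (b - c n - S n * a) \<le> C)"
    proof
      assume "\<exists>C. \<forall>n. h n * real (K n) powr b * real (M n) powr (1 - a) \<le> C"
      then obtain C where C: "\<And>n. h n * real (K n) powr b * real (M n) powr (1 - a) \<le> C" by blast
      have "real (K n) powr (b - c n - S n * a) \<le> 2 * C" for n using lo[of n] C[of n] by linarith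
      then show "\<exists>C. \<forall>n. real (K n) powr (b - c n - S n * a) \<le> C" by blast
    qed (use up order_trans in blast)
    moreover have "F a \<le> a" if "\<delta> \<le> a" using adm that ab by (auto simp: admissible_def)
    ultimately show ?thesis using X(2)[OF ab] reg[OF ab] by auto
  qed
  then show ?thesis using X(1) by blast
qed

theorem theorem4p4p1:
  fixes p :: real
  assumes "1 < p"
  shows "(\<forall>(X :: 'a set) \<rho> \<mu>. mm_space X \<rho> \<mu> \<and> emeasure \<mu> (X - supp_mu X \<rho> \<mu>) = 0 \<longrightarrow>
            (sq_boundary (Omega_HL X \<rho> \<mu> p) = {} \<and>
               (Omega_HL X \<rho> \<mu> p = {} \<or> Omega_HL X \<rho> \<mu> p = {0..1} \<times> {0..1}))
          \<or> (\<exists>\<delta> F. admissible \<delta> F \<and>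
               sq_boundary (Omega_HL X \<rho> \<mu> p) =
                 {\<delta>} \<times> {0..edge_lim \<delta> F} \<union> {(u, F u) | u. u \<in> {\<delta><..1}}))
       \<and> (\<forall>\<delta> F. admissible \<delta> F \<longrightarrow>
            (\<exists>(X :: real set) \<rho> \<mu>. mm_space X \<rho> \<mu> \<and>
               (\<forall>a \<in> {0..1}. \<forall>b \<in> {0..1}. maxc_bounded X \<rho> \<mu> p a b \<longleftrightarrow> \<delta> \<le> a \<and> b \<le> F a)))"
  using boundary_dichotomy[OF assms] realization[OF assms] by blast

end
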